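(* Let $R$ be a graded-commutative noetherian ring and $\mathsf T$ a compactly generated $R$-linear triangulated category with arbitrary coproducts. If $\mathsf T$ is noetherian and stratified by $R$, then for each pair of compact objects $C,D$ in $\mathsf T$ there is an equality $$\operatorname{supp}_R\operatorname{Hom}^*_{\mathsf T}(C,D)=\operatorname{supp}_RC\cap\operatorname{supp}_RD.$$ When in addition $R^i=0$ holds for all $i<0$, one has $\operatorname{Hom}^n_{\mathsf T}(C,D)=0$ for $n\gg0$ if and only if $\operatorname{Hom}^n_{\mathsf T}(D,C)=0$ for $n\gg0$.
   Context: Graded-commutative: $R$ is $\mathbb Z$-graded with $rs=(-1)^{|r||s|}sr$ for homogeneous $r,s$; $R^i$ is the degree $i$ component. $\operatorname{Spec}R$ is the set of homogeneous prime ideals; $\mathcal V(\mathfrak a)=\{\mathfrak p\in\operatorname{Spec}R\mid\mathfrak p\supseteq\mathfrak a\}$ for a homogeneous ideal $\mathfrak a$. $R$-modules are graded and $M_{\mathfrak p}$ is homogeneous localization. A subset $\mathcal V\subseteq\operatorname{Spec}R$ is specialization closed if $\mathfrak p\in\mathcal V$, $\mathfrak p\subseteq\mathfrak q$ imply $\mathfrak q\in\mathcal V$. The (homological) support $\operatorname{supp}_RM$ of a graded $R$-module $M$ is the set of $\mathfrak p\in\operatorname{Spec}R$ such that a shift of the injective hull $E(R/\mathfrak p)$ is a direct summand of some term of the minimal injective resolution of $M$; when $M$ is finitely generated it equals $\{\mathfrak p\in\operatorname{Spec}R\mid M_{\mathfrak p}\neq0\}$. $\mathsf T$ has suspension $\Sigma$.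 A localizing subcategory is a full triangulated subcategory closed under coproducts; $\operatorname{Loc}_{\mathsf T}(\mathsf C)$ is the smallest one containing $\mathsf C$. An object $C$ is compact if $\operatorname{Hom}_{\mathsf T}(C,-)$ commutes with coproducts; $\mathsf T^c$ is the full subcategory of compact objects. $\mathsf T$ is compactly generated if $\mathsf T=\operatorname{Loc}_{\mathsf T}(\mathsf G)$ for a set $\mathsf G$ of compact objects. $\mathsf T$ is $R$-linear if there is given a homomorphism of graded rings $R\to Z^*(\mathsf T)$ to the graded center ($Z^n(\mathsf T)$ consists of natural transformations $\eta\colon\mathrm{Id}\to\Sigma^n$ with $\eta\Sigma=(-1)^n\Sigma\eta$); then $\operatorname{Hom}^*_{\mathsf T}(X,Y)=\bigoplus_n\operatorname{Hom}^n_{\mathsf T}(X,Y)$, with $\operatorname{Hom}^n_{\mathsf T}(X,Y)=\operatorname{Hom}_{\mathsf T}(X,\Sigma^nY)$, is a graded $R$-module, and $\operatorname{End}^*_{\mathsf T}(X)=\operatorname{Hom}^*_{\mathsf T}(X,X)$. For specialization closed $\mathcal V$, let $\mathsf T_{\mathcal V}=\{X\in\mathsf T\mid\operatorname{Hom}^*_{\mathsf T}(C,X)_{\mathfrak p}=0\text{ for all }C\in\mathsf T^c,\ \mathfrak p\in\operatorname{Spec}R\setminus\mathcal V\}$. This is a localizing subcategory and there is a localization functor $L_{\mathcal V}\colon\mathsf T\to\mathsf T$ with $\operatorname{Ker}L_{\mathcal V}=\mathsf T_{\mathcal V}$, giving functorial exact triangles $\varGamma_{\mathcal V}X\to X\to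 L_{\mathcal V}X\to$ with $\varGamma_{\mathcal V}X\in\mathsf T_{\mathcal V}$ and $\operatorname{Hom}_{\mathsf T}(\mathsf T_{\mathcal V},L_{\mathcal V}X)=0$. For $\mathfrak p\in\operatorname{Spec}R$ put $\mathcal Z(\mathfrak p)=\{\mathfrak q\in\operatorname{Spec}R\mid\mathfrak q\not\subseteq\mathfrak p\}$, $X_{\mathfrak p}=L_{\mathcal Z(\mathfrak p)}X$, $\varGamma_{\mathfrak p}X=\varGamma_{\mathcal V(\mathfrak p)}(X_{\mathfrak p})$. $\varGamma_{\mathfrak p}\mathsf T$ is the essential image of $\varGamma_{\mathfrak p}$, a localizing subcategory of $\mathsf T$. The support of an object $X$ is $\operatorname{supp}_RX=\{\mathfrak p\in\operatorname{Spec}R\mid\varGamma_{\mathfrak p}X\neq0\}$. $\mathsf T$ is stratified by $R$ if (S1) the local-global principle holds, i.e. $\operatorname{Loc}_{\mathsf T}(X)=\operatorname{Loc}_{\mathsf T}(\{\varGamma_{\mathfrak p}X\mid\mathfrak p\in\operatorname{Spec}R\})$ for every object $X$; and (S2) for each $\mathfrak p\in\operatorname{Spec}R$ the localizing subcategory $\varGamma_{\mathfrak p}\mathsf T$ is either zero or minimal (nonzero with no proper nonzero localizing subcategories). $\mathsf T$ is noetherian if the $R$-module $\operatorname{End}^*_{\mathsf T}(C)$ is finitely generated for every compact object $C$. *)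

theory Defs
  imports "HOL-Algebra.QuotRing" "HOL-Algebra.Ring_Divisibility"
begin

unbundle cardinal_syntax

section \<open>Graded rings\<close>

record 'r gring = "'r ring" +
  deg :: "int \<Rightarrow> 'r set"

locale graded_ring = ring R for R :: "('r, 'z) gring_scheme" (structure) +
  assumes deg_subgroup: "additive_subgroup (deg R i) R"
    and one_deg: "\<one> \<in> deg R 0"
    and mult_deg: "r \<in> deg R i \<Longrightarrow> s \<in> deg R j \<Longrightarrow> r \<otimes> s \<in> deg R (i + j)"
    and direct_sum: "r \<in> carrier R \<Longrightarrow>
      \<exists>!c. (\<forall>i. c i \<in> deg R i) \<and> finite {i. c i \<noteq> \<zero>} \<and> r = (\<Oplus>i\<in>{i. c i \<noteq> \<zero>}. c i)"

locale graded_commutative_ring = graded_ring +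
  assumes graded_comm: "r \<in> deg R i \<Longrightarrow> s \<in> deg R j \<Longrightarrow>
      r \<otimes> s = (if even (i * j) then s \<otimes> r else \<ominus> (s \<otimes> r))"

definition homogeneous :: "('r, 'z) gring_scheme \<Rightarrow> 'r set" where
  "homogeneous R = (\<Union>i. deg R i)"

definition homogeneous_ideal :: "('r, 'z) gring_scheme \<Rightarrow> 'r set \<Rightarrow> bool" where
  "homogeneous_ideal R I \<longleftrightarrow> ideal I R \<and> I = genideal R (I \<inter> homogeneous R)"

text \<open>The locale \<open>primeideal\<close> of the library is restricted to commutative rings.\<close>

definition Spec :: "('r, 'z) gring_scheme \<Rightarrow> 'r set set" where
  "Spec R = {\<pp>. homogeneous_ideal R \<pp> \<and> \<pp> \<noteq> carrier R \<and>
     (\<forall>a\<in>carrier R. \<forall>b\<in>carrier R. a \<otimes>\<^bsub>R\<^esub> b \<in> \<pp> \<longrightarrow> a \<in> \<pp> \<or> b \<in> \<pp>)}"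

definition V_of :: "('r, 'z) gring_scheme \<Rightarrow> 'r set \<Rightarrow> 'r set set" where
  "V_of R \<aa> = {\<pp> \<in> Spec R. \<aa> \<subseteq> \<pp>}"

definition Z_of :: "('r, 'z) gring_scheme \<Rightarrow> 'r set \<Rightarrow> 'r set set" where
  "Z_of R \<pp> = {\<qq> \<in> Spec R. \<not> \<qq> \<subseteq> \<pp>}"


section \<open>Graded modules\<close>

text \<open>
  A graded left module is given by the family of its homogeneous components; the module itself is
  their direct sum.  The component \<open>cmpt M n\<close> is an abelian group in the sense of the library, so
  only the fields \<open>carrier\<close>, \<open>zero\<close> and \<open>add\<close> of the ring record matter.  The value
  \<open>act M i j r m\<close> is the product of \<open>r\<close> in degree \<open>i\<close> with \<open>m\<close> in degree \<open>j\<close>; the degrees are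
  arguments because the sets of elements of different components may overlap.
\<close>

record ('r, 'm) gmod =
  cmpt :: "int \<Rightarrow> 'm ring"
  act :: "int \<Rightarrow> int \<Rightarrow> 'r \<Rightarrow> 'm \<Rightarrow> 'm"

abbreviation elts :: "('r, 'm) gmod \<Rightarrow> int \<Rightarrow> 'm set" where
  "elts M n \<equiv> carrier (cmpt M n)"

definition graded_module :: "('r, 'z) gring_scheme \<Rightarrow> ('r, 'm) gmod \<Rightarrow> bool" where
  "graded_module R M \<longleftrightarrow>
     (\<forall>n. abelian_group (cmpt M n)) \<and>
     (\<forall>i j. \<forall>r\<in>deg R i. \<forall>m\<in>elts M j. act M i j r m \<in> elts M (i + j)) \<and>
     (\<forall>i j. \<forall>r\<in>deg R i. \<forall>m\<in>elts M j. \<forall>m'\<in>elts M j.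
        act M i j r (m \<oplus>\<^bsub>cmpt M j\<^esub> m') = act M i j r m \<oplus>\<^bsub>cmpt M (i + j)\<^esub> act M i j r m') \<and>
     (\<forall>i j. \<forall>r\<in>deg R i. \<forall>r'\<in>deg R i. \<forall>m\<in>elts M j.
        act M i j (r \<oplus>\<^bsub>R\<^esub> r') m = act M i j r m \<oplus>\<^bsub>cmpt M (i + j)\<^esub> act M i j r' m) \<and>
     (\<forall>i j k. \<forall>r\<in>deg R i. \<forall>s\<in>deg R j. \<forall>m\<in>elts M k.
        act M (i + j) k (r \<otimes>\<^bsub>R\<^esub> s) m = act M i (j + k) r (act M j k s m)) \<and>
     (\<forall>j. \<forall>m\<in>elts M j. act M 0 j \<one>\<^bsub>R\<^esub> m = m)"

definition graded_submodule ::
    "('r, 'z) gring_scheme \<Rightarrow> (int \<Rightarrow> 'm set) \<Rightarrow> ('r, 'm) gmod \<Rightarrow> bool" where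
  "graded_submodule R N M \<longleftrightarrow>
     (\<forall>n. additive_subgroup (N n) (cmpt M n)) \<and>
     (\<forall>i j. \<forall>r\<in>deg R i. \<forall>m\<in>N j. act M i j r m \<in> N (i + j))"

definition gmod_hom ::
    "('r, 'z) gring_scheme \<Rightarrow> ('r, 'm) gmod \<Rightarrow> ('r, 'n) gmod \<Rightarrow> (int \<Rightarrow> 'm \<Rightarrow> 'n) \<Rightarrow> bool" where
  "gmod_hom R M N f \<longleftrightarrow>
     (\<forall>n. f n \<in> elts M n \<rightarrow> elts N n) \<and>
     (\<forall>n. \<forall>a\<in>elts M n. \<forall>b\<in>elts M n. f n (a \<oplus>\<^bsub>cmpt M n\<^esub> b) = f n a \<oplus>\<^bsub>cmpt N n\<^esub> f n b) \<and>
     (\<forall>i j. \<forall>r\<in>deg R i. \<forall>a\<in>elts M j. f (i + j) (act M i j r a) = act N i j r (f j a))"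

definition gmod_mono ::
    "('r, 'z) gring_scheme \<Rightarrow> ('r, 'm) gmod \<Rightarrow> ('r, 'n) gmod \<Rightarrow> (int \<Rightarrow> 'm \<Rightarrow> 'n) \<Rightarrow> bool" where
  "gmod_mono R M N f \<longleftrightarrow> gmod_hom R M N f \<and> (\<forall>n. inj_on (f n) (elts M n))"

definition gmod_image :: "('r, 'm) gmod \<Rightarrow> (int \<Rightarrow> 'm \<Rightarrow> 'n) \<Rightarrow> int \<Rightarrow> 'n set" where
  "gmod_image M f n = f n ` elts M n"

definition gmod_kernel ::
    "('r, 'm) gmod \<Rightarrow> ('r, 'n) gmod \<Rightarrow> (int \<Rightarrow> 'm \<Rightarrow> 'n) \<Rightarrow> int \<Rightarrow> 'm set" where
  "gmod_kernel M N f n = {a \<in> elts M n. f n a = \<zero>\<^bsub>cmpt N n\<^esub>}"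

definition direct_summand ::
    "('r, 'z) gring_scheme \<Rightarrow> ('r, 'm) gmod \<Rightarrow> ('r, 'n) gmod \<Rightarrow> bool" where
  "direct_summand R M N \<longleftrightarrow>
     (\<exists>s \<pi>. gmod_hom R M N s \<and> gmod_hom R N M \<pi> \<and> (\<forall>n. \<forall>a\<in>elts M n. \<pi> n (s n a) = a))"

text \<open>
  The sign \<open>(-1)\<^bsup>d\<bar>r\<bar>\<^esup>\<close> that is often put into the action on a shift is omitted: multiplication by
  \<open>(-1)\<^bsup>dn\<^esup>\<close> in degree \<open>n\<close> is an isomorphism between the two versions.
\<close>

definition gmod_shift :: "int \<Rightarrow> ('r, 'm) gmod \<Rightarrow> ('r, 'm) gmod" where
  "gmod_shift d M = \<lparr>cmpt = (\<lambda>n. cmpt M (n + d)), act = (\<lambda>i j. act M i (j + d))\<rparr>"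

definition finitely_generated :: "('r, 'z) gring_scheme \<Rightarrow> ('r, 'm) gmod \<Rightarrow> bool" where
  "finitely_generated R M \<longleftrightarrow>
     (\<exists>S. finite S \<and> (\<forall>(d, m)\<in>S. m \<in> elts M d) \<and>
        (\<forall>N. graded_submodule R N M \<and> (\<forall>(d, m)\<in>S. m \<in> N d) \<longrightarrow> (\<forall>n. N n = elts M n)))"

definition gmod_quot :: "('r, 'z) gring_scheme \<Rightarrow> 'r set \<Rightarrow> ('r, 'r set) gmod" where
  "gmod_quot R I =
     \<lparr>cmpt = (\<lambda>n. (R Quot I)\<lparr>carrier := (\<lambda>r. I +>\<^bsub>R\<^esub> r) ` deg R n\<rparr>),
      act = (\<lambda>i j r A. rcoset_mult R I (I +>\<^bsub>R\<^esub> r) A)\<rparr>"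


subsection \<open>Homogeneous localization\<close>

text \<open>
  A triple \<open>(i, s, m)\<close> stands for the left fraction \<open>s\<^sup>-\<^sup>1m\<close>, where \<open>s\<close> has degree \<open>i\<close>.  The
  equivalence relation is the one of Ore localization: fractions are equal if they agree after
  being expanded to a common denominator.
\<close>

definition fractions ::
    "('r, 'z) gring_scheme \<Rightarrow> 'r set \<Rightarrow> ('r, 'm) gmod \<Rightarrow> int \<Rightarrow> (int \<times> 'r \<times> 'm) set" where
  "fractions R \<pp> M n = {(i, s, m). s \<in> deg R i \<and> s \<notin> \<pp> \<and> m \<in> elts M (i + n)}"

definition frac_rel :: "('r, 'z) gring_scheme \<Rightarrow> 'r set \<Rightarrow> ('r, 'm) gmod \<Rightarrow> int \<Rightarrow>
    ((int \<times> 'r \<times> 'm) \<times> (int \<times> 'r \<times> 'm)) set" where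
  "frac_rel R \<pp> M n =
     {((i, s, m), (i', s', m')).
        (i, s, m) \<in> fractions R \<pp> M n \<and> (i', s', m') \<in> fractions R \<pp> M n \<and>
        (\<exists>k k'. k + i = k' + i' \<and> (\<exists>u\<in>deg R k. \<exists>u'\<in>deg R k'.
           u \<otimes>\<^bsub>R\<^esub> s = u' \<otimes>\<^bsub>R\<^esub> s' \<and> u \<otimes>\<^bsub>R\<^esub> s \<notin> \<pp> \<and>
           act M k (i + n) u m = act M k' (i' + n) u' m'))}"

definition localization ::
    "('r, 'z) gring_scheme \<Rightarrow> 'r set \<Rightarrow> ('r, 'm) gmod \<Rightarrow> int \<Rightarrow> (int \<times> 'r \<times> 'm) set set" where
  "localization R \<pp> M n = fractions R \<pp> M n // frac_rel R \<pp> M n"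

definition localization_zero :: "('r, 'z) gring_scheme \<Rightarrow> 'r set \<Rightarrow> ('r, 'm) gmod \<Rightarrow> bool" where
  "localization_zero R \<pp> M \<longleftrightarrow>
     (\<forall>n. localization R \<pp> M n = {frac_rel R \<pp> M n `` {(0, \<one>\<^bsub>R\<^esub>, \<zero>\<^bsub>cmpt M n\<^esub>)}})"


subsection \<open>Minimal injective resolutions and support\<close>

text \<open>
  Injectivity is tested on the graded modules \<open>A\<close>, \<open>B\<close> whose elements lie in a fixed type, since
  there is no quantification over types.  That type contains a copy of every homogeneous ideal of
  \<open>R\<close>, so by Baer's criterion the extension property then holds for modules over all types.
\<close>

definition injective_gmod :: "('r, 'z) gring_scheme \<Rightarrow> ('r, 'e) gmod \<Rightarrow> bool" where
  "injective_gmod R E \<longleftrightarrow> graded_module R E \<and>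
     (\<forall>(A :: ('r, 'r + 'e) gmod) (B :: ('r, 'r + 'e) gmod) \<iota> f.
        graded_module R A \<and> graded_module R B \<and> gmod_mono R A B \<iota> \<and> gmod_hom R A E f \<longrightarrow>
        (\<exists>g. gmod_hom R B E g \<and> (\<forall>n. \<forall>a\<in>elts A n. g n (\<iota> n a) = f n a)))"

definition essential ::
    "('r, 'z) gring_scheme \<Rightarrow> (int \<Rightarrow> 'm set) \<Rightarrow> ('r, 'm) gmod \<Rightarrow> bool" where
  "essential R K E \<longleftrightarrow> graded_submodule R K E \<and>
     (\<forall>N. graded_submodule R N E \<and> (\<forall>n. N n \<inter> K n = {\<zero>\<^bsub>cmpt E n\<^esub>}) \<longrightarrow>
        (\<forall>n. N n = {\<zero>\<^bsub>cmpt E n\<^esub>}))"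

definition injective_hull ::
    "('r, 'z) gring_scheme \<Rightarrow> ('r, 'm) gmod \<Rightarrow> ('r, 'e) gmod \<Rightarrow> (int \<Rightarrow> 'm \<Rightarrow> 'e) \<Rightarrow> bool" where
  "injective_hull R M E f \<longleftrightarrow>
     injective_gmod R E \<and> gmod_mono R M E f \<and> essential R (gmod_image M f) E"

definition minimal_injective_resolution ::
    "('r, 'z) gring_scheme \<Rightarrow> ('r, 'm) gmod \<Rightarrow> (nat \<Rightarrow> ('r, 'e) gmod) \<Rightarrow> (int \<Rightarrow> 'm \<Rightarrow> 'e) \<Rightarrow>
      (nat \<Rightarrow> int \<Rightarrow> 'e \<Rightarrow> 'e) \<Rightarrow> bool" where
  "minimal_injective_resolution R M I \<eta> \<delta> \<longleftrightarrow>
     (\<forall>k. injective_gmod R (I k)) \<and>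
     gmod_mono R M (I 0) \<eta> \<and>
     (\<forall>k. gmod_hom R (I k) (I (Suc k)) (\<delta> k)) \<and>
     gmod_image M \<eta> = gmod_kernel (I 0) (I (Suc 0)) (\<delta> 0) \<and>
     (\<forall>k. gmod_image (I k) (\<delta> k) =
        gmod_kernel (I (Suc k)) (I (Suc (Suc k))) (\<delta> (Suc k))) \<and>
     (\<forall>k. essential R (gmod_kernel (I k) (I (Suc k)) (\<delta> k)) (I k))"

text \<open>
  The terms of a minimal injective resolution of \<open>M\<close> need a type of elements.  Let \<open>\<mu>\<close> be the
  cardinality of the type \<open>('r, 'm) hull_elt\<close>; it is infinite, is at least that of \<open>'m\<close>, and satisfies
  \<open>\<mu>\<^bsup>\<kappa>\<^esup> = \<mu>\<close>, where \<open>\<kappa>\<close> is the cardinality of \<open>int \<times> 'r\<close>.  If the components of \<open>N\<close> have at most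
  \<open>\<mu>\<close> elements, then so do their divisible hulls \<open>D\<^sup>n\<close>, and also the components
  \<open>\<Prod>i. Hom(R\<^sup>i, D\<^bsup>n+i\<^esup>)\<close> of an injective graded module containing \<open>N\<close>.  Hence every module on
  \<open>'m\<close> has a minimal injective resolution by modules on \<open>('r, 'm) hull_elt\<close>.  A direct summand of a
  term again has a copy on that type, so it is enough to look for the hull \<open>E\<close> of \<open>R/\<pp>\<close> there.
\<close>

type_synonym ('r, 'm) hull_elt = "int \<times> 'r \<Rightarrow> int \<times> 'm"

definition supp_gmod :: "('r, 'z) gring_scheme \<Rightarrow> ('r, 'm) gmod \<Rightarrow> 'r set set" where
  "supp_gmod R M = {\<pp> \<in> Spec R.
     \<exists>(I :: nat \<Rightarrow> ('r, ('r, 'm) hull_elt) gmod) \<eta> \<delta> (E :: ('r, ('r, 'm) hull_elt) gmod) f k d.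
       minimal_injective_resolution R M I \<eta> \<delta> \<and>
       injective_hull R (gmod_quot R \<pp>) E f \<and> direct_summand R (gmod_shift d E) (I k)}"


section \<open>Triangulated categories\<close>

record ('o, 'm) tcat =
  Obj :: "'o set"
  Hom :: "'o \<Rightarrow> 'o \<Rightarrow> 'm set"
  ident :: "'o \<Rightarrow> 'm"
  cmp :: "'m \<Rightarrow> 'm \<Rightarrow> 'm" (infixr "\<cdot>\<index>" 75)
  zero_mor :: "'o \<Rightarrow> 'o \<Rightarrow> 'm"
  plus_mor :: "'m \<Rightarrow> 'm \<Rightarrow> 'm"
  sus_obj :: "'o \<Rightarrow> 'o" ("\<Sigma>\<^sub>o\<index>")
  sus_mor :: "'m \<Rightarrow> 'm" ("\<Sigma>\<^sub>m\<index>")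
  triangles :: "('m \<times> 'm \<times> 'm) set"

definition hom_group :: "('o, 'm) tcat \<Rightarrow> 'o \<Rightarrow> 'o \<Rightarrow> 'm ring" where
  "hom_group T X Y =
     \<lparr>carrier = Hom T X Y, mult = undefined, one = undefined,
      zero = zero_mor T X Y, add = plus_mor T\<rparr>"

definition neg_mor :: "('o, 'm) tcat \<Rightarrow> 'o \<Rightarrow> 'o \<Rightarrow> 'm \<Rightarrow> 'm" where
  "neg_mor T X Y f = \<ominus>\<^bsub>hom_group T X Y\<^esub> f"

definition iso_mor :: "('o, 'm) tcat \<Rightarrow> 'o \<Rightarrow> 'o \<Rightarrow> 'm \<Rightarrow> bool" where
  "iso_mor T X Y f \<longleftrightarrow> f \<in> Hom T X Y \<and>
     (\<exists>g\<in>Hom T Y X. g \<cdot>\<^bsub>T\<^esub> f = ident T X \<and> f \<cdot>\<^bsub>T\<^esub> g = ident T Y)"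

definition iso_obj :: "('o, 'm) tcat \<Rightarrow> 'o \<Rightarrow> 'o \<Rightarrow> bool" where
  "iso_obj T X Y \<longleftrightarrow> (\<exists>f. iso_mor T X Y f)"

definition zero_obj :: "('o, 'm) tcat \<Rightarrow> 'o \<Rightarrow> bool" where
  "zero_obj T Z \<longleftrightarrow> Z \<in> Obj T \<and> ident T Z = zero_mor T Z Z"

definition exact_tri ::
    "('o, 'm) tcat \<Rightarrow> 'o \<Rightarrow> 'o \<Rightarrow> 'o \<Rightarrow> 'm \<Rightarrow> 'm \<Rightarrow> 'm \<Rightarrow> bool" where
  "exact_tri T X Y Z f g h \<longleftrightarrow>
     X \<in> Obj T \<and> Y \<in> Obj T \<and> Z \<in> Obj T \<and>
     f \<in> Hom T X Y \<and> g \<in> Hom T Y Z \<and> h \<in> Hom T Z (\<Sigma>\<^sub>o\<^bsub>T\<^esub> X) \<and> (f, g, h) \<in> triangles T"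

text \<open>
  Hom-sets of different pairs of objects are disjoint, hence composition and addition need no
  object arguments.
\<close>

locale category =
  fixes T :: "('o, 'm) tcat" (structure)
  assumes Hom_disjoint: "\<lbrakk>X \<in> Obj T; Y \<in> Obj T; X' \<in> Obj T; Y' \<in> Obj T;
      f \<in> Hom T X Y; f \<in> Hom T X' Y'\<rbrakk> \<Longrightarrow> X = X' \<and> Y = Y'"
    and ident_Hom: "X \<in> Obj T \<Longrightarrow> ident T X \<in> Hom T X X"
    and cmp_Hom: "\<lbrakk>X \<in> Obj T; Y \<in> Obj T; Z \<in> Obj T; f \<in> Hom T X Y; g \<in> Hom T Y Z\<rbrakk> \<Longrightarrow>
      g \<cdot> f \<in> Hom T X Z"
    and cmp_ident: "\<lbrakk>X \<in> Obj T; Y \<in> Obj T; f \<in> Hom T X Y\<rbrakk> \<Longrightarrow> f \<cdot> ident T X = f"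
    and ident_cmp: "\<lbrakk>X \<in> Obj T; Y \<in> Obj T; f \<in> Hom T X Y\<rbrakk> \<Longrightarrow> ident T Y \<cdot> f = f"
    and cmp_assoc: "\<lbrakk>W \<in> Obj T; X \<in> Obj T; Y \<in> Obj T; Z \<in> Obj T;
      f \<in> Hom T W X; g \<in> Hom T X Y; h \<in> Hom T Y Z\<rbrakk> \<Longrightarrow> (h \<cdot> g) \<cdot> f = h \<cdot> (g \<cdot> f)"

locale additive_category = category +
  assumes hom_abelian: "\<lbrakk>X \<in> Obj T; Y \<in> Obj T\<rbrakk> \<Longrightarrow> abelian_group (hom_group T X Y)"
    and cmp_plus: "\<lbrakk>X \<in> Obj T; Y \<in> Obj T; Z \<in> Obj T;
      f \<in> Hom T X Y; g \<in> Hom T Y Z; g' \<in> Hom T Y Z\<rbrakk> \<Longrightarrow>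
      plus_mor T g g' \<cdot> f = plus_mor T (g \<cdot> f) (g' \<cdot> f)"
    and plus_cmp: "\<lbrakk>X \<in> Obj T; Y \<in> Obj T; Z \<in> Obj T;
      f \<in> Hom T X Y; f' \<in> Hom T X Y; g \<in> Hom T Y Z\<rbrakk> \<Longrightarrow>
      g \<cdot> plus_mor T f f' = plus_mor T (g \<cdot> f) (g \<cdot> f')"
    and zero_exists: "\<exists>Z. zero_obj T Z"
    and biproduct_exists: "\<lbrakk>X \<in> Obj T; Y \<in> Obj T\<rbrakk> \<Longrightarrow>
      \<exists>B\<in>Obj T. \<exists>i\<in>Hom T X B. \<exists>j\<in>Hom T Y B. \<exists>p\<in>Hom T B X. \<exists>q\<in>Hom T B Y.
        p \<cdot> i = ident T X \<and> q \<cdot> j = ident T Y \<and>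
        q \<cdot> i = zero_mor T X Y \<and> p \<cdot> j = zero_mor T Y X \<and>
        plus_mor T (i \<cdot> p) (j \<cdot> q) = ident T B"

text \<open>The suspension is an automorphism of the category, so that all its integer powers exist.\<close>

locale triangulated_category = additive_category +
  assumes sus_obj_bij: "bij_betw \<Sigma>\<^sub>o (Obj T) (Obj T)"
    and sus_mor_bij: "\<lbrakk>X \<in> Obj T; Y \<in> Obj T\<rbrakk> \<Longrightarrow>
      bij_betw \<Sigma>\<^sub>m (Hom T X Y) (Hom T (\<Sigma>\<^sub>o X) (\<Sigma>\<^sub>o Y))"
    and sus_ident: "X \<in> Obj T \<Longrightarrow> \<Sigma>\<^sub>m (ident T X) = ident T (\<Sigma>\<^sub>o X)"
    and sus_cmp: "\<lbrakk>X \<in> Obj T; Y \<in> Obj T; Z \<in> Obj T; f \<in> Hom T X Y; g \<in> Hom T Y Z\<rbrakk> \<Longrightarrow>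
      \<Sigma>\<^sub>m (g \<cdot> f) = \<Sigma>\<^sub>m g \<cdot> \<Sigma>\<^sub>m f"
    and sus_plus: "\<lbrakk>X \<in> Obj T; Y \<in> Obj T; f \<in> Hom T X Y; f' \<in> Hom T X Y\<rbrakk> \<Longrightarrow>
      \<Sigma>\<^sub>m (plus_mor T f f') = plus_mor T (\<Sigma>\<^sub>m f) (\<Sigma>\<^sub>m f')"
    and TR1_iso: "\<lbrakk>exact_tri T X Y Z f g h; X' \<in> Obj T; Y' \<in> Obj T; Z' \<in> Obj T;
      f' \<in> Hom T X' Y'; g' \<in> Hom T Y' Z'; h' \<in> Hom T Z' (\<Sigma>\<^sub>o X');
      iso_mor T X X' a; iso_mor T Y Y' b; iso_mor T Z Z' c;
      f' \<cdot> a = b \<cdot> f; g' \<cdot> b = c \<cdot> g; h' \<cdot> c = \<Sigma>\<^sub>m a \<cdot> h\<rbrakk> \<Longrightarrow>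
      exact_tri T X' Y' Z' f' g' h'"
    and TR1_ident: "\<lbrakk>X \<in> Obj T; zero_obj T Z\<rbrakk> \<Longrightarrow>
      exact_tri T X X Z (ident T X) (zero_mor T X Z) (zero_mor T Z (\<Sigma>\<^sub>o X))"
    and TR1_cone: "\<lbrakk>X \<in> Obj T; Y \<in> Obj T; f \<in> Hom T X Y\<rbrakk> \<Longrightarrow> \<exists>Z g h. exact_tri T X Y Z f g h"
    and TR2: "\<lbrakk>X \<in> Obj T; Y \<in> Obj T; Z \<in> Obj T;
      f \<in> Hom T X Y; g \<in> Hom T Y Z; h \<in> Hom T Z (\<Sigma>\<^sub>o X)\<rbrakk> \<Longrightarrow>
      exact_tri T X Y Z f g h \<longleftrightarrow>
      exact_tri T Y Z (\<Sigma>\<^sub>o X) g h (neg_mor T (\<Sigma>\<^sub>o X) (\<Sigma>\<^sub>o Y) (\<Sigma>\<^sub>m f))"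
    and TR3: "\<lbrakk>exact_tri T X Y Z f g h; exact_tri T X' Y' Z' f' g' h';
      a \<in> Hom T X X'; b \<in> Hom T Y Y'; b \<cdot> f = f' \<cdot> a\<rbrakk> \<Longrightarrow>
      \<exists>c\<in>Hom T Z Z'. c \<cdot> g = g' \<cdot> b \<and> h' \<cdot> c = \<Sigma>\<^sub>m a \<cdot> h"
    and TR4: "\<lbrakk>exact_tri T X Y U f f' f''; exact_tri T Y Z W g g' g'';
      exact_tri T X Z V (g \<cdot> f) h' h''\<rbrakk> \<Longrightarrow>
      \<exists>a b. exact_tri T U V W a b (\<Sigma>\<^sub>m f' \<cdot> g'') \<and>
        a \<cdot> f' = h' \<cdot> g \<and> h'' \<cdot> a = f'' \<and> b \<cdot> h' = g' \<and> g'' \<cdot> b = \<Sigma>\<^sub>m f \<cdot> h''"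

definition arrows :: "('o, 'm) tcat \<Rightarrow> 'm set" where
  "arrows T = (\<Union>X\<in>Obj T. \<Union>Y\<in>Obj T. Hom T X Y)"

definition susp_obj :: "('o, 'm) tcat \<Rightarrow> int \<Rightarrow> 'o \<Rightarrow> 'o" where
  "susp_obj T n X =
     (if 0 \<le> n then (sus_obj T ^^ nat n) X else (inv_into (Obj T) (sus_obj T) ^^ nat (- n)) X)"

definition susp_mor :: "('o, 'm) tcat \<Rightarrow> int \<Rightarrow> 'm \<Rightarrow> 'm" where
  "susp_mor T n f =
     (if 0 \<le> n then (sus_mor T ^^ nat n) f else (inv_into (arrows T) (sus_mor T) ^^ nat (- n)) f)"


subsection \<open>Coproducts, compact objects, localizing subcategories\<close>

text \<open>
  ``Small'' means of cardinality less than that of a fixed set \<open>U\<close>, whose cardinality is regular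
  and uncountable.  A Grothendieck universe is the case where it is moreover a strong limit; the
  results do not need this, and without it there are nontrivial examples that do not depend on the
  existence of an inaccessible cardinal.
\<close>

definition universe :: "'u set \<Rightarrow> bool" where
  "universe U \<longleftrightarrow> natLeq <o |U| \<and> regularCard |U|"

definition small :: "'u set \<Rightarrow> 'a set \<Rightarrow> bool" where
  "small U A \<longleftrightarrow> |A| <o |U|"

definition coproduct ::
    "('o, 'm) tcat \<Rightarrow> 'u set \<Rightarrow> ('u \<Rightarrow> 'o) \<Rightarrow> 'o \<Rightarrow> ('u \<Rightarrow> 'm) \<Rightarrow> bool" where
  "coproduct T J F Y \<iota> \<longleftrightarrow> Y \<in> Obj T \<and> (\<forall>i\<in>J. \<iota> i \<in> Hom T (F i) Y) \<and>
     (\<forall>Z\<in>Obj T. \<forall>f. (\<forall>i\<in>J. f i \<in> Hom T (F i) Z) \<longrightarrow>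
        (\<exists>!h. h \<in> Hom T Y Z \<and> (\<forall>i\<in>J. h \<cdot>\<^bsub>T\<^esub> \<iota> i = f i)))"

definition has_coproducts :: "'u set \<Rightarrow> ('o, 'm) tcat \<Rightarrow> bool" where
  "has_coproducts U T \<longleftrightarrow>
     (\<forall>J F. J \<subseteq> U \<and> small U J \<and> F \<in> J \<rightarrow> Obj T \<longrightarrow> (\<exists>Y \<iota>. coproduct T J F Y \<iota>))"

text \<open>
  An object \<open>C\<close> is compact if the canonical map from the direct sum of the groups \<open>Hom T C (F i)\<close> to
  \<open>Hom T C (\<Coprod>i. F i)\<close> is bijective.
\<close>

definition compact_obj :: "'u set \<Rightarrow> ('o, 'm) tcat \<Rightarrow> 'o \<Rightarrow> bool" where
  "compact_obj U T C \<longleftrightarrow> C \<in> Obj T \<and>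
     (\<forall>J F Y \<iota>. J \<subseteq> U \<and> small U J \<and> F \<in> J \<rightarrow> Obj T \<and> coproduct T J F Y \<iota> \<longrightarrow>
        bij_betw
          (\<lambda>g. finsum (hom_group T C Y) (\<lambda>i. \<iota> i \<cdot>\<^bsub>T\<^esub> g i) {i \<in> J. g i \<noteq> zero_mor T C (F i)})
          {g \<in> (\<Pi>\<^sub>E i\<in>J. Hom T C (F i)). finite {i \<in> J. g i \<noteq> zero_mor T C (F i)}}
          (Hom T C Y))"

text \<open>
  The usual requirement that all sets of morphisms be small is only imposed on morphisms out of
  compact objects.
\<close>

definition locally_small :: "'u set \<Rightarrow> ('o, 'm) tcat \<Rightarrow> bool" where
  "locally_small U T \<longleftrightarrow> (\<forall>C X. compact_obj U T C \<and> X \<in> Obj T \<longrightarrow> small U (Hom T C X))"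

text \<open>Full subcategories are given by their sets of objects.\<close>

definition triangulated_sub :: "('o, 'm) tcat \<Rightarrow> 'o set \<Rightarrow> bool" where
  "triangulated_sub T S \<longleftrightarrow> S \<subseteq> Obj T \<and> S \<noteq> {} \<and>
     (\<forall>X\<in>S. \<forall>n. susp_obj T n X \<in> S) \<and>
     (\<forall>X Y Z f g h. exact_tri T X Y Z f g h \<and> X \<in> S \<and> Y \<in> S \<longrightarrow> Z \<in> S)"

definition localizing_sub :: "'u set \<Rightarrow> ('o, 'm) tcat \<Rightarrow> 'o set \<Rightarrow> bool" where
  "localizing_sub U T S \<longleftrightarrow> triangulated_sub T S \<and>
     (\<forall>J F Y \<iota>. J \<subseteq> U \<and> small U J \<and> F \<in> J \<rightarrow> S \<and> coproduct T J F Y \<iota> \<longrightarrow> Y \<in> S)"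

definition Loc :: "'u set \<Rightarrow> ('o, 'm) tcat \<Rightarrow> 'o set \<Rightarrow> 'o set" where
  "Loc U T A = \<Inter>{S. localizing_sub U T S \<and> A \<subseteq> S}"

definition compactly_generated :: "'u set \<Rightarrow> ('o, 'm) tcat \<Rightarrow> bool" where
  "compactly_generated U T \<longleftrightarrow>
     (\<exists>G. small U G \<and> (\<forall>C\<in>G. compact_obj U T C) \<and> Loc U T G = Obj T)"


subsection \<open>The action of a graded ring\<close>

definition graded_center :: "('o, 'm) tcat \<Rightarrow> int \<Rightarrow> ('o \<Rightarrow> 'm) set" where
  "graded_center T n = {\<eta>.
     (\<forall>X\<in>Obj T. \<eta> X \<in> Hom T X (susp_obj T n X)) \<and>
     (\<forall>X\<in>Obj T. \<forall>Y\<in>Obj T. \<forall>f\<in>Hom T X Y. \<eta> Y \<cdot>\<^bsub>T\<^esub> f = susp_mor T n f \<cdot>\<^bsub>T\<^esub> \<eta> X) \<and>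
     (\<forall>X\<in>Obj T. \<eta> (sus_obj T X) =
        (if even n then sus_mor T (\<eta> X)
         else neg_mor T (sus_obj T X) (susp_obj T (n + 1) X) (sus_mor T (\<eta> X))))}"

text \<open>
  A homomorphism of graded rings from \<open>R\<close> to the graded center; \<open>\<phi> n r\<close> is the image of \<open>r\<close> of
  degree \<open>n\<close>.  The product of \<open>\<eta>\<close> and \<open>\<theta>\<close> of degree \<open>n\<close> in the graded center is the composite of
  \<open>\<theta>\<close> with the \<open>n\<close>-fold suspension of \<open>\<eta>\<close>, as in the graded endomorphism rings.
\<close>

definition linear_action ::
    "('r, 'z) gring_scheme \<Rightarrow> ('o, 'm) tcat \<Rightarrow> (int \<Rightarrow> 'r \<Rightarrow> 'o \<Rightarrow> 'm) \<Rightarrow> bool" where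
  "linear_action R T \<phi> \<longleftrightarrow>
     (\<forall>n. \<forall>r\<in>deg R n. \<phi> n r \<in> graded_center T n) \<and>
     (\<forall>n. \<forall>r\<in>deg R n. \<forall>s\<in>deg R n. \<forall>X\<in>Obj T.
        \<phi> n (r \<oplus>\<^bsub>R\<^esub> s) X = plus_mor T (\<phi> n r X) (\<phi> n s X)) \<and>
     (\<forall>m n. \<forall>r\<in>deg R m. \<forall>s\<in>deg R n. \<forall>X\<in>Obj T.
        \<phi> (m + n) (r \<otimes>\<^bsub>R\<^esub> s) X = susp_mor T n (\<phi> m r X) \<cdot>\<^bsub>T\<^esub> \<phi> n s X) \<and>
     (\<forall>X\<in>Obj T. \<phi> 0 \<one>\<^bsub>R\<^esub> X = ident T X)"

definition hom_star ::
    "('o, 'm) tcat \<Rightarrow> (int \<Rightarrow> 'r \<Rightarrow> 'o \<Rightarrow> 'm) \<Rightarrow> 'o \<Rightarrow> 'o \<Rightarrow> ('r, 'm) gmod" where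
  "hom_star T \<phi> X Y =
     \<lparr>cmpt = (\<lambda>n. hom_group T X (susp_obj T n Y)),
      act = (\<lambda>i j r f. susp_mor T j (\<phi> i r Y) \<cdot>\<^bsub>T\<^esub> f)\<rparr>"

definition noetherian_category ::
    "'u set \<Rightarrow> ('r, 'z) gring_scheme \<Rightarrow> ('o, 'm) tcat \<Rightarrow> (int \<Rightarrow> 'r \<Rightarrow> 'o \<Rightarrow> 'm) \<Rightarrow> bool" where
  "noetherian_category U R T \<phi> \<longleftrightarrow>
     (\<forall>C. compact_obj U T C \<longrightarrow> finitely_generated R (hom_star T \<phi> C C))"


subsection \<open>Local cohomology, support and stratification\<close>

definition torsion_sub :: "'u set \<Rightarrow> ('r, 'z) gring_scheme \<Rightarrow> ('o, 'm) tcat \<Rightarrow>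
    (int \<Rightarrow> 'r \<Rightarrow> 'o \<Rightarrow> 'm) \<Rightarrow> 'r set set \<Rightarrow> 'o set" where
  "torsion_sub U R T \<phi> V = {X \<in> Obj T.
     \<forall>C \<pp>. compact_obj U T C \<and> \<pp> \<in> Spec R - V \<longrightarrow> localization_zero R \<pp> (hom_star T \<phi> C X)}"

definition localization_triangle :: "'u set \<Rightarrow> ('r, 'z) gring_scheme \<Rightarrow> ('o, 'm) tcat \<Rightarrow>
    (int \<Rightarrow> 'r \<Rightarrow> 'o \<Rightarrow> 'm) \<Rightarrow> 'r set set \<Rightarrow> 'o \<Rightarrow> 'o \<Rightarrow> 'o \<Rightarrow> bool" where
  "localization_triangle U R T \<phi> V X G L \<longleftrightarrow>
     (\<exists>f g h. exact_tri T G X L f g h) \<and> G \<in> torsion_sub U R T \<phi> V \<and>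
     (\<forall>Y\<in>torsion_sub U R T \<phi> V. Hom T Y L = {zero_mor T Y L})"

text \<open>
  For specialization closed \<open>V\<close> every object \<open>X\<close> has a localization triangle, and it is unique up
  to isomorphism.  The functors are only needed on objects and only up to isomorphism, so their
  values are chosen.
\<close>

definition local_pair :: "'u set \<Rightarrow> ('r, 'z) gring_scheme \<Rightarrow> ('o, 'm) tcat \<Rightarrow>
    (int \<Rightarrow> 'r \<Rightarrow> 'o \<Rightarrow> 'm) \<Rightarrow> 'r set set \<Rightarrow> 'o \<Rightarrow> 'o \<times> 'o" where
  "local_pair U R T \<phi> V X = (SOME (G, L). localization_triangle U R T \<phi> V X G L)"

definition Gamma_V :: "'u set \<Rightarrow> ('r, 'z) gring_scheme \<Rightarrow> ('o, 'm) tcat \<Rightarrow>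
    (int \<Rightarrow> 'r \<Rightarrow> 'o \<Rightarrow> 'm) \<Rightarrow> 'r set set \<Rightarrow> 'o \<Rightarrow> 'o" where
  "Gamma_V U R T \<phi> V X = fst (local_pair U R T \<phi> V X)"

definition L_V :: "'u set \<Rightarrow> ('r, 'z) gring_scheme \<Rightarrow> ('o, 'm) tcat \<Rightarrow>
    (int \<Rightarrow> 'r \<Rightarrow> 'o \<Rightarrow> 'm) \<Rightarrow> 'r set set \<Rightarrow> 'o \<Rightarrow> 'o" where
  "L_V U R T \<phi> V X = snd (local_pair U R T \<phi> V X)"

definition Gamma_p :: "'u set \<Rightarrow> ('r, 'z) gring_scheme \<Rightarrow> ('o, 'm) tcat \<Rightarrow>
    (int \<Rightarrow> 'r \<Rightarrow> 'o \<Rightarrow> 'm) \<Rightarrow> 'r set \<Rightarrow> 'o \<Rightarrow> 'o" where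
  "Gamma_p U R T \<phi> \<pp> X = Gamma_V U R T \<phi> (V_of R \<pp>) (L_V U R T \<phi> (Z_of R \<pp>) X)"

definition Gamma_p_image :: "'u set \<Rightarrow> ('r, 'z) gring_scheme \<Rightarrow> ('o, 'm) tcat \<Rightarrow>
    (int \<Rightarrow> 'r \<Rightarrow> 'o \<Rightarrow> 'm) \<Rightarrow> 'r set \<Rightarrow> 'o set" where
  "Gamma_p_image U R T \<phi> \<pp> = {Y \<in> Obj T. \<exists>X\<in>Obj T. iso_obj T (Gamma_p U R T \<phi> \<pp> X) Y}"

definition supp_obj :: "'u set \<Rightarrow> ('r, 'z) gring_scheme \<Rightarrow> ('o, 'm) tcat \<Rightarrow>
    (int \<Rightarrow> 'r \<Rightarrow> 'o \<Rightarrow> 'm) \<Rightarrow> 'o \<Rightarrow> 'r set set" where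
  "supp_obj U R T \<phi> X = {\<pp> \<in> Spec R. \<not> zero_obj T (Gamma_p U R T \<phi> \<pp> X)}"

definition local_global :: "'u set \<Rightarrow> ('r, 'z) gring_scheme \<Rightarrow> ('o, 'm) tcat \<Rightarrow>
    (int \<Rightarrow> 'r \<Rightarrow> 'o \<Rightarrow> 'm) \<Rightarrow> bool" where
  "local_global U R T \<phi> \<longleftrightarrow>
     (\<forall>X\<in>Obj T. Loc U T {X} = Loc U T ((\<lambda>\<pp>. Gamma_p U R T \<phi> \<pp> X) ` Spec R))"

definition zero_sub :: "('o, 'm) tcat \<Rightarrow> 'o set \<Rightarrow> bool" where
  "zero_sub T S \<longleftrightarrow> (\<forall>X\<in>S. zero_obj T X)"

definition minimal_sub :: "'u set \<Rightarrow> ('o, 'm) tcat \<Rightarrow> 'o set \<Rightarrow> bool" where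
  "minimal_sub U T S \<longleftrightarrow> localizing_sub U T S \<and> \<not> zero_sub T S \<and>
     (\<forall>S'. localizing_sub U T S' \<and> S' \<subseteq> S \<and> \<not> zero_sub T S' \<longrightarrow> S' = S)"

definition stratified :: "'u set \<Rightarrow> ('r, 'z) gring_scheme \<Rightarrow> ('o, 'm) tcat \<Rightarrow>
    (int \<Rightarrow> 'r \<Rightarrow> 'o \<Rightarrow> 'm) \<Rightarrow> bool" where
  "stratified U R T \<phi> \<longleftrightarrow> local_global U R T \<phi> \<and>
     (\<forall>\<pp>\<in>Spec R. zero_sub T (Gamma_p_image U R T \<phi> \<pp>) \<or>
        minimal_sub U T (Gamma_p_image U R T \<phi> \<pp>))"

end

theory Submission
 imports Defs
begin

text \<open>
 Let \<open>L\<close> denote the localization away from \<open>\<Z>(p)\<close>.  For compact \<open>C\<close> one has \<open>Hom*(C, X)\<^sub>p = 0\<close> if and only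
 if \<open>Hom*(C, LX) = 0\<close>.  The Koszul object \<open>D//p\<close>, an iterated cone of homogeneous generators of \<open>p\<close>, is
 compact and \<open>p\<close>-torsion, so \<open>L(D//p)\<close> lies in \<open>\<Gamma>\<^sub>p T\<close>; by Nakayama's lemma \<open>Hom*(C, D)\<^sub>p\<close> vanishes as soon
 as \<open>Hom*(C, D//p)\<^sub>p\<close> does.  It follows that \<open>p \<in> supp D\<close> if and only if \<open>End*(D)\<^sub>p \<noteq> 0\<close>, which holds
 whenever \<open>Hom*(C, D)\<^sub>p \<noteq> 0\<close>.  Conversely let \<open>p\<close> lie in both supports and suppose that \<open>Hom*(C, D)\<^sub>p = 0\<close>.
 The objects of \<open>\<Gamma>\<^sub>p T\<close> that receive no maps from the suspensions of \<open>C\<close> form a localizing subcategory.  It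
 contains \<open>L(D//p) \<noteq> 0\<close>, hence by minimality also \<open>L(C//p)\<close>, so \<open>End*(C)\<^sub>p = 0\<close>, a contradiction.

 The support of a finitely generated module \<open>M\<close>, defined through its minimal injective resolution, is
 \<open>{p. M\<^sub>p \<noteq> 0}\<close>: if \<open>p\<close> did not occur in the resolution, noetherian induction on \<open>J\<close> would show that all
 \<open>Ext(R/J, M)\<^sub>p\<close> vanish.  Finally \<open>M\<close> is bounded above if and only if every prime in its support
 contains all elements of positive degree, a condition that is symmetric in \<open>C\<close> and \<open>D\<close> for
 \<open>M = Hom*(C, D)\<close>.
\<close>

text \<open>Localized modules are never formed. Vanishing at p is expressed by denominators:
  \<open>tors\<close> for elements of a module, \<open>tor\<close> for morphisms. The sign rule is
  absorbed by replacing an element by its negative, which changes neither membership in a prime nor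
  vanishing. The support of a module asks for resolutions and hulls on one prescribed type. They
  come from a cardinality bound: an essential extension is no larger than the closure of the module
  under solutions of finite systems of equations. Nakayama's lemma on the cohomology of a resolution
  needs Ext(R/J, M) to be finitely generated; this is proved inside the injective resolution, by
  passing from R/J to J and raising the degree. The objects \<Gamma>_V X and L_V X are values of a
  choice operator, so localization triangles must be constructed. For V(p) and Z(p) a small set of
  Koszul objects detects vanishing, and a countable tower of cones kills all maps from that set.
  Compactness lets denominators be followed through the stages of the tower.\<close>

abbreviation "gsub \<equiv> graded_submodule"
abbreviation "gmodule \<equiv> graded_module"

abbreviation cmpt_zero ("\<zero>[_,_]") where "\<zero>[M,n] \<equiv> zero (cmpt M n)"
abbreviation cmpt_add ("(_ \<oplus>[_,_] _)" [65, 0, 0, 66] 65) where "x \<oplus>[M,n] y \<equiv> add (cmpt M n) x y"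
abbreviation cmpt_minus ("(_ \<ominus>[_,_] _)" [65, 0, 0, 66] 65) where "x \<ominus>[M,n] y \<equiv> a_minus (cmpt M n) x y"
abbreviation cmpt_neg ("(\<ominus>[_,_] _)" [0, 0, 81] 80) where "\<ominus>[M,n] x \<equiv> a_inv (cmpt M n) x"

section \<open>Homogeneous ideals\<close>

lemma additive_subgroupI':
 assumes "abelian_group G" and "S <= carrier G" and "\<zero>\<^bsub>G\<^esub> \<in> S"
  and "!!x y. x \<in> S ==> y \<in> S ==> x \<oplus>\<^bsub>G\<^esub> y \<in> S"
  and "!!x. x \<in> S ==> \<ominus>\<^bsub>G\<^esub> x \<in> S"
 shows "additive_subgroup S G"
proof -
 interpret abelian_group G by fact
 show ?thesis by (intro additive_subgroup.intro add.subgroupI) (use assms in \<open>auto simp: a_inv_def\<close>)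
qed

lemma additive_subgroup_neg:
 assumes "abelian_group G" "additive_subgroup S G" "x \<in> S"
 shows "\<ominus>\<^bsub>G\<^esub> x \<in> S" by (auto simp: a_inv_def subgroup.m_inv_closed additive_subgroup.a_subgroup assms(2) assms(3))

definition gcomp :: "('r, 'z) gring_scheme => 'r => int => 'r" where
 "gcomp R r = (THE c. (ALL i. c i \<in> deg R i) \<and> finite {i. c i ~= \<zero>\<^bsub>R\<^esub>} \<and>
   r = (\<Oplus>\<^bsub>R\<^esub>i\<in>{i. c i ~= \<zero>\<^bsub>R\<^esub>}. c i))"

text \<open>A homogeneous ideal as the family of its components. Left multiplication is enough, as
  graded commutativity supplies the right side; \<open>total_ideal\<close> turns the family back
  into a set of elements of the ring.\<close>

definition gideal :: "('r, 'z) gring_scheme => (int => 'r set) => bool" where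
 "gideal R J \<longleftrightarrow> (ALL n. additive_subgroup (J n) R \<and> J n <= deg R n) \<and>
   (ALL i j. \<forall>r\<in>deg R i. \<forall>x\<in>J j. r \<otimes>\<^bsub>R\<^esub> x \<in> J (i + j))"

definition total_ideal :: "('r, 'z) gring_scheme => (int => 'r set) => 'r set" where
 "total_ideal R J = {r \<in> carrier R. ALL i. gcomp R r i \<in> J i}"

text \<open>The ideal J + Ra for a of degree d, whence the degree n - d of the coefficient;
  \<open>gcol\<close> is the colon ideal (J : a). Up to a shift of the first term there is an exact
  sequence 0 -> R/(J : a) -> R/J -> R/(J + Ra) -> 0, and the inductions on ideals follow it.\<close>

definition gadd ::
  "('r, 'z) gring_scheme => (int => 'r set) => int => 'r => int => 'r set" where
 "gadd R J d a n = {j \<oplus>\<^bsub>R\<^esub> r \<otimes>\<^bsub>R\<^esub> a | j r. j \<in> J n \<and> r \<in> deg R (n - d)}"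

definition gcol ::
  "('r, 'z) gring_scheme => (int => 'r set) => int => 'r => int => 'r set" where
 "gcol R J d a n = {r \<in> deg R n. r \<otimes>\<^bsub>R\<^esub> a \<in> J (n + d)}"

context graded_ring
begin

lemma dcar: "r \<in> deg R i ==> r \<in> carrier R"
 using deg_subgroup additive_subgroup.a_subset by blast

lemma deg_zero [simp]: "\<zero> \<in> deg R i"
 by (rule additive_subgroup.zero_closed[OF deg_subgroup])

lemma deg_add: "r \<in> deg R i ==> s \<in> deg R i ==> r \<oplus> s \<in> deg R i"
 by (rule additive_subgroup.a_closed[OF deg_subgroup])

lemma deg_neg: "r \<in> deg R i ==> \<ominus> r \<in> deg R i"
 by (rule additive_subgroup_neg[OF is_abelian_group deg_subgroup])

lemma mult_deg': "r \<in> deg R i ==> s \<in> deg R j ==> n = i + j ==> r \<otimes> s \<in> deg R n"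
 using mult_deg by blast

lemma pow_deg: "r \<in> deg R i ==> r [^] (k::nat) \<in> deg R (int k * i)"
proof (induction k)
 case (Suc k)
 thus ?case by (auto intro!: mult_deg'[of _ "int k * i" _ i] simp: algebra_simps)
qed (simp add: one_deg)

lemma gcomp_props:
 assumes "r \<in> carrier R"
 shows gcomp_deg: "gcomp R r i \<in> deg R i"
  and gcomp_finite: "finite {i. gcomp R r i ~= \<zero>}"
  and gcomp_sum: "r = (\<Oplus>i\<in>{i. gcomp R r i ~= \<zero>}. gcomp R r i)"
 using theI'[OF direct_sum[OF assms]] by (simp_all add: gcomp_def)

lemma gcomp_eqI:
 assumes "!!i. c i \<in> deg R i" "finite A" "!!i. i \<notin> A ==> c i = \<zero>" "r = (\<Oplus>i\<in>A. c i)"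
 shows "gcomp R r = c"
proof -
 have c: "c i \<in> carrier R" for i using assms(1) dcar by blast
 have sub: "{i. c i ~= \<zero>} <= A" using assms(3) by blast
 have fin: "finite {i. c i ~= \<zero>}" using sub assms(2) finite_subset by blast
 have "(\<Oplus>i\<in>{i. c i ~= \<zero>}. c i) = (\<Oplus>i\<in>A. c i)"
  using c sub assms(2) by (intro add.finprod_mono_neutral_cong_left) auto
 hence rc: "r = (\<Oplus>i\<in>{i. c i ~= \<zero>}. c i)" using assms(4) by simp
 have rcar: "r \<in> carrier R" unfolding assms(4) using c by (auto intro: finsum_closed)
 show ?thesis using direct_sum[OF rcar] assms(1) fin rc gcomp_deg[OF rcar] gcomp_finite[OF rcar]
   gcomp_sum[OF rcar] by blast
qed

lemma gcomp_sum':
 assumes "r \<in> carrier R" "finite A" "{i. gcomp R r i ~= \<zero>} <= A"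
 shows "r = (\<Oplus>i\<in>A. gcomp R r i)"
proof -
 have c: "gcomp R r i \<in> carrier R" for i using gcomp_deg[OF assms(1)] dcar by blast
 have "(\<Oplus>i\<in>{i. gcomp R r i ~= \<zero>}. gcomp R r i) = (\<Oplus>i\<in>A. gcomp R r i)"
  using c assms by (intro add.finprod_mono_neutral_cong_left) auto
 thus ?thesis using gcomp_sum[OF assms(1)] by simp
qed

lemma gcomp_homogeneous:
 assumes "r \<in> deg R n" shows "gcomp R r = (%i. if i = n then r else \<zero>)"
 by (rule gcomp_eqI[of _ "{n}"]) (use assms dcar in auto)

lemma gcomp_zero [simp]: "gcomp R \<zero> i = \<zero>"
 using gcomp_homogeneous[of \<zero> 0] by simp

lemma gcomp_add:
 assumes "r \<in> carrier R" "s \<in> carrier R"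
 shows "gcomp R (r \<oplus> s) i = gcomp R r i \<oplus> gcomp R s i"
proof -
 let ?A = "{i. gcomp R r i ~= \<zero>} \<union> {i. gcomp R s i ~= \<zero>}"
 have fin: "finite ?A" using gcomp_finite assms by auto
 have c: "gcomp R r i \<in> carrier R" "gcomp R s i \<in> carrier R" for i using gcomp_deg dcar assms by blast+
 have "r \<oplus> s = (\<Oplus>i\<in>?A. gcomp R r i) \<oplus> (\<Oplus>i\<in>?A. gcomp R s i)"
  using gcomp_sum'[OF assms(1) fin] gcomp_sum'[OF assms(2) fin] by simp
 also have "... = (\<Oplus>i\<in>?A. gcomp R r i \<oplus> gcomp R s i)" using c by (intro finsum_addf[symmetric]) auto
 finally have "gcomp R (r \<oplus> s) = (%i. gcomp R r i \<oplus> gcomp R s i)"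
  using fin by (intro gcomp_eqI[of _ ?A]) (auto intro: deg_add gcomp_deg assms)
 thus ?thesis by simp
qed

lemma gcomp_neg:
 assumes "r \<in> carrier R"
 shows "gcomp R (\<ominus> r) i = \<ominus> gcomp R r i"
proof -
 have "gcomp R r i \<oplus> gcomp R (\<ominus> r) i = \<zero>" using gcomp_add[OF assms, of "\<ominus> r" i] assms by (simp add: r_neg)
 thus ?thesis by (metis a_inv_closed assms dcar gcomp_deg minus_equality minus_minus)
qed

lemma gcomp_mult_left:
 assumes "a \<in> deg R n" "r \<in> carrier R"
 shows "gcomp R (a \<otimes> r) i = a \<otimes> gcomp R r (i - n)"
proof -
 let ?A = "{i. gcomp R r i ~= \<zero>}"
 have fin: "finite ?A" using gcomp_finite assms by auto
 have c: "gcomp R r i \<in> carrier R" for i using gcomp_deg dcar assms by blast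
 have a: "a \<in> carrier R" using assms dcar by blast
 have inj: "inj_on (%i. i + n) ?A" by auto
 have "a \<otimes> r = a \<otimes> (\<Oplus>i\<in>?A. gcomp R r i)" using gcomp_sum[OF assms(2)] by simp
 also have "... = (\<Oplus>i\<in>?A. a \<otimes> gcomp R r i)" using c a fin by (intro finsum_rdistr) auto
 also have "... = (\<Oplus>i\<in>?A. a \<otimes> gcomp R r (i + n - n))" by simp
 also have "... = (\<Oplus>i\<in>(%i. i + n) ` ?A. a \<otimes> gcomp R r (i - n))" using c a inj by (subst finsum_reindex) auto
 finally have e: "a \<otimes> r = (\<Oplus>i\<in>(%i. i + n) ` ?A. a \<otimes> gcomp R r (i - n))" .
 have "gcomp R (a \<otimes> r) = (%i. a \<otimes> gcomp R r (i - n))"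
 proof (rule gcomp_eqI[OF _ _ _ e])
  show "a \<otimes> gcomp R r (i - n) \<in> deg R i" for i using assms by (intro mult_deg'[of _ n _ "i - n"]) (auto intro: gcomp_deg)
  show "finite ((%i. i + n) ` ?A)" using fin by simp
  show "a \<otimes> gcomp R r (i - n) = \<zero>" if "i \<notin> (%i. i + n) ` ?A" for i
  proof -
   have "gcomp R r (i - n) = \<zero>" using that by force
   thus ?thesis using a by simp
  qed
 qed
 thus ?thesis by simp
qed

lemma finsum_in_subgroup:
 assumes "additive_subgroup S R" "finite A" "!!i. i \<in> A ==> f i \<in> S"
 shows "(\<Oplus>i\<in>A. f i) \<in> S" using assms(2,3)
proof (induction A)
 case empty
 thus ?case using additive_subgroup.zero_closed[OF assms(1)] by simp
next
 case (insert x A)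
 have "f \<in> insert x A \<rightarrow> carrier R" using insert.prems additive_subgroup.a_subset[OF assms(1)] by blast
 thus ?case using insert additive_subgroup.a_closed[OF assms(1)] by auto
qed

lemma gideal_sub: "gideal R J ==> x \<in> J n ==> x \<in> deg R n"
 by (auto simp: gideal_def)

lemma gideal_zero: "gideal R J ==> \<zero> \<in> J n"
 by (rule additive_subgroup.zero_closed[of _ R]) (simp add: gideal_def)

lemma gideal_add_closed: "gideal R J ==> x \<in> J n ==> y \<in> J n ==> x \<oplus> y \<in> J n"
 by (rule additive_subgroup.a_closed[of _ R]) (simp_all add: gideal_def)

lemma gideal_neg: "gideal R J ==> x \<in> J n ==> \<ominus> x \<in> J n"
 by (rule additive_subgroup_neg[OF is_abelian_group]) (simp_all add: gideal_def)

lemma gideal_mult: "gideal R J ==> r \<in> deg R i ==> x \<in> J j ==> n = i + j ==> r \<otimes> x \<in> J n"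
 by (auto simp: gideal_def)

lemma gidealI:
 assumes "!!n x. x \<in> J n ==> x \<in> deg R n" "!!n. \<zero> \<in> J n"
  "!!n x y. x \<in> J n ==> y \<in> J n ==> x \<oplus> y \<in> J n"
  "!!i j r x. r \<in> deg R i ==> x \<in> J j ==> r \<otimes> x \<in> J (i + j)"
 shows "gideal R J"
proof -
 have "\<ominus> x \<in> J n" if "x \<in> J n" for x n
 proof -
  have "(\<ominus> \<one>) \<otimes> x \<in> J (0 + n)" using that by (intro assms(4)) (auto intro: deg_neg one_deg)
  moreover have "(\<ominus> \<one>) \<otimes> x = \<ominus> x" using dcar[OF assms(1)[OF that]] by (simp add: l_minus)
  ultimately show ?thesis by simp
 qed
 note neg = this
 have "additive_subgroup (J n) R" for n
 proof (rule additive_subgroupI'[OF is_abelian_group])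
  show "J n <= carrier R" using assms(1) dcar by blast
 qed (use neg assms(2,3) in blast)+
 thus ?thesis using assms unfolding gideal_def by blast
qed

lemma gideal_whole: "gideal R (deg R)"
 by (rule gidealI) (auto intro: deg_add mult_deg)

lemma gideal_eq_whole:
 assumes "gideal R J" "\<one> \<in> J 0" shows "J = deg R"
using gideal_mult assms(1) assms(2) dcar gideal_sub by fastforce

lemma gideal_null: "gideal R (%n. {\<zero>})"
 by (rule gidealI) (auto dest: dcar)

lemma total_ideal_homogeneous:
 assumes "gideal R J" "r \<in> deg R n"
 shows "r \<in> total_ideal R J \<longleftrightarrow> r \<in> J n" using assms gideal_zero[OF assms(1)] dcar
 by (auto simp: total_ideal_def gcomp_homogeneous)

end

section \<open>Homogeneous ideals and primes in a graded-commutative ring\<close>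

context graded_commutative_ring
begin

text \<open>The sign of graded commutativity is moved into the element: r s = s' r with s' = s or s'
  = -s. A prime contains s' exactly when it contains s, so later arguments need not compute
  signs.\<close>

lemma swap_deg:
 assumes "r \<in> deg R i" "s \<in> deg R j"
 obtains s' where "s' \<in> deg R j" "s' = s \<or> s' = \<ominus> s" "r \<otimes> s = s' \<otimes> r"
by (metis that assms graded_comm dcar l_minus deg_neg)

lemma gideal_mult_right:
 assumes "gideal R J" "x \<in> J j" "r \<in> deg R i" "n = j + i"
 shows "x \<otimes> r \<in> J n"
proof -
 obtain r' where r': "r' \<in> deg R i" "x \<otimes> r = r' \<otimes> x" using swap_deg[OF gideal_sub[OF assms(1,2)] assms(3)] by metis
 show ?thesis using gideal_mult[OF assms(1) r'(1) assms(2)] r'(2) assms(4) by (simp add: add.commute)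
qed

lemma gcomp_mult_right:
 assumes "a \<in> deg R n" "r \<in> carrier R"
 shows "gcomp R (r \<otimes> a) i = gcomp R r (i - n) \<otimes> a"
proof -
 let ?A = "{i. gcomp R r i ~= \<zero>}"
 have fin: "finite ?A" using gcomp_finite assms by auto
 have c: "gcomp R r i \<in> carrier R" for i using gcomp_deg dcar assms by blast
 have a: "a \<in> carrier R" using assms dcar by blast
 have inj: "inj_on (%i. i + n) ?A" by auto
 have "r \<otimes> a = (\<Oplus>i\<in>?A. gcomp R r i) \<otimes> a" using gcomp_sum[OF assms(2)] by simp
 also have "... = (\<Oplus>i\<in>?A. gcomp R r i \<otimes> a)" using c a fin by (intro finsum_ldistr) auto
 also have "... = (\<Oplus>i\<in>?A. gcomp R r (i + n - n) \<otimes> a)" by simp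
 also have "... = (\<Oplus>i\<in>(%i. i + n) ` ?A. gcomp R r (i - n) \<otimes> a)" using c a inj by (subst finsum_reindex) auto
 finally have e: "r \<otimes> a = (\<Oplus>i\<in>(%i. i + n) ` ?A. gcomp R r (i - n) \<otimes> a)" .
 have "gcomp R (r \<otimes> a) = (%i. gcomp R r (i - n) \<otimes> a)"
 proof (rule gcomp_eqI[OF _ _ _ e])
  show "gcomp R r (i - n) \<otimes> a \<in> deg R i" for i using assms by (intro mult_deg'[of _ "i - n" _ n]) (auto intro: gcomp_deg)
  show "finite ((%i. i + n) ` ?A)" using fin by simp
  show "gcomp R r (i - n) \<otimes> a = \<zero>" if "i \<notin> (%i. i + n) ` ?A" for i
  proof -
   have "gcomp R r (i - n) = \<zero>" using that by force
   thus ?thesis using a by simp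
  qed
 qed
 thus ?thesis by simp
qed

lemma total_ideal_ideal:
 assumes J: "gideal R J"
 shows "ideal (total_ideal R J) R"
proof -
 have sub: "additive_subgroup (total_ideal R J) R" by (rule additive_subgroupI'[OF is_abelian_group])
   (auto simp: total_ideal_def gcomp_add gcomp_neg
    intro: gideal_zero[OF J] gideal_add_closed[OF J] gideal_neg[OF J])
 have car: "x \<in> total_ideal R J ==> x \<in> carrier R" for x by (simp add: total_ideal_def)
 have l: "x \<otimes> a \<in> total_ideal R J" if "a \<in> total_ideal R J" "x \<in> deg R n" for a x n using that dcar[OF that(2)]
  by (auto simp: total_ideal_def gcomp_mult_left intro!: gideal_mult[OF J that(2)])
 have r: "a \<otimes> x \<in> total_ideal R J" if "a \<in> total_ideal R J" "x \<in> deg R n" for a x n using that dcar[OF that(2)]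
  by (auto simp: total_ideal_def gcomp_mult_right intro!: gideal_mult_right[OF J _ that(2)])
 show ?thesis
 proof (rule idealI[OF ring_axioms additive_subgroup.a_subgroup[OF sub]])
  fix a x assume a: "a \<in> total_ideal R J" and x: "x \<in> carrier R"
  let ?A = "{i. gcomp R x i ~= \<zero>}"
  have c: "gcomp R x i \<in> carrier R" for i using gcomp_deg[OF x] dcar by blast
  have "x \<otimes> a = (\<Oplus>i\<in>?A. gcomp R x i \<otimes> a)"
   using gcomp_sum[OF x] finsum_ldistr[of ?A a "gcomp R x"] gcomp_finite[OF x] car[OF a] c by auto
  thus "x \<otimes> a \<in> total_ideal R J"
   using finsum_in_subgroup[OF sub gcomp_finite[OF x], of "%i. gcomp R x i \<otimes> a"] l[OF a gcomp_deg[OF x]] by simp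
  have "a \<otimes> x = (\<Oplus>i\<in>?A. a \<otimes> gcomp R x i)"
   using gcomp_sum[OF x] finsum_rdistr[of ?A a "gcomp R x"] gcomp_finite[OF x] car[OF a] c by auto
  thus "a \<otimes> x \<in> total_ideal R J"
   using finsum_in_subgroup[OF sub gcomp_finite[OF x], of "%i. a \<otimes> gcomp R x i"] r[OF a gcomp_deg[OF x]] by simp
 qed
qed

lemma total_ideal_minimal:
 assumes J: "gideal R J" and "additive_subgroup S R" "!!n. J n <= S"
 shows "total_ideal R J <= S"
proof
 fix r assume r: "r \<in> total_ideal R J"
 hence rc: "r \<in> carrier R" by (simp add: total_ideal_def)
 have "(\<Oplus>i\<in>{i. gcomp R r i ~= \<zero>}. gcomp R r i) \<in> S"
  using r assms(3) by (intro finsum_in_subgroup[OF assms(2) gcomp_finite[OF rc]]) (auto simp: total_ideal_def)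
 thus "r \<in> S" using gcomp_sum[OF rc] by simp
qed

lemma gideal_of_ideal:
 assumes "ideal I R"
 shows "gideal R (%n. I \<inter> deg R n)"
proof -
 interpret I: ideal I R by fact
 show ?thesis by (rule gidealI) (auto intro: deg_add mult_deg I.I_l_closed dcar)
qed

lemma homogeneous_total_ideal:
 assumes J: "gideal R J"
 shows "homogeneous_ideal R (total_ideal R J)"
proof -
 let ?I = "total_ideal R J"
 have sub: "?I \<inter> homogeneous R <= carrier R" by (auto simp: total_ideal_def)
 have "Idl (?I \<inter> homogeneous R) <= ?I" by (rule genideal_minimal[OF total_ideal_ideal[OF J]]) auto
 moreover have "?I <= Idl (?I \<inter> homogeneous R)"
 proof (rule total_ideal_minimal[OF J])
  show "additive_subgroup (Idl (?I \<inter> homogeneous R)) R" using genideal_ideal[OF sub] by (simp add: ideal_def)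
  show "J n <= Idl (?I \<inter> homogeneous R)" for n
  proof
   fix x assume x: "x \<in> J n"
   hence "x \<in> ?I \<inter> homogeneous R" using total_ideal_homogeneous[OF J gideal_sub[OF J x]] gideal_sub[OF J x]
    by (auto simp: homogeneous_def)
   thus "x \<in> Idl (?I \<inter> homogeneous R)" using genideal_self[OF sub] by blast
  qed
 qed
 ultimately show ?thesis using total_ideal_ideal[OF J] by (auto simp: homogeneous_ideal_def)
qed

text \<open>The product of the components of highest degree outside \<open>J\<close> is a component of the product
 modulo \<open>J\<close>.\<close>

lemma total_ideal_prime:
 assumes J: "gideal R J" and one: "\<one> \<notin> J 0"
  and prime: "!!i j a b. a \<in> deg R i ==> b \<in> deg R j ==> a \<otimes> b \<in> J (i + j) ==> a \<in> J i \<or> b \<in> J j"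
 shows "total_ideal R J \<in> Spec R"
proof -
 let ?I = "total_ideal R J"
 interpret I: ideal ?I R by (rule total_ideal_ideal[OF J])
 have "?I ~= carrier R" using total_ideal_homogeneous[OF J one_deg] one one_closed by metis
 moreover have "a \<in> ?I \<or> b \<in> ?I" if a: "a \<in> carrier R" and b: "b \<in> carrier R" and ab: "a \<otimes> b \<in> ?I" for a b
 proof (rule ccontr)
  assume nI: "\<not> (a \<in> ?I \<or> b \<in> ?I)"
  have top: "EX m y z. z \<in> ?I \<and> y \<in> carrier R \<and> x = y \<oplus> z \<and> gcomp R y m \<notin> J m \<and>
    (\<forall>i>m. gcomp R y i = \<zero>)" if x: "x \<in> carrier R" and xI: "x \<notin> ?I" for x
  proof -
   let ?B = "{i. gcomp R x i \<notin> J i}"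
   have Bsub: "?B <= {i. gcomp R x i ~= \<zero>}" using gideal_zero[OF J] by auto
   have finB: "finite ?B" by (rule finite_subset[OF Bsub gcomp_finite[OF x]])
   have neB: "?B ~= {}" using xI x unfolding total_ideal_def by blast
   define m where "m = Max ?B"
   have mB: "m \<in> ?B" using Max_in[OF finB neB] by (simp add: m_def)
   have mmax: "gcomp R x i \<in> J i" if "i > m" for i using Max_ge[OF finB, of i] that by (force simp: m_def)
   let ?A = "{i. gcomp R x i ~= \<zero>}"
   define y where "y = (\<Oplus>i\<in>{i\<in>?A. i \<le> m}. gcomp R x i)"
   define z where "z = (\<Oplus>i\<in>{i\<in>?A. i > m}. gcomp R x i)"
   have c: "gcomp R x i \<in> carrier R" for i using gcomp_deg[OF x] dcar by blast
   have finA: "finite ?A" using gcomp_finite[OF x] .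
   have "x = (\<Oplus>i\<in>{i\<in>?A. i \<le> m} \<union> {i\<in>?A. i > m}. gcomp R x i)" by (rule gcomp_sum'[OF x]) (use finA in auto)
   also have "... = y \<oplus> z" unfolding y_def z_def by (rule finsum_Un_disjoint) (use finA c in auto)
   finally have xyz: "x = y \<oplus> z" .
   have ycar: "y \<in> carrier R" unfolding y_def using c by (auto intro: finsum_closed)
   have zI: "z \<in> ?I" unfolding z_def
   proof (rule finsum_in_subgroup[OF I.is_additive_subgroup])
    fix i assume "i \<in> {i\<in>?A. i > m}"
    thus "gcomp R x i \<in> ?I" using total_ideal_homogeneous[OF J gcomp_deg[OF x]] mmax by blast
   qed (use finA in auto)
   have yc: "gcomp R y = (%i. if i \<le> m then gcomp R x i else \<zero>)"
   proof (rule gcomp_eqI[of _ "{i\<in>?A. i \<le> m}"])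
    show "y = (\<Oplus>i\<in>{i\<in>?A. i \<le> m}. if i \<le> m then gcomp R x i else \<zero>)"
     unfolding y_def by (rule finsum_cong') (use c in auto)
   qed (use finA gcomp_deg[OF x] in auto)
   show ?thesis using xyz ycar zI mB by (intro exI[of _ m] exI[of _ y] exI[of _ z]) (auto simp: yc)
  qed
  obtain m y z where y: "z \<in> ?I" "y \<in> carrier R" "a = y \<oplus> z" "gcomp R y m \<notin> J m"
    "\<forall>i>m. gcomp R y i = \<zero>" using top[OF a] nI by blast
  obtain m' y' z' where y': "z' \<in> ?I" "y' \<in> carrier R" "b = y' \<oplus> z'" "gcomp R y' m' \<notin> J m'"
    "\<forall>i>m'. gcomp R y' i = \<zero>" using top[OF b] nI by blast
  have zc: "z \<in> carrier R" "z' \<in> carrier R" using y(1) y'(1) I.a_subset by blast+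
  have "a \<otimes> b = y \<otimes> y' \<oplus> (y \<otimes> z' \<oplus> z \<otimes> b)"
   unfolding y(3) using y y' zc b by (simp add: y'(3)[symmetric] l_distr) (simp add: y'(3) r_distr a_assoc)
  moreover have u: "y \<otimes> z' \<oplus> z \<otimes> b \<in> ?I" using y y' b by (intro I.a_closed I.I_l_closed I.I_r_closed) auto
  ultimately have "y \<otimes> y' = a \<otimes> b \<ominus> (y \<otimes> z' \<oplus> z \<otimes> b)"
   using y y' zc b a by (simp add: minus_eq a_assoc r_neg)
  hence yy: "y \<otimes> y' \<in> ?I" using I.a_closed[OF ab I.a_inv_closed[OF u]] by (simp add: minus_eq)
  let ?A = "{i. gcomp R y i ~= \<zero>}"
  have c: "gcomp R y i \<in> carrier R" "gcomp R y' i \<in> carrier R" for i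
   using gcomp_deg[OF y(2)] gcomp_deg[OF y'(2)] dcar by blast+
  have finA: "finite (insert m ?A)" using gcomp_finite[OF y(2)] by simp
  have "y \<otimes> y' = (\<Oplus>i\<in>insert m ?A. gcomp R y i) \<otimes> y'" using gcomp_sum'[OF y(2) finA subset_insertI] by simp
  also have "... = (\<Oplus>i\<in>insert m ?A. gcomp R y i \<otimes> y')" using c y' finA by (intro finsum_ldistr) auto
  also have "... = gcomp R y m \<otimes> y' \<oplus> (\<Oplus>i\<in>insert m ?A - {m}. gcomp R y i \<otimes> y')"
   using finA c y'(2) finsum_insert[of "insert m ?A - {m}" m "%i. gcomp R y i \<otimes> y'"] by (auto simp: insert_absorb)
  finally have e: "y \<otimes> y' = gcomp R y m \<otimes> y' \<oplus> (\<Oplus>i\<in>insert m ?A - {m}. gcomp R y i \<otimes> y')" .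
  \<comment> \<open>A term with index k different from m contributes nothing in degree m + m': if k
    > m the component of y vanishes, and if k < m the component of y' in degree m + m' - k > m'
    does.\<close>
  have "gcomp R (\<Oplus>i\<in>B. gcomp R y i \<otimes> y') (m + m') = \<zero>" if "finite B" "m \<notin> B" for B using that
  proof (induction B)
   case (insert k B)
   have "gcomp R (gcomp R y k \<otimes> y') (m + m') = gcomp R y k \<otimes> gcomp R y' (m + m' - k)"
    by (rule gcomp_mult_left[OF gcomp_deg[OF y(2)] y'(2)])
   also have "... = \<zero>" using y(5) y'(5) c insert.prems by (cases "k > m") (auto simp: not_less order.order_iff_strict)
   finally have *: "gcomp R (gcomp R y k \<otimes> y') (m + m') = \<zero>" .
   have "(\<Oplus>i\<in>insert k B. gcomp R y i \<otimes> y') = gcomp R y k \<otimes> y' \<oplus> (\<Oplus>i\<in>B. gcomp R y i \<otimes> y')"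
    using insert c y'(2) by (intro finsum_insert) auto
   thus ?case using insert * c y'(2) by (simp add: gcomp_add finsum_closed Pi_I)
  qed simp
  note rest = this[of "insert m ?A - {m}"]
  have gcs: "gcomp R (gcomp R y m \<otimes> y') (m + m') \<in> carrier R" using c y'(2) by (intro dcar[OF gcomp_deg]) auto
  have fc: "(\<Oplus>i\<in>insert m ?A - {m}. gcomp R y i \<otimes> y') \<in> carrier R" by (rule finsum_closed) (simp add: c y'(2) Pi_I)
  have rest': "gcomp R (\<Oplus>i\<in>insert m ?A - {m}. gcomp R y i \<otimes> y') (m + m') = \<zero>"
   by (rule rest) (rule finite_Diff[OF finA], simp)
  have "gcomp R (y \<otimes> y') (m + m') = gcomp R (gcomp R y m \<otimes> y') (m + m')"
   unfolding e gcomp_add[OF m_closed[OF c(1) y'(2)] fc] rest' using gcs by simp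
  also have "... = gcomp R y m \<otimes> gcomp R y' m'" by (simp add: gcomp_mult_left[OF gcomp_deg[OF y(2)] y'(2)])
  finally have ge: "gcomp R (y \<otimes> y') (m + m') = gcomp R y m \<otimes> gcomp R y' m'" .
  have "gcomp R (y \<otimes> y') (m + m') \<in> J (m + m')" using yy unfolding total_ideal_def by blast
  hence "gcomp R y m \<otimes> gcomp R y' m' \<in> J (m + m')" unfolding ge .
  thus False using prime[OF gcomp_deg[OF y(2)] gcomp_deg[OF y'(2)]] y(4) y'(4) by blast
 qed
 ultimately show ?thesis using homogeneous_total_ideal[OF J] by (auto simp: Spec_def)
qed

lemma Spec_ideal: "p \<in> Spec R ==> ideal p R"
 by (simp add: Spec_def homogeneous_ideal_def)

lemma Spec_prime:
 "p \<in> Spec R ==> a \<in> deg R i ==> b \<in> deg R j ==> a \<otimes> b \<in> p ==> a \<in> p \<or> b \<in> p"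
 using dcar by (auto simp: Spec_def)

lemma Spec_one: "p \<in> Spec R ==> \<one> \<notin> p"
 using ideal.one_imp_carrier by (fastforce simp: Spec_def homogeneous_ideal_def)

lemma Spec_gideal: "p \<in> Spec R ==> gideal R (%n. p \<inter> deg R n)"
 using gideal_of_ideal Spec_ideal by blast

lemma Spec_mult_right: "p \<in> Spec R ==> x \<in> p ==> r \<in> deg R i ==> x \<otimes> r \<in> p"
 using ideal.I_r_closed[OF Spec_ideal] dcar by blast

lemma Spec_neg:
 assumes "p \<in> Spec R" "x \<in> carrier R" shows "\<ominus> x \<in> p \<longleftrightarrow> x \<in> p"
using Spec_ideal assms(1) additive_subgroup_neg is_abelian_group minus_minus assms(2) by (fastforce simp: ideal_def)

lemma Spec_subset_homogeneous:
 assumes p: "p \<in> Spec R" and I: "ideal I R" and "!!n x. x \<in> deg R n ==> x \<in> p ==> x \<in> I"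
 shows "p <= I"
proof -
 have "p = Idl (p \<inter> homogeneous R)" using p by (simp add: Spec_def homogeneous_ideal_def)
 moreover have "Idl (p \<inter> homogeneous R) <= I" using assms(3) by (intro genideal_minimal[OF I]) (auto simp: homogeneous_def)
 ultimately show ?thesis by blast
qed

lemma gideal_gadd:
 assumes J: "gideal R J" and a: "a \<in> deg R d"
 shows "gideal R (gadd R J d a)"
proof (rule gidealI)
 have ac: "a \<in> carrier R" using a dcar by blast
 fix n x assume "x \<in> gadd R J d a n"
 thus "x \<in> deg R n" unfolding gadd_def by (auto intro!: deg_add mult_deg'[OF _ a] dest: gideal_sub[OF J])
next
 have ac: "a \<in> carrier R" using a dcar by blast
 show "\<zero> \<in> gadd R J d a n" for n
 proof -
  have "\<zero> = \<zero> \<oplus> \<zero> \<otimes> a" using ac by simp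
  thus ?thesis using gideal_zero[OF J, of n] deg_zero[of "n - d"] unfolding gadd_def by blast
 qed
next
 have ac: "a \<in> carrier R" using a dcar by blast
 fix n x y assume "x \<in> gadd R J d a n" "y \<in> gadd R J d a n"
 then obtain j r j' r' where *: "x = j \<oplus> r \<otimes> a" "y = j' \<oplus> r' \<otimes> a" "j \<in> J n" "j' \<in> J n"
  "r \<in> deg R (n - d)" "r' \<in> deg R (n - d)" unfolding gadd_def by blast
 have c: "j \<in> carrier R" "j' \<in> carrier R" "r \<in> carrier R" "r' \<in> carrier R" using * gideal_sub[OF J] dcar by blast+
 have "x \<oplus> y = (j \<oplus> j') \<oplus> (r \<oplus> r') \<otimes> a" unfolding *(1,2) using c ac by (simp add: l_distr a_ac)
 thus "x \<oplus> y \<in> gadd R J d a n" unfolding gadd_def using * gideal_add_closed[OF J] deg_add by blast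
next
 have ac: "a \<in> carrier R" using a dcar by blast
 fix i n s x assume s: "s \<in> deg R i" and "x \<in> gadd R J d a n"
 then obtain j r where *: "x = j \<oplus> r \<otimes> a" "j \<in> J n" "r \<in> deg R (n - d)" unfolding gadd_def by blast
 have c: "j \<in> carrier R" "r \<in> carrier R" "s \<in> carrier R" using * s gideal_sub[OF J] dcar by blast+
 have "s \<otimes> x = s \<otimes> j \<oplus> (s \<otimes> r) \<otimes> a" unfolding *(1) using c ac by (simp add: r_distr m_assoc)
 moreover have "s \<otimes> r \<in> deg R (i + n - d)" using s * by (auto intro: mult_deg')
 ultimately show "s \<otimes> x \<in> gadd R J d a (i + n)" unfolding gadd_def using gideal_mult[OF J s *(2)] by blast
qed

lemma gadd_incl:
 assumes J: "gideal R J" and a: "a \<in> deg R d"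
 shows "x \<in> J n ==> x \<in> gadd R J d a n" and "a \<in> gadd R J d a d"
proof -
 have ac: "a \<in> carrier R" using a dcar by blast
 show "x \<in> gadd R J d a n" if "x \<in> J n"
 proof -
  have "x = x \<oplus> \<zero> \<otimes> a" using dcar[OF gideal_sub[OF J that]] ac by simp
  thus ?thesis unfolding gadd_def using that deg_zero by blast
 qed
 have "a = \<zero> \<oplus> \<one> \<otimes> a" using ac by simp
 thus "a \<in> gadd R J d a d" unfolding gadd_def
  using gideal_zero[OF J] one_deg by (smt (verit, best) diff_self mem_Collect_eq)
qed

lemma gadd_least:
 assumes K: "gideal R K" "!!n. J n <= K n" "a \<in> K d"
 shows "gadd R J d a n <= K n" unfolding gadd_def
 using assms by (auto intro!: gideal_add_closed[OF K(1)] gideal_mult[OF K(1) _ K(3)])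

lemma gideal_gcol:
 assumes J: "gideal R J" and a: "a \<in> deg R d"
 shows "gideal R (gcol R J d a)"
proof (rule gidealI)
 have ac: "a \<in> carrier R" using a dcar by blast
 show "x \<oplus> y \<in> gcol R J d a n" if "x \<in> gcol R J d a n" "y \<in> gcol R J d a n" for n x y
  using that ac gideal_add_closed[OF J] dcar by (auto simp: gcol_def l_distr intro: deg_add)
 show "\<zero> \<in> gcol R J d a n" for n using gideal_zero[OF J] ac by (auto simp: gcol_def)
 fix i j r x assume r: "r \<in> deg R i" and x: "x \<in> gcol R J d a j"
 hence "r \<otimes> x \<otimes> a = r \<otimes> (x \<otimes> a)" using dcar ac by (auto simp: gcol_def m_assoc)
 thus "r \<otimes> x \<in> gcol R J d a (i + j)" using r x mult_deg gideal_mult[OF J r] by (auto simp: gcol_def add.assoc)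
qed (auto simp: gcol_def)

lemma gcol_incl:
 assumes J: "gideal R J" and a: "a \<in> deg R d" and "x \<in> J n"
 shows "x \<in> gcol R J d a n" using gideal_mult_right[OF J assms(3) a] gideal_sub[OF J] assms by (auto simp: gcol_def)

end

section \<open>The chain condition and noetherian induction on homogeneous ideals\<close>

locale noetherian_graded_ring = graded_commutative_ring R + noetherian_ring R
 for R :: "('r, 'z) gring_scheme" (structure)
begin

text \<open>The homogeneous components of finitely many ring generators of the total ideal suffice.
  Generation is phrased as minimality among homogeneous ideals, the form in which it is
  applied.\<close>

lemma gideal_fg:
 assumes J: "gideal R J"
 obtains S where "finite S" "!!d a. (d, a) \<in> S ==> a \<in> J d"
  "!!K n. gideal R K ==> (!!d a. (d, a) \<in> S ==> a \<in> K d) ==> J n <= K n"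
proof -
 obtain A where A: "A <= carrier R" "finite A" "total_ideal R J = Idl A" using finetely_gen[OF total_ideal_ideal[OF J]] by blast
 have AJ: "A <= total_ideal R J" using A genideal_self by blast
 define S where "S = (\<Union>x\<in>A. (%i. (i, gcomp R x i)) ` {i. gcomp R x i ~= \<zero>})"
 show ?thesis
 proof
  show "finite S" unfolding S_def using A gcomp_finite by blast
  show "a \<in> J d" if "(d, a) \<in> S" for d a using that AJ by (auto simp: S_def total_ideal_def)
  fix K n assume K: "gideal R K" and SK: "!!d a. (d, a) \<in> S ==> a \<in> K d"
  have "A <= total_ideal R K"
  proof
   fix x assume x: "x \<in> A"
   have "gcomp R x i \<in> K i" for i using SK[of i "gcomp R x i"] x gideal_zero[OF K, of i]
    by (cases "gcomp R x i = \<zero>") (auto simp: S_def)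
   thus "x \<in> total_ideal R K" using x A by (auto simp: total_ideal_def)
  qed
  hence "total_ideal R J <= total_ideal R K" unfolding A(3) by (rule genideal_minimal[OF total_ideal_ideal[OF K]])
  thus "J n <= K n" using total_ideal_homogeneous[OF J] total_ideal_homogeneous[OF K] gideal_sub[OF J] by blast
 qed
qed

text \<open>Without a maximal member there is a strictly ascending sequence in \<open>A\<close>; its
  union is finitely generated, and the generators already lie in one stage.\<close>

lemma gideal_maximal:
 assumes "A ~= {}" "!!J. J \<in> A ==> gideal R J"
 obtains J where "J \<in> A" "!!K. K \<in> A ==> (!!n. J n <= K n) ==> K = J"
proof (rule ccontr)
 assume neg: "\<not> thesis"
 note maxI = that
 have step: "\<exists>K\<in>A. (ALL n. J n <= K n) \<and> K ~= J" if "J \<in> A" for J using neg maxI[OF that] by metis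
 obtain J0 where "J0 \<in> A" using assms by blast
 have "EX F. \<forall>k::nat. F k \<in> A \<and> ((ALL n. F k n <= F (Suc k) n) \<and> F (Suc k) ~= F k)"
  by (rule dependent_nat_choice) (use \<open>J0 \<in> A\<close> step in blast)+
 then obtain F where F: "!!k::nat. F k \<in> A" "!!k. (ALL n. F k n <= F (Suc k) n) \<and> F (Suc k) ~= F k" by blast
 have mono: "F k n <= F l n" if "k \<le> l" for k l n using that by (induction rule: dec_induct) (use F(2) in blast)+
 define U where "U n = (\<Union>k. F k n)" for n
 have gi: "gideal R (F k)" for k using F assms by blast
 have U: "gideal R U"
 proof (rule gidealI)
  fix n x y assume "x \<in> U n" "y \<in> U n"
  then obtain k l where "x \<in> F k n" "y \<in> F l n" by (auto simp: U_def)
  hence "x \<in> F (max k l) n" "y \<in> F (max k l) n" using mono by (meson max.cobounded1 max.cobounded2 subsetD)+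
  thus "x \<oplus> y \<in> U n" using gideal_add_closed[OF gi] unfolding U_def by blast
 next
  fix i j r x assume "r \<in> deg R i" "x \<in> U j"
  thus "r \<otimes> x \<in> U (i + j)" unfolding U_def by (auto intro: gideal_mult[OF gi])
 next
  show "\<zero> \<in> U n" for n unfolding U_def by (simp add: gideal_zero[OF gi])
 next
  fix n x assume "x \<in> U n"
  then obtain k where "x \<in> F k n" unfolding U_def by blast
  thus "x \<in> deg R n" by (rule gideal_sub[OF gi])
 qed
 obtain S where S: "finite S" "!!d a. (d, a) \<in> S ==> a \<in> U d"
  "!!K n. gideal R K ==> (!!d a. (d, a) \<in> S ==> a \<in> K d) ==> U n <= K n" using gideal_fg[OF U] by metis
 have "\<forall>x\<in>S. EX k. snd x \<in> F k (fst x)" using S(2) by (auto simp: U_def)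
 then obtain k where k: "!!x. x \<in> S ==> snd x \<in> F (k x) (fst x)" by metis
 define m where "m = Max (insert 0 (k ` S))"
 have "a \<in> F m d" if "(d, a) \<in> S" for d a
 proof -
  have "k (d, a) \<le> m" using that S(1) by (simp add: m_def)
  thus ?thesis using k[OF that] mono by auto
 qed
 hence "U n <= F m n" for n using S(3)[OF gi] by blast
 moreover have "F (Suc m) n <= U n" for n by (auto simp: U_def)
 ultimately have "F (Suc m) = F m" using F(2) by blast
 thus False using F(2) by blast
qed

text \<open>Noetherian induction: a maximal counterexample \<open>J\<close> that is not prime is sandwiched between
 \<open>J + Ra\<close> and \<open>(J : a)\<close> for some \<open>a\<close>, both of which are larger.\<close>

lemma gideal_induct [consumes 1, case_names whole prime split]:
 assumes J: "gideal R J"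
  and whole: "P (deg R)"
  and prime: "!!q. q \<in> Spec R ==>
   (!!K. gideal R K ==> (!!n. q \<inter> deg R n <= K n) ==> K ~= (%n. q \<inter> deg R n) ==> P K) ==>
   P (%n. q \<inter> deg R n)"
  and split: "!!J a d. gideal R J ==> a \<in> deg R d ==> P (gadd R J d a) ==>
   P (gcol R J d a) ==> P J"
 shows "P J"
proof (rule ccontr)
 assume "\<not> P J"
 hence "{J. gideal R J \<and> \<not> P J} ~= {}" using J by blast
 then obtain J where "J \<in> {J. gideal R J \<and> \<not> P J}"
  and max': "!!K. K \<in> {J. gideal R J \<and> \<not> P J} ==> (!!n. J n <= K n) ==> K = J"
  using gideal_maximal[of "{J. gideal R J \<and> \<not> P J}"] by (metis (no_types, lifting) mem_Collect_eq)
 hence J: "gideal R J" and nP: "\<not> P J" by auto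
 have max: "P K" if "gideal R K" "!!n. J n <= K n" "K ~= J" for K using max'[of K] that by blast
 have one: "\<one> \<notin> J 0" using gideal_eq_whole[OF J] whole nP by metis
 show False
 proof (cases "EX i j a b. a \<in> deg R i \<and> b \<in> deg R j \<and> a \<otimes> b \<in> J (i + j) \<and> a \<notin> J i \<and> b \<notin> J j")
  case True
  then obtain i j a b where ab: "a \<in> deg R i" "b \<in> deg R j" "a \<otimes> b \<in> J (i + j)" "a \<notin> J i" "b \<notin> J j"
   by blast
  have "P (gadd R J j b)" using gadd_incl[OF J ab(2)] ab(5) by (intro max gideal_gadd[OF J ab(2)]) auto
  moreover have "P (gcol R J j b)"
  proof (intro max gideal_gcol[OF J ab(2)])
   have "a \<in> gcol R J j b i" using ab by (simp add: gcol_def)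
   thus "gcol R J j b ~= J" using ab(4) by auto
  qed (use gcol_incl[OF J ab(2)] in blast)
  ultimately show False using split[OF J ab(2)] nP by blast
 next
  case False
  hence spec: "total_ideal R J \<in> Spec R" using total_ideal_prime[OF J one] by blast
  have eq: "(%n. total_ideal R J \<inter> deg R n) = J" using total_ideal_homogeneous[OF J] gideal_sub[OF J] by (intro ext) blast
  have "P (%n. total_ideal R J \<inter> deg R n)" by (metis prime spec eq max)
  thus False using nP eq by simp
 qed
qed

text \<open>Noetherian induction on the contrapositive. In the inductive step x^k = j + r a and x^m
  a in J give x^(m + k) = x^m j + r' x^m a in J, where r' is r up to sign.\<close>

lemma prime_avoiding_powers:
 assumes J: "gideal R J" and x: "x \<in> deg R d" and "!!k::nat. x [^] k \<notin> J (int k * d)"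
 obtains q where "q \<in> Spec R" "!!n. J n <= q" "x \<notin> q"
proof -
 have xc: "x \<in> carrier R" using x dcar by blast
 have "(\<forall>q\<in>Spec R. (ALL n. J n <= q) --> x \<in> q) --> (\<exists>k::nat. x [^] k \<in> J (int k * d))" using J
 proof (induction rule: gideal_induct)
  case whole
  show ?case using one_deg by (auto intro!: exI[of _ "0::nat"])
 next
  case (prime q)
  show ?case
  proof
   assume "\<forall>q'\<in>Spec R. (ALL n. q \<inter> deg R n <= q') --> x \<in> q'"
   hence "x \<in> q" using prime(1) by blast
   thus "\<exists>k::nat. x [^] k \<in> q \<inter> deg R (int k * d)" using x xc by (intro exI[of _ "Suc 0"]) auto
  qed
 next
  case (split J a e)
  note J = split(1) and a = split(2)
  have ac: "a \<in> carrier R" using a dcar by blast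
  show ?case
  proof
   assume A: "\<forall>q\<in>Spec R. (ALL n. J n <= q) --> x \<in> q"
   have "\<exists>k::nat. x [^] k \<in> gadd R J e a (int k * d)" using split(3) A gadd_incl(1)[OF J a] by blast
   then obtain k :: nat and j r where k: "j \<in> J (int k * d)" "r \<in> deg R (int k * d - e)"
    "x [^] k = j \<oplus> r \<otimes> a" unfolding gadd_def by blast
   have "\<exists>k::nat. x [^] k \<in> gcol R J e a (int k * d)" using split(4) A gcol_incl[OF J a] by blast
   then obtain m :: nat where m: "x [^] m \<otimes> a \<in> J (int m * d + e)" unfolding gcol_def by blast
   have xm: "x [^] m \<in> deg R (int m * d)" by (rule pow_deg[OF x])
   obtain r' where r': "r' \<in> deg R (int k * d - e)" "x [^] m \<otimes> r = r' \<otimes> x [^] m" using swap_deg[OF xm k(2)] by metis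
   have c: "j \<in> carrier R" "r \<in> carrier R" "r' \<in> carrier R" using k r' gideal_sub[OF J] dcar by blast+
   have "x [^] (m + k) = x [^] m \<otimes> j \<oplus> x [^] m \<otimes> r \<otimes> a"
    using k(3) c ac xc by (simp add: nat_pow_mult[symmetric] r_distr m_assoc)
   also have "... = x [^] m \<otimes> j \<oplus> r' \<otimes> (x [^] m \<otimes> a)" using r' c ac xc by (simp add: m_assoc)
   also have "... \<in> J (int (m + k) * d)" by (intro gideal_add_closed[OF J] gideal_mult[OF J xm k(1)] gideal_mult[OF J r'(1) m])
     (auto simp: algebra_simps)
   finally show "\<exists>k::nat. x [^] k \<in> J (int k * d)" by blast
  qed
 qed
 thus ?thesis using that assms(3) by blast
qed

end

section \<open>Graded modules over noetherian rings\<close>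

text \<open>The class of \<open>x\<close> in M/P becomes zero in the localization at p. The relative
  form makes the quotient module unnecessary; \<open>null_sub M\<close> gives the absolute
  case.\<close>

definition tors ::
  "('r, 'z) gring_scheme => ('r, 'm) gmod => 'r set => (int => 'm set) => int => 'm => bool" where
 "tors R M p P n x \<longleftrightarrow> (EX i. \<exists>s\<in>deg R i. s \<notin> p \<and> act M i n s x \<in> P (i + n))"

definition null_sub :: "('r, 'm) gmod => int => 'm set" where
 "null_sub M n = {\<zero>[M,n]}"

definition add_cyclic :: "('r, 'z) gring_scheme => ('r, 'm) gmod => (int => 'm set) =>
  int => 'm => int => 'm set" where
 "add_cyclic R M P d m n =
   {y \<oplus>[M,n] act M (n - d) d r m | y r. y \<in> P n \<and> r \<in> deg R (n - d)}"

text \<open>Finite generation of Q modulo P, with generators taken in Q, expressed without the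
  quotient. It is applied to cycles modulo boundaries.\<close>

definition fg_over ::
  "('r, 'z) gring_scheme => ('r, 'm) gmod => (int => 'm set) => (int => 'm set) => bool" where
 "fg_over R M Q P \<longleftrightarrow> (EX S. finite S \<and> (\<forall>(d, m)\<in>S. m \<in> Q d) \<and>
   (ALL N. gsub R N M \<and> (ALL n. P n <= N n) \<and> (\<forall>(d, m)\<in>S. m \<in> N d) -->
    (ALL n. Q n <= N n)))"

lemma fg_overE:
 assumes "fg_over R M Q P"
 obtains S where "finite S" "\<forall>(d, m)\<in>S. m \<in> Q d"
  "!!N. gsub R N M ==> ALL n. P n <= N n ==> \<forall>(d, m)\<in>S. m \<in> N d ==> ALL n. Q n <= N n"
using assms exE that by (fastforce simp: fg_over_def)

lemma fg_over_trans:
 assumes "fg_over R M Q P" "fg_over R M P P'" "!!n. P n <= Q n"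
 shows "fg_over R M Q P'"
proof -
 obtain S where S: "finite S" "\<forall>(d, m)\<in>S. m \<in> Q d"
  "!!N. gsub R N M ==> ALL n. P n <= N n ==> \<forall>(d, m)\<in>S. m \<in> N d ==> ALL n. Q n <= N n"
  by (rule fg_overE[OF assms(1)], rule that; assumption)
 obtain S' where S': "finite S'" "\<forall>(d, m)\<in>S'. m \<in> P d"
  "!!N. gsub R N M ==> ALL n. P' n <= N n ==> \<forall>(d, m)\<in>S'. m \<in> N d ==> ALL n. P n <= N n"
  by (rule fg_overE[OF assms(2)], rule that; assumption)
 show ?thesis unfolding fg_over_def
 proof (intro exI[of _ "S \<union> S'"] conjI allI impI)
  show "finite (S \<union> S')" using S S' by simp
  show "\<forall>(d, m)\<in>S \<union> S'. m \<in> Q d" using S(2) S'(2) assms(3) by fastforce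
  fix N n
  assume N: "gsub R N M \<and> (ALL n. P' n <= N n) \<and> (\<forall>(d, m)\<in>S \<union> S'. m \<in> N d)"
  hence "ALL n. P n <= N n" using S'(3)[of N] by blast
  thus "Q n <= N n" using S(3)[of N] N by blast
 qed
qed

locale graded_mod = graded_commutative_ring R for R :: "('r, 'z) gring_scheme" (structure) +
 fixes M :: "('r, 'm) gmod"
 assumes graded_module: "gmodule R M"
begin

lemma cmpt_abelian: "abelian_group (cmpt M n)"
 using graded_module by (simp add: graded_module_def)

sublocale G: abelian_group "cmpt M n" for n by (rule cmpt_abelian)

lemma act_closed:
 "r \<in> deg R i ==> x \<in> elts M j ==> n = i + j ==> act M i j r x \<in> elts M n" using graded_module by (simp add: graded_module_def)

lemma act_add:
 "r \<in> deg R i ==> x \<in> elts M j ==> y \<in> elts M j ==> n = i + j ==>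
  act M i j r (x \<oplus>[M,j] y) = act M i j r x \<oplus>[M,n] act M i j r y"
 using graded_module by (simp add: graded_module_def)

lemma act_add_left:
 "r \<in> deg R i ==> s \<in> deg R i ==> x \<in> elts M j ==> n = i + j ==>
  act M i j (r \<oplus> s) x = act M i j r x \<oplus>[M,n] act M i j s x"
 using graded_module by (simp add: graded_module_def)

lemma act_act:
 "r \<in> deg R i ==> s \<in> deg R j ==> x \<in> elts M k ==> n = j + k ==> m = i + j ==>
  act M i n r (act M j k s x) = act M m k (r \<otimes> s) x"
 using graded_module by (simp add: graded_module_def)

lemma act_one: "x \<in> elts M j ==> act M 0 j \<one> x = x"
 using graded_module by (simp add: graded_module_def)

lemma act_zero:
 assumes "r \<in> deg R i" "n = i + j"
 shows "act M i j r \<zero>[M,j] = \<zero>[M,n]" by (metis act_closed assms(1) G.zero_closed assms(2) act_add G.add.l_cancel_one)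

lemma act_zero_left:
 assumes "x \<in> elts M j" "n = i + j"
 shows "act M i j \<zero> x = \<zero>[M,n]"
proof -
 have c: "act M i j \<zero> x \<in> elts M n" using act_closed[OF deg_zero assms] .
 have "act M i j \<zero> x \<oplus>[M,n] act M i j \<zero> x = act M i j \<zero> x" using act_add_left[OF deg_zero deg_zero assms] by simp
 thus ?thesis using c by (metis G.add.l_cancel_one)
qed

lemma act_neg:
 assumes "r \<in> deg R i" "x \<in> elts M j" "n = i + j"
 shows "act M i j r (\<ominus>[M,j] x) = \<ominus>[M,n] act M i j r x"
by (metis G.minus_equality act_add assms(1) G.a_inv_closed assms(2) assms(2,3) G.l_neg act_zero assms(1,3) assms act_closed)

lemma act_neg_left:
 assumes "r \<in> deg R i" "x \<in> elts M j" "n = i + j"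
 shows "act M i j (\<ominus> r) x = \<ominus>[M,n] act M i j r x"
proof (rule G.minus_equality[symmetric])
 show "act M i j (\<ominus> r) x \<oplus>[M,n] act M i j r x = \<zero>[M,n]" using act_add_left[OF deg_neg[OF assms(1)] assms]
  by (simp add: l_neg[OF dcar[OF assms(1)]] act_zero_left[OF assms(2,3)])
qed (use assms in \<open>auto intro!: act_closed deg_neg\<close>)

lemma act_minus:
 assumes "r \<in> deg R i" "x \<in> elts M j" "y \<in> elts M j" "n = i + j"
 shows "act M i j r (x \<ominus>[M,j] y) = act M i j r x \<ominus>[M,n] act M i j r y"
 using assms by (simp add: a_minus_def act_add[OF assms(1)] act_neg[OF assms(1)])

lemma act_swap:
 assumes "r \<in> deg R i" "s \<in> deg R j"
 obtains s' where "s' \<in> deg R j" "s' = s \<or> s' = \<ominus> s"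
  "!!x k n m. x \<in> elts M k ==> n = j + k ==> m = i + k ==>
   act M i n r (act M j k s x) = act M j m s' (act M i k r x)"
proof -
 obtain s' where s': "s' \<in> deg R j" "s' = s \<or> s' = \<ominus> s" "r \<otimes> s = s' \<otimes> r" using swap_deg[OF assms] .
 show ?thesis by (metis that s'(1,2) act_act assms s'(1) assms(1) s'(3) add.commute)
qed

lemma minus_eq_zero:
 assumes "x \<in> elts M n" "y \<in> elts M n" "x \<ominus>[M,n] y = \<zero>[M,n]" shows "x = y"
proof -
 have "x = (x \<ominus>[M,n] y) \<oplus>[M,n] y" using assms(1,2) by (simp add: a_minus_def G.a_assoc G.l_neg)
 thus ?thesis using assms by simp
qed

lemma add_minus_cancel:
 assumes "x \<in> elts M n" "y \<in> elts M n"
 shows "x \<oplus>[M,n] y \<ominus>[M,n] x = y" "x \<oplus>[M,n] y \<ominus>[M,n] y = x"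
  "x \<oplus>[M,n] (y \<ominus>[M,n] x) = y" "(y \<ominus>[M,n] x) \<oplus>[M,n] x = y"
proof -
 have a: "x \<oplus>[M,n] y \<ominus>[M,n] x = y" if "x \<in> elts M n" "y \<in> elts M n" for x y
  using that by (simp add: a_minus_def G.a_comm[of x] G.a_assoc G.r_neg)
 have b: "(y \<ominus>[M,n] x) \<oplus>[M,n] x = y" using assms by (simp add: a_minus_def G.a_assoc G.l_neg)
 show "x \<oplus>[M,n] y \<ominus>[M,n] x = y" using a assms by blast
 show "x \<oplus>[M,n] y \<ominus>[M,n] y = x" using a[of y x] assms by (simp add: G.a_comm)
 show "(y \<ominus>[M,n] x) \<oplus>[M,n] x = y" by (rule b)
 thus "x \<oplus>[M,n] (y \<ominus>[M,n] x) = y" using assms by (simp add: G.a_comm)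
qed

lemma minus_add_cancel:
 assumes "x \<in> elts M n" "y \<in> elts M n" "z \<in> elts M n"
 shows "x \<ominus>[M,n] (y \<oplus>[M,n] z) \<oplus>[M,n] y = x \<ominus>[M,n] z"
  "(y \<oplus>[M,n] z) \<ominus>[M,n] (x \<oplus>[M,n] z) = y \<ominus>[M,n] x"
proof -
 have "x \<ominus>[M,n] (y \<oplus>[M,n] z) \<oplus>[M,n] y =
   (x \<ominus>[M,n] z) \<oplus>[M,n] (y \<oplus>[M,n] \<ominus>[M,n] y)"
  using assms by (simp add: a_minus_def G.minus_add G.a_ac)
 thus "x \<ominus>[M,n] (y \<oplus>[M,n] z) \<oplus>[M,n] y = x \<ominus>[M,n] z" using assms by (simp add: G.r_neg)
 have "(y \<oplus>[M,n] z) \<ominus>[M,n] (x \<oplus>[M,n] z) =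
   (y \<ominus>[M,n] x) \<oplus>[M,n] (z \<oplus>[M,n] \<ominus>[M,n] z)"
  using assms by (simp add: a_minus_def G.minus_add G.a_ac)
 thus "(y \<oplus>[M,n] z) \<ominus>[M,n] (x \<oplus>[M,n] z) = y \<ominus>[M,n] x" using assms by (simp add: G.r_neg)
qed

lemma sub_elts: "gsub R N M ==> x \<in> N n ==> x \<in> elts M n"
 using additive_subgroup.a_subset[of "N n" "cmpt M n"] by (auto simp: graded_submodule_def)

lemma sub_zero: "gsub R N M ==> \<zero>[M,n] \<in> N n"
 by (rule additive_subgroup.zero_closed) (simp add: graded_submodule_def)

lemma sub_add: "gsub R N M ==> x \<in> N n ==> y \<in> N n ==> x \<oplus>[M,n] y \<in> N n"
 by (rule additive_subgroup.a_closed) (simp_all add: graded_submodule_def)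

lemma sub_neg: "gsub R N M ==> x \<in> N n ==> \<ominus>[M,n] x \<in> N n"
 by (rule additive_subgroup_neg[OF cmpt_abelian]) (simp_all add: graded_submodule_def)

lemma sub_minus: "gsub R N M ==> x \<in> N n ==> y \<in> N n ==> x \<ominus>[M,n] y \<in> N n"
 unfolding a_minus_def by (intro sub_add sub_neg)

lemma sub_act:
 "gsub R N M ==> r \<in> deg R i ==> x \<in> N j ==> n = i + j ==> act M i j r x \<in> N n" by (simp add: graded_submodule_def)

lemma submoduleI:
 assumes "!!n x. x \<in> N n ==> x \<in> elts M n" "!!n. \<zero>[M,n] \<in> N n"
  "!!n x y. x \<in> N n ==> y \<in> N n ==> x \<oplus>[M,n] y \<in> N n"
  "!!i j r x. r \<in> deg R i ==> x \<in> N j ==> act M i j r x \<in> N (i + j)"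
 shows "gsub R N M"
proof -
 have neg: "\<ominus>[M,n] x \<in> N n" if "x \<in> N n" for x n
 proof -
  have "act M 0 n (\<ominus> \<one>) x \<in> N (0 + n)" by (rule assms(4)[OF deg_neg[OF one_deg] that])
  moreover have "act M 0 n (\<ominus> \<one>) x = \<ominus>[M,n] x"
   using act_neg_left[OF one_deg assms(1)[OF that], of n] act_one[OF assms(1)[OF that]] by simp
  ultimately show ?thesis by simp
 qed
 have "additive_subgroup (N n) (cmpt M n)" for n
 proof (rule additive_subgroupI'[OF cmpt_abelian])
  show "N n <= elts M n" using assms(1) by blast
 qed (use assms(2,3) neg in blast)+
 thus ?thesis using assms(4) unfolding graded_submodule_def by blast
qed

lemma sub_whole: "gsub R (elts M) M"
 by (rule submoduleI) (auto intro: act_closed)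

lemma sub_null: "gsub R (null_sub M) M"
 by (rule submoduleI) (auto simp: null_sub_def act_zero)

lemma sub_Int:
 "gsub R N M ==> gsub R K M ==> gsub R (%n. N n \<inter> K n) M"
 by (rule submoduleI) (auto intro: sub_elts sub_zero sub_add sub_act)

lemma sub_add_cyclic:
 assumes P: "gsub R P M" and m: "m \<in> elts M d"
 shows "gsub R (add_cyclic R M P d m) M"
proof (rule submoduleI)
 fix n x assume "x \<in> add_cyclic R M P d m n"
 then obtain y r where *: "x = y \<oplus>[M,n] act M (n - d) d r m" "y \<in> P n" "r \<in> deg R (n - d)" unfolding add_cyclic_def by blast
 show "x \<in> elts M n" unfolding *(1) by (intro G.a_closed sub_elts[OF P *(2)] act_closed[OF *(3) m]) simp
next
 fix n
 have "\<zero>[M,n] = \<zero>[M,n] \<oplus>[M,n] act M (n - d) d \<zero> m" by (simp add: act_zero_left[OF m, of n])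
 thus "\<zero>[M,n] \<in> add_cyclic R M P d m n" unfolding add_cyclic_def using sub_zero[OF P, of n] deg_zero[of "n - d"] by blast
next
 fix n x x' assume "x \<in> add_cyclic R M P d m n" "x' \<in> add_cyclic R M P d m n"
 then obtain y r y' r' where *: "x = y \<oplus>[M,n] act M (n - d) d r m" "y \<in> P n" "r \<in> deg R (n - d)"
   "x' = y' \<oplus>[M,n] act M (n - d) d r' m" "y' \<in> P n" "r' \<in> deg R (n - d)" unfolding add_cyclic_def by blast
 have c: "y \<in> elts M n" "y' \<in> elts M n" "act M (n - d) d r m \<in> elts M n" "act M (n - d) d r' m \<in> elts M n"
  using sub_elts[OF P] * act_closed[OF *(3) m, of n] act_closed[OF *(6) m, of n] by auto
 have "x \<oplus>[M,n] x' = (y \<oplus>[M,n] y') \<oplus>[M,n] act M (n - d) d (r \<oplus> r') m"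
  unfolding *(1,4) act_add_left[OF *(3,6) m, of n, simplified] using c by (simp add: G.a_ac)
 thus "x \<oplus>[M,n] x' \<in> add_cyclic R M P d m n" unfolding add_cyclic_def using sub_add[OF P *(2,5)] deg_add[OF *(3,6)] by blast
next
 fix i j s x assume s: "s \<in> deg R i" and "x \<in> add_cyclic R M P d m j"
 then obtain y r where *: "x = y \<oplus>[M,j] act M (j - d) d r m" "y \<in> P j" "r \<in> deg R (j - d)" unfolding add_cyclic_def by blast
 have c: "y \<in> elts M j" "act M (j - d) d r m \<in> elts M j" using sub_elts[OF P] * act_closed[OF *(3) m, of j] by auto
 have "act M i j s x = act M i j s y \<oplus>[M,i + j] act M (i + j - d) d (s \<otimes> r) m"
  unfolding *(1) act_add[OF s c refl] by (simp add: act_act[OF s *(3) m, of j "i + j - d"])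
 moreover have "s \<otimes> r \<in> deg R (i + j - d)" using s *(3) by (auto intro: mult_deg')
 ultimately show "act M i j s x \<in> add_cyclic R M P d m (i + j)" unfolding add_cyclic_def using sub_act[OF P s *(2) refl] by blast
qed

lemma add_cyclic_incl:
 assumes P: "gsub R P M" and m: "m \<in> elts M d"
 shows "P n <= add_cyclic R M P d m n" "m \<in> add_cyclic R M P d m d"
proof
 fix x assume x: "x \<in> P n"
 have "x = x \<oplus>[M,n] act M (n - d) d \<zero> m" using sub_elts[OF P x] by (simp add: act_zero_left[OF m, of n])
 thus "x \<in> add_cyclic R M P d m n" unfolding add_cyclic_def using x deg_zero[of "n - d"] by blast
next
 have "m = \<zero>[M,d] \<oplus>[M,d] act M (d - d) d \<one> m" using m by (simp add: act_one)
 moreover have "\<one> \<in> deg R (d - d)" using one_deg by simp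
 ultimately show "m \<in> add_cyclic R M P d m d" unfolding add_cyclic_def using sub_zero[OF P, of d] by blast
qed

lemma add_cyclic_least:
 assumes N: "gsub R N M" and "!!n. P n <= N n" and "m \<in> N d"
 shows "add_cyclic R M P d m n <= N n"
proof
 fix x assume "x \<in> add_cyclic R M P d m n"
 then obtain y r where *: "x = y \<oplus>[M,n] act M (n - d) d r m" "y \<in> P n" "r \<in> deg R (n - d)" unfolding add_cyclic_def by blast
 show "x \<in> N n" unfolding *(1) using assms(2) *(2) by (intro sub_add[OF N] sub_act[OF N *(3) assms(3)]) auto
qed

text \<open>This is the ideal of all r with r m in A + B. With A a submodule P and B a submodule of
  P + Rm, it collects the coefficients of m that occur in B.\<close>

lemma gideal_translate:
 assumes A: "gsub R A M" and B: "gsub R B M" and m: "m \<in> elts M d"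
 shows "gideal R (%n. {r \<in> deg R n. \<exists>w\<in>A (n + d). w \<oplus>[M,n + d] act M n d r m \<in> B (n + d)})"
proof (rule gidealI)
 fix n
 have "\<zero>[M,n + d] \<oplus>[M,n + d] act M n d \<zero> m = \<zero>[M,n + d]" by (simp add: act_zero_left[OF m refl])
 thus "\<zero> \<in> {r \<in> deg R n. \<exists>w\<in>A (n + d). w \<oplus>[M,n + d] act M n d r m \<in> B (n + d)}"
  using sub_zero[OF A] sub_zero[OF B] by (auto intro!: bexI[of _ "\<zero>[M,n + d]"])
next
 fix n r s
 assume "r \<in> {r \<in> deg R n. \<exists>w\<in>A (n + d). w \<oplus>[M,n + d] act M n d r m \<in> B (n + d)}"
  "s \<in> {r \<in> deg R n. \<exists>w\<in>A (n + d). w \<oplus>[M,n + d] act M n d r m \<in> B (n + d)}"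
 then obtain v w where *: "r \<in> deg R n" "s \<in> deg R n" "v \<in> A (n + d)" "w \<in> A (n + d)"
  "v \<oplus>[M,n + d] act M n d r m \<in> B (n + d)" "w \<oplus>[M,n + d] act M n d s m \<in> B (n + d)" by blast
 have c: "v \<in> elts M (n + d)" "w \<in> elts M (n + d)" "act M n d r m \<in> elts M (n + d)" "act M n d s m \<in> elts M (n + d)"
  using * sub_elts[OF A] act_closed[OF _ m refl] by auto
 have "(v \<oplus>[M,n + d] w) \<oplus>[M,n + d] act M n d (r \<oplus> s) m =
   (v \<oplus>[M,n + d] act M n d r m) \<oplus>[M,n + d] (w \<oplus>[M,n + d] act M n d s m)"
  using c by (simp add: act_add_left[OF *(1,2) m refl] G.a_ac)
 also have "... \<in> B (n + d)" by (rule sub_add[OF B *(5,6)])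
 finally show "r \<oplus> s \<in> {r \<in> deg R n. \<exists>w\<in>A (n + d). w \<oplus>[M,n + d] act M n d r m \<in> B (n + d)}"
  using deg_add[OF *(1,2)] sub_add[OF A *(3,4)] by blast
next
 fix i n s r
 assume s: "s \<in> deg R i"
  and "r \<in> {r \<in> deg R n. \<exists>w\<in>A (n + d). w \<oplus>[M,n + d] act M n d r m \<in> B (n + d)}"
 then obtain v where *: "r \<in> deg R n" "v \<in> A (n + d)" "v \<oplus>[M,n + d] act M n d r m \<in> B (n + d)" by blast
 have e: "i + n + d = i + (n + d)" by simp
 have "act M i (n + d) s v \<oplus>[M,i + n + d] act M (i + n) d (s \<otimes> r) m =
   act M i (n + d) s (v \<oplus>[M,n + d] act M n d r m)"
  using act_act[OF s *(1) m refl refl] act_add[OF s sub_elts[OF A *(2)] act_closed[OF *(1) m refl] e] by simp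
 also have "... \<in> B (i + n + d)" by (rule sub_act[OF B s *(3) e])
 finally show "s \<otimes> r \<in> {r \<in> deg R (i + n). \<exists>w\<in>A (i + n + d). w \<oplus>[M,i + n + d] act M (i + n) d r m \<in> B (i + n + d)}"
  using mult_deg[OF s *(1)] sub_act[OF A s *(2) e] by blast
qed simp

lemma gideal_residual:
 assumes B: "gsub R B M" and m: "m \<in> elts M d"
 shows "gideal R (%n. {r \<in> deg R n. act M n d r m \<in> B (n + d)})"
proof -
 have "(\<exists>w\<in>null_sub M (n + d). w \<oplus>[M,n + d] act M n d r m \<in> B (n + d)) \<longleftrightarrow> act M n d r m \<in> B (n + d)"
  if "r \<in> deg R n" for n r using act_closed[OF that m refl] by (simp add: null_sub_def)
 hence "(%n. {r \<in> deg R n. \<exists>w\<in>null_sub M (n + d). w \<oplus>[M,n + d] act M n d r m \<in> B (n + d)}) =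
   (%n. {r \<in> deg R n. act M n d r m \<in> B (n + d)})"
  by (intro ext Collect_cong conj_cong refl) blast
 thus ?thesis using gideal_translate[OF sub_null B m] by simp
qed

lemma fg_iff: "finitely_generated R M \<longleftrightarrow> fg_over R M (elts M) (null_sub M)"
proof -
 have "(ALL n. N n = elts M n) \<longleftrightarrow> (ALL n. elts M n <= N n)" "ALL n. null_sub M n <= N n"
  if "gsub R N M" for N using sub_elts[OF that] sub_zero[OF that] by (auto simp: null_sub_def)
 thus ?thesis unfolding finitely_generated_def fg_over_def by meson
qed

lemma tors_submodule:
 assumes p: "p \<in> Spec R" and P: "gsub R P M"
 shows "gsub R (%n. {x \<in> elts M n. tors R M p P n x}) M"
proof (rule submoduleI)
 fix n
 have "act M 0 n \<one> \<zero>[M,n] \<in> P (0 + n)" using sub_zero[OF P] by (simp add: act_one)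
 thus "\<zero>[M,n] \<in> {x \<in> elts M n. tors R M p P n x}" using one_deg Spec_one[OF p] unfolding tors_def by blast
next
 fix n x y assume "x \<in> {x \<in> elts M n. tors R M p P n x}" "y \<in> {x \<in> elts M n. tors R M p P n x}"
 then obtain i s j t where x: "x \<in> elts M n" "s \<in> deg R i" "s \<notin> p" "act M i n s x \<in> P (i + n)"
  and y: "y \<in> elts M n" "t \<in> deg R j" "t \<notin> p" "act M j n t y \<in> P (j + n)" unfolding tors_def by blast
 have "s \<otimes> t \<notin> p" using Spec_prime[OF p x(2) y(2)] x(3) y(3) by blast
 moreover have "act M (i + j) n (s \<otimes> t) x \<in> P (i + j + n)"
 proof -
  obtain t' where t': "t' \<in> deg R j" "!!x k n m. x \<in> elts M k ==> n = j + k ==> m = i + k ==>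
   act M i n s (act M j k t x) = act M j m t' (act M i k s x)" using act_swap[OF x(2) y(2)] by metis
  have "act M (i + j) n (s \<otimes> t) x = act M j (i + n) t' (act M i n s x)"
   using act_act[OF x(2) y(2) x(1) refl refl] t'(2)[OF x(1) refl refl] by simp
  thus ?thesis using sub_act[OF P t'(1) x(4), of "i + j + n"] by simp
 qed
 moreover have "act M (i + j) n (s \<otimes> t) y \<in> P (i + j + n)"
  using act_act[OF x(2) y(2) y(1) refl refl] sub_act[OF P x(2) y(4), of "i + j + n"] by simp
 ultimately show "x \<oplus>[M,n] y \<in> {x \<in> elts M n. tors R M p P n x}" unfolding tors_def using x y mult_deg[OF x(2) y(2)]
  by (auto simp: act_add[OF mult_deg[OF x(2) y(2)]] intro!: exI[of _ "i + j"] bexI[of _ "s \<otimes> t"] sub_add[OF P])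
next
 fix j n r x assume r: "r \<in> deg R j" and "x \<in> {x \<in> elts M n. tors R M p P n x}"
 then obtain i s where x: "x \<in> elts M n" "s \<in> deg R i" "s \<notin> p" "act M i n s x \<in> P (i + n)" unfolding tors_def by blast
 obtain r' where r': "r' \<in> deg R j" "!!x k n m. x \<in> elts M k ==> n = j + k ==> m = i + k ==>
   act M i n s (act M j k r x) = act M j m r' (act M i k s x)" using act_swap[OF x(2) r] by metis
 have "act M i (j + n) s (act M j n r x) \<in> P (i + (j + n))"
  using r'(2)[OF x(1) refl refl] sub_act[OF P r'(1) x(4), of "i + (j + n)"] by simp
 thus "act M j n r x \<in> {x \<in> elts M (j + n). tors R M p P (j + n) x}"
  using x(2,3) act_closed[OF r x(1) refl] unfolding tors_def by blast
qed simp

lemma tors_tors: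
 assumes p: "p \<in> Spec R" and x: "x \<in> elts M n" and s: "s \<in> deg R i" "s \<notin> p"
  and t: "tors R M p P (i + n) (act M i n s x)"
 shows "tors R M p P n x"
proof -
 obtain j t where t: "t \<in> deg R j" "t \<notin> p" "act M j (i + n) t (act M i n s x) \<in> P (j + (i + n))"
  using t unfolding tors_def by blast
 have "act M (j + i) n (t \<otimes> s) x \<in> P (j + i + n)" using t(3) act_act[OF t(1) s(1) x refl refl] by (simp add: add.assoc)
 thus ?thesis using mult_deg[OF t(1) s(1)] Spec_prime[OF p t(1) s(1)] t(2) s(2) unfolding tors_def by blast
qed

lemma tors_incl:
 assumes "p \<in> Spec R" "x \<in> P n" "x \<in> elts M n"
 shows "tors R M p P n x" unfolding tors_def using Spec_one[OF assms(1)] one_deg assms(2,3)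
 by (intro exI[of _ 0] bexI[of _ \<one>]) (auto simp: act_one)

text \<open>If x over 1 equals 0 over 1, the Ore relation yields a denominator killing x. Conversely
  two fractions with denominators s and s' are expanded to the common denominator s' s = r s';
  further factors t and v outside p kill the two expanded numerators, so any two fractions
  coincide.\<close>

lemma localization_zero_iff:
 assumes p: "p \<in> Spec R"
 shows "localization_zero R p M \<longleftrightarrow> (ALL n. \<forall>x\<in>elts M n. tors R M p (null_sub M) n x)"
proof
 assume L: "localization_zero R p M"
 show "ALL n. \<forall>x\<in>elts M n. tors R M p (null_sub M) n x"
 proof (intro allI ballI)
  fix n x assume x: "x \<in> elts M n"
  have fr: "(0, \<one>, x) \<in> fractions R p M n" using x Spec_one[OF p] one_deg by (simp add: fractions_def)
  have "((0, \<one>, x), (0, \<one>, x)) \<in> frac_rel R p M n"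
   using fr one_deg Spec_one[OF p] by (auto simp: frac_rel_def intro!: exI[of _ 0] bexI[of _ \<one>])
  moreover have "frac_rel R p M n `` {(0, \<one>, x)} = frac_rel R p M n `` {(0, \<one>, \<zero>[M,n])}"
  proof -
   have "frac_rel R p M n `` {(0, \<one>, x)} \<in> localization R p M n" unfolding localization_def by (rule quotientI[OF fr])
   thus ?thesis using L by (simp add: localization_zero_def)
  qed
  ultimately have "((0, \<one>, \<zero>[M,n]), (0, \<one>, x)) \<in> frac_rel R p M n" by blast
  then obtain k u u' where u: "u \<in> deg R k" "u' \<in> deg R k" "u \<otimes> \<one> = u' \<otimes> \<one>" "u \<otimes> \<one> \<notin> p"
   "act M k n u \<zero>[M,n] = act M k n u' x" by (auto simp: frac_rel_def)
  hence "u' \<notin> p" using dcar by auto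
  moreover have "act M k n u' x \<in> null_sub M (k + n)" using u(5) act_zero[OF u(1) refl] by (simp add: null_sub_def)
  ultimately show "tors R M p (null_sub M) n x" using u(2) unfolding tors_def by blast
 qed
next
 assume T: "ALL n. \<forall>x\<in>elts M n. tors R M p (null_sub M) n x"
 have rel: "(f, g) \<in> frac_rel R p M n" if "f \<in> fractions R p M n" "g \<in> fractions R p M n" for f g n
 proof -
  obtain i s m i' s' m' where fg: "f = (i, s, m)" "g = (i', s', m')" by (metis prod_cases3)
  have f: "s \<in> deg R i" "s \<notin> p" "m \<in> elts M (i + n)"
   and g: "s' \<in> deg R i'" "s' \<notin> p" "m' \<in> elts M (i' + n)" using that unfolding fg fractions_def by auto
  obtain r where r: "r \<in> deg R i" "r = s \<or> r = \<ominus> s" "s' \<otimes> s = r \<otimes> s'" using swap_deg[OF g(1) f(1)] .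
  have a: "act M i' (i + n) s' m \<in> elts M (i' + (i + n))" "act M i (i' + n) r m' \<in> elts M (i + (i' + n))"
   using act_closed f g r by blast+
  obtain j t where t: "t \<in> deg R j" "t \<notin> p" "act M j (i' + (i + n)) t (act M i' (i + n) s' m) = \<zero>[M,j + (i' + (i + n))]"
   using T a(1) unfolding tors_def null_sub_def by blast
  obtain l v where v: "v \<in> deg R l" "v \<notin> p" "act M l (i + (i' + n)) v (act M i (i' + n) r m') = \<zero>[M,l + (i + (i' + n))]"
   using T a(2) unfolding tors_def null_sub_def by blast
  obtain t' where t': "t' \<in> deg R j" "t' = t \<or> t' = \<ominus> t" "v \<otimes> t = t' \<otimes> v" using swap_deg[OF v(1) t(1)] .
  have vt: "v \<otimes> t \<in> deg R (l + j)" "v \<otimes> t \<notin> p" using v t mult_deg Spec_prime[OF p v(1) t(1)] by blast+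
  have car: "s \<in> carrier R" "s' \<in> carrier R" "r \<in> carrier R" "v \<in> carrier R" "t \<in> carrier R"
   using f g r v t dcar by blast+
  have u: "v \<otimes> t \<otimes> s' \<in> deg R (l + j + i')" "v \<otimes> t \<otimes> r \<in> deg R (l + j + i)"
   using mult_deg vt f g r by blast+
  have eq: "v \<otimes> t \<otimes> s' \<otimes> s = v \<otimes> t \<otimes> r \<otimes> s'" using r(3) car by (simp add: m_assoc)
  have np: "v \<otimes> t \<otimes> s' \<otimes> s \<notin> p" using Spec_prime[OF p u(1) f(1)] Spec_prime[OF p vt(1) g(1)] vt f g by blast
  have z1: "act M (l + j + i') (i + n) (v \<otimes> t \<otimes> s') m = \<zero>[M,l + j + i' + (i + n)]"
  proof -
   have "act M (l + j + i') (i + n) (v \<otimes> t \<otimes> s') m = act M l (j + (i' + (i + n))) v (act M j (i' + (i + n)) t (act M i' (i + n) s' m))"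
    using act_act[OF vt(1) g(1) f(3) refl refl] act_act[OF v(1) t(1) a(1) refl refl] by simp
   also have "... = \<zero>[M,l + j + i' + (i + n)]" unfolding t(3) by (rule act_zero[OF v(1)]) simp
   finally show ?thesis .
  qed
  have z2: "act M (l + j + i) (i' + n) (v \<otimes> t \<otimes> r) m' = \<zero>[M,l + j + i' + (i + n)]"
  proof -
   have "act M (l + j + i) (i' + n) (v \<otimes> t \<otimes> r) m' = act M j (l + (i + (i' + n))) t' (act M l (i + (i' + n)) v (act M i (i' + n) r m'))"
    using act_act[OF vt(1) r(1) g(3) refl refl] act_act[OF t'(1) v(1) a(2) refl refl] t'(3) by (simp add: add.commute)
   also have "... = \<zero>[M,l + j + i' + (i + n)]" unfolding v(3) by (rule act_zero[OF t'(1)]) simp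
   finally show ?thesis .
  qed
  have "EX k k'. k + i = k' + i' \<and> (\<exists>u\<in>deg R k. \<exists>u'\<in>deg R k'. u \<otimes> s = u' \<otimes> s' \<and> u \<otimes> s \<notin> p \<and>
      act M k (i + n) u m = act M k' (i' + n) u' m')"
   by (rule exI[of _ "l + j + i'"], rule exI[of _ "l + j + i"], rule conjI, simp,
     rule bexI[OF _ u(1)], rule bexI[OF _ u(2)]) (use eq np z1 z2 in auto)
  thus ?thesis using that unfolding frac_rel_def fg by simp
 qed
 show "localization_zero R p M" unfolding localization_zero_def
 proof
  fix n
  have z: "(0, \<one>, \<zero>[M,n]) \<in> fractions R p M n" using Spec_one[OF p] one_deg by (simp add: fractions_def)
  have "frac_rel R p M n `` {f} = frac_rel R p M n `` {(0, \<one>, \<zero>[M,n])}" if "f \<in> fractions R p M n" for f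
  proof -
   have "frac_rel R p M n `` {g} = fractions R p M n" if "g \<in> fractions R p M n" for g using rel[OF that] by (auto simp: frac_rel_def)
   thus ?thesis using that z by simp
  qed
  thus "localization R p M n = {frac_rel R p M n `` {(0, \<one>, \<zero>[M,n])}}" unfolding localization_def quotient_def using z by blast
 qed
qed

text \<open>Induction on the number of generators; multiplying by \<open>u \<notin> p\<close> moves the last generator
 into the submodule generated by the others.\<close>

lemma nakayama:
 assumes p: "p \<in> Spec R" and Q: "gsub R Q M" and P: "gsub R P M"
  and fg: "fg_over R M Q P" and a: "a \<in> deg R d" "a \<in> p"
  and div: "!!n x. x \<in> Q n ==> EX i s y. s \<in> deg R i \<and> s \<notin> p \<and> y \<in> Q (i + n - d) \<and>
   act M i n s x \<ominus>[M,i + n] act M d (i + n - d) a y \<in> P (i + n)"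
  and x: "x \<in> Q n"
 shows "tors R M p P n x"
proof -
 obtain S where S: "finite S" "\<forall>(d, m)\<in>S. m \<in> Q d"
  "!!N. gsub R N M ==> ALL n. P n <= N n ==> \<forall>(d, m)\<in>S. m \<in> N d ==> ALL n. Q n <= N n"
  by (rule fg_overE[OF fg], rule that; assumption)
 have "ALL n. \<forall>x\<in>Q n. tors R M p P n x" using S P div
 proof (induction S arbitrary: P)
  case empty
  hence "ALL n. Q n <= P n" by blast
  thus ?case using tors_incl[OF p] sub_elts[OF Q] by blast
 next
  case (insert g S)
  obtain e m where g: "g = (e, m)" by (cases g)
  have mQ: "m \<in> Q e" using insert.prems(1) g by auto
  have m: "m \<in> elts M e" by (rule sub_elts[OF Q mQ])
  note P = insert.prems(3)
  let ?P = "add_cyclic R M P e m"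
  have P': "gsub R ?P M" by (rule sub_add_cyclic[OF P m])
  note inc = add_cyclic_incl[OF P m]
  have IH: "ALL n. \<forall>x\<in>Q n. tors R M p ?P n x"
  proof (rule insert.IH[OF _ _ P'])
   show "\<forall>(d, m)\<in>S. m \<in> Q d" using insert.prems(1) by blast
   show "ALL n. Q n <= N n" if "gsub R N M" "ALL n. ?P n <= N n" "\<forall>(d, m)\<in>S. m \<in> N d" for N
   using insert.prems(2) that(1) that(2) inc(1) that inc(2) g by blast
   show "EX i s y. s \<in> deg R i \<and> s \<notin> p \<and> y \<in> Q (i + n - d) \<and>
    act M i n s x \<ominus>[M,i + n] act M d (i + n - d) a y \<in> ?P (i + n)" if "x \<in> Q n" for n x
    using insert.prems(4)[OF that] inc(1) by blast
  qed
  have um: "tors R M p P e m"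
  proof -
   obtain i s y where s: "s \<in> deg R i" "s \<notin> p" "y \<in> Q (i + e - d)"
    "act M i e s m \<ominus>[M,i + e] act M d (i + e - d) a y \<in> P (i + e)" using insert.prems(4)[OF mQ] by blast
   define k where "k = i + e - d"
   have s': "y \<in> Q k" "act M i e s m \<ominus>[M,i + e] act M d k a y \<in> P (i + e)" using s by (simp_all add: k_def)
   have y: "y \<in> elts M k" by (rule sub_elts[OF Q s'(1)])
   obtain j t where t: "t \<in> deg R j" "t \<notin> p" "act M j k t y \<in> ?P (j + k)" using IH s'(1) unfolding tors_def by blast
   obtain w r where w: "act M j k t y = w \<oplus>[M,j + k] act M (j + k - e) e r m" "w \<in> P (j + k)"
    "r \<in> deg R (j + k - e)" using t(3) unfolding add_cyclic_def by blast
   obtain a' where a': "a' \<in> deg R d" "a' = a \<or> a' = \<ominus> a" "!!x k n m. x \<in> elts M k ==> n = d + k ==> m = j + k ==>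
    act M j n t (act M d k a x) = act M d m a' (act M j k t x)" by (rule act_swap[OF t(1) a(1)], rule that; assumption)
   have a'p: "a' \<in> p" using a' a(2) Spec_neg[OF p dcar[OF a(1)]] by auto
   \<comment> \<open>Applying t to s m = a y modulo P and inserting t y = w + r m gives u m in P.
     Moreover u is outside p, because a' r lies in p while t s does not.\<close>
   define u where "u = t \<otimes> s \<ominus> a' \<otimes> r"
   have ar: "a' \<otimes> r \<in> deg R (j + i)" by (rule mult_deg'[OF a'(1) w(3)]) (simp add: k_def)
   have ts: "t \<otimes> s \<in> deg R (j + i)" by (rule mult_deg[OF t(1) s(1)])
   have u: "u \<in> deg R (j + i)" unfolding u_def a_minus_def by (intro deg_add deg_neg ts ar)
   have "u \<notin> p"
   proof
    assume "u \<in> p"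
    moreover have "a' \<otimes> r \<in> p" by (rule Spec_mult_right[OF p a'p w(3)])
    ultimately have "u \<oplus> a' \<otimes> r \<in> p" using additive_subgroup.a_closed[of p R] Spec_ideal[OF p] by (simp add: ideal_def)
    moreover have "u \<oplus> a' \<otimes> r = t \<otimes> s" unfolding u_def
     using dcar[OF ts] dcar[OF ar] by (simp add: minus_eq a_assoc l_neg)
    ultimately show False using Spec_prime[OF p t(1) s(1)] t(2) s(2) by simp
   qed
   moreover have "act M (j + i) e u m \<in> P (j + i + e)"
   proof -
    let ?n = "j + i + e"
    have c: "act M i e s m \<in> elts M (i + e)" "act M d k a y \<in> elts M (i + e)"
     using act_closed[OF s(1) m] act_closed[OF a(1) y] by (auto simp: k_def)
    have aw: "act M d (j + k) a' w \<in> P ?n" by (rule sub_act[OF P a'(1) w(2)]) (simp add: k_def)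
    have rm: "act M (j + k - e) e r m \<in> elts M (j + k)" by (rule act_closed[OF w(3) m]) simp
    have awe: "act M d (j + k) a' w \<in> elts M ?n" by (rule sub_elts[OF P aw])
    have arm: "act M (j + i) e (a' \<otimes> r) m \<in> elts M ?n" by (rule act_closed[OF ar m refl])
    have tsm: "act M (j + i) e (t \<otimes> s) m \<in> elts M ?n" by (rule act_closed[OF ts m refl])
    have "act M d (j + k) a' (act M j k t y) = act M d (j + k) a' w \<oplus>[M,?n] act M (j + i) e (a' \<otimes> r) m"
     unfolding w(1) using act_add[OF a'(1) sub_elts[OF P w(2)] rm, of ?n] act_act[OF a'(1) w(3) m, of "j + k" "j + i"] by (simp add: k_def)
    moreover have "act M j (i + e) t (act M d k a y) = act M d (j + k) a' (act M j k t y)" by (rule a'(3)[OF y]) (auto simp: k_def)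
    ultimately have e1: "act M j (i + e) t (act M d k a y) = act M d (j + k) a' w \<oplus>[M,?n] act M (j + i) e (a' \<otimes> r) m" by simp
    have e2: "act M j (i + e) t (act M i e s m) = act M (j + i) e (t \<otimes> s) m" by (rule act_act[OF t(1) s(1) m refl refl])
    have "act M j (i + e) t (act M i e s m \<ominus>[M,i + e] act M d k a y) \<in> P ?n" by (rule sub_act[OF P t(1) s'(2)]) simp
    hence "act M (j + i) e (t \<otimes> s) m \<ominus>[M,?n] (act M d (j + k) a' w \<oplus>[M,?n] act M (j + i) e (a' \<otimes> r) m) \<in> P ?n"
     using act_minus[OF t(1) c, of ?n] e1 e2 by simp
    hence "act M (j + i) e (t \<otimes> s) m \<ominus>[M,?n] (act M d (j + k) a' w \<oplus>[M,?n] act M (j + i) e (a' \<otimes> r) m)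
      \<oplus>[M,?n] act M d (j + k) a' w \<in> P ?n" using aw sub_add[OF P] by blast
    moreover have "act M (j + i) e (t \<otimes> s) m \<ominus>[M,?n] (act M d (j + k) a' w \<oplus>[M,?n] act M (j + i) e (a' \<otimes> r) m)
      \<oplus>[M,?n] act M d (j + k) a' w = act M (j + i) e (t \<otimes> s) m \<ominus>[M,?n] act M (j + i) e (a' \<otimes> r) m"
     by (rule minus_add_cancel(1)[OF tsm awe arm])
    moreover have "act M (j + i) e u m = act M (j + i) e (t \<otimes> s) m \<ominus>[M,?n] act M (j + i) e (a' \<otimes> r) m"
     unfolding u_def a_minus_def by (simp add: act_add_left[OF ts deg_neg[OF ar] m refl] act_neg_left[OF ar m refl])
    ultimately show ?thesis by simp
   qed
   ultimately show ?thesis using u unfolding tors_def by blast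
  qed
  show ?case
  proof (intro allI ballI)
   fix n x assume x: "x \<in> Q n"
   obtain i s where s: "s \<in> deg R i" "s \<notin> p" "act M i n s x \<in> ?P (i + n)" using IH x unfolding tors_def by blast
   have "?P (i + n) <= {x \<in> elts M (i + n). tors R M p P (i + n) x}" by (rule add_cyclic_least[OF tors_submodule[OF p P]])
     (use tors_incl[OF p] sub_elts[OF P] um m in auto)
   thus "tors R M p P n x" using tors_tors[OF p sub_elts[OF Q x] s(1,2)] s(3) by blast
  qed
 qed
 thus ?thesis using x by blast
qed

end

section \<open>Submodules of finitely generated modules, and associated primes\<close>

locale noetherian_graded_mod = noetherian_graded_ring R + graded_mod R M
 for R :: "('r, 'z) gring_scheme" (structure) and M :: "('r, 'm) gmod"
begin

text \<open>The coefficients of a generator m that occur in Q' modulo P form a finitely generated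
  ideal. Elements of Q' realizing generators of this ideal generate the intersection of Q' with P +
  Rm over the intersection with P; the induction adds one generator m at a time.\<close>

lemma fg_over_sub_aux:
 assumes Q': "gsub R Q' M" and "!!n. Q' n <= Q n" and "finite S"
  and "gsub R P M" and "\<forall>(d, m)\<in>S. m \<in> elts M d"
  and "!!N. gsub R N M ==> ALL n. P n <= N n ==> \<forall>(d, m)\<in>S. m \<in> N d ==> ALL n. Q n <= N n"
 shows "fg_over R M Q' (%n. Q' n \<inter> P n)" using assms(3-6)
proof (induction S arbitrary: P)
 case empty
 hence "ALL n. Q n <= P n" by blast
 hence "!!n. Q' n \<inter> P n = Q' n" using assms(2) by blast
 thus ?case unfolding fg_over_def by (intro exI[of _ "{}"]) auto
next
 case (insert g S)
 obtain d m where g: "g = (d, m)" by (cases g)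
 have m: "m \<in> elts M d" using insert.prems(2) g by auto
 note P = insert.prems(1)
 let ?P = "add_cyclic R M P d m"
 have P': "gsub R ?P M" by (rule sub_add_cyclic[OF P m])
 note inc = add_cyclic_incl[OF P m]
 have "fg_over R M Q' (%n. Q' n \<inter> ?P n)"
 proof (rule insert.IH[OF P'])
  show "\<forall>(d, m)\<in>S. m \<in> elts M d" using insert.prems(2) by blast
  show "ALL n. Q n <= N n" if "gsub R N M" "ALL n. ?P n <= N n" "\<forall>(d, m)\<in>S. m \<in> N d" for N
  using insert.prems(3) that(1) that(2) inc(1) that inc(2) g by blast
 qed
 moreover have "fg_over R M (%n. Q' n \<inter> ?P n) (%n. Q' n \<inter> P n)"
 proof -
  define J where "J B n = {r \<in> deg R n. \<exists>w\<in>P (n + d). w \<oplus>[M,n + d] act M n d r m \<in> B (n + d)}" for B n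
  have J: "gideal R (J B)" if "gsub R B M" for B unfolding J_def by (rule gideal_translate[OF P that m])
  obtain A where A: "finite A" "!!e a. (e, a) \<in> A ==> a \<in> J Q' e"
   "!!K n. gideal R K ==> (!!e a. (e, a) \<in> A ==> a \<in> K e) ==> J Q' n <= K n" using gideal_fg[OF J[OF Q']] by metis
  have "\<forall>z\<in>A. \<exists>w\<in>P (fst z + d). w \<oplus>[M,fst z + d] act M (fst z) d (snd z) m \<in> Q' (fst z + d)"
   using A(2) unfolding J_def by auto
  then obtain w where w: "!!z. z \<in> A ==> w z \<in> P (fst z + d)"
   "!!z. z \<in> A ==> w z \<oplus>[M,fst z + d] act M (fst z) d (snd z) m \<in> Q' (fst z + d)" by metis
  define f where "f z = (fst z + d, w z \<oplus>[M,fst z + d] act M (fst z) d (snd z) m)" for z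
  show ?thesis unfolding fg_over_def
  proof (intro exI[of _ "f ` A"] conjI allI impI)
   show "finite (f ` A)" using A by simp
   show "\<forall>(e, x)\<in>f ` A. x \<in> Q' e \<inter> ?P e"
   proof
    fix y assume "y \<in> f ` A"
    then obtain z where z: "z \<in> A" "y = f z" by blast
    have zd: "snd z \<in> deg R (fst z)" using A(2)[of "fst z" "snd z"] z by (simp add: J_def)
    have "act M (fst z) d (snd z) m \<in> ?P (fst z + d)" by (rule sub_act[OF P' zd inc(2) refl])
    moreover have "w z \<in> ?P (fst z + d)" using w(1)[OF z(1)] inc(1) by blast
    ultimately show "case y of (e, x) => x \<in> Q' e \<inter> ?P e" using w(2)[OF z(1)] sub_add[OF P'] by (simp add: z f_def)
   qed
   fix N n
   assume N: "gsub R N M \<and> (ALL n. Q' n \<inter> P n <= N n) \<and> (\<forall>(e, x)\<in>f ` A. x \<in> N e)"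
   let ?B = "%n. Q' n \<inter> N n"
   have N': "gsub R N M" using N by blast
   have B: "gsub R ?B M" by (rule sub_Int[OF Q' N'])
   \<comment> \<open>The chosen elements of Q' lie in N, so the generators of the coefficient ideal
     of Q' are already coefficients of elements of \<open>?B\<close>; minimality gives the
     rest.\<close>
   have sub: "J Q' k <= J ?B k" for k
   proof (rule A(3)[OF J[OF B]])
    fix e a assume ea: "(e, a) \<in> A"
    hence "a \<in> deg R e" using A(2) by (auto simp: J_def)
    moreover have "w (e, a) \<oplus>[M,e + d] act M e d a m \<in> ?B (e + d)" using w(2)[OF ea] N ea by (force simp: f_def)
    ultimately show "a \<in> J ?B e" using w(1)[OF ea] unfolding J_def by auto
   qed
   show "Q' n \<inter> ?P n <= N n"
   proof
    fix x assume x: "x \<in> Q' n \<inter> ?P n"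
    then obtain y r where y: "x = y \<oplus>[M,n] act M (n - d) d r m" "y \<in> P n" "r \<in> deg R (n - d)"
     unfolding add_cyclic_def by blast
    have "r \<in> J Q' (n - d)" using x y by (auto simp: J_def)
    hence "r \<in> J ?B (n - d)" using sub by blast
    then obtain v where v: "v \<in> P n" "v \<oplus>[M,n] act M (n - d) d r m \<in> ?B n" by (auto simp: J_def)
    have rm: "act M (n - d) d r m \<in> elts M n" by (rule act_closed[OF y(3) m]) simp
    have c: "y \<in> elts M n" "v \<in> elts M n" using sub_elts[OF P] y v by blast+
    \<comment> \<open>\<open>?v\<close> is an element of N with the same coefficient r as x, so
      their difference lies in both Q' and P, hence in N.\<close>
    let ?v = "v \<oplus>[M,n] act M (n - d) d r m"
    have "x \<ominus>[M,n] ?v = y \<ominus>[M,n] v" unfolding y(1) by (rule minus_add_cancel(2)[OF c(2,1) rm])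
    moreover have "x \<ominus>[M,n] ?v \<in> Q' n" using x v by (intro sub_minus[OF Q']) auto
    moreover have "y \<ominus>[M,n] v \<in> P n" by (rule sub_minus[OF P y(2) v(1)])
    ultimately have "x \<ominus>[M,n] ?v \<in> N n" using N by auto
    hence "(x \<ominus>[M,n] ?v) \<oplus>[M,n] ?v \<in> N n" using v(2) by (intro sub_add[OF N' _ IntD2])
    moreover have "(x \<ominus>[M,n] ?v) \<oplus>[M,n] ?v = x" by (rule add_minus_cancel(4)) (use x c rm sub_elts[OF Q'] in auto)
    ultimately show "x \<in> N n" by simp
   qed
  qed
 qed
 ultimately show ?case by (rule fg_over_trans) blast
qed

lemma fg_over_sub:
 assumes "fg_over R M Q P" "gsub R P M" "gsub R Q M" "gsub R Q' M" "!!n. Q' n <= Q n"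
 shows "fg_over R M Q' (%n. Q' n \<inter> P n)"
proof -
 obtain S where S: "finite S" "\<forall>(d, m)\<in>S. m \<in> Q d"
  "!!N. gsub R N M ==> ALL n. P n <= N n ==> \<forall>(d, m)\<in>S. m \<in> N d ==> ALL n. Q n <= N n"
  by (rule fg_overE[OF assms(1)], rule that; assumption)
 show ?thesis by (rule fg_over_sub_aux[OF assms(4,5) S(1) assms(2) _ S(3)]) (use S(2) sub_elts[OF assms(3)] in fastforce)+
qed

text \<open>Take a nonzero homogeneous class y of M/N with maximal annihilator. If a b kills y and b
  does not, the annihilator of b y contains that of y, hence equals it, and a belongs to it; so the
  annihilator is prime.\<close>

lemma associated_prime:
 assumes N: "gsub R N M" and x: "x \<in> elts M n" "x \<notin> N n"
 obtains q m y where "q \<in> Spec R" "y \<in> elts M m" "y \<notin> N m"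
  "!!i r. r \<in> deg R i ==> act M i m r y \<in> N (i + m) \<longleftrightarrow> r \<in> q"
proof -
 define res where "res m y = (%n. {r \<in> deg R n. act M n m r y \<in> N (n + m)})" for m y
 let ?A = "{res m y | m y. y \<in> elts M m \<and> y \<notin> N m}"
 have "?A ~= {}" using x by blast
 moreover have "gideal R J" if "J \<in> ?A" for J using that gideal_residual[OF N] by (auto simp: res_def)
 ultimately have "\<exists>J\<in>?A. \<forall>K\<in>?A. (ALL n. J n <= K n) --> K = J"
 proof (rule gideal_maximal)
  fix J assume J: "J \<in> ?A" and max: "!!K. K \<in> ?A ==> (!!n. J n <= K n) ==> K = J"
  show ?thesis by (rule bexI[OF _ J]) (use max in blast)
 qed
 then obtain J where J: "J \<in> ?A" and max: "!!K. K \<in> ?A ==> (!!n. J n <= K n) ==> K = J" by blast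
 then obtain m y where y: "J = res m y" "y \<in> elts M m" "y \<notin> N m" by blast
 have gJ: "gideal R J" using gideal_residual[OF N y(2)] y(1) by (simp add: res_def)
 have one: "\<one> \<notin> J 0" using y by (auto simp: res_def act_one)
 have spec: "total_ideal R J \<in> Spec R"
 proof (rule total_ideal_prime[OF gJ one])
  fix i j a b assume a: "a \<in> deg R i" and b: "b \<in> deg R j" and ab: "a \<otimes> b \<in> J (i + j)"
  show "a \<in> J i \<or> b \<in> J j"
  proof (rule disjCI)
   assume "b \<notin> J j"
   hence bN: "act M j m b y \<notin> N (j + m)" using b by (simp add: y(1) res_def)
   let ?K = "res (j + m) (act M j m b y)"
   have "?K \<in> ?A" using bN act_closed[OF b y(2) refl] by blast
   moreover have "J n <= ?K n" for n
   proof
    fix r assume "r \<in> J n"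
    hence r: "r \<in> deg R n" "act M n m r y \<in> N (n + m)" by (auto simp: y(1) res_def)
    obtain b' where b': "b' \<in> deg R j" "!!x k n' m. x \<in> elts M k ==> n' = j + k ==> m = n + k ==>
     act M n n' r (act M j k b x) = act M j m b' (act M n k r x)" using act_swap[OF r(1) b] by metis
    have "act M n (j + m) r (act M j m b y) \<in> N (n + (j + m))"
     using b'(2)[OF y(2) refl refl] sub_act[OF N b'(1) r(2), of "n + (j + m)"] by simp
    thus "r \<in> ?K n" using r by (simp add: res_def)
   qed
   ultimately have K: "?K = J" using max by blast
   have "act M i (j + m) a (act M j m b y) \<in> N (i + (j + m))"
    using ab act_act[OF a b y(2) refl refl] by (simp add: y(1) res_def add.assoc)
   hence "a \<in> ?K i" using a by (simp add: res_def)
   thus "a \<in> J i" unfolding K .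
  qed
 qed
 show ?thesis using that spec y(2,3) total_ideal_homogeneous gJ y(1) by (simp add: res_def)
qed

end

section \<open>Homomorphisms, quotients and injective modules\<close>

text \<open>Transport of the module structure along \<open>q\<close>, computed on chosen preimages.
  An injective \<open>q\<close> moves a module to another type; a \<open>q\<close> that selects
  coset representatives produces a quotient.\<close>

definition gimg :: "('r, 'm) gmod => (int => 'm => 'n) => ('r, 'n) gmod" where
 "gimg M q =
   \<lparr>cmpt = (%n. \<lparr>carrier = q n ` elts M n, mult = undefined, one = undefined,
    zero = q n \<zero>[M,n],
    add = (%u v. q n (inv_into (elts M n) (q n) u \<oplus>[M,n] inv_into (elts M n) (q n) v))\<rparr>),
   act = (%i j r u. q (i + j) (act M i j r (inv_into (elts M j) (q j) u)))\<rparr>"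

text \<open>A quotient consisting of representatives stays on the type of M, as a resolution with
  all its terms on one type demands.\<close>

definition coset_rep :: "('r, 'm) gmod => (int => 'm set) => int => 'm => 'm" where
 "coset_rep M N n x = (SOME y. y \<in> elts M n \<and> x \<ominus>[M,n] y \<in> N n)"

definition ideal_mod :: "('r, 'z) gring_scheme => (int => 'r set) => ('r, 'r) gmod" where
 "ideal_mod R J =
   \<lparr>cmpt = (%n. \<lparr>carrier = J n, mult = undefined, one = undefined, zero = \<zero>\<^bsub>R\<^esub>, add = add R\<rparr>),
   act = (%i j r x. r \<otimes>\<^bsub>R\<^esub> x)\<rparr>"

definition sub_mod :: "('r, 'm) gmod => (int => 'm set) => ('r, 'm) gmod" where
 "sub_mod M N = \<lparr>cmpt = (%n. (cmpt M n)\<lparr>carrier := N n\<rparr>), act = act M\<rparr>"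

definition gsum :: "('r, 'm) gmod => ('r, 'n) gmod => ('r, 'm \<times> 'n) gmod" where
 "gsum M N =
   \<lparr>cmpt = (%n. \<lparr>carrier = elts M n \<times> elts N n, mult = undefined, one = undefined,
    zero = (\<zero>[M,n], \<zero>[N,n]),
    add = (%u v. (fst u \<oplus>[M,n] fst v, snd u \<oplus>[N,n] snd v))\<rparr>),
   act = (%i j r u. (act M i j r (fst u), act N i j r (snd u)))\<rparr>"

context graded_commutative_ring
begin

lemma gmodI: "gmodule R M ==> graded_mod R M"
 by (simp add: graded_mod_def graded_commutative_ring_axioms graded_mod_axioms_def)

lemma hom_closed: "gmod_hom R M N f ==> x \<in> elts M n ==> f n x \<in> elts N n"
 by (auto simp: gmod_hom_def)

lemma hom_add:
 "gmod_hom R M N f ==> x \<in> elts M n ==> y \<in> elts M n ==>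
  f n (x \<oplus>[M,n] y) = f n x \<oplus>[N,n] f n y"
 by (auto simp: gmod_hom_def)

lemma hom_act:
 "gmod_hom R M N f ==> r \<in> deg R i ==> x \<in> elts M j ==> n = i + j ==>
  f n (act M i j r x) = act N i j r (f j x)"
 by (auto simp: gmod_hom_def)

lemma hom_comp:
 "gmod_hom R L M f ==> gmod_hom R M N g ==> gmod_hom R L N (%n x. g n (f n x))" by (auto simp: gmod_hom_def Pi_iff)

lemma hom_zero:
 assumes "gmodule R M" "gmodule R N" "gmod_hom R M N f"
 shows "f n \<zero>[M,n] = \<zero>[N,n]"
proof -
 interpret M: graded_mod R M by (rule gmodI[OF assms(1)])
 interpret N: graded_mod R N by (rule gmodI[OF assms(2)])
 have "f n \<zero>[M,n] \<oplus>[N,n] f n \<zero>[M,n] = f n \<zero>[M,n]"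
  using hom_add[OF assms(3) M.G.zero_closed M.G.zero_closed, of n] by simp
 thus ?thesis using hom_closed[OF assms(3) M.G.zero_closed, of n] by (metis N.G.add.l_cancel_one)
qed

lemma hom_neg:
 assumes "gmodule R M" "gmodule R N" "gmod_hom R M N f" "x \<in> elts M n"
 shows "f n (\<ominus>[M,n] x) = \<ominus>[N,n] f n x"
proof -
 interpret M: graded_mod R M by (rule gmodI[OF assms(1)])
 interpret N: graded_mod R N by (rule gmodI[OF assms(2)])
 show ?thesis
 proof (rule N.G.minus_equality[symmetric])
  show "f n (\<ominus>[M,n] x) \<oplus>[N,n] f n x = \<zero>[N,n]"
   using hom_add[OF assms(3) M.G.a_inv_closed[OF assms(4)] assms(4)] M.G.l_neg[OF assms(4)]
    hom_zero[OF assms(1-3)] by simp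
 qed (use assms(4) hom_closed[OF assms(3)] in auto)
qed

lemma hom_minus:
 assumes "gmodule R M" "gmodule R N" "gmod_hom R M N f" "x \<in> elts M n" "y \<in> elts M n"
 shows "f n (x \<ominus>[M,n] y) = f n x \<ominus>[N,n] f n y"
proof -
 interpret M: graded_mod R M by (rule gmodI[OF assms(1)])
 show ?thesis using assms(4,5) hom_add[OF assms(3)] hom_neg[OF assms(1-3)] by (simp add: a_minus_def)
qed

lemma hom_image_submodule:
 assumes "gmodule R M" "gmodule R N" "gmod_hom R M N f" "gsub R P M"
 shows "gsub R (%n. f n ` P n) N"
proof -
 interpret M: graded_mod R M by (rule gmodI[OF assms(1)])
 interpret N: graded_mod R N by (rule gmodI[OF assms(2)])
 note P = M.sub_elts[OF assms(4)]
 show ?thesis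
 proof (rule N.submoduleI)
  show "\<zero>[N,n] \<in> f n ` P n" for n using M.sub_zero[OF assms(4)] hom_zero[OF assms(1-3)] by (metis imageI)
  fix n u v assume "u \<in> f n ` P n" "v \<in> f n ` P n"
  then obtain x y where "u = f n x" "v = f n y" "x \<in> P n" "y \<in> P n" by blast
  thus "u \<oplus>[N,n] v \<in> f n ` P n" using hom_add[OF assms(3) P P] M.sub_add[OF assms(4)] by (metis imageI)
 next
  fix i j r u assume r: "r \<in> deg R i" and "u \<in> f j ` P j"
  then obtain x where "u = f j x" "x \<in> P j" by blast
  thus "act N i j r u \<in> f (i + j) ` P (i + j)" using hom_act[OF assms(3) r P refl] M.sub_act[OF assms(4) r] by (metis imageI)
 qed (use hom_closed[OF assms(3)] P in blast)
qed

lemma hom_preimage_submodule: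
 assumes "gmodule R M" "gmodule R N" "gmod_hom R M N f" "gsub R P N"
 shows "gsub R (%n. {x \<in> elts M n. f n x \<in> P n}) M"
proof -
 interpret M: graded_mod R M by (rule gmodI[OF assms(1)])
 interpret N: graded_mod R N by (rule gmodI[OF assms(2)])
 show ?thesis by (rule M.submoduleI) (auto simp: hom_zero[OF assms(1-3)] hom_add[OF assms(3)] hom_act[OF assms(3) _ _ refl]
    intro: N.sub_zero[OF assms(4)] N.sub_add[OF assms(4)] N.sub_act[OF assms(4)] M.act_closed)
qed

lemma kernel_submodule:
 assumes "gmodule R M" "gmodule R N" "gmod_hom R M N f"
 shows "gsub R (gmod_kernel M N f) M"
proof -
 interpret N: graded_mod R N by (rule gmodI[OF assms(2)])
 have "gmod_kernel M N f = (%n. {x \<in> elts M n. f n x \<in> null_sub N n})" by (auto simp: gmod_kernel_def null_sub_def)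
 thus ?thesis using hom_preimage_submodule[OF assms N.sub_null] by simp
qed

lemma image_submodule:
 assumes "gmodule R M" "gmodule R N" "gmod_hom R M N f"
 shows "gsub R (gmod_image M f) N"
proof -
 interpret M: graded_mod R M by (rule gmodI[OF assms(1)])
 have "gmod_image M f = (%n. f n ` elts M n)" by (auto simp: gmod_image_def)
 thus ?thesis using hom_image_submodule[OF assms M.sub_whole] by simp
qed

lemma inj_on_iff_kernel:
 assumes "gmodule R M" "gmodule R N" "gmod_hom R M N f"
 shows "inj_on (f n) (elts M n) \<longleftrightarrow> (\<forall>x\<in>elts M n. f n x = \<zero>[N,n] --> x = \<zero>[M,n])"
proof
 interpret M: graded_mod R M by (rule gmodI[OF assms(1)])
 interpret N: graded_mod R N by (rule gmodI[OF assms(2)])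
 show "\<forall>x\<in>elts M n. f n x = \<zero>[N,n] --> x = \<zero>[M,n]" if "inj_on (f n) (elts M n)"
  using that hom_zero[OF assms] by (metis M.G.zero_closed inj_onD)
 assume k: "\<forall>x\<in>elts M n. f n x = \<zero>[N,n] --> x = \<zero>[M,n]"
 show "inj_on (f n) (elts M n)"
 proof (rule inj_onI)
  fix x y assume xy: "x \<in> elts M n" "y \<in> elts M n" "f n x = f n y"
  have "f n (x \<ominus>[M,n] y) = \<zero>[N,n]" using hom_minus[OF assms xy(1,2)] xy hom_closed[OF assms(3) xy(2)]
   by (simp add: a_minus_def N.G.r_neg)
  thus "x = y" using k M.minus_eq_zero[OF xy(1,2)] xy by simp
 qed
qed

lemma gimg_graded_module:
 assumes M: "gmodule R M"
  and cadd: "!!n x x' y y'. x \<in> elts M n ==> x' \<in> elts M n ==> y \<in> elts M n ==> y' \<in> elts M n ==>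
   q n x = q n x' ==> q n y = q n y' ==> q n (x \<oplus>[M,n] y) = q n (x' \<oplus>[M,n] y')"
  and cact: "!!i j r x x'. r \<in> deg R i ==> x \<in> elts M j ==> x' \<in> elts M j ==> q j x = q j x' ==>
   q (i + j) (act M i j r x) = q (i + j) (act M i j r x')"
 shows "gmodule R (gimg M q)" "gmod_hom R M (gimg M q) q"
  "elts (gimg M q) n = q n ` elts M n"
proof -
 interpret M: graded_mod R M by (rule gmodI[OF M])
 let ?Q = "gimg M q"
 let ?iv = "%n. inv_into (elts M n) (q n)"
 have iv: "?iv n (q n x) \<in> elts M n" "q n (?iv n (q n x)) = q n x" if "x \<in> elts M n" for x n
  using that by (auto intro: inv_into_into f_inv_into_f)
 have el: "elts ?Q n = q n ` elts M n" for n by (simp add: gimg_def)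
 have ad: "q n x \<oplus>[?Q,n] q n y = q n (x \<oplus>[M,n] y)" if "x \<in> elts M n" "y \<in> elts M n" for x y n
  using cadd[OF iv(1) that(1) iv(1) that(2) iv(2) iv(2)] that by (simp add: gimg_def)
 have ac: "act ?Q i j r (q j x) = q (i + j) (act M i j r x)" if "r \<in> deg R i" "x \<in> elts M j" for i j r x
  using cact[OF that(1) iv(1) that(2) iv(2)] that by (simp add: gimg_def)
 have ze: "\<zero>[?Q,n] = q n \<zero>[M,n]" for n by (simp add: gimg_def)
 have gr: "abelian_group (cmpt ?Q n)" for n
 proof (rule abelian_groupI)
  fix u v assume "u \<in> elts ?Q n" "v \<in> elts ?Q n"
  then obtain x y where xy: "x \<in> elts M n" "y \<in> elts M n" "u = q n x" "v = q n y" by (auto simp: el)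
  show "u \<oplus>[?Q,n] v \<in> elts ?Q n" using xy by (simp add: ad el)
  show "u \<oplus>[?Q,n] v = v \<oplus>[?Q,n] u" using xy by (simp add: ad M.G.a_comm)
  fix w assume "w \<in> elts ?Q n"
  then obtain z where z: "z \<in> elts M n" "w = q n z" by (auto simp: el)
  show "u \<oplus>[?Q,n] v \<oplus>[?Q,n] w = u \<oplus>[?Q,n] (v \<oplus>[?Q,n] w)" using xy z by (simp add: ad M.G.a_assoc)
 next
  fix u assume "u \<in> elts ?Q n"
  then obtain x where x: "x \<in> elts M n" "u = q n x" by (auto simp: el)
  show "\<zero>[?Q,n] \<oplus>[?Q,n] u = u" using x by (simp add: ze ad)
  show "\<exists>y\<in>elts ?Q n. y \<oplus>[?Q,n] u = \<zero>[?Q,n]"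
   using x by (intro bexI[of _ "q n (\<ominus>[M,n] x)"]) (auto simp: ze ad M.G.l_neg el)
 qed (simp add: ze el)
 show "gmodule R ?Q" unfolding graded_module_def
 proof (intro conjI allI ballI gr)
  fix i j r u assume r: "r \<in> deg R i" and "u \<in> elts ?Q j"
  then obtain x where x: "x \<in> elts M j" "u = q j x" by (auto simp: el)
  show "act ?Q i j r u \<in> elts ?Q (i + j)" using M.act_closed[OF r x(1) refl] x by (simp add: ac[OF r] el)
  fix v assume "v \<in> elts ?Q j"
  then obtain y where y: "y \<in> elts M j" "v = q j y" by (auto simp: el)
  show "act ?Q i j r (u \<oplus>[?Q,j] v) = act ?Q i j r u \<oplus>[?Q,i + j] act ?Q i j r v" using x y M.act_closed[OF r _ refl]
   by (simp add: ad ac[OF r] M.act_add[OF r])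
 next
  fix i j r s u assume r: "r \<in> deg R i" "s \<in> deg R i" and "u \<in> elts ?Q j"
  then obtain x where x: "x \<in> elts M j" "u = q j x" by (auto simp: el)
  show "act ?Q i j (r \<oplus> s) u = act ?Q i j r u \<oplus>[?Q,i + j] act ?Q i j s u"
   using x r M.act_closed[OF r(1) x(1) refl] M.act_closed[OF r(2) x(1) refl] by (simp add: ad ac deg_add M.act_add_left[OF r])
 next
  fix i j k r s u assume r: "r \<in> deg R i" and s: "s \<in> deg R j" and "u \<in> elts ?Q k"
  then obtain x where x: "x \<in> elts M k" "u = q k x" by (auto simp: el)
  show "act ?Q (i + j) k (r \<otimes> s) u = act ?Q i (j + k) r (act ?Q j k s u)"
   using x M.act_closed[OF s x(1) refl] M.act_act[OF r s x(1) refl refl] by (simp add: ac[OF r] ac[OF s] ac[OF mult_deg[OF r s]] add.assoc)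
 next
  fix j u assume "u \<in> elts ?Q j"
  then obtain x where x: "x \<in> elts M j" "u = q j x" by (auto simp: el)
  show "act ?Q 0 j \<one> u = u" using x by (simp add: ac[OF one_deg] M.act_one)
 qed
 show "gmod_hom R M ?Q q" unfolding gmod_hom_def by (auto simp: el ad ac)
 show "elts ?Q n = q n ` elts M n" by (rule el)
qed

lemma quotient_mod:
 fixes M :: "('a, 'm) gmod"
 assumes M: "gmodule R M" and N: "gsub R N M"
 obtains Q :: "('a, 'm) gmod" and q where "gmodule R Q" "gmod_hom R M Q q"
  "!!n. elts Q n = q n ` elts M n"
  "!!n x. x \<in> elts M n ==> q n x = \<zero>[Q,n] \<longleftrightarrow> x \<in> N n"
proof -
 interpret M: graded_mod R M by (rule gmodI[OF M])
 let ?q = "coset_rep M N"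
 have sym: "y \<ominus>[M,n] x \<in> N n" if "x \<ominus>[M,n] y \<in> N n" "x \<in> elts M n" "y \<in> elts M n" for x y n
  using M.sub_neg[OF N that(1)] that by (simp add: a_minus_def M.G.minus_add M.G.a_comm)
 have trans: "x \<ominus>[M,n] z \<in> N n"
  if "x \<ominus>[M,n] y \<in> N n" "y \<ominus>[M,n] z \<in> N n" "x \<in> elts M n" "y \<in> elts M n" "z \<in> elts M n" for x y z n
 proof -
  have "(x \<ominus>[M,n] y) \<oplus>[M,n] (y \<ominus>[M,n] z) = x \<ominus>[M,n] z"
   using that(3-5) by (simp add: a_minus_def M.G.a_assoc M.G.r_neg1)
  thus ?thesis using M.sub_add[OF N that(1,2)] by simp
 qed
 have self: "x \<ominus>[M,n] x \<in> N n" if "x \<in> elts M n" for x n using that M.sub_zero[OF N] by (simp add: a_minus_def M.G.r_neg)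
 have qx: "?q n x \<in> elts M n \<and> x \<ominus>[M,n] ?q n x \<in> N n" if "x \<in> elts M n" for x n
  unfolding coset_rep_def by (rule someI[of _ x]) (use that self in auto)
 have qeq: "?q n x = ?q n y \<longleftrightarrow> x \<ominus>[M,n] y \<in> N n" if "x \<in> elts M n" "y \<in> elts M n" for x y n
 proof
  assume "?q n x = ?q n y"
  thus "x \<ominus>[M,n] y \<in> N n" using trans[where n=n and x=x and y="?q n x" and z=y] sym[where n=n and x=y and y="?q n y"]
    qx[OF that(1)] qx[OF that(2)] that by simp
 next
  assume a: "x \<ominus>[M,n] y \<in> N n"
  have "(z \<in> elts M n \<and> x \<ominus>[M,n] z \<in> N n) \<longleftrightarrow> (z \<in> elts M n \<and> y \<ominus>[M,n] z \<in> N n)" for z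
   using a trans[where n=n and x=x and y=y and z=z] trans[where n=n and x=y and y=x and z=z] sym[OF a that] that by blast
  thus "?q n x = ?q n y" unfolding coset_rep_def by presburger
 qed
 have g: "gmodule R (gimg M ?q)" "gmod_hom R M (gimg M ?q) ?q" "elts (gimg M ?q) n = ?q n ` elts M n" for n
 proof -
  have 1: "?q n (x \<oplus>[M,n] y) = ?q n (x' \<oplus>[M,n] y')"
   if "x \<in> elts M n" "x' \<in> elts M n" "y \<in> elts M n" "y' \<in> elts M n" "?q n x = ?q n x'" "?q n y = ?q n y'" for n x x' y y'
  proof -
   have "(x \<oplus>[M,n] y) \<ominus>[M,n] (x' \<oplus>[M,n] y') = (x \<ominus>[M,n] x') \<oplus>[M,n] (y \<ominus>[M,n] y')"
    using that by (simp add: a_minus_def M.G.minus_add M.G.a_ac)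
   thus ?thesis using that qeq M.sub_add[OF N] by simp
  qed
  have 2: "?q (i + j) (act M i j r x) = ?q (i + j) (act M i j r x')"
   if r: "r \<in> deg R i" and x: "x \<in> elts M j" "x' \<in> elts M j" "?q j x = ?q j x'" for i j r x x'
   using qeq[OF M.act_closed[OF r x(1) refl] M.act_closed[OF r x(2) refl]] qeq[OF x(1,2)] x(3)
    M.sub_act[OF N r _ refl] M.act_minus[OF r x(1,2) refl] by metis
  show "gmodule R (gimg M ?q)" "gmod_hom R M (gimg M ?q) ?q" "elts (gimg M ?q) n = ?q n ` elts M n"
   by (rule gimg_graded_module[OF M 1 2]; assumption)+
 qed
 show ?thesis
 proof (rule that[OF g(1,2)])
  show "elts (gimg M ?q) n = ?q n ` elts M n" for n by (rule g(3))
 next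
  fix n x assume x: "x \<in> elts M n"
  have "\<zero>[gimg M ?q,n] = ?q n \<zero>[M,n]" by (simp add: gimg_def)
  thus "?q n x = \<zero>[gimg M ?q,n] \<longleftrightarrow> x \<in> N n"
   using qeq[OF x M.G.zero_closed] M.add_minus_cancel(2)[OF x M.G.zero_closed] x by simp
 qed
qed

lemma transport_mod:
 assumes M: "gmodule R M" and inj: "!!n. inj_on (g n) (elts M n)"
 shows "gmodule R (gimg M g)" "gmod_hom R M (gimg M g) g"
  "gmod_hom R (gimg M g) M (%n. inv_into (elts M n) (g n))"
  "elts (gimg M g) n = g n ` elts M n"
proof -
 interpret M: graded_mod R M by (rule gmodI[OF M])
 have eq: "x = y" if "x \<in> elts M n" "y \<in> elts M n" "g n x = g n y" for x y n using inj that by (metis inj_onD)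
 show g: "gmodule R (gimg M g)" "gmod_hom R M (gimg M g) g"
  and el: "!!n. elts (gimg M g) n = g n ` elts M n" by (rule gimg_graded_module[OF M]; use eq in metis)+
 show "gmod_hom R (gimg M g) M (%n. inv_into (elts M n) (g n))" unfolding gmod_hom_def
 proof (intro conjI allI ballI)
  show "inv_into (elts M n) (g n) \<in> elts (gimg M g) n \<rightarrow> elts M n" for n by (auto simp: el inv_into_into)
 next
  fix n a b assume "a \<in> elts (gimg M g) n" "b \<in> elts (gimg M g) n"
  then obtain x y where xy: "x \<in> elts M n" "y \<in> elts M n" "a = g n x" "b = g n y" by (auto simp: el)
  thus "inv_into (elts M n) (g n) (a \<oplus>[gimg M g,n] b) =
   inv_into (elts M n) (g n) a \<oplus>[M,n] inv_into (elts M n) (g n) b"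
   using hom_add[OF g(2) xy(1,2)] inj[of n] by (metis M.G.a_closed inv_into_f_f)
 next
  fix i j r a assume r: "r \<in> deg R i" and "a \<in> elts (gimg M g) j"
  then obtain x where x: "x \<in> elts M j" "a = g j x" by (auto simp: el)
  thus "inv_into (elts M (i + j)) (g (i + j)) (act (gimg M g) i j r a) =
   act M i j r (inv_into (elts M j) (g j) a)"
   using hom_act[OF g(2) r x(1) refl] inj M.act_closed[OF r x(1) refl] by (metis inv_into_f_f)
 qed
qed

lemma sub_mod_module:
 assumes M: "gmodule R M" and N: "gsub R N M"
 shows "gmodule R (sub_mod M N)" "gmod_mono R (sub_mod M N) M (%n x. x)"
proof -
 interpret M: graded_mod R M by (rule gmodI[OF M])
 have gr: "abelian_group (cmpt (sub_mod M N) n)" for n using M.sub_elts[OF N] by (intro abelian_groupI)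
   (auto simp: sub_mod_def M.sub_add[OF N] M.sub_zero[OF N] M.G.a_ac M.G.l_neg M.G.r_neg
    intro!: bexI[OF _ M.sub_neg[OF N]])
 show "gmodule R (sub_mod M N)" unfolding graded_module_def using M.sub_elts[OF N]
  by (intro conjI allI ballI gr) (auto simp: sub_mod_def M.act_one
    M.sub_act[OF N _ _ refl] M.act_add[OF _ _ _ refl] M.act_add_left[OF _ _ _ refl]
    M.act_act[OF _ _ _ refl refl])
 show "gmod_mono R (sub_mod M N) M (%n x. x)" using M.sub_elts[OF N] by (auto simp: gmod_mono_def gmod_hom_def sub_mod_def)
qed

lemma gsum_module:
 assumes M: "gmodule R M" and N: "gmodule R N"
 shows "gmodule R (gsum M N)"
proof -
 interpret M: graded_mod R M by (rule gmodI[OF M])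
 interpret N: graded_mod R N by (rule gmodI[OF N])
 have gr: "abelian_group (cmpt (gsum M N) n)" for n
 proof (rule abelian_groupI)
  fix u assume "u \<in> elts (gsum M N) n"
  thus "\<exists>y\<in>elts (gsum M N) n. y \<oplus>[gsum M N,n] u = \<zero>[gsum M N,n]"
   by (intro bexI[of _ "(\<ominus>[M,n] fst u, \<ominus>[N,n] snd u)"]) (auto simp: gsum_def M.G.l_neg N.G.l_neg)
 qed (auto simp: gsum_def M.G.a_ac N.G.a_ac)
 show ?thesis unfolding graded_module_def by (intro conjI allI ballI gr) (auto simp: gsum_def M.act_one N.act_one
    M.act_closed[OF _ _ refl] M.act_add[OF _ _ _ refl] M.act_add_left[OF _ _ _ refl]
    M.act_act[OF _ _ _ refl refl] N.act_closed[OF _ _ refl] N.act_add[OF _ _ _ refl]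
    N.act_add_left[OF _ _ _ refl] N.act_act[OF _ _ _ refl refl])
qed

lemma ideal_mod_module:
 assumes J: "gideal R J"
 shows "gmodule R (ideal_mod R J)"
proof -
 have c: "x \<in> J n ==> x \<in> carrier R" for x n using gideal_sub[OF J] dcar by blast
 have gr: "abelian_group (cmpt (ideal_mod R J) n)" for n using c by (intro abelian_groupI)
   (auto simp: ideal_mod_def gideal_add_closed[OF J] gideal_zero[OF J] a_ac l_neg r_neg
    intro!: bexI[OF _ gideal_neg[OF J]])
 show ?thesis unfolding graded_module_def using c dcar
  by (intro conjI allI ballI gr) (auto simp: ideal_mod_def gideal_mult[OF J _ _ refl] r_distr l_distr m_assoc)
qed

lemma shift_module:
 assumes M: "gmodule R M"
 shows "gmodule R (gmod_shift d M)"
proof -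
 interpret M: graded_mod R M by (rule gmodI[OF M])
 show ?thesis unfolding graded_module_def by (intro conjI allI ballI)
   (auto simp: gmod_shift_def M.cmpt_abelian M.act_one add.assoc M.act_closed[OF _ _ refl]
    M.act_add[OF _ _ _ refl] M.act_add_left[OF _ _ _ refl] M.act_act[OF _ _ _ refl refl])
qed

lemma injective_module: "injective_gmod R E ==> gmodule R E"
 by (simp add: injective_gmod_def)

text \<open>Injectivity is defined by test modules on the type \<open>'a + 'e\<close>; test modules
  on a type that embeds there are transported. The left summand serves for ideals, the right one for
  hulls.\<close>

lemma injective_extend:
 fixes E :: "('a, 'e) gmod" and A B :: "('a, 'm) gmod" and h :: "'m => 'a + 'e"
 assumes E: "injective_gmod R E" and h: "inj h" and A: "gmodule R A" and B: "gmodule R B"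
  and io: "gmod_mono R A B io" and f: "gmod_hom R A E f"
 obtains g where "gmod_hom R B E g" "!!n a. a \<in> elts A n ==> g n (io n a) = f n a"
proof -
 have inj: "inj_on h S" for S using h by (meson inj_on_subset subset_UNIV)
 let ?A = "gimg A (%n. h)" and ?B = "gimg B (%n. h)"
 note tA = transport_mod[OF A, of "%n. h", OF inj]
 note tB = transport_mod[OF B, of "%n. h", OF inj]
 have ioh: "gmod_hom R A B io" and ioi: "inj_on (io n) (elts A n)" for n using io by (auto simp: gmod_mono_def)
 have ivA: "inv_into (elts A n) h (h a) = a" if "a \<in> elts A n" for n a using that by (simp add: inv_into_f_f[OF inj])
 let ?io = "%n x. h (io n (inv_into (elts A n) h x))"
 let ?f = "%n x. f n (inv_into (elts A n) h x)"
 have "gmod_hom R ?A ?B ?io" by (rule hom_comp[OF hom_comp[OF tA(3) ioh] tB(2)])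
 moreover have "inj_on (?io n) (elts ?A n)" for n
 proof (rule inj_onI)
  fix x y assume "x \<in> elts ?A n" "y \<in> elts ?A n" and e: "?io n x = ?io n y"
  then obtain a b where ab: "x = h a" "y = h b" "a \<in> elts A n" "b \<in> elts A n" by (auto simp: tA(4))
  have "io n a = io n b" using injD[OF h e] ivA ab by simp
  thus "x = y" using inj_onD[OF ioi] ab by metis
 qed
 ultimately have "gmod_mono R ?A ?B ?io" by (simp add: gmod_mono_def)
 moreover have "gmod_hom R ?A E ?f" by (rule hom_comp[OF tA(3) f])
 ultimately obtain g where g: "gmod_hom R ?B E g" "!!n a. a \<in> elts ?A n ==> g n (?io n a) = ?f n a"
  using E tA(1) tB(1) unfolding injective_gmod_def by blast
 show ?thesis using that hom_comp tB(2) g(1) g(2) ivA tA(4) by fastforce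
qed

text \<open>Baer's condition for the map \<open>ra + j \<mapsto> ry\<close> on the ideal \<open>J + Ra\<close>.\<close>

lemma injective_divisible:
 fixes E :: "('a, 'e) gmod"
 assumes E: "injective_gmod R E" and J: "gideal R J" and a: "a \<in> deg R d" and y: "y \<in> elts E m"
  and ann: "!!n r. r \<in> gcol R J d a n ==> act E n m r y = \<zero>[E,n + m]"
 obtains z where "z \<in> elts E (m - d)" "act E d (m - d) a z = y"
  "!!n r. r \<in> J n ==> act E n (m - d) r z = \<zero>[E,n + (m - d)]"
proof -
 interpret E: graded_mod R E by (rule gmodI[OF injective_module[OF E]])
 have ac: "a \<in> carrier R" using a dcar by blast
 let ?I = "gadd R J d a"
 note I = gideal_gadd[OF J a]
 \<comment> \<open>The shift places a, an element of degree d, into degree m, where its prescribed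
   image y lives.\<close>
 let ?A = "gmod_shift (d - m) (ideal_mod R ?I)" and ?B = "gmod_shift (d - m) (ideal_mod R (deg R))"
 have elA: "elts ?A n = ?I (n + (d - m))" and elB: "elts ?B n = deg R (n + (d - m))" for n by (simp_all add: gmod_shift_def ideal_mod_def)
 \<comment> \<open>A coefficient of a in x modulo J. Two choices differ by an element of (J : a),
   which annihilates y; so the value of \<open>f\<close> does not depend on the choice.\<close>
 define co where "co n x = (SOME r. r \<in> deg R (n - m) \<and> (\<exists>j\<in>J (n + (d - m)). x = j \<oplus> r \<otimes> a))" for n x
 define f where "f n x = act E (n - m) m (co n x) y" for n x
 have f: "f n (j \<oplus> r \<otimes> a) = act E (n - m) m r y" if j: "j \<in> J (n + (d - m))" and r: "r \<in> deg R (n - m)" for n j r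
 proof -
  let ?x = "j \<oplus> r \<otimes> a"
  have "co n ?x \<in> deg R (n - m) \<and> (\<exists>j\<in>J (n + (d - m)). ?x = j \<oplus> co n ?x \<otimes> a)"
   unfolding co_def by (rule someI[of _ r]) (use j r in blast)
  then obtain j' where *: "co n ?x \<in> deg R (n - m)" "j' \<in> J (n + (d - m))" "?x = j' \<oplus> co n ?x \<otimes> a" by blast
  define r' where "r' = co n ?x"
  have r': "r' \<in> deg R (n - m)" and e: "j \<oplus> r \<otimes> a = j' \<oplus> r' \<otimes> a" using * by (simp_all add: r'_def)
  have c: "j \<in> carrier R" "j' \<in> carrier R" "r \<in> carrier R" "r' \<in> carrier R"
   using j *(2) r r' gideal_sub[OF J] dcar by blast+
  have "(r \<oplus> \<ominus> r') \<otimes> a = r \<otimes> a \<oplus> \<ominus> (r' \<otimes> a)" using c ac by (simp add: l_distr l_minus)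
  also have "... = \<ominus> j \<oplus> (j \<oplus> r \<otimes> a) \<oplus> \<ominus> (r' \<otimes> a)" using c ac by (simp add: r_neg1)
  also have "... = \<ominus> j \<oplus> j'" unfolding e using c ac by (simp add: a_assoc r_neg)
  finally have "(r \<oplus> \<ominus> r') \<otimes> a \<in> J (n + (d - m))" using gideal_add_closed[OF J gideal_neg[OF J j] *(2)] by simp
  hence "r \<oplus> \<ominus> r' \<in> gcol R J d a (n - m)"
   using r r' by (auto simp: gcol_def algebra_simps intro: deg_add deg_neg)
  from ann[OF this] have "act E (n - m) m r y \<ominus>[E,n] act E (n - m) m r' y = \<zero>[E,n]"
   using E.act_add_left[OF r deg_neg[OF r'] y, of n] E.act_neg_left[OF r' y, of n] by (simp add: a_minus_def)
  hence "act E (n - m) m r y = act E (n - m) m r' y" by (rule E.minus_eq_zero[rotated 2]) (auto intro!: E.act_closed[OF _ y] r r')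
  thus ?thesis unfolding f_def r'_def by simp
 qed
 have Aex: "EX j r. j \<in> J (n + (d - m)) \<and> r \<in> deg R (n - m) \<and> x = j \<oplus> r \<otimes> a" if "x \<in> elts ?A n" for n x
 using that elA by (auto simp: gadd_def)
 have fh: "gmod_hom R ?A E f" unfolding gmod_hom_def
 proof (intro conjI allI ballI)
  show "f n \<in> elts ?A n \<rightarrow> elts E n" for n using Aex f E.act_closed y by fastforce
 next
  fix n x x' assume "x \<in> elts ?A n" "x' \<in> elts ?A n"
  then obtain j r j' r' where *: "j \<in> J (n + (d - m))" "r \<in> deg R (n - m)" "x = j \<oplus> r \<otimes> a"
   "j' \<in> J (n + (d - m))" "r' \<in> deg R (n - m)" "x' = j' \<oplus> r' \<otimes> a" using Aex by meson
  have c: "j \<in> carrier R" "j' \<in> carrier R" "r \<in> carrier R" "r' \<in> carrier R" using * gideal_sub[OF J] dcar by blast+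
  have "x \<oplus> x' = (j \<oplus> j') \<oplus> (r \<oplus> r') \<otimes> a" unfolding *(3,6) using c ac by (simp add: l_distr a_ac)
  hence "f n (x \<oplus> x') = act E (n - m) m (r \<oplus> r') y" using f[OF gideal_add_closed[OF J *(1,4)] deg_add[OF *(2,5)]] by simp
  thus "f n (x \<oplus>[?A,n] x') = f n x \<oplus>[E,n] f n x'" using f[OF *(1,2)] f[OF *(4,5)] *(3,6) E.act_add_left[OF *(2,5) y, of n]
   by (simp add: gmod_shift_def ideal_mod_def)
 next
  fix i n s x assume s: "s \<in> deg R i" and "x \<in> elts ?A n"
  then obtain j r where *: "j \<in> J (n + (d - m))" "r \<in> deg R (n - m)" "x = j \<oplus> r \<otimes> a" using Aex by blast
  have c: "j \<in> carrier R" "r \<in> carrier R" "s \<in> carrier R" using * s gideal_sub[OF J] dcar by blast+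
  have "s \<otimes> x = s \<otimes> j \<oplus> (s \<otimes> r) \<otimes> a" unfolding *(3) using c ac by (simp add: r_distr m_assoc)
  moreover have "s \<otimes> j \<in> J (i + n + (d - m))" by (rule gideal_mult[OF J s *(1)]) simp
  moreover have sr: "s \<otimes> r \<in> deg R (i + n - m)" by (rule mult_deg'[OF s *(2)]) simp
  ultimately have "f (i + n) (s \<otimes> x) = act E (i + n - m) m (s \<otimes> r) y" using f by simp
  also have "... = act E i n s (act E (n - m) m r y)" by (rule E.act_act[OF s *(2) y, symmetric]) auto
  finally show "f (i + n) (act ?A i n s x) = act E i n s (f n x)" using f[OF *(1,2)] *(3) by (simp add: gmod_shift_def ideal_mod_def)
 qed
 have mo: "gmod_mono R ?A ?B (%n x. x)"
  using gideal_sub[OF I] by (auto simp: gmod_mono_def gmod_hom_def elA elB) (auto simp: gmod_shift_def ideal_mod_def)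
 have mA: "gmodule R ?A" by (rule shift_module[OF ideal_mod_module[OF I]])
 have mB: "gmodule R ?B" by (rule shift_module[OF ideal_mod_module[OF gideal_whole]])
 have inl: "inj (Inl :: 'a => 'a + 'e)" by simp
 obtain g where g: "gmod_hom R ?B E g" "!!n x. x \<in> elts ?A n ==> g n x = f n x"
  by (rule injective_extend[OF E inl mA mB mo fh], rule that; assumption)
 have one: "\<one> \<in> elts ?B (m - d)" using one_deg by (simp add: elB)
 have gr: "g (n + (m - d)) r = act E n (m - d) r (g (m - d) \<one>)" if "r \<in> deg R n" for n r
  using hom_act[OF g(1) that one refl] dcar[OF that] by (simp add: gmod_shift_def ideal_mod_def)
 \<comment> \<open>The extension is determined by the image z of 1: its value at a is a z = y, and
   at elements of J it is zero.\<close>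
 show ?thesis
 proof (rule that)
  show "g (m - d) \<one> \<in> elts E (m - d)" by (rule hom_closed[OF g(1) one])
  have "a \<in> elts ?A m" using gadd_incl(2)[OF J a] by (simp add: elA)
  hence "g m a = f m a" by (rule g(2))
  also have "f m a = y" using f[of \<zero> m \<one>] gideal_zero[OF J] one_deg ac E.act_one[OF y] by simp
  finally show "act E d (m - d) a (g (m - d) \<one>) = y" using gr[OF a] by simp
  fix n r assume r: "r \<in> J n"
  hence "r \<in> elts ?A (n + (m - d))" using gadd_incl(1)[OF J a r] by (simp add: elA)
  hence "g (n + (m - d)) r = f (n + (m - d)) r" by (rule g(2))
  also have "... = \<zero>[E,n + (m - d)]"
   using f[of r "n + (m - d)" \<zero>] r ac dcar[OF gideal_sub[OF J r]] E.act_zero_left[OF y, of "n + (m - d)" "n - d"] by simp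
  finally show "act E n (m - d) r (g (m - d) \<one>) = \<zero>[E,n + (m - d)]" using gr[OF gideal_sub[OF J r]] by simp
 qed
qed

text \<open>The cyclic submodule generated by x is nonzero, so it meets K nontrivially. Together
  with \<open>essentialI\<close> this replaces submodules by multiples of single elements.\<close>

lemma essentialD:
 assumes E: "gmodule R E" and K: "essential R K E" and x: "x \<in> elts E n" "x ~= \<zero>[E,n]"
 obtains i r where "r \<in> deg R i" "act E i n r x \<in> K (i + n)" "act E i n r x ~= \<zero>[E,i + n]"
proof -
 interpret E: graded_mod R E by (rule gmodI[OF E])
 let ?N = "add_cyclic R E (null_sub E) n x"
 have N: "gsub R ?N E" by (rule E.sub_add_cyclic[OF E.sub_null x(1)])
 have K': "gsub R K E" using K by (simp add: essential_def)
 have "x \<in> ?N n" by (rule E.add_cyclic_incl(2)[OF E.sub_null x(1)])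
 hence "\<not> (ALL n. ?N n = {\<zero>[E,n]})" using x(2) by (metis singletonD)
 then obtain k where k: "?N k \<inter> K k ~= {\<zero>[E,k]}" using K N unfolding essential_def by blast
 then obtain u where u: "u \<in> ?N k" "u \<in> K k" "u ~= \<zero>[E,k]" using E.sub_zero[OF N, of k] E.sub_zero[OF K', of k] by blast
 then obtain r where r: "r \<in> deg R (k - n)" "u = \<zero>[E,k] \<oplus>[E,k] act E (k - n) n r x"
  unfolding add_cyclic_def null_sub_def by blast
 have "u = act E (k - n) n r x" using r E.act_closed[OF r(1) x(1), of k] by simp
 thus ?thesis using that[OF r(1)] u by simp
qed

lemma essentialI:
 assumes E: "gmodule R E" and K: "gsub R K E"
  and w: "!!n x. x \<in> elts E n ==> x ~= \<zero>[E,n] ==>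
   EX i r. r \<in> deg R i \<and> act E i n r x \<in> K (i + n) \<and> act E i n r x ~= \<zero>[E,i + n]"
 shows "essential R K E" unfolding essential_def
proof (intro conjI K allI impI)
 interpret E: graded_mod R E by (rule gmodI[OF E])
 fix N n assume N: "gsub R N E \<and> (ALL n. N n \<inter> K n = {\<zero>[E,n]})"
 have "x = \<zero>[E,n]" if x: "x \<in> N n" for x
 proof (rule ccontr)
  assume "x ~= \<zero>[E,n]"
  then obtain i r where r: "r \<in> deg R i" "act E i n r x \<in> K (i + n)" "act E i n r x ~= \<zero>[E,i + n]"
   using w[OF E.sub_elts] N x by blast
  have "act E i n r x \<in> N (i + n)" using E.sub_act N r(1) x by blast
  thus False using N r(2,3) by blast
 qed
 thus "N n = {\<zero>[E,n]}" using E.sub_zero N by blast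
qed

end

section \<open>Torsion in essential extensions\<close>

context noetherian_graded_ring
begin

lemma noetherian_graded_modI: "gmodule R M ==> noetherian_graded_mod R M"
 by (simp add: noetherian_graded_mod_def gmodI noetherian_graded_ring_axioms)

text \<open>Otherwise some y outside the torsion submodule has a prime annihilator q modulo torsion.
  As q is finitely generated, a single s outside p makes q annihilate s y itself. A nonzero multiple
  r s y lies in N and is torsion, so r s is in q. Since s is not in q, r is, and then r s y =
  0.\<close>

lemma essential_torsion:
 assumes E: "gmodule R E" and N: "essential R N E" and p: "p \<in> Spec R"
  and tor: "!!n x. x \<in> N n ==> tors R E p (null_sub E) n x"
  and x: "x \<in> elts E n"
 shows "tors R E p (null_sub E) n x"
proof (rule ccontr)
 interpret E: noetherian_graded_mod R E by (rule noetherian_graded_modI[OF E])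
 let ?T = "%n. {x \<in> elts E n. tors R E p (null_sub E) n x}"
 have T: "gsub R ?T E" by (rule E.tors_submodule[OF p E.sub_null])
 assume "\<not> tors R E p (null_sub E) n x"
 hence xT: "x \<notin> ?T n" by simp
 obtain q m y where q: "q \<in> Spec R" and y: "y \<in> elts E m" "y \<notin> ?T m"
  and ann: "!!i r. r \<in> deg R i ==> act E i m r y \<in> ?T (i + m) \<longleftrightarrow> r \<in> q"
  by (rule E.associated_prime[OF T x xT], rule that; assumption)
 have ny: "\<not> tors R E p (null_sub E) m y" using y by simp
 obtain S where S: "finite S" "!!d a. (d, a) \<in> S ==> a \<in> q \<inter> deg R d"
  "!!K n. gideal R K ==> (!!d a. (d, a) \<in> S ==> a \<in> K d) ==> q \<inter> deg R n <= K n"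
  using gideal_fg[OF Spec_gideal[OF q]] by metis
 \<comment> \<open>For each generator a of q the element a y is torsion; the product of the finitely
   many denominators, adjusted by signs, serves as the common s.\<close>
 have "EX i s. s \<in> deg R i \<and> s \<notin> p \<and> (\<forall>(d, a)\<in>S. act E (d + i) m (a \<otimes> s) y = \<zero>[E,d + i + m])"
  using S(1,2)
 proof (induction S)
  case empty
  show ?case using one_deg Spec_one[OF p] by auto
 next
  case (insert z S)
  obtain i s where s: "s \<in> deg R i" "s \<notin> p" "\<forall>(d, a)\<in>S. act E (d + i) m (a \<otimes> s) y = \<zero>[E,d + i + m]"
   using insert by blast
  obtain d a where z: "z = (d, a)" by (cases z)
  have a: "a \<in> q" "a \<in> deg R d" using insert.prems z by blast+
  have "act E d m a y \<in> ?T (d + m)" using ann[OF a(2)] a(1) by blast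
  then obtain j t where t: "t \<in> deg R j" "t \<notin> p" "act E j (d + m) t (act E d m a y) = \<zero>[E,j + (d + m)]"
   unfolding tors_def null_sub_def by blast
  obtain s' where s': "s' \<in> deg R i" "s' = s \<or> s' = \<ominus> s" "t \<otimes> s = s' \<otimes> t" using swap_deg[OF t(1) s(1)] .
  have ts: "t \<otimes> s \<in> deg R (j + i)" "t \<otimes> s \<notin> p" using mult_deg[OF t(1) s(1)] Spec_prime[OF p t(1) s(1)] t(2) s(2) by blast+
  have "act E (e + (j + i)) m (b \<otimes> (t \<otimes> s)) y = \<zero>[E,e + (j + i) + m]" if eb: "(e, b) \<in> insert z S" for e b
  proof (cases "(e, b) = z")
   case True
   hence b: "b = a" "e = d" using z by auto
   obtain w where w: "w \<in> deg R (j + i)" "a \<otimes> (t \<otimes> s) = w \<otimes> a" "w = t \<otimes> s \<or> w = \<ominus> (t \<otimes> s)"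
    using swap_deg[OF a(2) ts(1)] by metis
   have z0: "act E (j + i + d) m (t \<otimes> s \<otimes> a) y = \<zero>[E,j + i + d + m]"
   proof -
    have c: "a \<in> carrier R" "s' \<in> carrier R" "t \<in> carrier R" using a s' t dcar by blast+
    have "act E (j + i + d) m (t \<otimes> s \<otimes> a) y = act E i (j + (d + m)) s' (act E j (d + m) t (act E d m a y))"
     using E.act_act[OF t(1) a(2) y(1) refl refl] E.act_act[OF s'(1) mult_deg[OF t(1) a(2)] y(1), of "j + (d + m)" "j + i + d"]
     c by (simp add: s'(3) m_assoc algebra_simps)
    also have "... = \<zero>[E,j + i + d + m]" unfolding t(3) by (rule E.act_zero[OF s'(1)]) simp
    finally show ?thesis .
   qed
   have "act E (d + (j + i)) m (w \<otimes> a) y = \<zero>[E,d + (j + i) + m]" using w(3)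
   proof
    assume "w = t \<otimes> s" thus ?thesis using z0 by (simp add: algebra_simps)
   next
    assume "w = \<ominus> (t \<otimes> s)"
    moreover have "\<ominus> (t \<otimes> s) \<otimes> a = \<ominus> (t \<otimes> s \<otimes> a)"
     using dcar[OF ts(1)] dcar[OF a(2)] by (simp add: l_minus)
    ultimately show ?thesis using z0 E.act_neg_left[OF mult_deg[OF ts(1) a(2)] y(1) refl] by (simp add: algebra_simps)
   qed
   thus ?thesis using w(2) b by simp
  next
   case False
   hence eS: "(e, b) \<in> S" using eb by simp
   have b: "b \<in> deg R e" using insert.prems eb by blast
   obtain t' where t': "t' \<in> deg R j" "b \<otimes> t = t' \<otimes> b" using swap_deg[OF b t(1)] by metis
   have c: "b \<in> carrier R" "s \<in> carrier R" "t \<in> carrier R" "t' \<in> carrier R" using b s t t' dcar by blast+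
   have "b \<otimes> (t \<otimes> s) = t' \<otimes> (b \<otimes> s)" using t'(2) c by (simp add: m_assoc[symmetric])
   hence "act E (e + (j + i)) m (b \<otimes> (t \<otimes> s)) y = act E j (e + i + m) t' (act E (e + i) m (b \<otimes> s) y)"
    using E.act_act[OF t'(1) mult_deg[OF b s(1)] y(1), of "e + i + m" "e + (j + i)"] by (simp add: algebra_simps)
   also have "... = \<zero>[E,e + (j + i) + m]" using s(3) eS E.act_zero[OF t'(1), of "e + (j + i) + m" "e + i + m"] by auto
   finally show ?thesis .
  qed
  thus ?case using ts by (intro exI[of _ "j + i"] exI[of _ "t \<otimes> s"]) auto
 qed
 then obtain i s where s: "s \<in> deg R i" "s \<notin> p" "\<forall>(d, a)\<in>S. act E (d + i) m (a \<otimes> s) y = \<zero>[E,d + i + m]" by blast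
 have sy: "act E i m s y \<in> elts E (i + m)" by (rule E.act_closed[OF s(1) y(1) refl])
 have qs: "act E k (i + m) r (act E i m s y) = \<zero>[E,k + (i + m)]" if "r \<in> q" "r \<in> deg R k" for k r
 proof -
  let ?K = "%n. {r \<in> deg R n. act E n (i + m) r (act E i m s y) \<in> null_sub E (n + (i + m))}"
  have "q \<inter> deg R k <= ?K k"
  proof (rule S(3)[OF E.gideal_residual[OF E.sub_null sy]])
   fix d a assume da: "(d, a) \<in> S"
   hence a: "a \<in> deg R d" using S(2) by blast
   thus "a \<in> ?K d" using E.act_act[OF a s(1) y(1) refl refl] s(3) da by (auto simp: null_sub_def add.assoc)
  qed
  thus ?thesis using that by (auto simp: null_sub_def)
 qed
 have sp: "act E i m s y ~= \<zero>[E,i + m]" using ny s(1,2) unfolding tors_def null_sub_def by blast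
 obtain k r where r: "r \<in> deg R k" "act E k (i + m) r (act E i m s y) \<in> N (k + (i + m))"
  "act E k (i + m) r (act E i m s y) ~= \<zero>[E,k + (i + m)]" by (rule essentialD[OF E N sy sp])
 have rs: "r \<otimes> s \<in> deg R (k + i)" by (rule mult_deg[OF r(1) s(1)])
 have "act E (k + i) m (r \<otimes> s) y \<in> ?T (k + i + m)"
  using tor[OF r(2)] E.act_act[OF r(1) s(1) y(1) refl refl] E.act_closed[OF rs y(1) refl] by (simp add: add.assoc)
 hence "r \<otimes> s \<in> q" using ann[OF rs] by blast
 \<comment> \<open>If s were in q, then s y and with it y would be torsion.\<close>
 moreover have "s \<notin> q" using ann s(1) E.tors_tors p y(1) s(1,2) ny by blast
 ultimately have "r \<in> q" using Spec_prime[OF q r(1) s(1)] by blast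
 thus False using qs r by blast
qed

end

section \<open>Injective hulls\<close>

text \<open>Inclusion of modules on one type with agreeing operations, so that a chain of extensions
  has a union.\<close>

definition gext :: "('r, 'z) gring_scheme => ('r, 'm) gmod => ('r, 'm) gmod => bool" where
 "gext R E F \<longleftrightarrow>
   (ALL n. elts E n <= elts F n \<and> \<zero>[E,n] = \<zero>[F,n] \<and>
    (\<forall>x\<in>elts E n. \<forall>y\<in>elts E n. x \<oplus>[E,n] y = x \<oplus>[F,n] y)) \<and>
   (ALL i j. \<forall>r\<in>deg R i. \<forall>x\<in>elts E j. act E i j r x = act F i j r x)"

text \<open>Operations of the union are evaluated in a chosen member containing the arguments; all
  members of a chain that contain them give the same value.\<close>

definition union_pick :: "('r, 'm) gmod set => int => 'm set => ('r, 'm) gmod" where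
 "union_pick C n A = (SOME E. E \<in> C \<and> A <= elts E n)"

definition union_mod :: "('r, 'm) gmod set => ('r, 'm) gmod" where
 "union_mod C =
   \<lparr>cmpt = (%n. \<lparr>carrier = (\<Union>E\<in>C. elts E n), mult = undefined, one = undefined,
    zero = \<zero>[union_pick C n {},n],
    add = (%x y. x \<oplus>[union_pick C n {x, y},n] y)\<rparr>),
   act = (%i j r x. act (union_pick C j {x}) i j r x)\<rparr>"

lemma gextD:
 assumes "gext R E F"
 shows "x \<in> elts E n ==> x \<in> elts F n" "\<zero>[E,n] = \<zero>[F,n]"
  "x \<in> elts E n ==> y \<in> elts E n ==> x \<oplus>[E,n] y = x \<oplus>[F,n] y"
  "r \<in> deg R i ==> x \<in> elts E j ==> act E i j r x = act F i j r x" using assms by (auto simp: gext_def)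

lemma gext_refl: "gext R E E"
 by (simp add: gext_def)

lemma gext_trans: "gext R E F ==> gext R F G ==> gext R E G"
 unfolding gext_def by (metis (no_types, lifting) subset_eq)

context graded_commutative_ring
begin

lemma gext_submodule:
 assumes "gmodule R E" "gmodule R F" "gext R E F"
 shows "gsub R (elts E) F" "gmod_mono R E F (%n x. x)"
proof -
 interpret E: graded_mod R E by (rule gmodI[OF assms(1)])
 interpret F: graded_mod R F by (rule gmodI[OF assms(2)])
 note D = gextD[OF assms(3)]
 show "gsub R (elts E) F"
 proof (rule F.submoduleI)
  show "x \<in> elts F n" if "x \<in> elts E n" for x n using D(1)[OF that] .
  show "\<zero>[F,n] \<in> elts E n" for n using E.G.zero_closed[of n] D(2)[of n] by simp
  show "x \<oplus>[F,n] y \<in> elts E n" if "x \<in> elts E n" "y \<in> elts E n" for x y n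
   using E.G.a_closed[OF that] D(3)[OF that] by simp
  show "act F i j r x \<in> elts E (i + j)" if "r \<in> deg R i" "x \<in> elts E j" for i j r x
   using E.act_closed[OF that refl] D(4)[OF that] by simp
 qed
 show "gmod_mono R E F (%n x. x)" using assms(3) by (auto simp: gmod_mono_def gmod_hom_def gext_def)
qed

text \<open>One multiplier moves an element into the image of D, a second one moves it into
  K.\<close>

lemma essential_image_trans:
 assumes D: "gmodule R D" and E: "gmodule R E" and F: "gmodule R F"
  and K: "essential R K D" and f: "gmod_mono R D E f" and fe: "essential R (gmod_image D f) E"
  and KE: "!!n. f n ` K n <= K' n" and K': "gsub R K' E"
 shows "essential R K' E"
proof (rule essentialI[OF E K'])
 interpret D: graded_mod R D by (rule gmodI[OF D])
 interpret E: graded_mod R E by (rule gmodI[OF E])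
 have fh: "gmod_hom R D E f" and fi: "inj_on (f n) (elts D n)" for n using f by (auto simp: gmod_mono_def)
 note f0 = hom_zero[OF D E fh]
 fix n x assume x: "x \<in> elts E n" "x ~= \<zero>[E,n]"
 obtain i r where r: "r \<in> deg R i" "act E i n r x \<in> gmod_image D f (i + n)" "act E i n r x ~= \<zero>[E,i + n]"
  by (rule essentialD[OF E fe x])
 then obtain y where y: "y \<in> elts D (i + n)" "act E i n r x = f (i + n) y" by (auto simp: gmod_image_def)
 have "y ~= \<zero>[D,i + n]" using r(3) y(2) f0 by auto
 then obtain j s where s: "s \<in> deg R j" "act D j (i + n) s y \<in> K (j + (i + n))"
  "act D j (i + n) s y ~= \<zero>[D,j + (i + n)]" by (rule essentialD[OF D K y(1)])
 have sy: "act D j (i + n) s y \<in> elts D (j + (i + n))" by (rule D.act_closed[OF s(1) y(1) refl])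
 have e: "act E (j + i) n (s \<otimes> r) x = f (j + (i + n)) (act D j (i + n) s y)"
  using E.act_act[OF s(1) r(1) x(1) refl refl] hom_act[OF fh s(1) y(1) refl] y(2) by simp
 have "f (j + (i + n)) (act D j (i + n) s y) ~= \<zero>[E,j + (i + n)]"
  using s(3) f0[of "j + (i + n)"] inj_onD[OF fi _ sy D.G.zero_closed] by auto
 moreover have "f (j + (i + n)) (act D j (i + n) s y) \<in> K' (j + (i + n))" using KE s(2) by blast
 ultimately show "EX i r. r \<in> deg R i \<and> act E i n r x \<in> K' (i + n) \<and> act E i n r x ~= \<zero>[E,i + n]"
  using e mult_deg[OF s(1) r(1)] by (intro exI[of _ "j + i"] exI[of _ "s \<otimes> r"]) (simp add: add.assoc)
qed

lemma union_chain:
 assumes C: "C ~= {}" "!!E. E \<in> C ==> gmodule R E"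
  and ch: "!!E F. E \<in> C ==> F \<in> C ==> gext R E F \<or> gext R F E"
 shows "gmodule R (union_mod C)" "!!E. E \<in> C ==> gext R E (union_mod C)"
  "elts (union_mod C) n = (\<Union>E\<in>C. elts E n)"
proof -
 let ?U = "union_mod C"
 have el: "elts ?U n = (\<Union>E\<in>C. elts E n)" for n by (simp add: union_mod_def)
 have dir: "\<exists>E\<in>C. A <= elts E n" if "finite A" "A <= elts ?U n" for A n using that
 proof (induction A)
  case empty thus ?case using C by blast
 next
  case (insert x A)
  then obtain E F where EF: "E \<in> C" "A <= elts E n" "F \<in> C" "x \<in> elts F n" unfolding el by blast
  have sub: "elts G n <= elts H n" if "gext R G H" for G H using that by (simp add: gext_def)
  consider "gext R E F" | "gext R F E" using ch[OF EF(1,3)] by blast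
  thus ?case using EF sub by cases blast+
 qed
 have pick: "union_pick C n A \<in> C \<and> A <= elts (union_pick C n A) n" if "E \<in> C" "A <= elts E n" for E A n
  unfolding union_pick_def by (rule someI[of _ E]) (use that in blast)
 show ext: "gext R E ?U" if E: "E \<in> C" for E
 proof -
  have z: "\<zero>[E,n] = \<zero>[?U,n]" for n
  proof -
   have "union_pick C n {} \<in> C" using pick[OF E, of "{}" n] by simp
   hence "\<zero>[E,n] = \<zero>[union_pick C n {},n]" using ch[OF E, of "union_pick C n {}"] gextD(2)[of R E "union_pick C n {}" n]
     gextD(2)[of R "union_pick C n {}" E n] by auto
   thus ?thesis by (simp add: union_mod_def)
  qed
  have a: "x \<oplus>[E,n] y = x \<oplus>[?U,n] y" if "x \<in> elts E n" "y \<in> elts E n" for x y n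
  proof -
   have p: "union_pick C n {x, y} \<in> C" "x \<in> elts (union_pick C n {x, y}) n" "y \<in> elts (union_pick C n {x, y}) n"
    using pick[OF E, of "{x, y}" n] that by auto
   hence "x \<oplus>[E,n] y = x \<oplus>[union_pick C n {x, y},n] y" using ch[OF E p(1)] gextD(3) that by metis
   thus ?thesis by (simp add: union_mod_def)
  qed
  have b: "act E i j r x = act ?U i j r x" if "r \<in> deg R i" "x \<in> elts E j" for i j r x
  proof -
   have p: "union_pick C j {x} \<in> C" "x \<in> elts (union_pick C j {x}) j" using pick[OF E, of "{x}" j] that by auto
   hence "act E i j r x = act (union_pick C j {x}) i j r x" using ch[OF E p(1)] gextD(4) that by metis
   thus ?thesis by (simp add: union_mod_def)
  qed
  show ?thesis unfolding gext_def using z a b E el by auto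
 qed
 have mem: "\<exists>E\<in>C. x \<in> elts E n \<and> y \<in> elts E n \<and> z \<in> elts E n"
  if "x \<in> elts ?U n" "y \<in> elts ?U n" "z \<in> elts ?U n" for x y z n using dir[of "{x, y, z}" n] that by auto
 have gr: "abelian_group (cmpt ?U n)" for n
 proof (rule abelian_groupI)
  fix x y assume xy: "x \<in> elts ?U n" "y \<in> elts ?U n"
  obtain E where E: "E \<in> C" "x \<in> elts E n" "y \<in> elts E n" using mem[OF xy xy(2)] by blast
  interpret E: graded_mod R E by (rule gmodI[OF C(2)[OF E(1)]])
  note D = gextD[OF ext[OF E(1)]]
  show "x \<oplus>[?U,n] y \<in> elts ?U n" using E.G.a_closed[OF E(2,3)] D(3)[OF E(2,3)] D(1) by simp
  show "x \<oplus>[?U,n] y = y \<oplus>[?U,n] x" using E.G.a_comm[OF E(2,3)] D(3) E by metis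
 next
  fix x y z assume xyz: "x \<in> elts ?U n" "y \<in> elts ?U n" "z \<in> elts ?U n"
  obtain E where E: "E \<in> C" "x \<in> elts E n" "y \<in> elts E n" "z \<in> elts E n" using mem[OF xyz] by blast
  interpret E: graded_mod R E by (rule gmodI[OF C(2)[OF E(1)]])
  note D = gextD[OF ext[OF E(1)]]
  show "x \<oplus>[?U,n] y \<oplus>[?U,n] z = x \<oplus>[?U,n] (y \<oplus>[?U,n] z)"
   using E.G.a_assoc[OF E(2-4)] D(3)[OF E(2,3)] D(3)[OF E(3,4)]
    D(3)[OF E.G.a_closed[OF E(2,3)] E(4)] D(3)[OF E(2) E.G.a_closed[OF E(3,4)]] by simp
 next
  obtain E where E: "E \<in> C" using C by blast
  interpret E: graded_mod R E by (rule gmodI[OF C(2)[OF E(1)]])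
  show "\<zero>[?U,n] \<in> elts ?U n" using gextD(1,2)[OF ext[OF E]] E.G.zero_closed by metis
 next
  fix x assume x: "x \<in> elts ?U n"
  obtain E where E: "E \<in> C" "x \<in> elts E n" using mem[OF x x x] by blast
  interpret E: graded_mod R E by (rule gmodI[OF C(2)[OF E(1)]])
  note D = gextD[OF ext[OF E(1)]]
  show "\<zero>[?U,n] \<oplus>[?U,n] x = x" using E.G.l_zero[OF E(2)] D(2) D(3)[OF E.G.zero_closed E(2)] by simp
  show "\<exists>y\<in>elts ?U n. y \<oplus>[?U,n] x = \<zero>[?U,n]"
   using E.G.l_neg[OF E(2)] D(2) D(3)[OF E.G.a_inv_closed[OF E(2)] E(2)] D(1)[OF E.G.a_inv_closed[OF E(2)]] by (metis)
 qed
 show "gmodule R ?U" unfolding graded_module_def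
 proof (intro conjI allI ballI gr)
  fix i j r x y assume r: "r \<in> deg R i" and xy: "x \<in> elts ?U j" "y \<in> elts ?U j"
  obtain E where E: "E \<in> C" "x \<in> elts E j" "y \<in> elts E j" using mem[OF xy xy(2)] by blast
  interpret E: graded_mod R E by (rule gmodI[OF C(2)[OF E(1)]])
  note D = gextD[OF ext[OF E(1)]]
  show "act ?U i j r (x \<oplus>[?U,j] y) = act ?U i j r x \<oplus>[?U,i + j] act ?U i j r y"
   using E.act_add[OF r E(2,3) refl] D(3)[OF E(2,3)] D(4)[OF r E(2)] D(4)[OF r E(3)]
    D(4)[OF r E.G.a_closed[OF E(2,3)]] D(3)[OF E.act_closed[OF r E(2) refl] E.act_closed[OF r E(3) refl]] by simp
 next
  fix i j r x assume r: "r \<in> deg R i" and x: "x \<in> elts ?U j"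
  obtain E where E: "E \<in> C" "x \<in> elts E j" using mem[OF x x x] by blast
  interpret E: graded_mod R E by (rule gmodI[OF C(2)[OF E(1)]])
  note D = gextD[OF ext[OF E(1)]]
  show "act ?U i j r x \<in> elts ?U (i + j)" using E.act_closed[OF r E(2) refl] D(4)[OF r E(2)] D(1) by simp
  fix s assume s: "s \<in> deg R i"
  show "act ?U i j (r \<oplus> s) x = act ?U i j r x \<oplus>[?U,i + j] act ?U i j s x"
   using E.act_add_left[OF r s E(2) refl] D(4)[OF r E(2)] D(4)[OF s E(2)] D(4)[OF deg_add[OF r s] E(2)]
    D(3)[OF E.act_closed[OF r E(2) refl] E.act_closed[OF s E(2) refl]] by simp
 next
  fix i j k r s x assume r: "r \<in> deg R i" and s: "s \<in> deg R j" and x: "x \<in> elts ?U k"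
  obtain E where E: "E \<in> C" "x \<in> elts E k" using mem[OF x x x] by blast
  interpret E: graded_mod R E by (rule gmodI[OF C(2)[OF E(1)]])
  note D = gextD[OF ext[OF E(1)]]
  show "act ?U (i + j) k (r \<otimes> s) x = act ?U i (j + k) r (act ?U j k s x)"
   using E.act_act[OF r s E(2) refl refl] D(4)[OF s E(2)] D(4)[OF mult_deg[OF r s] E(2)]
    D(4)[OF r E.act_closed[OF s E(2) refl]] by simp
 next
  fix j x assume x: "x \<in> elts ?U j"
  obtain E where E: "E \<in> C" "x \<in> elts E j" using mem[OF x x x] by blast
  interpret E: graded_mod R E by (rule gmodI[OF C(2)[OF E(1)]])
  show "act ?U 0 j \<one> x = x" using E.act_one[OF E(2)] gextD(4)[OF ext[OF E(1)] one_deg E(2)] by simp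
 qed
 show "elts ?U n = (\<Union>E\<in>C. elts E n)" by (rule el)
qed

text \<open>\<open>gext\<close> is only a preorder, as the records may differ outside the carriers.
  A maximal chain therefore takes the place of a maximal element, and maximality says no more than
  equality of carriers.\<close>

lemma maximal_essential_extension:
 assumes N: "gmodule R N"
 obtains E where "gmodule R E" "gext R N E" "essential R (elts N) E"
  "!!F. gmodule R F ==> gext R E F ==> essential R (elts E) F ==> elts F = elts E"
proof -
 interpret N: graded_mod R N by (rule gmodI[OF N])
 define A where "A = {E. gmodule R E \<and> gext R N E \<and> essential R (elts N) E}"
 have "essential R (elts N) N" unfolding essential_def using N.sub_whole N.sub_elts by blast
 hence NA: "N \<in> A" using N gext_refl by (simp add: A_def)
 obtain C where "pred_on.maxchain A (gext R) C" using pred_on.Hausdorff by blast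
 hence mc: "C <= A" "!!E F. E \<in> C ==> F \<in> C ==> gext R E F \<or> gext R F E"
  and max: "!!D. pred_on.chain A (gext R) D ==> \<not> C \<subset> D"
  unfolding pred_on.maxchain_def pred_on.chain_def using gext_refl by blast+
 have ne: "C ~= {}" using NA max by (auto simp: pred_on.chain_def)
 have CM: "gmodule R E" if "E \<in> C" for E using that mc(1) by (auto simp: A_def)
 let ?U = "union_mod C"
 note U = union_chain[OF ne CM mc(2)]
 have UM: "gmodule R ?U" by (rule U(1))
 have UE: "gext R E ?U" if "E \<in> C" for E by (rule U(2)) (use that in auto)
 have Uel: "elts ?U n = (\<Union>E\<in>C. elts E n)" for n by (rule U(3))
 interpret U: graded_mod R ?U by (rule gmodI[OF UM])
 have NU: "gext R N ?U" using ne mc(1) UE gext_trans unfolding A_def by blast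
 have esU: "essential R (elts N) ?U"
 proof (rule essentialI[OF UM gext_submodule(1)[OF N UM NU]])
  fix n x assume x: "x \<in> elts ?U n" "x ~= \<zero>[?U,n]"
  then obtain E where E: "E \<in> C" "x \<in> elts E n" unfolding Uel by blast
  note D = gextD[OF UE[OF E(1)]]
  have EM: "gmodule R E" and eE: "essential R (elts N) E" using E mc(1) by (auto simp: A_def)
  have "x ~= \<zero>[E,n]" using x(2) D(2) by simp
  then obtain i r where "r \<in> deg R i" "act E i n r x \<in> elts N (i + n)" "act E i n r x ~= \<zero>[E,i + n]"
   by (rule essentialD[OF EM eE E(2)])
  thus "EX i r. r \<in> deg R i \<and> act ?U i n r x \<in> elts N (i + n) \<and> act ?U i n r x ~= \<zero>[?U,i + n]"
   using D(2) D(4)[OF _ E(2)] by metis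
 qed
 show ?thesis
 proof (rule that[OF UM NU esU])
  fix F assume F: "gmodule R F" "gext R ?U F" "essential R (elts ?U) F"
  have UF: "gmod_mono R ?U F (%n x. x)" by (rule gext_submodule(2)[OF UM F(1,2)])
  have NF: "gext R N F" by (rule gext_trans[OF NU F(2)])
  have "gmod_image ?U (%n x. x) = elts ?U" by (auto simp: gmod_image_def)
  hence "essential R (elts N) F" using essential_image_trans[OF UM F(1) F(1) esU UF _ _ gext_submodule(1)[OF N F(1) NF]] F(3) by simp
  hence "F \<in> A" using F NF by (simp add: A_def)
  hence "pred_on.chain A (gext R) (insert F C)" unfolding pred_on.chain_def using mc UE F(2) gext_trans by blast
  hence "F \<in> C" using max by blast
  hence "elts F n <= elts ?U n" for n using gextD(1)[OF UE] by blast
  thus "elts F = elts ?U" using gextD(1)[OF F(2)] by blast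
 qed
qed

text \<open>Zorn's lemma for submodules that contain K and meet D trivially. Adding x to a maximal
  one destroys the trivial intersection, and this is the last conclusion.\<close>

lemma maximal_complement:
 fixes P :: "('a, 'm) gmod"
 assumes P: "gmodule R P" and K: "gsub R K P" and D: "gsub R D P"
  and KD: "!!n x. x \<in> K n ==> x \<in> D n ==> x = \<zero>[P,n]"
 obtains N where "gsub R N P" "!!n. K n <= N n"
  "!!n x. x \<in> N n ==> x \<in> D n ==> x = \<zero>[P,n]"
  "!!n x. x \<in> elts P n ==> x \<notin> N n ==> EX i r w. r \<in> deg R i \<and> w \<in> N (i + n) \<and>
   w \<oplus>[P,i + n] act P i n r x \<in> D (i + n) \<and> w \<oplus>[P,i + n] act P i n r x ~= \<zero>[P,i + n]"
proof -
 interpret P: graded_mod R P by (rule gmodI[OF P])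
 define good where "good N \<longleftrightarrow> gsub R N P \<and> (ALL n. K n <= N n) \<and>
  (ALL n x. x \<in> N n --> x \<in> D n --> x = \<zero>[P,n])" for N
 \<comment> \<open>Families of components are encoded as sets of pairs, so that Zorn's lemma for set
   inclusion applies.\<close>
 let ?S = "%N. Sigma (UNIV :: int set) N"
 let ?A = "{T. good (%n. T `` {n})}"
 have SI: "(?S N) `` {n} = N n" for N :: "int => 'm set" and n by auto
 have "good K" using K KD by (simp add: good_def)
 hence ne: "?A ~= {}" using SI[of K] by (intro ex_in_conv[THEN iffD1] exI[of _ "?S K"]) simp
 have "\<exists>M\<in>?A. \<forall>X\<in>?A. M <= X --> X = M"
 proof (rule subset_Zorn_nonempty[OF ne])
  fix C assume C: "C ~= {}" "subset.chain ?A C"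
  have g: "good (%n. T `` {n})" if "T \<in> C" for T using C(2) that by (auto simp: subset_chain_def)
  have gs: "gsub R (%n. T `` {n}) P" if "T \<in> C" for T using g[OF that] by (simp add: good_def)
  obtain T0 where T0: "T0 \<in> C" using C by blast
  have "gsub R (%n. \<Union>C `` {n}) P"
  proof (rule P.submoduleI)
   fix n x assume "x \<in> \<Union>C `` {n}"
   thus "x \<in> elts P n" using P.sub_elts[OF gs] by blast
  next
   show "\<zero>[P,n] \<in> \<Union>C `` {n}" for n using P.sub_zero[OF gs[OF T0], of n] T0 by blast
  next
   fix n x y assume "x \<in> \<Union>C `` {n}" "y \<in> \<Union>C `` {n}"
   then obtain T T' where T: "T \<in> C" "T' \<in> C" "x \<in> T `` {n}" "y \<in> T' `` {n}" by blast
   then consider "T <= T'" | "T' <= T" using C(2) unfolding subset_chain_def by blast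
   then obtain T'' where "T'' \<in> C" "x \<in> T'' `` {n}" "y \<in> T'' `` {n}" using T by cases blast+
   thus "x \<oplus>[P,n] y \<in> \<Union>C `` {n}" using P.sub_add[OF gs, of T'' x n y] by blast
  next
   fix i j r x assume r: "r \<in> deg R i" and "x \<in> \<Union>C `` {j}"
   then obtain T where "T \<in> C" "x \<in> T `` {j}" by blast
   thus "act P i j r x \<in> \<Union>C `` {i + j}" using P.sub_act[OF gs r, of T x j "i + j"] by blast
  qed
  moreover have "K n <= \<Union>C `` {n}" for n using g[OF T0] T0 unfolding good_def by blast
  moreover have "x = \<zero>[P,n]" if x: "x \<in> \<Union>C `` {n}" "x \<in> D n" for n x using x(1) g x(2) by (auto simp: good_def)
  ultimately show "\<Union>C \<in> ?A" by (simp add: good_def)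
 qed
 then obtain T where T: "good (%n. T `` {n})" "!!X. good (%n. X `` {n}) ==> T <= X ==> X = T" by blast
 define N where "N n = T `` {n}" for n
 have N: "gsub R N P" and KN: "!!n. K n <= N n"
  and ND: "!!n x. x \<in> N n ==> x \<in> D n ==> x = \<zero>[P,n]" using T(1) unfolding good_def N_def by blast+
 show ?thesis
 proof (rule that[OF N KN ND])
  fix n x assume x: "x \<in> elts P n" "x \<notin> N n"
  let ?N = "add_cyclic R P N n x"
  note inc = P.add_cyclic_incl[OF N x(1)]
  have "\<not> good ?N"
  proof
   assume "good ?N"
   hence "good (%n. ?S ?N `` {n})" using SI[of ?N] by simp
   moreover have "T <= ?S ?N" using inc(1) by (auto simp: N_def)
   ultimately have "?S ?N = T" using T(2) by blast
   hence "?N n = N n" using SI[of ?N n] by (simp add: N_def)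
   thus False using inc(2) x(2) by simp
  qed
  then obtain k u where u: "u \<in> ?N k" "u \<in> D k" "u ~= \<zero>[P,k]"
   using P.sub_add_cyclic[OF N x(1)] KN inc(1) unfolding good_def by blast
  then obtain w r where w: "u = w \<oplus>[P,k] act P (k - n) n r x" "w \<in> N k" "r \<in> deg R (k - n)" unfolding add_cyclic_def by blast
  thus "EX i r w. r \<in> deg R i \<and> w \<in> N (i + n) \<and> w \<oplus>[P,i + n] act P i n r x \<in> D (i + n) \<and>
    w \<oplus>[P,i + n] act P i n r x ~= \<zero>[P,i + n]"
   using u by (intro exI[of _ "k - n"] exI[of _ r] exI[of _ w]) simp
 qed
qed

end

section \<open>Cardinality of essential extensions\<close>

lemma card_of_lists_le:
 assumes "infinite B" "|A| \<le>o |B|"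
 shows "|lists A| \<le>o |B|"
proof -
 have *: "|{xs \<in> lists A. length xs = k}| \<le>o |B|" for k
 proof (induction k)
  case 0
  have "{xs \<in> lists A. length xs = 0} = {[]}" by auto
  thus ?case using card_of_singl_ordLeq[of B "[]"] assms(1) by auto
 next
  case (Suc k)
  have "{xs \<in> lists A. length xs = Suc k} <= (%(x, xs). x # xs) ` (A \<times> {xs \<in> lists A. length xs = k})"
  proof
   fix xs assume "xs \<in> {xs \<in> lists A. length xs = Suc k}"
   then obtain y ys where "xs = y # ys" "y \<in> A" "ys \<in> lists A" "length ys = k" by (cases xs) auto
   thus "xs \<in> (%(x, xs). x # xs) ` (A \<times> {xs \<in> lists A. length xs = k})" by force
  qed
  hence "|{xs \<in> lists A. length xs = Suc k}| \<le>o |(%(x, xs). x # xs) ` (A \<times> {xs \<in> lists A. length xs = k})|"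
   by (rule card_of_mono1)
  also have "|(%(x, xs). x # xs) ` (A \<times> {xs \<in> lists A. length xs = k})| \<le>o |A \<times> {xs \<in> lists A. length xs = k}|"
   by (rule card_of_image)
  also have "|A \<times> {xs \<in> lists A. length xs = k}| \<le>o |B|"
   by (rule card_of_Times_ordLeq_infinite_Field) (use assms Suc in \<open>simp_all add: Field_card_of card_of_card_order_on\<close>)
  finally show ?case .
 qed
 have "lists A = (\<Union>k\<in>(UNIV::nat set). {xs \<in> lists A. length xs = k})" by auto
 moreover have "|\<Union>k\<in>(UNIV::nat set). {xs \<in> lists A. length xs = k}| \<le>o |B|"
  by (rule card_of_UNION_ordLeq_infinite) (use assms * infinite_iff_card_of_nat in auto)
 ultimately show ?thesis by simp
qed

context noetherian_graded_ring
begin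

text \<open>Let \<open>C\<close> contain \<open>N\<close> and be closed under the module operations and under solutions of finite
 systems \<open>a\<^sub>i x = e\<^sub>i\<close>.  If \<open>x \<notin> C\<close>, subtract from \<open>x\<close> a solution \<open>y \<in> C\<close> of the system given by
 generators of \<open>(C : x)\<close>; no multiple of \<open>x - y\<close> is a nonzero element of \<open>N\<close>.\<close>

lemma essential_closure:
 assumes E: "gmodule R E" and N: "essential R N E"
  and NC: "!!n. N n <= C n" and CE: "!!n. C n <= elts E n"
  and add: "!!n x y. x \<in> C n ==> y \<in> C n ==> x \<oplus>[E,n] y \<in> C n"
  and act: "!!i n r x. r \<in> deg R i ==> x \<in> C n ==> act E i n r x \<in> C (i + n)"
  and sol: "!!n L x. x \<in> elts E n ==> (!!d a e. (d, a, e) \<in> set L ==> a \<in> deg R d \<and> e \<in> C (d + n) \<and> act E d n a x = e) ==>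
   \<exists>y\<in>C n. \<forall>(d, a, e)\<in>set L. act E d n a y = e"
 shows "elts E n <= C n"
proof
 interpret E: graded_mod R E by (rule gmodI[OF E])
 have N': "gsub R N E" using N by (simp add: essential_def)
 have C: "gsub R C E" using CE NC E.sub_zero[OF N'] add act by (intro E.submoduleI) blast+
 fix x assume x: "x \<in> elts E n"
 show "x \<in> C n"
 proof (rule ccontr)
  assume xC: "x \<notin> C n"
  define J where "J k = {r \<in> deg R k. act E k n r x \<in> C (k + n)}" for k
  have gJ: "gideal R J" unfolding J_def by (rule E.gideal_residual[OF C x])
  obtain S where S: "finite S" "!!d a. (d, a) \<in> S ==> a \<in> J d"
   "!!K k. gideal R K ==> (!!d a. (d, a) \<in> S ==> a \<in> K d) ==> J k <= K k" using gideal_fg[OF gJ] by metis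
  obtain l where l: "set l = S" using S(1) finite_list by blast
  let ?L = "map (%(d, a). (d, a, act E d n a x)) l"
  have "\<exists>y\<in>C n. \<forall>(d, a, e)\<in>set ?L. act E d n a y = e"
   by (rule sol[OF x]) (use S(2) l in \<open>auto simp: J_def\<close>)
  then obtain y where y: "y \<in> C n" "!!d a. (d, a) \<in> S ==> act E d n a y = act E d n a x" using l by fastforce
  have ye: "y \<in> elts E n" using y CE by blast
  let ?z = "x \<ominus>[E,n] y"
  have z: "?z \<in> elts E n" using x ye by simp
  have z0: "?z ~= \<zero>[E,n]" using E.minus_eq_zero[OF x ye] y(1) xC by auto
  obtain i r where r: "r \<in> deg R i" "act E i n r ?z \<in> N (i + n)" "act E i n r ?z ~= \<zero>[E,i + n]"
   by (rule essentialD[OF E N z z0])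
  have rz: "act E i n r ?z = act E i n r x \<ominus>[E,i + n] act E i n r y" by (rule E.act_minus[OF r(1) x ye refl])
  have c: "act E i n r x \<in> elts E (i + n)" "act E i n r y \<in> elts E (i + n)" using E.act_closed[OF r(1) _ refl] x ye by blast+
  have "act E i n r ?z \<in> C (i + n)" using r(2) NC by blast
  hence "act E i n r ?z \<oplus>[E,i + n] act E i n r y \<in> C (i + n)" using add act[OF r(1) y(1)] by blast
  hence "act E i n r x \<in> C (i + n)" using E.add_minus_cancel(4)[OF c(2,1)] rz by simp
  hence "r \<in> J i" using r(1) by (simp add: J_def)
  \<comment> \<open>All generators of (C : x) annihilate x - y, hence so does the whole ideal, in
    contradiction to the nonzero multiple.\<close>
  moreover have "J i <= {r \<in> deg R i. act E i n r ?z \<in> null_sub E (i + n)}"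
  proof (rule S(3)[OF E.gideal_residual[OF E.sub_null z]])
   fix d a assume da: "(d, a) \<in> S"
   have a: "a \<in> deg R d" using S(2)[OF da] by (simp add: J_def)
   have "act E d n a ?z = act E d n a x \<ominus>[E,d + n] act E d n a x" using E.act_minus[OF a x ye refl] y(2)[OF da] by simp
   also have "... = \<zero>[E,d + n]" using E.act_closed[OF a x refl] by (simp add: a_minus_def E.G.r_neg)
   finally show "a \<in> {r \<in> deg R d. act E d n r ?z \<in> null_sub E (d + n)}" using a by (simp add: null_sub_def)
  qed
  ultimately show False using r(3) by (auto simp: null_sub_def)
 qed
qed

text \<open>The closure of N under the operations and under one chosen solution of each solvable
  finite system arises in countably many rounds, each preserving the bound |X|. By
  \<open>essential_closure\<close> it is the whole of E.\<close>

lemma essential_bound: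
 fixes E :: "('r, 'm) gmod" and X :: "'x set"
 assumes E: "gmodule R E" and N: "essential R N E"
  and X: "|UNIV :: (int \<times> 'r) set| \<le>o |X|" and NX: "!!n. |N n| \<le>o |X|"
 shows "|elts E n| \<le>o |X|"
proof -
 interpret E: graded_mod R E by (rule gmodI[OF E])
 have N': "gsub R N E" using N by (simp add: essential_def)
 have infI: "infinite (UNIV :: (int \<times> 'r) set)" by (simp add: finite_prod)
 have infX: "infinite X" using card_of_ordLeq_infinite[OF X infI] .
 have intX: "|UNIV :: int set| \<le>o |X|" using ordLeq_transitive[OF card_of_Times1[of "UNIV :: 'r set" "UNIV :: int set"]] X by simp
 define solves where "solves n L x \<longleftrightarrow> x \<in> elts E n \<and>
   (\<forall>(d, a, e)\<in>set L. act E d n a x = e)" for n and L :: "(int \<times> 'r \<times> 'm) list" and x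
 define sol where "sol n L = (SOME x. solves n L x)" for n L
 \<comment> \<open>One round of closure: sums, multiples, and a selected solution for every finite
   system whose right-hand sides come from S. The parameters stem from int, from the ring and from
   lists, none of which exceeds |X|.\<close>
 define F where "F S = S \<union> (%((n, x), (m, y)). (n, x \<oplus>[E,n] y)) ` (S \<times> S)
   \<union> (%((i, r), (n, x)). (i + n, act E i n r x)) ` (UNIV \<times> S)
   \<union> (%(n, L). (n, sol n L)) ` (UNIV \<times> lists ((%((d, a), (m, e)). (d, a, e)) ` (UNIV \<times> S)))" for S
 have SF: "S <= F S" for S unfolding F_def by blast
 have cF: "|F S| \<le>o |X|" if S: "|S| \<le>o |X|" for S
 proof -
  have t: "|A \<times> B| \<le>o |X|" if "|A| \<le>o |X|" "|B| \<le>o |X|" for A :: "'p set" and B :: "'q set"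
   by (rule card_of_Times_ordLeq_infinite_Field) (use that infX in \<open>simp_all add: Field_card_of card_of_card_order_on\<close>)
  have i: "|f ` A| \<le>o |X|" if "|A| \<le>o |X|" for A :: "'p set" and f :: "'p => 'q" using ordLeq_transitive[OF card_of_image that] .
  have u: "|A \<union> B| \<le>o |X|" if "|A| \<le>o |X|" "|B| \<le>o |X|" for A B :: "'p set"
   by (rule card_of_Un_ordLeq_infinite_Field) (use that infX in \<open>simp_all add: Field_card_of card_of_card_order_on\<close>)
  show ?thesis unfolding F_def by (intro u i t S X intX card_of_lists_le[OF infX])
 qed
 define S where "S k = (F ^^ k) (Sigma UNIV N)" for k
 have cS: "|S k| \<le>o |X|" for k
 proof (induction k)
  case 0
  have "|Sigma UNIV N| \<le>o |X|" by (rule card_of_Sigma_ordLeq_infinite[OF infX intX]) (use NX in blast)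
  thus ?case by (simp add: S_def)
 qed (simp add: S_def cF)
 have mono: "S k <= S l" if "k \<le> l" for k l
  using that by (induction rule: dec_induct) (use SF in \<open>auto simp: S_def\<close>)
 have Fmono: "F (S k) = S (Suc k)" for k by (simp add: S_def)
 define U where "U = (\<Union>k. S k)"
 have cU: "|U| \<le>o |X|" unfolding U_def by (rule card_of_UNION_ordLeq_infinite[OF infX]) (use cS infX infinite_iff_card_of_nat in auto)
 define C where "C n = {x. (n, x) \<in> U} \<inter> elts E n" for n
 have fin: "EX k. set l <= S k" if "set l <= U" for l using that
 proof (induction l)
  case (Cons z l)
  then obtain k k' where "set l <= S k" "z \<in> S k'" by (auto simp: U_def)
  hence "set (z # l) <= S (max k k')" using mono[of k "max k k'"] mono[of k' "max k k'"] by auto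
  thus ?case by blast
 qed simp
 have step: "z \<in> U" if "z \<in> F (S k)" for z k using that Fmono by (auto simp: U_def)
 have "elts E n <= C n"
 proof (rule essential_closure[OF E N])
  show "N n <= C n" for n
  proof -
   have "Sigma UNIV N <= U" unfolding U_def S_def by (metis UN_upper UNIV_I funpow_0)
   thus ?thesis using E.sub_elts[OF N'] by (auto simp: C_def)
  qed
  show "C n <= elts E n" for n by (simp add: C_def)
 next
  fix n x y assume xy: "x \<in> C n" "y \<in> C n"
  hence "set [(n, x), (n, y)] <= U" by (simp add: C_def)
  then obtain k where "set [(n, x), (n, y)] <= S k" using fin by blast
  hence k: "(n, x) \<in> S k" "(n, y) \<in> S k" by simp_all
  have "(n, x \<oplus>[E,n] y) \<in> (%((n, x), (m, y)). (n, x \<oplus>[E,n] y)) ` (S k \<times> S k)"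
   by (rule image_eqI[of _ _ "((n, x), (n, y))"]) (use k in auto)
  hence "(n, x \<oplus>[E,n] y) \<in> U" by (intro step[of _ k]) (simp add: F_def)
  thus "x \<oplus>[E,n] y \<in> C n" using xy by (simp add: C_def)
 next
  fix i n r x assume r: "r \<in> deg R i" and x: "x \<in> C n"
  then obtain k where k: "(n, x) \<in> S k" by (auto simp: C_def U_def)
  have "(i + n, act E i n r x) \<in> (%((i, r), (n, x)). (i + n, act E i n r x)) ` (UNIV \<times> S k)"
   by (rule image_eqI[of _ _ "((i, r), (n, x))"]) (use k in auto)
  hence "(i + n, act E i n r x) \<in> U" by (intro step[of _ k]) (simp add: F_def)
  thus "act E i n r x \<in> C (i + n)" using x E.act_closed[OF r _ refl] by (simp add: C_def)
 next
  fix n L x assume x: "x \<in> elts E n"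
   and L: "!!d a e. (d, a, e) \<in> set L ==> a \<in> deg R d \<and> e \<in> C (d + n) \<and> act E d n a x = e"
  have "solves n L x" unfolding solves_def using x L by blast
  hence s: "solves n L (sol n L)" unfolding sol_def by (rule someI)
  have "set (map (%(d, a, e). (d + n, e)) L) <= U" using L by (auto simp: C_def)
  then obtain k where k: "set (map (%(d, a, e). (d + n, e)) L) <= S k" using fin by blast
  have "L \<in> lists ((%((d, a), (m, e)). (d, a, e)) ` (UNIV \<times> S k))" unfolding in_lists_conv_set
  proof (rule ballI)
   fix z assume "z \<in> set L"
   obtain d a e where z: "z = (d, a, e)" by (cases z)
   have "(d + n, e) \<in> S k" using \<open>z \<in> set L\<close> k z by force
   thus "z \<in> (%((d, a), (m, e)). (d, a, e)) ` (UNIV \<times> S k)" by (intro image_eqI[of _ _ "((d, a), (d + n, e))"]) (auto simp: z)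
  qed
  hence "(n, sol n L) \<in> (%(n, L). (n, sol n L)) ` (UNIV \<times> lists ((%((d, a), (m, e)). (d, a, e)) ` (UNIV \<times> S k)))"
   by (intro image_eqI[of _ _ "(n, L)"]) auto
  hence "(n, sol n L) \<in> U" by (intro step[of _ k]) (simp add: F_def)
  thus "\<exists>y\<in>C n. \<forall>(d, a, e)\<in>set L. act E d n a y = e"
   using s unfolding solves_def by (intro bexI[of _ "sol n L"]) (auto simp: C_def)
 qed
 hence "elts E n <= snd ` U" unfolding C_def by force
 hence "|elts E n| \<le>o |snd ` U|" by (rule card_of_mono1)
 thus ?thesis using ordLeq_transitive[OF _ ordLeq_transitive[OF card_of_image cU]] by blast
qed

end

lemma card_leI: "inj_on f A ==> f ` A <= B ==> |A| \<le>o |B|"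
 using card_of_ordLeq[THEN iffD1, of A B] by metis

lemma card_leE:
 assumes "|A| \<le>o |B|" obtains f where "inj_on f A" "f ` A <= B"
 using card_of_ordLeq[THEN iffD2, OF assms] by metis

context graded_commutative_ring
begin

lemma essential_whole:
 assumes "gmodule R E" shows "essential R (elts E) E"
proof -
 interpret E: graded_mod R E by (rule gmodI[OF assms])
 show ?thesis
 proof (rule essentialI[OF assms E.sub_whole])
  fix n x assume "x \<in> elts E n" "x ~= \<zero>[E,n]"
  thus "EX i r. r \<in> deg R i \<and> act E i n r x \<in> elts E (i + n) \<and> act E i n r x ~= \<zero>[E,i + n]"
   using E.act_one[of x n] one_deg by (intro exI[of _ 0] exI[of _ \<one>]) simp
 qed
qed

lemma mono_comp:
 assumes f: "gmod_mono R L M f" and g: "gmod_mono R M N g"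
 shows "gmod_mono R L N (%n x. g n (f n x))"
proof -
 have fh: "gmod_hom R L M f" and gh: "gmod_hom R M N g" using f g by (auto simp: gmod_mono_def)
 have "inj_on (%x. g n (f n x)) (elts L n)" for n
 proof (rule comp_inj_on[of "f n" "elts L n" "g n", unfolded comp_def])
  show "inj_on (f n) (elts L n)" using f by (simp add: gmod_mono_def)
  show "inj_on (g n) (f n ` elts L n)"
   by (rule inj_on_subset[of _ "elts M n"]) (use g hom_closed[OF fh] in \<open>auto simp: gmod_mono_def\<close>)
 qed
 thus ?thesis using hom_comp[OF fh gh] by (simp add: gmod_mono_def)
qed

lemma hom_inverse:
 assumes M: "gmodule R M" and f: "gmod_mono R M N f" and surj: "!!n. f n ` elts M n = elts N n"
 shows "gmod_hom R N M (%n. inv_into (elts M n) (f n))"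
proof -
 interpret M: graded_mod R M by (rule gmodI[OF M])
 have h: "gmod_hom R M N f" and i: "inj_on (f n) (elts M n)" for n using f by (auto simp: gmod_mono_def)
 have ex: "\<exists>x\<in>elts M n. a = f n x" if "a \<in> elts N n" for a n using that surj[of n] by blast
 show ?thesis unfolding gmod_hom_def
 proof (intro conjI allI ballI)
  show "inv_into (elts M n) (f n) \<in> elts N n \<rightarrow> elts M n" for n using surj[of n] by (auto intro: inv_into_into)
 next
  fix n a b assume "a \<in> elts N n" "b \<in> elts N n"
  then obtain x y where xy: "x \<in> elts M n" "a = f n x" "y \<in> elts M n" "b = f n y" using ex by meson
  thus "inv_into (elts M n) (f n) (a \<oplus>[N,n] b) =
   inv_into (elts M n) (f n) a \<oplus>[M,n] inv_into (elts M n) (f n) b"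
   using hom_add[OF h xy(1,3)] i by (metis M.G.a_closed inv_into_f_f)
 next
  fix k j r a assume r: "r \<in> deg R k" and "a \<in> elts N j"
  then obtain x where x: "x \<in> elts M j" "a = f j x" using ex by meson
  thus "inv_into (elts M (k + j)) (f (k + j)) (act N k j r a) =
   act M k j r (inv_into (elts M j) (f j) a)"
   using hom_act[OF h r x(1) refl] i M.act_closed[OF r x(1) refl] by (metis inv_into_f_f)
 qed
qed

lemma gsum_homs:
 assumes E: "gmodule R E" and B: "gmodule R B"
 shows "gmod_hom R E (gsum E B) (%n x. (x, \<zero>[B,n]))" "gmod_hom R B (gsum E B) (%n x. (\<zero>[E,n], x))"
proof -
 interpret E: graded_mod R E by (rule gmodI[OF E])
 interpret B: graded_mod R B by (rule gmodI[OF B])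
 show "gmod_hom R E (gsum E B) (%n x. (x, \<zero>[B,n]))" "gmod_hom R B (gsum E B) (%n x. (\<zero>[E,n], x))"
  by (auto simp: gmod_hom_def gsum_def B.act_zero E.act_zero)
qed

text \<open>A map \<open>f : A \<rightarrow> E\<close> is extended along \<open>io : A \<rightarrow> B\<close> by dividing \<open>E \<oplus> B\<close> by a submodule that is
 maximal among those containing the pairs \<open>(f a, -io a)\<close> and meeting \<open>E\<close> trivially; the quotient is
 an essential extension of \<open>E\<close>.\<close>

lemma no_extension_injective:
 fixes E :: "('a, 'x) gmod"
 assumes E: "gmodule R E"
  and noext: "!!(Q :: ('a, 'x \<times> ('a + 'x)) gmod) j n. gmodule R Q ==> gmod_mono R E Q j ==>
   essential R (gmod_image E j) Q ==> j n ` elts E n = elts Q n"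
 shows "injective_gmod R E" unfolding injective_gmod_def
proof (intro conjI E allI impI)
 fix A B :: "('a, 'a + 'x) gmod" and io f
 assume asm: "gmodule R A \<and> gmodule R B \<and> gmod_mono R A B io \<and> gmod_hom R A E f"
 hence A: "gmodule R A" and B: "gmodule R B" and io: "gmod_hom R A B io"
  and ioi: "!!n. inj_on (io n) (elts A n)" and f: "gmod_hom R A E f" by (auto simp: gmod_mono_def)
 interpret E: graded_mod R E by (rule gmodI[OF E])
 interpret A: graded_mod R A by (rule gmodI[OF A])
 interpret B: graded_mod R B by (rule gmodI[OF B])
 let ?P = "gsum E B"
 note P = gsum_module[OF E B]
 interpret P: graded_mod R ?P by (rule gmodI[OF P])
 have Pel: "elts ?P n = elts E n \<times> elts B n" for n by (simp add: gsum_def)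
 have Padd: "u \<oplus>[?P,n] v = (fst u \<oplus>[E,n] fst v, snd u \<oplus>[B,n] snd v)" for u v n by (simp add: gsum_def)
 have Pz: "\<zero>[?P,n] = (\<zero>[E,n], \<zero>[B,n])" for n by (simp add: gsum_def)
 note homs = gsum_homs[OF E B]
 define c where "c n a = (f n a, \<ominus>[B,n] io n a)" for n a
 have c: "gmod_hom R A ?P c" using hom_closed[OF f] hom_closed[OF io]
  by (auto simp: gmod_hom_def gsum_def c_def hom_add[OF f] hom_add[OF io] hom_act[OF f _ _ refl]
    hom_act[OF io _ _ refl] B.G.minus_add B.act_neg[OF _ _ refl])
 define K where "K n = c n ` elts A n" for n
 have K: "gsub R K ?P" unfolding K_def by (rule hom_image_submodule[OF A P c A.sub_whole])
 define D where "D n = (%x. (x, \<zero>[B,n])) ` elts E n" for n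
 have D: "gsub R D ?P" unfolding D_def by (rule hom_image_submodule[OF E P homs(1) E.sub_whole])
 \<comment> \<open>A relation (f a, -io a) lying in E has io a = 0, hence a = 0 because io is
   injective.\<close>
 have KD: "x = \<zero>[?P,n]" if x: "x \<in> K n" "x \<in> D n" for n x
 proof -
  obtain a where a: "a \<in> elts A n" "x = c n a" using x(1) by (auto simp: K_def)
  hence "\<ominus>[B,n] io n a = \<zero>[B,n]" using x(2) by (auto simp: c_def D_def)
  hence "io n a = \<zero>[B,n]" using hom_closed[OF io a(1)] by (metis B.G.add.inv_eq_1_iff a_inv_def)
  hence "a = \<zero>[A,n]" using inj_on_iff_kernel[OF A B io] ioi a(1) by blast
  thus ?thesis using a hom_zero[OF A P c] by simp
 qed
 obtain N where N: "gsub R N ?P" "!!n. K n <= N n"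
  "!!n x. x \<in> N n ==> x \<in> D n ==> x = \<zero>[?P,n]"
  "!!n x. x \<in> elts ?P n ==> x \<notin> N n ==> EX i r w. r \<in> deg R i \<and> w \<in> N (i + n) \<and>
   w \<oplus>[?P,i + n] act ?P i n r x \<in> D (i + n) \<and> w \<oplus>[?P,i + n] act ?P i n r x ~= \<zero>[?P,i + n]"
  by (rule maximal_complement[OF P K D], rule KD, assumption+, rule that, assumption+)
 obtain Q :: "('a, 'x \<times> ('a + 'x)) gmod" and q where Q: "gmodule R Q" and q: "gmod_hom R ?P Q q"
  and Qel: "!!n. elts Q n = q n ` elts ?P n"
  and q0: "!!n x. x \<in> elts ?P n ==> q n x = \<zero>[Q,n] \<longleftrightarrow> x \<in> N n" by (rule quotient_mod[OF P N(1)]) blast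
 interpret Q: graded_mod R Q by (rule gmodI[OF Q])
 define j where "j n e = q n (e, \<zero>[B,n])" for n e
 have jh: "gmod_hom R E Q j" unfolding j_def by (rule hom_comp[OF homs(1) q])
 have "inj_on (j n) (elts E n)" for n unfolding inj_on_iff_kernel[OF E Q jh] using q0 Pel N(3) Pz by (auto simp: j_def D_def)
 hence jm: "gmod_mono R E Q j" using jh by (simp add: gmod_mono_def)
 have "essential R (gmod_image E j) Q"
 proof (rule essentialI[OF Q image_submodule[OF E Q jh]])
  fix n u assume u: "u \<in> elts Q n" "u ~= \<zero>[Q,n]"
  then obtain x where x: "x \<in> elts ?P n" "u = q n x" unfolding Qel by blast
  hence "x \<notin> N n" using q0 u(2) by blast
  then obtain i r w where r: "r \<in> deg R i" "w \<in> N (i + n)" "w \<oplus>[?P,i + n] act ?P i n r x \<in> D (i + n)"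
   "w \<oplus>[?P,i + n] act ?P i n r x ~= \<zero>[?P,i + n]" using N(4)[OF x(1)] by blast
  let ?y = "w \<oplus>[?P,i + n] act ?P i n r x"
  have w: "w \<in> elts ?P (i + n)" by (rule P.sub_elts[OF N(1) r(2)])
  have rx: "act ?P i n r x \<in> elts ?P (i + n)" by (rule P.act_closed[OF r(1) x(1) refl])
  have "q (i + n) ?y = q (i + n) w \<oplus>[Q,i + n] q (i + n) (act ?P i n r x)" by (rule hom_add[OF q w rx])
  also have "... = act Q i n r u" using q0[OF w] r(2) hom_closed[OF q rx] hom_act[OF q r(1) x(1) refl] x(2) by simp
  finally have qy: "act Q i n r u = q (i + n) ?y" by simp
  obtain e where e: "e \<in> elts E (i + n)" "?y = (e, \<zero>[B,i + n])" using r(3) unfolding D_def by blast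
  have "?y \<notin> N (i + n)" using N(3) r(3,4) by blast
  hence "q (i + n) ?y ~= \<zero>[Q,i + n]" using q0[of ?y "i + n"] w rx by simp
  moreover have "q (i + n) ?y \<in> gmod_image E j (i + n)" unfolding e(2) gmod_image_def j_def using e(1) by blast
  ultimately show "EX i r. r \<in> deg R i \<and> act Q i n r u \<in> gmod_image E j (i + n) \<and> act Q i n r u ~= \<zero>[Q,i + n]"
   using r(1) unfolding qy[symmetric] by blast
 qed
 \<comment> \<open>Since the essential extension Q is trivial, B -> Q followed by the inverse of E
   -> Q is the desired extension of f.\<close>
 hence surj: "j n ` elts E n = elts Q n" for n by (rule noext[OF Q jm])
 note inv = hom_inverse[OF E jm surj]
 show "EX g. gmod_hom R B E g \<and> (ALL n. \<forall>a\<in>elts A n. g n (io n a) = f n a)"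
 proof (intro exI conjI allI ballI)
  show "gmod_hom R B E (%n b. inv_into (elts E n) (j n) (q n (\<zero>[E,n], b)))" by (rule hom_comp[OF hom_comp[OF homs(2) q] inv])
  fix n a assume a: "a \<in> elts A n"
  have fa: "f n a \<in> elts E n" and ia: "io n a \<in> elts B n" using hom_closed[OF f a] hom_closed[OF io a] .
  have ca: "c n a \<in> elts ?P n" "c n a \<in> N n" using hom_closed[OF c a] N(2) a by (auto simp: K_def)
  have "(f n a, \<zero>[B,n]) = c n a \<oplus>[?P,n] (\<zero>[E,n], io n a)" using fa ia by (simp add: Padd c_def B.G.l_neg)
  hence "j n (f n a) = q n (c n a) \<oplus>[Q,n] q n (\<zero>[E,n], io n a)"
   using hom_add[OF q ca(1), of "(\<zero>[E,n], io n a)"] ia by (simp add: j_def Pel)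
  hence "j n (f n a) = q n (\<zero>[E,n], io n a)"
   using q0[OF ca(1)] ca(2) hom_closed[OF q, of "(\<zero>[E,n], io n a)" n] ia by (simp add: Pel)
  thus "inv_into (elts E n) (j n) (q n (\<zero>[E,n], io n a)) = f n a" using fa jm by (metis gmod_mono_def inv_into_f_f)
 qed
qed

end

section \<open>Hulls and minimal resolutions on a prescribed type\<close>

context noetherian_graded_ring
begin

text \<open>An essential extension of \<open>E\<close> is too small to fill the type, so it can be moved into the type
 without moving \<open>E\<close>.\<close>

lemma maximal_extension_surj:
 fixes E :: "('r, 'x set) gmod" and Q :: "('r, 'q) gmod"
 assumes E: "gmodule R E" and Q: "gmodule R Q"
  and X: "|UNIV :: (int \<times> 'r) set| \<le>o |UNIV :: 'x set|" and EX: "!!n. |elts E n| \<le>o |UNIV :: 'x set|"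
  and max: "!!F. gmodule R F ==> gext R E F ==> essential R (elts E) F ==> elts F = elts E"
  and k: "gmod_mono R E Q k" and ess: "essential R (gmod_image E k) Q"
 shows "k n ` elts E n = elts Q n"
proof -
 interpret E: graded_mod R E by (rule gmodI[OF E])
 interpret Q: graded_mod R Q by (rule gmodI[OF Q])
 have kh: "gmod_hom R E Q k" and ki: "inj_on (k n) (elts E n)" for n using k by (auto simp: gmod_mono_def)
 have infX: "infinite (UNIV :: 'x set)" using card_of_ordLeq_infinite[OF X] by (simp add: finite_prod)
 have QX: "|elts Q n| \<le>o |UNIV :: 'x set|" for n by (metis essential_bound Q ess X ordLeq_transitive card_of_image EX gmod_image_def)
 have "EX g. inj_on g (elts Q n) \<and> (\<forall>y\<in>elts E n. g (k n y) = y)" for n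
 proof -
  \<comment> \<open>A component of E has at most |'x| elements, while the type \<open>'x set\<close>
    has more; the complement thus has room for the new elements of Q.\<close>
  have "|UNIV :: 'x set| \<le>o |UNIV - elts E n|"
  proof (rule ccontr)
   assume "\<not> |UNIV :: 'x set| \<le>o |UNIV - elts E n|"
   hence "|UNIV - elts E n| \<le>o |UNIV :: 'x set|"
    using not_ordLeq_iff_ordLess[OF card_of_Well_order card_of_Well_order] ordLess_imp_ordLeq by blast
   hence "|elts E n \<union> (UNIV - elts E n)| \<le>o |UNIV :: 'x set|"
    using infX EX by (intro card_of_Un_ordLeq_infinite_Field) (simp_all add: Field_card_of card_of_card_order_on)
   hence "|UNIV :: 'x set set| \<le>o |UNIV :: 'x set|" by simp
   moreover have "|UNIV :: 'x set| <o |UNIV :: 'x set set|" using card_of_Pow[of "UNIV :: 'x set"] by simp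
   ultimately show False using not_ordLess_ordLeq by blast
  qed
  hence "|elts Q n| \<le>o |UNIV - elts E n|" by (rule ordLeq_transitive[OF QX])
  then obtain h where h: "inj_on h (elts Q n)" "h ` elts Q n <= UNIV - elts E n" by (rule card_leE)
  \<comment> \<open>On the image of E the map undoes the embedding, elsewhere it lands outside E; so
    it is injective and keeps E in place.\<close>
  let ?g = "%u. if u \<in> k n ` elts E n then inv_into (elts E n) (k n) u else h u"
  have 1: "inv_into (elts E n) (k n) u \<in> elts E n" if "u \<in> k n ` elts E n" for u using that by (rule inv_into_into)
  have "inj_on ?g (elts Q n)"
  proof (rule inj_onI)
   fix u v assume uv: "u \<in> elts Q n" "v \<in> elts Q n" "?g u = ?g v"
   consider "u \<in> k n ` elts E n" "v \<in> k n ` elts E n" | "u \<in> k n ` elts E n" "v \<notin> k n ` elts E n"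
    | "u \<notin> k n ` elts E n" "v \<in> k n ` elts E n" | "u \<notin> k n ` elts E n" "v \<notin> k n ` elts E n" by blast
   thus "u = v"
   proof cases
    case 1 thus ?thesis using uv(3) inv_into_injective by fastforce
   next
    case 2 hence "h v \<in> elts E n" using uv(3) 1[OF 2(1)] by simp
    thus ?thesis using h(2) uv(2) by blast
   next
    case 3 hence "h u \<in> elts E n" using uv(3) 1[OF 3(2)] by simp
    thus ?thesis using h(2) uv(1) by blast
   next
    case 4 thus ?thesis using uv h(1) by (auto dest: inj_onD)
   qed
  qed
  moreover have "?g (k n y) = y" if "y \<in> elts E n" for y using that ki by simp
  ultimately show ?thesis by (intro exI[of _ ?g] conjI ballI)
 qed
 then obtain g where gi: "!!n. inj_on (g n) (elts Q n)" and gk: "!!n y. y \<in> elts E n ==> g n (k n y) = y" by metis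
 let ?F = "gimg Q g"
 note t = transport_mod[OF Q, of g, OF gi]
 interpret F: graded_mod R ?F by (rule gmodI[OF t(1)])
 have mono: "gmod_mono R Q ?F g" using t(2) gi by (simp add: gmod_mono_def)
 have kc: "k n y \<in> elts Q n" if "y \<in> elts E n" for n y by (rule hom_closed[OF kh that])
 have ext: "gext R E ?F" unfolding gext_def
 proof (intro conjI allI ballI)
  show "elts E n <= elts ?F n" for n using gk kc by (metis t(4) image_eqI subsetI)
  show "\<zero>[E,n] = \<zero>[?F,n]" for n using gk[OF E.G.zero_closed, of n] hom_zero[OF E Q kh, of n] hom_zero[OF Q t(1,2), of n] by simp
  show "x \<oplus>[E,n] y = x \<oplus>[?F,n] y" if "x \<in> elts E n" "y \<in> elts E n" for n x y
   using gk[OF E.G.a_closed[OF that]] hom_add[OF kh that] hom_add[OF t(2) kc[OF that(1)] kc[OF that(2)]]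
    gk[OF that(1)] gk[OF that(2)] by simp
  show "act E i j r x = act ?F i j r x" if "r \<in> deg R i" "x \<in> elts E j" for i j r x
   using gk[OF E.act_closed[OF that refl]] hom_act[OF kh that refl] hom_act[OF t(2) that(1) kc[OF that(2)] refl]
    gk[OF that(2)] by simp
 qed
 have "gmod_image Q g = elts ?F" by (rule HOL.ext) (simp add: gmod_image_def t(4))
 hence e1: "essential R (gmod_image Q g) ?F" using essential_whole[OF t(1)] by simp
 have "essential R (elts E) ?F"
 proof (rule essential_image_trans[OF Q t(1) t(1) ess mono e1])
  show "g n ` gmod_image E k n <= elts E n" for n using gk by (auto simp: gmod_image_def)
  show "gsub R (elts E) ?F" by (rule gext_submodule(1)[OF E t(1) ext])
 qed
 hence eq: "elts ?F = elts E" by (rule max[OF t(1) ext])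
 show ?thesis
 proof
  show "k n ` elts E n <= elts Q n" using kc by blast
  show "elts Q n <= k n ` elts E n"
  proof
   fix u assume u: "u \<in> elts Q n"
   have gu: "g n u \<in> elts E n" using eq u t(4)[of n] by (metis imageI)
   hence "g n (k n (g n u)) = g n u" by (rule gk)
   hence "k n (g n u) = u" using inj_onD[OF gi _ kc[OF gu] u] by blast
   thus "u \<in> k n ` elts E n" using gu by (metis imageI)
  qed
 qed
qed

text \<open>A maximal essential extension is formed on the larger type \<open>'x set\<close>, where
  every further essential extension could be realized. By the cardinality bound it has at most |'x|
  elements in each degree and can be brought back to \<open>'x\<close>; having only trivial
  essential extensions, it is injective.\<close>

lemma hull_exists:
 fixes N :: "('r, 'n) gmod"
 assumes N: "gmodule R N"
  and X: "|UNIV :: (int \<times> 'r) set| \<le>o |UNIV :: 'x set|" and NX: "!!n. |elts N n| \<le>o |UNIV :: 'x set|"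
 obtains E :: "('r, 'x) gmod" and \<eta> where "injective_gmod R E" "gmod_mono R N E \<eta>" "essential R (gmod_image N \<eta>) E"
proof -
 interpret N: graded_mod R N by (rule gmodI[OF N])
 have "ALL n. \<exists>j :: 'n => 'x. inj_on j (elts N n)" using card_leE[OF NX] by metis
 then obtain j :: "int => 'n => 'x" where j: "!!n. inj_on (j n) (elts N n)" by metis
 define g where "g n x = {j n x}" for n x
 have gi: "inj_on (g n) (elts N n)" for n using j[of n] by (auto simp: inj_on_def g_def)
 let ?N = "gimg N g"
 note tN = transport_mod[OF N, of g, OF gi]
 obtain E where E: "gmodule R E" "gext R ?N E" "essential R (elts ?N) E"
  "!!F. gmodule R F ==> gext R E F ==> essential R (elts E) F ==> elts F = elts E"
  by (rule maximal_essential_extension[OF tN(1)]) blast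
 have EX: "|elts E n| \<le>o |UNIV :: 'x set|" for n
 proof (rule essential_bound[OF E(1,3) X])
  show "|elts ?N n| \<le>o |UNIV :: 'x set|" for n unfolding tN(4) by (rule ordLeq_transitive[OF card_of_image NX])
 qed
 have "ALL n. \<exists>t :: 'x set => 'x. inj_on t (elts E n)" using card_leE[OF EX] by metis
 then obtain t :: "int => 'x set => 'x" where ti: "!!n. inj_on (t n) (elts E n)" by metis
 let ?E = "gimg E t"
 note tE = transport_mod[OF E(1), of t, OF ti]
 have tm: "gmod_mono R E ?E t" using tE(2) ti by (simp add: gmod_mono_def)
 have "gmod_image E t = elts ?E" by (rule ext) (simp add: gmod_image_def tE(4))
 hence te: "essential R (gmod_image E t) ?E" using essential_whole[OF tE(1)] by simp
 have inj: "injective_gmod R ?E"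
 proof (rule no_extension_injective[OF tE(1)])
  fix Q :: "('r, 'x \<times> ('r + 'x)) gmod" and q n
  assume Q: "gmodule R Q" and q: "gmod_mono R ?E Q q" and qe: "essential R (gmod_image ?E q) Q"
  have m: "gmod_mono R E Q (%n x. q n (t n x))" by (rule mono_comp[OF tm q])
  have "gmod_image E (%n x. q n (t n x)) = gmod_image ?E q" by (rule ext) (simp add: gmod_image_def tE(4) image_image)
  hence "(%x. q n (t n x)) ` elts E n = elts Q n" using maximal_extension_surj[OF E(1) Q X EX E(4) m] qe by simp
  thus "q n ` elts ?E n = elts Q n" by (simp add: tE(4) image_image)
 qed
 have gm: "gmod_mono R N ?N g" using tN(2) gi by (simp add: gmod_mono_def)
 have Nm: "gmod_mono R N ?E (%n x. t n (g n x))" by (rule mono_comp[OF mono_comp[OF gm gext_submodule(2)[OF tN(1) E(1,2)]] tm])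
 show ?thesis
 proof (rule that[OF inj Nm])
  show "essential R (gmod_image N (%n x. t n (g n x))) ?E"
  proof (rule essential_image_trans[OF E(1) tE(1) tE(1) E(3) tm te])
   show "t n ` elts ?N n <= gmod_image N (%n x. t n (g n x)) n" for n by (auto simp: gmod_image_def tN(4))
   show "gsub R (gmod_image N (%n x. t n (g n x))) ?E" using image_submodule[OF N tE(1)] Nm by (simp add: gmod_mono_def)
  qed
 qed
qed

text \<open>F is a hull of E/P. The quotient uses representatives in E, so it is small enough for a
  hull on the same type.\<close>

lemma resolution_step:
 fixes E :: "('r, 'x) gmod"
 assumes E: "gmodule R E" and P: "gsub R P E"
  and X: "|UNIV :: (int \<times> 'r) set| \<le>o |UNIV :: 'x set|"
 obtains F :: "('r, 'x) gmod" and dl where "injective_gmod R F" "gmod_hom R E F dl"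
  "gmod_kernel E F dl = P" "essential R (gmod_image E dl) F"
proof -
 interpret E: graded_mod R E by (rule gmodI[OF E])
 obtain Q :: "('r, 'x) gmod" and q where Q: "gmodule R Q" and q: "gmod_hom R E Q q"
  and Qel: "!!n. elts Q n = q n ` elts E n"
  and q0: "!!n x. x \<in> elts E n ==> q n x = \<zero>[Q,n] \<longleftrightarrow> x \<in> P n" by (rule quotient_mod[OF E P]) blast
 have "|elts Q n| \<le>o |UNIV :: 'x set|" for n by (rule card_of_mono1) simp
 then obtain F :: "('r, 'x) gmod" and \<eta> where F: "injective_gmod R F" "gmod_mono R Q F \<eta>" "essential R (gmod_image Q \<eta>) F"
  using hull_exists[OF Q X] by blast
 have FM: "gmodule R F" by (rule injective_module[OF F(1)])
 have \<eta>: "gmod_hom R Q F \<eta>" "!!n. inj_on (\<eta> n) (elts Q n)" using F(2) by (auto simp: gmod_mono_def)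
 have k: "\<eta> n u = \<zero>[F,n] \<longleftrightarrow> u = \<zero>[Q,n]" if "u \<in> elts Q n" for n u
  using inj_on_iff_kernel[OF Q FM \<eta>(1)] \<eta>(2) that hom_zero[OF Q FM \<eta>(1)] by blast
 show ?thesis
 proof (rule that[OF F(1) hom_comp[OF q \<eta>(1)]])
  show "gmod_kernel E F (%n x. \<eta> n (q n x)) = P"
   using k[OF hom_closed[OF q]] q0 E.sub_elts[OF P] unfolding gmod_kernel_def by (intro ext) auto
  have "gmod_image E (%n x. \<eta> n (q n x)) = gmod_image Q \<eta>" by (rule ext) (simp add: gmod_image_def Qel image_image)
  thus "essential R (gmod_image E (%n x. \<eta> n (q n x))) F" using F(3) by simp
 qed
qed

text \<open>Indicator functions embed the pairs of degrees and scalars, constant functions embed the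
  elements of the module.\<close>

lemma hull_elt_large:
 "|UNIV :: (int \<times> 'r) set| \<le>o |UNIV :: ('r, 'm) hull_elt set|" "|A :: 'm set| \<le>o |UNIV :: ('r, 'm) hull_elt set|"
proof -
 let ?f = "%(a :: int \<times> 'r) b. (if a = b then 1 else 0 :: int, undefined :: 'm)"
 have "a = a'" if "?f a = ?f a'" for a a' :: "int \<times> 'r" using fun_cong[OF that, of a] by (simp split: if_splits)
 hence "inj ?f" by (rule injI)
 thus "|UNIV :: (int \<times> 'r) set| \<le>o |UNIV :: ('r, 'm) hull_elt set|" by (rule card_leI) simp
 let ?g = "%x (b :: int \<times> 'r). (0 :: int, x :: 'm)"
 have "x = x'" if "?g x = ?g x'" for x x' using fun_cong[OF that] by simp
 hence "inj_on ?g A" by (auto intro: inj_onI)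
 thus "|A| \<le>o |UNIV :: ('r, 'm) hull_elt set|" by (rule card_leI) simp
qed

text \<open>The iteration carries pairs (E, P) with P essential in E: P is the image of the
  preceding map and becomes the kernel of the next one.\<close>

lemma minimal_injective_resolution_exists:
 fixes M :: "('r, 'm) gmod"
 assumes M: "gmodule R M"
 obtains I :: "nat => ('r, ('r, 'm) hull_elt) gmod" and \<eta> dl where "minimal_injective_resolution R M I \<eta> dl"
proof -
 obtain I0 :: "('r, ('r, 'm) hull_elt) gmod" and \<eta> where I0: "injective_gmod R I0" "gmod_mono R M I0 \<eta>"
  "essential R (gmod_image M \<eta>) I0" by (rule hull_exists[OF M hull_elt_large])
 let ?inv = "%(E, P). injective_gmod R E \<and> essential R P E"
 let ?step = "%(E, P) (F, P'). EX dl. gmod_hom R E F dl \<and> gmod_kernel E F dl = P \<and> P' = gmod_image E dl"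
 have ex: "\<exists>t :: ('r, ('r, 'm) hull_elt) gmod \<times> (int => ('r, 'm) hull_elt set). ?inv t \<and> ?step s t" if "?inv s" for s :: "('r, ('r, 'm) hull_elt) gmod \<times> (int => ('r, 'm) hull_elt set)"
 proof -
  obtain E P where s: "s = (E, P)" by (cases s)
  have E: "injective_gmod R E" and P: "gsub R P E" using that s by (auto simp: essential_def)
  obtain F :: "('r, ('r, 'm) hull_elt) gmod" and dl where F: "injective_gmod R F" "gmod_hom R E F dl"
   "gmod_kernel E F dl = P" "essential R (gmod_image E dl) F"
   by (rule resolution_step[OF injective_module[OF E] P hull_elt_large(1)])
  have "?inv (F, gmod_image E dl) \<and> ?step s (F, gmod_image E dl)" unfolding s using F by auto
  thus ?thesis by - (rule exI[where x = "(F, gmod_image E dl)"])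
 qed
 define nx :: "('r, ('r, 'm) hull_elt) gmod \<times> (int => ('r, 'm) hull_elt set) =>
   ('r, ('r, 'm) hull_elt) gmod \<times> (int => ('r, 'm) hull_elt set)"
  where "nx s = (SOME t. ?inv t \<and> ?step s t)" for s
 have nx: "?inv (nx s) \<and> ?step s (nx s)" if "?inv s" for s :: "('r, ('r, 'm) hull_elt) gmod \<times> (int => ('r, 'm) hull_elt set)"
  unfolding nx_def by (rule someI_ex[OF ex[OF that]])
 define s where "s k = (nx ^^ k) (I0, gmod_image M \<eta>)" for k
 have sinv: "?inv (s k)" for k
 proof (induction k)
  case 0 show ?case using I0 by (simp add: s_def)
 next
  case (Suc k) thus ?case using nx[of "s k"] by (simp add: s_def)
 qed
 have sstep: "?step (s k) (s (Suc k))" for k using nx[OF sinv[of k]] by (simp add: s_def)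
 have s0: "s 0 = (I0, gmod_image M \<eta>)" by (simp add: s_def)
 define I where "I k = fst (s k)" for k
 define P where "P k = snd (s k)" for k
 have IP: "s k = (I k, P k)" for k by (simp add: I_def P_def)
 have "ALL k. EX dl. gmod_hom R (I k) (I (Suc k)) dl \<and> gmod_kernel (I k) (I (Suc k)) dl = P k \<and> P (Suc k) = gmod_image (I k) dl"
  using sstep unfolding IP by simp
 then obtain dl where dl: "!!k. gmod_hom R (I k) (I (Suc k)) (dl k)"
  "!!k. gmod_kernel (I k) (I (Suc k)) (dl k) = P k" "!!k. P (Suc k) = gmod_image (I k) (dl k)" by metis
 have I: "injective_gmod R (I k)" "essential R (P k) (I k)" for k using sinv[of k] unfolding IP by auto
 have "I 0 = I0" "P 0 = gmod_image M \<eta>" using s0 unfolding IP by auto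
 hence "minimal_injective_resolution R M I \<eta> dl"
  unfolding minimal_injective_resolution_def dl(2) using I I0 dl by auto
 thus ?thesis by (rule that)
qed

end

section \<open>The support of a finitely generated module\<close>

text \<open>This is Hom(R/J, M), an element being the image of 1.\<close>

definition ann_sub ::
  "('r, 'm) gmod => (int => 'r set) => int => 'm set" where
 "ann_sub M J n = {x \<in> elts M n. ALL i. \<forall>r\<in>J i. act M i n r x = \<zero>[M,i + n]}"

definition sum_sub ::
  "('r, 'm) gmod => (int => 'm set) => (int => 'm set) => int => 'm set" where
 "sum_sub M P Q n = {x \<oplus>[M,n] y | x y. x \<in> P n \<and> y \<in> Q n}"

context graded_mod
begin

lemma ann_submodule:
 assumes J: "gideal R J"
 shows "gsub R (ann_sub M J) M"
proof (rule submoduleI)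
 show "\<zero>[M,n] \<in> ann_sub M J n" for n using gideal_sub[OF J] by (auto simp: ann_sub_def act_zero[OF _ refl])
next
 fix n x y assume xy: "x \<in> ann_sub M J n" "y \<in> ann_sub M J n"
 hence c: "x \<in> elts M n" "y \<in> elts M n" by (auto simp: ann_sub_def)
 have "act M i n r (x \<oplus>[M,n] y) = \<zero>[M,i + n]" if "r \<in> J i" for i r
  using act_add[OF gideal_sub[OF J that] c refl] xy that by (simp add: ann_sub_def)
 thus "x \<oplus>[M,n] y \<in> ann_sub M J n" using c by (simp add: ann_sub_def)
next
 fix i j s x assume s: "s \<in> deg R i" and x: "x \<in> ann_sub M J j"
 hence c: "x \<in> elts M j" by (auto simp: ann_sub_def)
 have "act M k (i + j) r (act M i j s x) = \<zero>[M,k + (i + j)]" if r: "r \<in> J k" for k r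
 proof -
  obtain s' where s': "s' \<in> deg R i" "act M k (i + j) r (act M i j s x) = act M i (k + j) s' (act M k j r x)"
   using act_swap[OF gideal_sub[OF J r] s] c by metis
  thus ?thesis using x r act_zero[OF s'(1), of "k + (i + j)" "k + j"] by (simp add: ann_sub_def)
 qed
 thus "act M i j s x \<in> ann_sub M J (i + j)" using act_closed[OF s c refl] by (simp add: ann_sub_def)
qed (simp add: ann_sub_def)

lemma sum_submodule:
 assumes P: "gsub R P M" and Q: "gsub R Q M"
 shows "gsub R (sum_sub M P Q) M"
proof (rule submoduleI)
 show "x \<in> elts M n" if "x \<in> sum_sub M P Q n" for n x using that sub_elts[OF P] sub_elts[OF Q] by (auto simp: sum_sub_def)
 have "\<zero>[M,n] = \<zero>[M,n] \<oplus>[M,n] \<zero>[M,n]" for n by simp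
 thus "\<zero>[M,n] \<in> sum_sub M P Q n" for n using sub_zero[OF P, of n] sub_zero[OF Q, of n] unfolding sum_sub_def by blast
next
 fix n u v assume "u \<in> sum_sub M P Q n" "v \<in> sum_sub M P Q n"
 then obtain x y x' y' where *: "u = x \<oplus>[M,n] y" "v = x' \<oplus>[M,n] y'" "x \<in> P n" "x' \<in> P n"
  "y \<in> Q n" "y' \<in> Q n" unfolding sum_sub_def by blast
 have "x \<in> elts M n" "x' \<in> elts M n" "y \<in> elts M n" "y' \<in> elts M n" using * sub_elts[OF P] sub_elts[OF Q] by auto
 hence "u \<oplus>[M,n] v = (x \<oplus>[M,n] x') \<oplus>[M,n] (y \<oplus>[M,n] y')" unfolding * by (simp add: G.a_ac)
 thus "u \<oplus>[M,n] v \<in> sum_sub M P Q n" unfolding sum_sub_def using sub_add[OF P *(3,4)] sub_add[OF Q *(5,6)] by blast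
next
 fix i j r u assume r: "r \<in> deg R i" and "u \<in> sum_sub M P Q j"
 then obtain x y where *: "u = x \<oplus>[M,j] y" "x \<in> P j" "y \<in> Q j" unfolding sum_sub_def by blast
 show "act M i j r u \<in> sum_sub M P Q (i + j)" unfolding *(1) act_add[OF r sub_elts[OF P *(2)] sub_elts[OF Q *(3)] refl] sum_sub_def
  using sub_act[OF P r *(2) refl] sub_act[OF Q r *(3) refl] by blast
qed

lemma sum_sub_incl:
 assumes P: "gsub R P M" and Q: "gsub R Q M"
 shows "P n <= sum_sub M P Q n" "Q n <= sum_sub M P Q n"
proof -
 have "x = x \<oplus>[M,n] \<zero>[M,n]" if "x \<in> P n" for x using sub_elts[OF P that] by simp
 thus "P n <= sum_sub M P Q n" using sub_zero[OF Q, of n] unfolding sum_sub_def by blast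
 have "x = \<zero>[M,n] \<oplus>[M,n] x" if "x \<in> Q n" for x using sub_elts[OF Q that] by simp
 thus "Q n <= sum_sub M P Q n" using sub_zero[OF P, of n] unfolding sum_sub_def by blast
qed

lemma act_swap':
 assumes r: "r \<in> deg R i" and a: "a \<in> deg R d" and x: "x \<in> elts M k"
 obtains r' where "r' \<in> deg R i" "r' = r \<or> r' = \<ominus> r"
  "act M i (d + k) r (act M d k a x) = act M d (i + k) a (act M i k r' x)"
proof -
 obtain s where s: "s \<in> deg R i" "s = r \<or> s = \<ominus> r"
  "act M d (i + k) a (act M i k r x) = act M i (d + k) s (act M d k a x)" using act_swap[OF a r] x by metis
 have rx: "act M i k r x \<in> elts M (i + k)" and ax: "act M d k a x \<in> elts M (d + k)"
  using act_closed[OF r x refl] act_closed[OF a x refl] .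
 show ?thesis using s(2)
 proof
  assume "s = r" thus ?thesis using that[OF r] s(3) by simp
 next
  assume sr: "s = \<ominus> r"
  have "act M d (i + k) a (act M i k (\<ominus> r) x) = \<ominus>[M,d + (i + k)] act M d (i + k) a (act M i k r x)"
   using act_neg_left[OF r x refl] act_neg[OF a rx refl] by simp
  also have "... = \<ominus>[M,d + (i + k)] (\<ominus>[M,d + (i + k)] act M i (d + k) r (act M d k a x))"
   using s(3) sr act_neg_left[OF r ax, of "d + (i + k)"] by simp
  also have "... = act M i (d + k) r (act M d k a x)" using act_closed[OF r ax, of "d + (i + k)"] by simp
  finally show ?thesis using that[of "\<ominus> r"] deg_neg[OF r] by simp
 qed
qed

lemma act_sum_zero:
 assumes "j \<in> deg R n" "r \<in> deg R (n - d)" "a \<in> deg R d" "x \<in> elts M k"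
  "act M n k j x = \<zero>[M,n + k]" "act M d k a x = \<zero>[M,d + k]"
 shows "act M n k (j \<oplus> r \<otimes> a) x = \<zero>[M,n + k]"
proof -
 have ra: "r \<otimes> a \<in> deg R n" by (rule mult_deg'[OF assms(2,3)]) simp
 have "act M n k (r \<otimes> a) x = act M (n - d) (d + k) r (act M d k a x)" by (rule act_act[OF assms(2-4), symmetric]) auto
 also have "... = \<zero>[M,n + k]" unfolding assms(6) by (rule act_zero[OF assms(2)]) simp
 finally show ?thesis using act_add_left[OF assms(1) ra assms(4) refl] assms(5) by simp
qed

text \<open>With \<open>ann_sub_colon\<close> this describes the left exact sequence 0 -> Hom(R/(J +
  Ra), M) -> Hom(R/J, M) -> Hom(R/(J : a), M), in which the last map is multiplication by a.\<close>

lemma ann_sub_add: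
 assumes J: "gideal R J" and a: "a \<in> deg R d"
 shows "x \<in> ann_sub M (gadd R J d a) n \<longleftrightarrow> x \<in> ann_sub M J n \<and> act M d n a x = \<zero>[M,d + n]"
proof
 show "x \<in> ann_sub M J n \<and> act M d n a x = \<zero>[M,d + n]" if "x \<in> ann_sub M (gadd R J d a) n"
  using that gadd_incl[OF J a] unfolding ann_sub_def by blast
 assume x: "x \<in> ann_sub M J n \<and> act M d n a x = \<zero>[M,d + n]"
 have xe: "x \<in> elts M n" using x by (simp add: ann_sub_def)
 have "act M i n s x = \<zero>[M,i + n]" if s: "s \<in> gadd R J d a i" for i s
 using s x act_sum_zero gideal_sub J a xe by (auto simp: gadd_def ann_sub_def)
 thus "x \<in> ann_sub M (gadd R J d a) n" using xe by (simp add: ann_sub_def)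
qed

lemma ann_sub_colon:
 assumes J: "gideal R J" and a: "a \<in> deg R d" and x: "x \<in> ann_sub M J n"
 shows "act M d n a x \<in> ann_sub M (gcol R J d a) (d + n)"
proof -
 have xe: "x \<in> elts M n" using x by (simp add: ann_sub_def)
 have "act M i (d + n) r (act M d n a x) = \<zero>[M,i + (d + n)]" if "r \<in> gcol R J d a i" for i r
 proof -
  have r: "r \<in> deg R i" "r \<otimes> a \<in> J (i + d)" using that by (auto simp: gcol_def)
  have "act M i (d + n) r (act M d n a x) = act M (i + d) n (r \<otimes> a) x" by (rule act_act[OF r(1) a xe refl refl])
  thus ?thesis using x r(2) by (simp add: ann_sub_def add.assoc)
 qed
 thus ?thesis using act_closed[OF a xe refl] by (simp add: ann_sub_def)
qed

end

lemma fg_over_image: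
 assumes R: "graded_commutative_ring R" and M: "gmodule R M" and N: "gmodule R N"
  and f: "gmod_hom R M N f" and fg: "fg_over R M Q P"
  and Q: "gsub R Q M" and P': "gsub R P' N" and PP: "!!n. f n ` P n <= P' n"
  and PQ: "!!n. P n <= Q n"
 shows "fg_over R N (%n. f n ` Q n) P'"
proof -
 interpret graded_commutative_ring R by (rule R)
 interpret M: graded_mod R M by (rule gmodI[OF M])
 obtain S where S: "finite S" "\<forall>(d, m)\<in>S. m \<in> Q d"
  "!!N. gsub R N M ==> ALL n. P n <= N n ==> \<forall>(d, m)\<in>S. m \<in> N d ==> ALL n. Q n <= N n"
  by (rule fg_overE[OF fg], rule that; assumption)
 show ?thesis unfolding fg_over_def
 proof (intro exI[of _ "(%(d, m). (d, f d m)) ` S"] conjI allI impI)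
  show "finite ((%(d, m). (d, f d m)) ` S)" using S by simp
  show "\<forall>(d, m)\<in>(%(d, m). (d, f d m)) ` S. m \<in> f d ` Q d" using S(2) by auto
  fix K n assume K: "gsub R K N \<and> (ALL n. P' n <= K n) \<and> (\<forall>(d, m)\<in>(%(d, m). (d, f d m)) ` S. m \<in> K d)"
  let ?K = "%n. {x \<in> elts M n. f n x \<in> K n}"
  have "ALL n. Q n <= ?K n"
  proof (rule S(3))
   show "gsub R ?K M" by (rule hom_preimage_submodule[OF M N f]) (use K in blast)
   show "ALL n. P n <= ?K n" using CollectI M.sub_elts Q PQ PP K by fast
   show "\<forall>(d, m)\<in>S. m \<in> ?K d" using S(2) M.sub_elts Q image_eqI K by auto
  qed
  thus "f n ` Q n <= K n" by blast
 qed
qed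

section \<open>The cohomology of Hom(R/J, I) for a minimal injective resolution I\<close>

locale injective_resolution = noetherian_graded_ring R
 for R :: "('r, 'z) gring_scheme" (structure) +
 fixes M :: "('r, 'm) gmod" and I :: "nat => ('r, 'e) gmod" and \<eta> :: "int => 'm => 'e"
  and dl :: "nat => int => 'e => 'e"
 assumes module: "gmodule R M" and resolution: "minimal_injective_resolution R M I \<eta> dl"
begin

lemma I_injective: "injective_gmod R (I k)"
 using resolution by (simp add: minimal_injective_resolution_def)

lemma I_module: "gmodule R (I k)"
 by (rule injective_module[OF I_injective])

sublocale M: noetherian_graded_mod R M by (rule noetherian_graded_modI[OF module])

sublocale I: noetherian_graded_mod R "I k" for k by (rule noetherian_graded_modI[OF I_module])

lemma \<eta>_hom: "gmod_hom R M (I 0) \<eta>" and \<eta>_inj: "inj_on (\<eta> n) (elts M n)"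
 using resolution by (auto simp: minimal_injective_resolution_def gmod_mono_def)

lemma dl_hom: "gmod_hom R (I k) (I (Suc k)) (dl k)"
 using resolution by (simp add: minimal_injective_resolution_def)

lemma exact0: "x \<in> elts (I 0) n ==> dl 0 n x = \<zero>[I (Suc 0),n] \<longleftrightarrow> x \<in> \<eta> n ` elts M n"
proof -
 assume x: "x \<in> elts (I 0) n"
 have "gmod_image M \<eta> n = gmod_kernel (I 0) (I (Suc 0)) (dl 0) n"
  using resolution by (simp add: minimal_injective_resolution_def)
 thus ?thesis using x by (auto simp: gmod_image_def gmod_kernel_def)
qed

lemma exact: "x \<in> elts (I (Suc k)) n ==>
  dl (Suc k) n x = \<zero>[I (Suc (Suc k)),n] \<longleftrightarrow> x \<in> dl k n ` elts (I k) n"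
proof -
 assume x: "x \<in> elts (I (Suc k)) n"
 have "gmod_image (I k) (dl k) n = gmod_kernel (I (Suc k)) (I (Suc (Suc k))) (dl (Suc k)) n"
  using resolution by (simp add: minimal_injective_resolution_def)
 thus ?thesis using x by (auto simp: gmod_image_def gmod_kernel_def)
qed

lemma kernel_essential: "essential R (gmod_kernel (I k) (I (Suc k)) (dl k)) (I k)"
 using resolution by (simp add: minimal_injective_resolution_def)

lemmas dl_closed = hom_closed[OF dl_hom]
lemmas dl_add = hom_add[OF dl_hom]
lemmas dl_act = hom_act[OF dl_hom]
lemmas dl_zero = hom_zero[OF I_module I_module dl_hom]
lemmas dl_minus = hom_minus[OF I_module I_module dl_hom]

lemma dl_dl: "x \<in> elts (I k) n ==> dl (Suc k) n (dl k n x) = \<zero>[I (Suc (Suc k)),n]"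
 using exact[OF dl_closed] by blast

text \<open>Vanishing at \<open>p\<close> is inherited from the kernels, because they are essential.\<close>

lemma torsion_resolution:
 assumes p: "p \<in> Spec R" and tor: "!!n x. x \<in> elts M n ==> tors R M p (null_sub M) n x"
  and x: "x \<in> elts (I k) n"
 shows "tors R (I k) p (null_sub (I k)) n x" using x
proof (induction k arbitrary: n x)
 case 0
 show ?case
 proof (rule essential_torsion[OF I_module kernel_essential p _ 0])
  fix n x assume x: "x \<in> gmod_kernel (I 0) (I (Suc 0)) (dl 0) n"
  then obtain m where m: "m \<in> elts M n" "x = \<eta> n m" using exact0 by (auto simp: gmod_kernel_def)
  obtain i s where s: "s \<in> deg R i" "s \<notin> p" "act M i n s m = \<zero>[M,i + n]"
   using tor[OF m(1)] unfolding tors_def null_sub_def by blast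
  have "act (I 0) i n s x = \<zero>[I 0,i + n]"
   using hom_act[OF \<eta>_hom s(1) m(1) refl] s(3) m(2) hom_zero[OF module I_module \<eta>_hom] by simp
  thus "tors R (I 0) p (null_sub (I 0)) n x" using s(1,2) unfolding tors_def null_sub_def by blast
 qed
next
 case (Suc k)
 show ?case
 proof (rule essential_torsion[OF I_module kernel_essential p _ Suc.prems])
  fix n x assume "x \<in> gmod_kernel (I (Suc k)) (I (Suc (Suc k))) (dl (Suc k)) n"
  then obtain m where m: "m \<in> elts (I k) n" "x = dl k n m" using exact by (auto simp: gmod_kernel_def)
  obtain i s where s: "s \<in> deg R i" "s \<notin> p" "act (I k) i n s m = \<zero>[I k,i + n]"
   using Suc.IH[OF m(1)] unfolding tors_def null_sub_def by blast
  have "act (I (Suc k)) i n s x = \<zero>[I (Suc k),i + n]" using dl_act[OF s(1) m(1) refl] s(3) m(2) dl_zero by simp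
  thus "tors R (I (Suc k)) p (null_sub (I (Suc k))) n x" using s(1,2) unfolding tors_def null_sub_def by blast
 qed
qed

text \<open>Cycles and boundaries of the complex \<open>Hom(R/J, I)\<close>, whose terms are the submodules
 of elements annihilated by \<open>J\<close>; its cohomology is \<open>Ext(R/J, M)\<close>.\<close>

definition cyc :: "nat => (int => 'r set) => int => 'e set" where
 "cyc k J n = {x \<in> ann_sub (I k) J n. dl k n x = \<zero>[I (Suc k),n]}"

definition bd :: "nat => (int => 'r set) => int => 'e set" where
 "bd k J n = (case k of 0 => null_sub (I 0) n | Suc l => dl l n ` ann_sub (I l) J n)"

lemma ann_elts: "x \<in> ann_sub (I k) J n ==> x \<in> elts (I k) n"
 by (simp add: ann_sub_def)

lemma ann_act: "x \<in> ann_sub (I k) J n ==> r \<in> J i ==> act (I k) i n r x = \<zero>[I k,i + n]"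
 by (simp add: ann_sub_def)

lemma dl_ann:
 assumes J: "gideal R J" and x: "x \<in> ann_sub (I k) J n"
 shows "dl k n x \<in> ann_sub (I (Suc k)) J n"
proof -
 have "act (I (Suc k)) i n r (dl k n x) = \<zero>[I (Suc k),i + n]" if "r \<in> J i" for i r
  using dl_act[OF gideal_sub[OF J that] ann_elts[OF x] refl] ann_act[OF x that] dl_zero by simp
 thus ?thesis using dl_closed[OF ann_elts[OF x]] by (simp add: ann_sub_def)
qed

lemma cyc_submodule: assumes J: "gideal R J" shows "gsub R (cyc k J) (I k)"
proof -
 have "cyc k J = (%n. ann_sub (I k) J n \<inter> gmod_kernel (I k) (I (Suc k)) (dl k) n)"
  by (rule ext) (auto simp: cyc_def gmod_kernel_def ann_sub_def)
 thus ?thesis using I.sub_Int[OF I.ann_submodule[OF J] kernel_submodule[OF I_module I_module dl_hom]] by simp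
qed

lemma bd_submodule: assumes J: "gideal R J" shows "gsub R (bd k J) (I k)"
proof (cases k)
 case 0
 have "bd 0 J = null_sub (I 0)" by (rule ext) (simp add: bd_def)
 thus ?thesis using I.sub_null 0 by simp
next
 case (Suc l)
 have "bd (Suc l) J = (%n. dl l n ` ann_sub (I l) J n)" by (rule ext) (simp add: bd_def)
 thus ?thesis using hom_image_submodule[OF I_module I_module dl_hom I.ann_submodule[OF J]] Suc by simp
qed

lemma bd_cyc: assumes J: "gideal R J" shows "bd k J n <= cyc k J n"
proof (cases k)
 case 0
 thus ?thesis using I.sub_zero[OF I.ann_submodule[OF J]] dl_zero by (auto simp: bd_def cyc_def null_sub_def)
next
 case (Suc l)
 thus ?thesis using dl_ann[OF J] dl_dl[OF ann_elts] by (auto simp: bd_def cyc_def)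
qed

lemma bd_mono: "(!!n. J n <= J' n) ==> bd k J' n <= bd k J n"
 by (cases k) (fastforce simp: bd_def ann_sub_def)+

text \<open>Injectivity of the terms makes multiplication by a surjective from Hom(R/J, I) onto
  Hom(R/(J : a), I). \<open>bd_divide\<close> is the consequence for boundaries.\<close>

lemma ann_divide:
 assumes J: "gideal R J" and a: "a \<in> deg R d" and y: "y \<in> ann_sub (I k) (gcol R J d a) (d + m)"
 obtains z where "z \<in> ann_sub (I k) J m" "act (I k) d m a z = y"
proof -
 obtain z where z: "z \<in> elts (I k) (d + m - d)" "act (I k) d (d + m - d) a z = y"
  "!!n r. r \<in> J n ==> act (I k) n (d + m - d) r z = \<zero>[I k,n + (d + m - d)]"
  by (rule injective_divisible[OF I_injective J a ann_elts[OF y]], rule ann_act[OF y], assumption, rule that, assumption+)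
 thus ?thesis using that[of z] by (simp add: ann_sub_def)
qed

lemma bd_divide:
 assumes J: "gideal R J" and a: "a \<in> deg R d" and y: "y \<in> bd k (gcol R J d a) (d + m)"
 obtains z where "z \<in> bd k J m" "act (I k) d m a z = y"
proof (cases k)
 case 0
 thus ?thesis using that[of "\<zero>[I 0,m]"] y I.act_zero[OF a, of "d + m" m] by (simp add: bd_def null_sub_def)
next
 case (Suc l)
 then obtain w where w: "w \<in> ann_sub (I l) (gcol R J d a) (d + m)" "y = dl l (d + m) w" using y by (auto simp: bd_def)
 obtain z where z: "z \<in> ann_sub (I l) J m" "act (I l) d m a z = w" by (rule ann_divide[OF J a w(1)])
 have "act (I k) d m a (dl l m z) = y" using dl_act[OF a ann_elts[OF z(1)] refl] z(2) w(2) Suc by simp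
 thus ?thesis using that[of "dl l m z"] z(1) Suc by (simp add: bd_def)
qed

text \<open>As the terms are injective, Hom(J, I) is I modulo the elements annihilated by J;
  \<open>rel_cyc\<close> consists of the representatives of its cycles.\<close>

definition rel_cyc :: "nat => (int => 'r set) => int => 'e set" where
 "rel_cyc k J n = {x \<in> elts (I k) n. dl k n x \<in> ann_sub (I (Suc k)) J n}"

definition rel_bd :: "nat => (int => 'r set) => int => 'e set" where
 "rel_bd k J = sum_sub (I k) (bd k (%n. {\<zero>})) (ann_sub (I k) J)"

lemma rel_cyc_submodule: "gideal R J ==> gsub R (rel_cyc k J) (I k)"
 using hom_preimage_submodule[OF I_module I_module dl_hom I.ann_submodule] unfolding rel_cyc_def .

lemma rel_bd_submodule: "gideal R J ==> gsub R (rel_bd k J) (I k)"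
 unfolding rel_bd_def by (intro I.sum_submodule bd_submodule gideal_null I.ann_submodule)

lemma rel_bd_incl:
 assumes "gideal R J"
 shows "bd k (%n. {\<zero>}) n <= rel_bd k J n" "ann_sub (I k) J n <= rel_bd k J n"
 unfolding rel_bd_def using I.sum_sub_incl[OF bd_submodule[OF gideal_null] I.ann_submodule[OF assms]] by blast+

text \<open>\<open>rel_cyc\<close> modulo \<open>rel_bd\<close> is the cohomology \<open>Ext(J, M)\<close> of \<open>I\<close> modulo the elements
 annihilated by \<open>J\<close>.  The ideal is built up by adding one generator \<open>a\<close> at a time; then
 \<open>(J + Ra)/J\<close> is a shift of \<open>R/(J : a)\<close>.\<close>

lemma rel_fg_step:
 assumes F: "fg_over R (I k) (cyc k (gcol R J d a)) (bd k (gcol R J d a))"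
  and J: "gideal R J" and a: "a \<in> deg R d" and fg: "fg_over R (I k) (rel_cyc k J) (rel_bd k J)"
 shows "fg_over R (I k) (rel_cyc k (gadd R J d a)) (rel_bd k (gadd R J d a))"
proof -
 let ?J = "gadd R J d a" and ?C = "gcol R J d a"
 have J': "gideal R ?J" by (rule gideal_gadd[OF J a])
 have C: "gideal R ?C" by (rule gideal_gcol[OF J a])
 note W' = rel_cyc_submodule[OF J'] and W = rel_cyc_submodule[OF J]
  and P' = rel_bd_submodule[OF J'] and P = rel_bd_submodule[OF J]
 have annJ: "ann_sub (I l) ?J n <= ann_sub (I l) J n" for l n using I.ann_sub_add[OF J a] by blast
 have "fg_over R (I k) (rel_cyc k ?J) (%n. rel_cyc k ?J n \<inter> rel_bd k J n)"
  by (rule I.fg_over_sub[OF fg P W W']) (use annJ in \<open>auto simp: rel_cyc_def\<close>)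
 moreover have "fg_over R (I k) (%n. rel_cyc k ?J n \<inter> rel_bd k J n) (rel_bd k ?J)"
 proof -
  obtain S where S: "finite S" "\<forall>(n, t)\<in>S. t \<in> cyc k ?C n"
   "!!N. gsub R N (I k) ==> ALL n. bd k ?C n <= N n ==> \<forall>(n, t)\<in>S. t \<in> N n ==> ALL n. cyc k ?C n <= N n"
   by (rule fg_overE[OF F], rule that; assumption)
  \<comment> \<open>Each generator of the cycles for (J : a) is a multiple a t with t annihilated by
    J; these t are the new generators, in degrees lowered by d.\<close>
  have "\<forall>z\<in>S. EX t'. t' \<in> ann_sub (I k) J (fst z - d) \<and> act (I k) d (fst z - d) a t' = snd z"
  proof
   fix z assume "z \<in> S"
   hence "snd z \<in> ann_sub (I k) ?C (d + (fst z - d))" using S(2) by (auto simp: cyc_def)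
   thus "EX t'. t' \<in> ann_sub (I k) J (fst z - d) \<and> act (I k) d (fst z - d) a t' = snd z" by (rule ann_divide[OF J a]) blast
  qed
  then obtain t where t: "!!z. z \<in> S ==> t z \<in> ann_sub (I k) J (fst z - d)"
   "!!z. z \<in> S ==> act (I k) d (fst z - d) a (t z) = snd z" by metis
  show ?thesis unfolding fg_over_def
  proof (intro exI[of _ "(%z. (fst z - d, t z)) ` S"] conjI allI impI)
   show "finite ((%z. (fst z - d, t z)) ` S)" using S by simp
   show "\<forall>(n, x)\<in>(%z. (fst z - d, t z)) ` S. x \<in> rel_cyc k ?J n \<inter> rel_bd k J n"
   proof (clarsimp, intro conjI)
    fix n y assume ny: "(n, y) \<in> S"
    have tz: "t (n, y) \<in> ann_sub (I k) J (n - d)" "act (I k) d (n - d) a (t (n, y)) = y" using t[OF ny] by auto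
    thus "t (n, y) \<in> rel_bd k J (n - d)" using rel_bd_incl(2)[OF J] by blast
    have "dl k n y = \<zero>[I (Suc k),n]" using S(2) ny by (auto simp: cyc_def)
    hence "act (I (Suc k)) d (n - d) a (dl k (n - d) (t (n, y))) = \<zero>[I (Suc k),n]"
     using dl_act[OF a ann_elts[OF tz(1)], of n] tz(2) by simp
    thus "t (n, y) \<in> rel_cyc k ?J (n - d)"
     using dl_ann[OF J tz(1)] ann_elts[OF tz(1)] I.ann_sub_add[OF J a] by (simp add: rel_cyc_def)
   qed
   fix N n assume N: "gsub R N (I k) \<and> (ALL n. rel_bd k ?J n <= N n) \<and>
    (\<forall>(n, x)\<in>(%z. (fst z - d, t z)) ` S. x \<in> N n)"
   hence N': "gsub R N (I k)" by blast
   have annN: "ann_sub (I k) ?J n <= N n" and bdN: "bd k (%n. {\<zero>}) n <= N n" for n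
    using N rel_bd_incl[OF J'] by blast+
   \<comment> \<open>The image under multiplication by a of the elements of N annihilated by J. It
     contains the boundaries and the chosen generators for (J : a), hence all cycles for (J :
     a).\<close>
   let ?N = "%m. {y \<in> elts (I k) m. \<exists>v\<in>N (m - d). v \<in> ann_sub (I k) J (m - d) \<and> act (I k) d (m - d) a v = y}"
   note annsub = I.ann_submodule[OF J]
   have Nsub: "gsub R ?N (I k)"
   proof (rule I.submoduleI)
    fix m show "\<zero>[I k,m] \<in> ?N m"
     using I.sub_zero[OF N', of "m - d"] I.sub_zero[OF annsub, of k "m - d"] I.act_zero[OF a, of m "m - d"] by auto
   next
    fix m x y assume "x \<in> ?N m" "y \<in> ?N m"
    then obtain v w where *: "v \<in> N (m - d)" "v \<in> ann_sub (I k) J (m - d)" "act (I k) d (m - d) a v = x"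
     "w \<in> N (m - d)" "w \<in> ann_sub (I k) J (m - d)" "act (I k) d (m - d) a w = y" "x \<in> elts (I k) m" "y \<in> elts (I k) m" by blast
    have "act (I k) d (m - d) a (v \<oplus>[I k,m - d] w) = x \<oplus>[I k,m] y"
     using I.act_add[OF a ann_elts[OF *(2)] ann_elts[OF *(5)], of m] *(3,6) by simp
    thus "x \<oplus>[I k,m] y \<in> ?N m" using I.sub_add[OF N' *(1,4)] I.sub_add[OF annsub *(2,5)] *(7,8) by blast
   next
    fix i m r x assume r: "r \<in> deg R i" and "x \<in> ?N m"
    then obtain v where *: "v \<in> N (m - d)" "v \<in> ann_sub (I k) J (m - d)" "act (I k) d (m - d) a v = x" "x \<in> elts (I k) m" by blast
    obtain r' where r': "r' \<in> deg R i"
     "act (I k) i (d + (m - d)) r (act (I k) d (m - d) a v) = act (I k) d (i + (m - d)) a (act (I k) i (m - d) r' v)"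
     using I.act_swap'[OF r a ann_elts[OF *(2)]] by metis
    have e: "i + m - d = i + (m - d)" by simp
    have "act (I k) i (m - d) r' v \<in> N (i + m - d)" "act (I k) i (m - d) r' v \<in> ann_sub (I k) J (i + m - d)"
     using I.sub_act[OF N' r'(1) *(1) e] I.sub_act[OF annsub r'(1) *(2) e] .
    moreover have "act (I k) d (i + m - d) a (act (I k) i (m - d) r' v) = act (I k) i m r x" using r'(2) *(3) unfolding e by simp
    ultimately show "act (I k) i m r x \<in> ?N (i + m)" using I.act_closed[OF r *(4) refl] by blast
   qed simp
   have cN: "cyc k ?C m <= ?N m" for m
   proof -
    have "ALL n. cyc k ?C n <= ?N n"
    proof (rule S(3)[OF Nsub])
     show "ALL n. bd k ?C n <= ?N n"
     proof (intro allI subsetI)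
      fix n y assume y: "y \<in> bd k ?C n"
      have ye: "y \<in> elts (I k) n" by (rule I.sub_elts[OF bd_submodule[OF C] y])
      have "y \<in> bd k ?C (d + (n - d))" using y by simp
      then obtain z where z: "z \<in> bd k J (n - d)" "act (I k) d (n - d) a z = y" by (rule bd_divide[OF J a])
      have "z \<in> bd k (%n. {\<zero>}) (n - d)" using z(1) bd_mono[of "%n. {\<zero>}" J] gideal_zero[OF J] by blast
      hence "z \<in> N (n - d)" using bdN by blast
      moreover have "z \<in> ann_sub (I k) J (n - d)" using z(1) bd_cyc[OF J] by (auto simp: cyc_def)
      ultimately show "y \<in> ?N n" using z(2) ye by blast
     qed
     show "\<forall>(n, x)\<in>S. x \<in> ?N n" using S(2) ann_elts N t by (fastforce simp: cyc_def)
    qed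
    thus ?thesis by blast
   qed
   show "rel_cyc k ?J n \<inter> rel_bd k J n <= N n"
   proof
    fix x assume x: "x \<in> rel_cyc k ?J n \<inter> rel_bd k J n"
    then obtain b v where bv: "x = b \<oplus>[I k,n] v" "b \<in> bd k (%n. {\<zero>}) n" "v \<in> ann_sub (I k) J n"
     unfolding rel_bd_def sum_sub_def by blast
    have be: "b \<in> elts (I k) n" by (rule I.sub_elts[OF bd_submodule[OF gideal_null] bv(2)])
    have ve: "v \<in> elts (I k) n" by (rule ann_elts[OF bv(3)])
    have "dl k n b = \<zero>[I (Suc k),n]" using bd_cyc[OF gideal_null] bv(2) by (auto simp: cyc_def)
    hence "dl k n x = dl k n v" unfolding bv(1) using dl_add[OF be ve] dl_closed[OF ve] by simp
    hence "dl k n v \<in> ann_sub (I (Suc k)) ?J n" using x by (simp add: rel_cyc_def)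
    hence "act (I (Suc k)) d n a (dl k n v) = \<zero>[I (Suc k),d + n]" using I.ann_sub_add[OF J a] by blast
    hence "act (I k) d n a v \<in> cyc k ?C (d + n)" using I.ann_sub_colon[OF J a bv(3)] dl_act[OF a ve refl] by (simp add: cyc_def)
    hence "act (I k) d n a v \<in> ?N (d + n)" using cN by blast
    \<comment> \<open>Since a v = a w, the difference v - w is annihilated by J and by a, so it lies
      in N; thus v does too.\<close>
    then obtain w where w: "w \<in> N n" "w \<in> ann_sub (I k) J n" "act (I k) d n a w = act (I k) d n a v" by auto
    have av: "act (I k) d n a v \<in> elts (I k) (d + n)" by (rule I.act_closed[OF a ve refl])
    have "act (I k) d n a (v \<ominus>[I k,n] w) = \<zero>[I k,d + n]"
     using I.act_minus[OF a ve ann_elts[OF w(2)] refl] w(3) av by (simp add: a_minus_def I.G.r_neg)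
    hence "v \<ominus>[I k,n] w \<in> ann_sub (I k) ?J n" using I.sub_minus[OF annsub bv(3) w(2)] I.ann_sub_add[OF J a] by blast
    hence "(v \<ominus>[I k,n] w) \<oplus>[I k,n] w \<in> N n" using annN w(1) I.sub_add[OF N'] by blast
    hence "v \<in> N n" using I.add_minus_cancel(4)[OF ann_elts[OF w(2)] ve] by simp
    thus "x \<in> N n" unfolding bv(1) using bdN bv(2) I.sub_add[OF N'] by blast
   qed
  qed
 qed
 ultimately show ?thesis by (rule fg_over_trans) blast
qed

lemma rel_fg:
 assumes F: "!!J. gideal R J ==> fg_over R (I k) (cyc k J) (bd k J)" and J: "gideal R J"
 shows "fg_over R (I k) (rel_cyc k J) (rel_bd k J)"
proof -
 have *: "EX A. gideal R A \<and> (\<forall>(d, a)\<in>S. a \<in> A d) \<and>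
   (ALL K n. gideal R K \<and> (\<forall>(d, a)\<in>S. a \<in> K d) --> A n <= K n) \<and> fg_over R (I k) (rel_cyc k A) (rel_bd k A)"
  if "finite S" "\<forall>(d, a)\<in>S. a \<in> deg R d" for S using that
 proof (induction S)
  case empty
  \<comment> \<open>Everything is annihilated by the zero ideal, so no generators are needed at the
    start.\<close>
  have "rel_cyc k (%n. {\<zero>}) n <= rel_bd k (%n. {\<zero>}) n" for n using rel_bd_incl(2)[OF gideal_null, of k n]
   by (auto simp: rel_cyc_def ann_sub_def I.act_zero_left[OF _ refl])
  hence "fg_over R (I k) (rel_cyc k (%n. {\<zero>})) (rel_bd k (%n. {\<zero>}))" unfolding fg_over_def by (intro exI[of _ "{}"]) blast
  thus ?case using gideal_null gideal_zero by (intro exI[of _ "%n. {\<zero>}"]) auto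
 next
  case (insert g S)
  obtain d a where g: "g = (d, a)" by (cases g)
  have a: "a \<in> deg R d" using insert.prems g by auto
  obtain A where A: "gideal R A" "\<forall>(d, a)\<in>S. a \<in> A d" "!!K n. gideal R K ==> \<forall>(d, a)\<in>S. a \<in> K d ==> A n <= K n"
   "fg_over R (I k) (rel_cyc k A) (rel_bd k A)" using insert.IH insert.prems by auto
  have "\<forall>(e, b)\<in>insert g S. b \<in> gadd R A d a e" using A(2) gadd_incl[OF A(1) a] g by auto
  moreover have "gadd R A d a n <= K n" if "gideal R K" "\<forall>(d, a)\<in>insert g S. a \<in> K d" for K n
   by (rule gadd_least[OF that(1)]) (use A(3)[OF that(1)] that(2) g in auto)
  ultimately show ?case using gideal_gadd[OF A(1) a] rel_fg_step[OF F[OF gideal_gcol[OF A(1) a]] A(1) a A(4)]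
   by (intro exI[of _ "gadd R A d a"]) blast
 qed
 obtain S where S: "finite S" "!!d a. (d, a) \<in> S ==> a \<in> J d"
  "!!K n. gideal R K ==> (!!d a. (d, a) \<in> S ==> a \<in> K d) ==> J n <= K n" using gideal_fg[OF J] by metis
 have "\<forall>(d, a)\<in>S. a \<in> deg R d" using S(2) gideal_sub[OF J] by blast
 then obtain A where A: "gideal R A" "\<forall>(d, a)\<in>S. a \<in> A d" "!!K n. gideal R K ==> \<forall>(d, a)\<in>S. a \<in> K d ==> A n <= K n"
  "fg_over R (I k) (rel_cyc k A) (rel_bd k A)" using *[OF S(1)] by blast
 have "A n = J n" for n using A(3)[OF J] S(2) S(3)[OF A(1)] A(2) by blast
 hence "A = J" by (rule ext)
 thus ?thesis using A(4) by simp
qed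

text \<open>In degree 0 the cycles form a submodule of M. By exactness of the resolution the
  differential maps \<open>rel_cyc k J\<close> onto the cycles of degree k + 1 and
  \<open>rel_bd k J\<close> into the boundaries; thus Ext(J, M) in degree k controls Ext(R/J, M) in
  degree k + 1.\<close>

lemma cohomology_fg:
 assumes fg: "finitely_generated R M" and J: "gideal R J"
 shows "fg_over R (I k) (cyc k J) (bd k J)" using J
proof (induction k arbitrary: J)
 case 0
 have "fg_over R (I 0) (%n. \<eta> n ` elts M n) (null_sub (I 0))"
  by (rule fg_over_image[OF graded_commutative_ring_axioms module I_module \<eta>_hom fg[unfolded M.fg_iff] M.sub_whole I.sub_null])
   (auto simp: null_sub_def hom_zero[OF module I_module \<eta>_hom])
 hence "fg_over R (I 0) (cyc 0 J) (%n. cyc 0 J n \<inter> null_sub (I 0) n)"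
  by (rule I.fg_over_sub[OF _ I.sub_null hom_image_submodule[OF module I_module \<eta>_hom M.sub_whole] cyc_submodule[OF 0]])
   (use exact0 ann_elts in \<open>auto simp: cyc_def\<close>)
 moreover have "(%n. cyc 0 J n \<inter> null_sub (I 0) n) = bd 0 J" using bd_cyc[OF 0, of 0] by (intro ext) (auto simp: bd_def)
 ultimately show ?case by simp
next
 case (Suc k)
 note J = Suc.prems
 have "fg_over R (I (Suc k)) (%n. dl k n ` rel_cyc k J n) (bd (Suc k) J)"
 proof (rule fg_over_image[OF graded_commutative_ring_axioms I_module I_module dl_hom rel_fg[OF Suc.IH J]
    rel_cyc_submodule[OF J] bd_submodule[OF J]])
  fix n
  have 1: "dl k n (b \<oplus>[I k,n] v) = dl k n v" if "b \<in> bd k (%n. {\<zero>}) n" "v \<in> ann_sub (I k) J n" for b v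
  proof -
   have be: "b \<in> elts (I k) n" by (rule I.sub_elts[OF bd_submodule[OF gideal_null] that(1)])
   have "dl k n b = \<zero>[I (Suc k),n]" using bd_cyc[OF gideal_null] that(1) by (auto simp: cyc_def)
   thus ?thesis using dl_add[OF be ann_elts[OF that(2)]] dl_closed[OF ann_elts[OF that(2)]] by simp
  qed
  show "dl k n ` rel_bd k J n <= bd (Suc k) J n" using 1 by (auto simp: rel_bd_def sum_sub_def bd_def)
  show "rel_bd k J n <= rel_cyc k J n"
  proof
   fix x assume x: "x \<in> rel_bd k J n"
   hence "dl k n x \<in> ann_sub (I (Suc k)) J n" using 1 dl_ann[OF J] by (auto simp: rel_bd_def sum_sub_def)
   thus "x \<in> rel_cyc k J n" using I.sub_elts[OF rel_bd_submodule[OF J] x] by (simp add: rel_cyc_def)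
  qed
 qed
 moreover have "(%n. dl k n ` rel_cyc k J n) = cyc (Suc k) J"
  using exact[OF ann_elts] dl_dl by (intro ext) (auto simp: rel_cyc_def cyc_def)
 ultimately show ?case by simp
qed

text \<open>By noetherian induction \<open>Ext(R/J, M)\<close> vanishes at \<open>p\<close> for all \<open>J\<close>, in particular
 for \<open>J = 0\<close>.\<close>

lemma prime_annihilator_exists:
 assumes fg: "finitely_generated R M" and p: "p \<in> Spec R" and m: "m \<in> elts M n" "\<not> tors R M p (null_sub M) n m"
 obtains k d x where "x \<in> elts (I k) d"
  "!!i r. r \<in> deg R i ==> act (I k) i d r x = \<zero>[I k,i + d] \<longleftrightarrow> r \<in> p"
proof (rule ccontr)
 note witness = that
 assume "\<not> thesis"
 hence noann: "EX i r. r \<in> deg R i \<and> \<not> (act (I k) i d r x = \<zero>[I k,i + d] \<longleftrightarrow> r \<in> p)"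
  if "x \<in> elts (I k) d" for k d x using witness[OF that] by blast
 have tor0: "tors R (I k) p (bd k J) n x"
  if J: "gideal R J" and s: "s \<in> deg R i" "s \<notin> p" "act (I k) i n s x = \<zero>[I k,i + n]" for k J i s n x unfolding tors_def
  by (rule exI[of _ i], rule bexI[OF _ s(1)]) (simp add: s(2,3) I.sub_zero[OF bd_submodule[OF J]])
 have "ALL k n. \<forall>x\<in>cyc k J n. tors R (I k) p (bd k J) n x" if "gideal R J" for J using that
 proof (induction rule: gideal_induct)
  case whole
  show ?case using tor0 gideal_whole one_deg Spec_one p ann_act by (auto simp: cyc_def)
 next
  case (prime q)
  let ?q = "%n. q \<inter> deg R n"
  note gq = Spec_gideal[OF prime(1)]
  show ?case
  proof (cases "EX i r. r \<in> deg R i \<and> r \<in> q \<and> r \<notin> p")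
   case True
   then obtain i r where r: "r \<in> deg R i" "r \<in> q" "r \<notin> p" by blast
   hence "act (I k) i n r x = \<zero>[I k,i + n]" if "x \<in> cyc k ?q n" for k n x
    using that ann_act[of x k ?q n r i] by (simp add: cyc_def)
   thus ?thesis using tor0[OF gq r(1,3)] by blast
  next
   case False
   hence qp: "!!i r. r \<in> deg R i ==> r \<in> q ==> r \<in> p" by blast
   show ?thesis
   proof (cases "EX d a. a \<in> deg R d \<and> a \<in> p \<and> a \<notin> q")
    \<comment> \<open>Here q and p have the same homogeneous elements. A cycle is annihilated by p,
      and by assumption its annihilator is not exactly p, so some element outside p kills
      it.\<close>
    case False
    hence eq: "r \<in> q \<longleftrightarrow> r \<in> p" if "r \<in> deg R i" for r i using qp that by blast
    show ?thesis
    proof (intro allI ballI)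
     fix k n x assume x: "x \<in> cyc k ?q n"
     hence xa: "x \<in> ann_sub (I k) ?q n" by (simp add: cyc_def)
     obtain i r where r: "r \<in> deg R i" "\<not> (act (I k) i n r x = \<zero>[I k,i + n] \<longleftrightarrow> r \<in> p)"
      using noann[OF ann_elts[OF xa]] by blast
     have "r \<in> p ==> act (I k) i n r x = \<zero>[I k,i + n]" using ann_act[OF xa, of r i] eq[OF r(1)] r(1) by simp
     thus "tors R (I k) p (bd k ?q) n x" using r tor0[OF gq r(1)] by blast
    qed
   next
    case True
    \<comment> \<open>Now q is strictly smaller than p. Because (q : a) = q, a cycle x is a z. The
      differential of z is a cycle for q + Ra, so by induction a multiple s of it is the
      differential of some w annihilated by q + Ra. Then s z - w is a cycle whose product with a is
      s x up to sign: multiplication by a is surjective at p and Nakayama's lemma applies.\<close>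
    then obtain d a where a: "a \<in> deg R d" "a \<in> p" "a \<notin> q" by blast
    let ?K = "gadd R ?q d a"
    have IH: "ALL k n. \<forall>x\<in>cyc k ?K n. tors R (I k) p (bd k ?K) n x"
    proof (rule prime(2)[OF gideal_gadd[OF gq a(1)]])
     show "?q n <= ?K n" for n using gadd_incl(1)[OF gq a(1)] by blast
     have "a \<in> ?K d" by (rule gadd_incl(2)[OF gq a(1)])
     thus "?K ~= ?q" using a(3) by auto
    qed
    have colon: "gcol R ?q d a i <= ?q i" for i using Spec_prime[OF prime(1) _ a(1)] a(3) by (auto simp: gcol_def)
    show ?thesis
    proof (intro allI ballI)
     fix k n x assume "x \<in> cyc k ?q n"
     thus "tors R (I k) p (bd k ?q) n x"
     proof (rule I.nakayama[OF p cyc_submodule[OF gq] bd_submodule[OF gq] cohomology_fg[OF fg gq] a(1,2), rotated])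
      fix n x assume x: "x \<in> cyc k ?q n"
      define e where "e = n - d"
      have n: "n = d + e" by (simp add: e_def)
      have "x \<in> ann_sub (I k) (gcol R ?q d a) (d + e)" using x colon unfolding cyc_def ann_sub_def n by blast
      then obtain z where z: "z \<in> ann_sub (I k) ?q e" "act (I k) d e a z = x" by (rule ann_divide[OF gq a(1)])
      note ze = ann_elts[OF z(1)]
      have "dl k n x = \<zero>[I (Suc k),n]" using x by (simp add: cyc_def)
      hence "act (I (Suc k)) d e a (dl k e z) = \<zero>[I (Suc k),d + e]" using dl_act[OF a(1) ze refl] z(2) n by simp
      hence "dl k e z \<in> cyc (Suc k) ?K e"
       using dl_ann[OF gq z(1)] I.ann_sub_add[OF gq a(1)] dl_dl[OF ze] by (simp add: cyc_def)
      hence "tors R (I (Suc k)) p (bd (Suc k) ?K) e (dl k e z)" using IH by blast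
      then obtain i s where s: "s \<in> deg R i" "s \<notin> p" "act (I (Suc k)) i e s (dl k e z) \<in> bd (Suc k) ?K (i + e)"
       unfolding tors_def by blast
      then obtain w where w: "w \<in> ann_sub (I k) ?K (i + e)" "act (I (Suc k)) i e s (dl k e z) = dl k (i + e) w"
       by (auto simp: bd_def)
      note we = ann_elts[OF w(1)]
      have wq: "w \<in> ann_sub (I k) ?q (i + e)" "act (I k) d (i + e) a w = \<zero>[I k,d + (i + e)]"
       using w(1) I.ann_sub_add[OF gq a(1)] by blast+
      have sz: "act (I k) i e s z \<in> ann_sub (I k) ?q (i + e)" by (rule I.sub_act[OF I.ann_submodule[OF gq] s(1) z(1) refl])
      note sze = ann_elts[OF sz]
      let ?y = "act (I k) i e s z \<ominus>[I k,i + e] w"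
      have "dl k (i + e) ?y = \<zero>[I (Suc k),i + e]"
       using dl_minus[OF sze we] dl_act[OF s(1) ze refl] w(2) dl_closed[OF we] by (simp add: a_minus_def I.G.r_neg)
      hence y: "?y \<in> cyc k ?q (i + e)" using I.sub_minus[OF I.ann_submodule[OF gq] sz wq(1)] by (simp add: cyc_def)
      obtain s' where s': "s' \<in> deg R i" "s' = s \<or> s' = \<ominus> s"
       "act (I k) d (i + e) a (act (I k) i e s z) = act (I k) i (d + e) s' (act (I k) d e a z)" using I.act_swap[OF a(1) s(1)] ze by metis
      have s'p: "s' \<notin> p" using s' s(2) Spec_neg[OF p dcar[OF s(1)]] by auto
      have asz: "act (I k) d (i + e) a (act (I k) i e s z) \<in> elts (I k) (d + (i + e))" by (rule I.act_closed[OF a(1) sze refl])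
      have "act (I k) d (i + e) a ?y = act (I k) i n s' x" using I.act_minus[OF a(1) sze we refl] wq(2) s'(3) z(2) n asz
        I.add_minus_cancel(2)[OF asz I.G.zero_closed] by simp
      moreover have "act (I k) i n s' x \<in> elts (I k) (i + n)" using x ann_elts by (intro I.act_closed[OF s'(1)]) (auto simp: cyc_def)
      ultimately have "act (I k) i n s' x \<ominus>[I k,i + n] act (I k) d (i + e) a ?y \<in> bd k ?q (i + n)"
       using I.sub_zero[OF bd_submodule[OF gq]] by (simp add: a_minus_def I.G.r_neg)
      moreover have "i + n - d = i + e" by (simp add: e_def)
      ultimately show "EX i s y. s \<in> deg R i \<and> s \<notin> p \<and> y \<in> cyc k ?q (i + n - d) \<and>
       act (I k) i n s x \<ominus>[I k,i + n] act (I k) d (i + n - d) a y \<in> bd k ?q (i + n)"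
       using s'(1) s'p y by metis
     qed
    qed
   qed
  qed
 next
  case (split J a d)
  note J = split(1) and a = split(2) and IH1 = split(3) and IH2 = split(4)
  show ?case
  proof (intro allI ballI)
   fix k n x assume x: "x \<in> cyc k J n"
   hence xa: "x \<in> ann_sub (I k) J n" and dx: "dl k n x = \<zero>[I (Suc k),n]" by (auto simp: cyc_def)
   note xe = ann_elts[OF xa]
   \<comment> \<open>By induction a multiple of a x is a boundary for (J : a), hence equals a b for
     a boundary b with respect to J. So s' x - b is a cycle for J + Ra and is torsion by the other
     induction hypothesis.\<close>
   have "act (I k) d n a x \<in> cyc k (gcol R J d a) (d + n)"
    using I.ann_sub_colon[OF J a xa] dl_act[OF a xe refl] dx I.act_zero[OF a refl] by (simp add: cyc_def)
   hence "tors R (I k) p (bd k (gcol R J d a)) (d + n) (act (I k) d n a x)" using IH2 by blast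
   then obtain i s where s: "s \<in> deg R i" "s \<notin> p"
    "act (I k) i (d + n) s (act (I k) d n a x) \<in> bd k (gcol R J d a) (i + (d + n))" unfolding tors_def by blast
   obtain s' where s': "s' \<in> deg R i" "s' = s \<or> s' = \<ominus> s"
    "act (I k) i (d + n) s (act (I k) d n a x) = act (I k) d (i + n) a (act (I k) i n s' x)" by (rule I.act_swap'[OF s(1) a xe])
   have s'p: "s' \<notin> p" using s' s(2) Spec_neg[OF p dcar[OF s(1)]] by auto
   have "act (I k) d (i + n) a (act (I k) i n s' x) \<in> bd k (gcol R J d a) (d + (i + n))"
    using s(3) s'(3) by (simp add: algebra_simps)
   then obtain b where b: "b \<in> bd k J (i + n)" "act (I k) d (i + n) a b = act (I k) d (i + n) a (act (I k) i n s' x)"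
    by (rule bd_divide[OF J a])
   have bc: "b \<in> cyc k J (i + n)" using b(1) bd_cyc[OF J] by blast
   hence ba: "b \<in> ann_sub (I k) J (i + n)" by (simp add: cyc_def)
   have sx: "act (I k) i n s' x \<in> cyc k J (i + n)" by (rule I.sub_act[OF cyc_submodule[OF J] s'(1) x refl])
   hence sxa: "act (I k) i n s' x \<in> ann_sub (I k) J (i + n)" by (simp add: cyc_def)
   let ?y = "act (I k) i n s' x \<ominus>[I k,i + n] b"
   have "act (I k) d (i + n) a ?y = \<zero>[I k,d + (i + n)]"
    using I.act_minus[OF a ann_elts[OF sxa] ann_elts[OF ba] refl] b(2) I.act_closed[OF a ann_elts[OF sxa] refl]
    by (simp add: a_minus_def I.G.r_neg)
   hence "?y \<in> ann_sub (I k) (gadd R J d a) (i + n)"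
    using I.sub_minus[OF I.ann_submodule[OF J] sxa ba] I.ann_sub_add[OF J a] by blast
   hence "?y \<in> cyc k (gadd R J d a) (i + n)" using I.sub_minus[OF cyc_submodule[OF J] sx bc] by (simp add: cyc_def)
   hence "tors R (I k) p (bd k (gadd R J d a)) (i + n) ?y" using IH1 by blast
   then obtain l t where t: "t \<in> deg R l" "t \<notin> p" "act (I k) l (i + n) t ?y \<in> bd k (gadd R J d a) (l + (i + n))"
    unfolding tors_def by blast
   have "act (I k) l (i + n) t ?y \<in> bd k J (l + (i + n))"
    using t(3) bd_mono[of J "gadd R J d a"] gadd_incl(1)[OF J a] by blast
   hence ty: "tors R (I k) p (bd k J) (i + n) ?y" using t(1,2) unfolding tors_def by blast
   note T = I.tors_submodule[OF p bd_submodule[OF J]]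
   have ye: "?y \<in> elts (I k) (i + n)" using ann_elts[OF sxa] ann_elts[OF ba] by simp
   have "?y \<oplus>[I k,i + n] b \<in> {x \<in> elts (I k) (i + n). tors R (I k) p (bd k J) (i + n) x}"
    by (rule I.sub_add[OF T]) (use ty ye ann_elts[OF ba] I.tors_incl[where P = "bd k J", OF p b(1)] in auto)
   hence "tors R (I k) p (bd k J) (i + n) (act (I k) i n s' x)" using I.add_minus_cancel(4)[OF ann_elts[OF ba] ann_elts[OF sxa]] by simp
   thus "tors R (I k) p (bd k J) n x" by (rule I.tors_tors[OF p xe s'(1) s'p])
  qed
 qed
 hence "\<forall>x\<in>cyc 0 (%n. {\<zero>}) n. tors R (I 0) p (bd 0 (%n. {\<zero>})) n x" using gideal_null by blast
 moreover have "\<eta> n m \<in> cyc 0 (%n. {\<zero>}) n"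
  using exact0[OF hom_closed[OF \<eta>_hom m(1)]] m(1) hom_closed[OF \<eta>_hom m(1)]
  by (auto simp: cyc_def ann_sub_def I.act_zero_left[OF _ refl])
 ultimately have "tors R (I 0) p (null_sub (I 0)) n (\<eta> n m)" by (auto simp: bd_def tors_def)
 then obtain i s where s: "s \<in> deg R i" "s \<notin> p" "act (I 0) i n s (\<eta> n m) = \<zero>[I 0,i + n]"
  unfolding tors_def null_sub_def by blast
 have "\<eta> (i + n) (act M i n s m) = \<zero>[I 0,i + n]" using hom_act[OF \<eta>_hom s(1) m(1) refl] s(3) by simp
 hence "act M i n s m = \<zero>[M,i + n]"
  using inj_on_iff_kernel[OF module I_module \<eta>_hom] \<eta>_inj M.act_closed[OF s(1) m(1) refl] by blast
 thus False using m(2) s(1,2) unfolding tors_def null_sub_def by blast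
qed

end

section \<open>Comparison of the two descriptions of the support, and boundedness\<close>

lemma shift_shift: "gmod_shift (- d) (gmod_shift d M) = M" "gmod_shift d (gmod_shift (- d) M) = M"
 by (simp_all add: gmod_shift_def)

lemma shift_hom:
 assumes "gmod_hom R M N f" shows "gmod_hom R (gmod_shift d M) (gmod_shift d N) (%n. f (n + d))"
 using assms by (auto simp: gmod_hom_def gmod_shift_def add.assoc)

context graded_commutative_ring
begin

lemma gmod_quot_simps:
 assumes p: "p \<in> Spec R"
 shows "elts (gmod_quot R p) n = (%r. p +> r) ` deg R n"
  "!!r s. r \<in> deg R n ==> s \<in> deg R n ==>
   (p +> r) \<oplus>[gmod_quot R p,n] (p +> s) = p +> (r \<oplus> s)"
  "!!r s i. r \<in> deg R i ==> s \<in> deg R n ==>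
   act (gmod_quot R p) i n r (p +> s) = p +> (r \<otimes> s)"
  "!!r s. r \<in> deg R n ==> s \<in> deg R n ==> p +> r = p +> s \<longleftrightarrow> r \<ominus> s \<in> p"
proof -
 interpret p: ideal p R by (rule Spec_ideal[OF p])
 show "elts (gmod_quot R p) n = (%r. p +> r) ` deg R n" by (simp add: gmod_quot_def)
 fix r s assume "r \<in> deg R n" and s: "s \<in> deg R n"
 hence c: "r \<in> carrier R" "s \<in> carrier R" using dcar by blast+
 show "(p +> r) \<oplus>[gmod_quot R p,n] (p +> s) = p +> (r \<oplus> s)"
  using p.a_rcos_sum[OF c] by (simp add: gmod_quot_def FactRing_def)
 show "p +> r = p +> s \<longleftrightarrow> r \<ominus> s \<in> p"
  using quotient_eq_iff_same_a_r_cos[OF p.ideal_axioms c] by simp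
next
 interpret p: ideal p R by (rule Spec_ideal[OF p])
 fix r s i assume "r \<in> deg R i" "s \<in> deg R n"
 thus "act (gmod_quot R p) i n r (p +> s) = p +> (r \<otimes> s)"
  using p.rcoset_mult_add[of r s] dcar by (simp add: gmod_quot_def)
qed

end

context noetherian_graded_ring
begin

text \<open>If M vanished at p, so would all terms of the resolution. But the image of 1 of R/p in
  the hull, and then in a term of the resolution, has annihilator exactly p among homogeneous
  elements.\<close>

lemma supp_gmod_torsion:
 fixes M :: "('r, 'm) gmod"
 assumes M: "gmodule R M" and p: "p \<in> supp_gmod R M"
 shows "\<not> localization_zero R p M"
proof
 interpret M: noetherian_graded_mod R M by (rule noetherian_graded_modI[OF M])
 assume lz: "localization_zero R p M"
 obtain I :: "nat => ('r, ('r, 'm) hull_elt) gmod" and \<eta> dl and E :: "('r, ('r, 'm) hull_elt) gmod" and f k d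
  where pS: "p \<in> Spec R" and res: "minimal_injective_resolution R M I \<eta> dl"
   and hull: "injective_hull R (gmod_quot R p) E f" and sum: "direct_summand R (gmod_shift d E) (I k)"
  using p unfolding supp_gmod_def by blast
 interpret injective_resolution R M I \<eta> dl by unfold_locales (rule M, rule res)
 let ?Q = "gmod_quot R p"
 note Q = gmod_quot_simps[OF pS]
 have E: "gmodule R E" using hull injective_module by (auto simp: injective_hull_def)
 interpret E: graded_mod R E by (rule gmodI[OF E])
 have f: "gmod_hom R ?Q E f" "!!n. inj_on (f n) (elts ?Q n)" using hull by (auto simp: injective_hull_def gmod_mono_def)
 obtain s \<pi> where s: "gmod_hom R (gmod_shift d E) (I k) s" and \<pi>: "gmod_hom R (I k) (gmod_shift d E) \<pi>"
  and \<pi>s: "!!n a. a \<in> elts (gmod_shift d E) n ==> \<pi> n (s n a) = a" using sum unfolding direct_summand_def by blast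
 have one: "p +> \<one> \<in> elts ?Q 0" using one_deg by (simp add: Q(1))
 define e where "e = f 0 (p +> \<one>)"
 have e: "e \<in> elts E 0" unfolding e_def by (rule hom_closed[OF f(1) one])
 hence es: "e \<in> elts (gmod_shift d E) (- d)" by (simp add: gmod_shift_def)
 have x: "s (- d) e \<in> elts (I k) (- d)" by (rule hom_closed[OF s es])
 have "tors R (I k) p (null_sub (I k)) (- d) (s (- d) e)" using torsion_resolution[OF pS _ x] lz M.localization_zero_iff[OF pS] by blast
 then obtain i t where t: "t \<in> deg R i" "t \<notin> p" "act (I k) i (- d) t (s (- d) e) = \<zero>[I k,i + - d]"
  unfolding tors_def null_sub_def by blast
 have "\<pi> (i + - d) (act (I k) i (- d) t (s (- d) e)) = act (gmod_shift d E) i (- d) t e"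
  using hom_act[OF \<pi> t(1) x refl] \<pi>s[OF es] by simp
 hence "act (gmod_shift d E) i (- d) t e = \<zero>[gmod_shift d E,i + - d]"
  using t(3) hom_zero[OF I_module shift_module[OF E] \<pi>] by simp
 hence te: "act E i 0 t e = \<zero>[E,i]" by (simp add: gmod_shift_def)
 have ft: "f i (p +> t) = \<zero>[E,i]"
  using hom_act[OF f(1) t(1) one, of i] Q(3)[OF t(1) one_deg] dcar[OF t(1)] te by (simp add: e_def)
 have z: "p +> \<zero> \<in> elts ?Q i" by (simp add: Q(1))
 have "f i (p +> \<zero>) \<oplus>[E,i] f i (p +> \<zero>) = f i (p +> \<zero>)"
  using hom_add[OF f(1) z z] Q(2)[of \<zero> i \<zero>] by simp
 hence "f i (p +> \<zero>) = \<zero>[E,i]" using hom_closed[OF f(1) z] by (metis E.G.add.l_cancel_one)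
 hence "p +> t = p +> \<zero>"
  using ft inj_onD[OF f(2) _ _ z, of "p +> t"] t(1) by (simp add: Q(1))
 thus False using Q(4)[OF t(1) deg_zero] t(2) dcar[OF t(1)] by (simp add: a_minus_def)
qed

text \<open>An element x with annihilator p in a term of the resolution generates a shifted copy of
  R/p. Its hull maps to that term by injectivity of the term, injectively because Rx is essential in
  the hull, and splits off because the hull is injective.\<close>

lemma torsion_supp_gmod:
 fixes M :: "('r, 'm) gmod"
 assumes M: "gmodule R M" and fg: "finitely_generated R M" and p: "p \<in> Spec R"
  and nz: "\<not> localization_zero R p M"
 shows "p \<in> supp_gmod R M"
proof -
 interpret M: noetherian_graded_mod R M by (rule noetherian_graded_modI[OF M])
 obtain I :: "nat => ('r, ('r, 'm) hull_elt) gmod" and \<eta> dl where res: "minimal_injective_resolution R M I \<eta> dl"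
  by (rule minimal_injective_resolution_exists[OF M])
 interpret injective_resolution R M I \<eta> dl by unfold_locales (rule M, rule res)
 obtain n m where m: "m \<in> elts M n" "\<not> tors R M p (null_sub M) n m" using nz M.localization_zero_iff[OF p] by blast
 obtain k d x where x: "x \<in> elts (I k) d"
  and ann: "!!i r. r \<in> deg R i ==> act (I k) i d r x = \<zero>[I k,i + d] \<longleftrightarrow> r \<in> p"
  by (rule prime_annihilator_exists[OF fg p m], rule that; assumption)
 let ?N = "add_cyclic R (I k) (null_sub (I k)) d x"
 have N: "gsub R ?N (I k)" by (rule I.sub_add_cyclic[OF I.sub_null x])
 have Nel: "?N n = (%r. act (I k) (n - d) d r x) ` deg R (n - d)" for n using I.act_closed x by (force simp: add_cyclic_def null_sub_def)
 let ?C = "sub_mod (I k) ?N"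
 note C = sub_mod_module[OF I_module N]
 have Cel: "elts ?C n = ?N n" for n by (simp add: sub_mod_def)
 let ?C' = "gmod_shift d ?C"
 have C': "gmodule R ?C'" by (rule shift_module[OF C(1)])
 have C'el: "elts ?C' n = (%r. act (I k) n d r x) ` deg R n" for n by (simp add: gmod_shift_def Cel Nel)
 obtain E :: "('r, ('r, 'm) hull_elt) gmod" and h where E: "injective_gmod R E" and h: "gmod_mono R ?C' E h"
  and ess: "essential R (gmod_image ?C' h) E" by (rule hull_exists[OF C' hull_elt_large(1)[where 'm = 'm] card_of_mono1[OF subset_UNIV]])
 have EM: "gmodule R E" by (rule injective_module[OF E])
 interpret E: graded_mod R E by (rule gmodI[OF EM])
 have hh: "gmod_hom R ?C' E h" and hi: "!!n. inj_on (h n) (elts ?C' n)" using h by (auto simp: gmod_mono_def)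
 let ?Q = "gmod_quot R p"
 note Q = gmod_quot_simps[OF p]
 have rx: "act (I k) n d r x \<in> elts ?C' n" if "r \<in> deg R n" for n r using that by (simp add: C'el)
 \<comment> \<open>The assignment r + p to r x is well defined and injective, so Rx is identified
   with R/p up to a shift by d.\<close>
 have same: "act (I k) n d r x = act (I k) n d s x \<longleftrightarrow> p +> r = p +> s" if r: "r \<in> deg R n" and s: "s \<in> deg R n" for n r s
 proof -
  have c: "act (I k) n d r x \<in> elts (I k) (n + d)" "act (I k) n d s x \<in> elts (I k) (n + d)"
   using I.act_closed[OF r x refl] I.act_closed[OF s x refl] .
  have "r \<ominus> s \<in> deg R n" unfolding a_minus_def by (rule deg_add[OF r deg_neg[OF s]])
  hence "p +> r = p +> s \<longleftrightarrow> act (I k) n d (r \<ominus> s) x = \<zero>[I k,n + d]"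
   using ann Q(4)[OF r s] by simp
  also have "act (I k) n d (r \<ominus> s) x = act (I k) n d r x \<ominus>[I k,n + d] act (I k) n d s x"
   unfolding a_minus_def using I.act_add_left[OF r deg_neg[OF s] x refl] I.act_neg_left[OF s x refl] by simp
  also have "... = \<zero>[I k,n + d] \<longleftrightarrow> act (I k) n d r x = act (I k) n d s x"
   using I.minus_eq_zero[OF c] c by (auto simp: a_minus_def I.G.r_neg)
  finally show ?thesis by blast
 qed
 define f where "f n A = h n (act (I k) n d (SOME r. r \<in> deg R n \<and> A = p +> r) x)" for n A
 have f: "f n (p +> r) = h n (act (I k) n d r x)" if r: "r \<in> deg R n" for n r
 proof -
  have "(SOME s. s \<in> deg R n \<and> p +> r = p +> s) \<in> deg R n \<and>
   p +> r = p +> (SOME s. s \<in> deg R n \<and> p +> r = p +> s)"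
   by (rule someI[of _ r]) (use r in simp)
  thus ?thesis unfolding f_def using same[OF r] by metis
 qed
 have fh: "gmod_hom R ?Q E f" unfolding gmod_hom_def
 proof (intro conjI allI ballI)
  show "f n \<in> elts ?Q n \<rightarrow> elts E n" for n using f rx hom_closed[OF hh] by (auto simp: Q(1))
 next
  fix n A B assume "A \<in> elts ?Q n" "B \<in> elts ?Q n"
  then obtain r s where rs: "r \<in> deg R n" "s \<in> deg R n" "A = p +> r" "B = p +> s" by (auto simp: Q(1))
  have "act (I k) n d (r \<oplus> s) x = act (I k) n d r x \<oplus>[?C',n] act (I k) n d s x"
   using I.act_add_left[OF rs(1,2) x refl] by (simp add: gmod_shift_def sub_mod_def)
  thus "f n (A \<oplus>[?Q,n] B) = f n A \<oplus>[E,n] f n B"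
   using f[OF deg_add[OF rs(1,2)]] f rs Q(2)[OF rs(1,2)] hom_add[OF hh rx[OF rs(1)] rx[OF rs(2)]] by simp
 next
  fix i n r A assume r: "r \<in> deg R i" and "A \<in> elts ?Q n"
  then obtain s where s: "s \<in> deg R n" "A = p +> s" by (auto simp: Q(1))
  have "act (I k) (i + n) d (r \<otimes> s) x = act ?C' i n r (act (I k) n d s x)"
   using I.act_act[OF r s(1) x refl refl] by (simp add: gmod_shift_def sub_mod_def)
  thus "f (i + n) (act ?Q i n r A) = act E i n r (f n A)"
   using f[OF mult_deg[OF r s(1)]] f[OF s(1)] s(2) Q(3)[OF r s(1)] hom_act[OF hh r rx[OF s(1)] refl] by simp
 qed
 have "inj_on (f n) (elts ?Q n)" for n
 proof (rule inj_onI)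
  fix A B assume "A \<in> elts ?Q n" "B \<in> elts ?Q n" and e: "f n A = f n B"
  then obtain r s where rs: "r \<in> deg R n" "s \<in> deg R n" "A = p +> r" "B = p +> s" by (auto simp: Q(1))
  thus "A = B" using e f inj_onD[OF hi _ rx[OF rs(1)] rx[OF rs(2)]] same by simp
 qed
 hence fm: "gmod_mono R ?Q E f" using fh by (simp add: gmod_mono_def)
 have "gmod_image ?Q f = gmod_image ?C' h" using f by (intro ext) (simp add: gmod_image_def Q(1) C'el image_image)
 hence hull: "injective_hull R ?Q E f" using E fm ess by (simp add: injective_hull_def)
 let ?B = "gmod_shift (- d) E"
 have B: "gmodule R ?B" by (rule shift_module[OF EM])
 have inr: "inj (Inr :: ('r, 'm) hull_elt => 'r + ('r, 'm) hull_elt)" by simp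
 have "gmod_hom R (gmod_shift (- d) ?C') ?B (%n. h (n + - d))" by (rule shift_hom[OF hh])
 moreover have "elts ?C' (n + - d) = elts ?C n" for n by (simp add: gmod_shift_def)
 ultimately have \<kappa>: "gmod_mono R ?C ?B (%n. h (n + - d))" using hi unfolding shift_shift gmod_mono_def by metis
 have incl: "gmod_hom R ?C (I k) (%n x. x)" using C(2) by (simp add: gmod_mono_def)
 obtain g where g: "gmod_hom R ?B (I k) g" "!!n a. a \<in> elts ?C n ==> g n (h (n + - d) a) = a"
  by (rule injective_extend[OF I_injective inr C(1) B \<kappa> incl], rule that; assumption)
 let ?g = "%n. g (n + d)"
 have g': "gmod_hom R E (gmod_shift d (I k)) ?g" using shift_hom[OF g(1), of d] by (simp add: shift_shift)
 have "inj_on (?g n) (elts E n)" for n unfolding inj_on_iff_kernel[OF EM shift_module[OF I_module] g']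
 proof (intro ballI impI)
  fix e assume e: "e \<in> elts E n" "?g n e = \<zero>[gmod_shift d (I k),n]"
  show "e = \<zero>[E,n]"
  proof (rule ccontr)
   assume "e ~= \<zero>[E,n]"
   then obtain i r where r: "r \<in> deg R i" "act E i n r e \<in> gmod_image ?C' h (i + n)" "act E i n r e ~= \<zero>[E,i + n]"
    by (rule essentialD[OF EM ess e(1)])
   then obtain c where c: "c \<in> elts ?C' (i + n)" "act E i n r e = h (i + n) c" by (auto simp: gmod_image_def)
   have "c \<in> elts ?C (i + n + d)" using c(1) by (simp add: gmod_shift_def)
   hence gc: "?g (i + n) (h (i + n) c) = c" using g(2)[of c "i + n + d"] by simp
   have "?g (i + n) (act E i n r e) = \<zero>[gmod_shift d (I k),i + n]"
    using hom_act[OF g' r(1) e(1) refl] e(2) graded_mod.act_zero[OF gmodI[OF shift_module[OF I_module]] r(1) refl] by simp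
   hence "c = \<zero>[?C',i + n]" using gc c(2) by (simp add: gmod_shift_def sub_mod_def)
   thus False using r(3) c(2) hom_zero[OF C' EM hh] by simp
  qed
 qed
 hence gm: "gmod_mono R E (gmod_shift d (I k)) ?g" using g' by (simp add: gmod_mono_def)
 have idE: "gmod_hom R E E (%n x. x)" by (simp add: gmod_hom_def)
 obtain \<pi> where \<pi>: "gmod_hom R (gmod_shift d (I k)) E \<pi>" "!!n a. a \<in> elts E n ==> \<pi> n (?g n a) = a"
  by (rule injective_extend[OF E inr EM shift_module[OF I_module] gm idE], rule that; assumption)
 have \<pi>': "gmod_hom R (I k) ?B (%n. \<pi> (n + - d))" using shift_hom[OF \<pi>(1), of "- d"] by (simp add: shift_shift)
 have "direct_summand R ?B (I k)" unfolding direct_summand_def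
 proof (intro exI conjI allI ballI)
  show "gmod_hom R ?B (I k) g" by (rule g(1))
  show "gmod_hom R (I k) ?B (%n. \<pi> (n + - d))" by (rule \<pi>')
  fix n a assume "a \<in> elts ?B n"
  hence "a \<in> elts E (n + - d)" by (simp add: gmod_shift_def)
  thus "\<pi> (n + - d) (g n a) = a" using \<pi>(2)[of a "n + - d"] by simp
 qed
 thus ?thesis unfolding supp_gmod_def using p res hull by blast
qed

theorem supp_gmod_eq:
 fixes M :: "('r, 'm) gmod"
 assumes "gmodule R M" "finitely_generated R M"
 shows "supp_gmod R M = {p \<in> Spec R. \<not> localization_zero R p M}"
using supp_gmod_torsion assms(1) torsion_supp_gmod assms by (force simp: supp_gmod_def)

text \<open>A homogeneous r of positive degree outside p has powers of arbitrarily large degree, so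
  it would make a module that vanishes in large degrees zero at p. For the converse, a prime
  containing the annihilator of a generator lies in the support and so contains all positive
  degrees; noetherian induction shows that the annihilator itself agrees with R in large
  degrees.\<close>

lemma bounded_iff_support:
 assumes M: "gmodule R M" and fg: "finitely_generated R M"
 shows "(EX N. \<forall>n\<ge>N. elts M n = {\<zero>[M,n]}) \<longleftrightarrow>
  (\<forall>p\<in>Spec R. \<not> localization_zero R p M --> (\<forall>d>0. deg R d <= p))"
proof
 interpret M: noetherian_graded_mod R M by (rule noetherian_graded_modI[OF M])
 assume "EX N. \<forall>n\<ge>N. elts M n = {\<zero>[M,n]}"
 then obtain N where N: "!!n. n \<ge> N ==> elts M n = {\<zero>[M,n]}" by blast
 show "\<forall>p\<in>Spec R. \<not> localization_zero R p M --> (\<forall>d>0. deg R d <= p)"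
 proof (intro ballI impI allI subsetI, rule ccontr)
  fix p d r assume p: "p \<in> Spec R" and nz: "\<not> localization_zero R p M" and d: "d > 0" and r: "r \<in> deg R d" "r \<notin> p"
  have np: "r [^] (k::nat) \<notin> p" for k
  proof (induction k)
   case 0 show ?case using Spec_one[OF p] by simp
  next
   case (Suc k) thus ?case using Spec_prime[OF p pow_deg[OF r(1)] r(1)] r(2) by auto
  qed
  have "tors R M p (null_sub M) n x" if x: "x \<in> elts M n" for n x
  proof -
   define k where "k = nat (N - n)"
   have "int k \<le> int k * d" using d by (simp add: mult_le_cancel_left1)
   moreover have "N - n \<le> int k" by (simp add: k_def)
   ultimately have "int k * d + n \<ge> N" by linarith
   hence "act M (int k * d) n (r [^] k) x \<in> null_sub M (int k * d + n)"
    using M.act_closed[OF pow_deg[OF r(1)] x refl] N by (auto simp: null_sub_def)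
   thus ?thesis unfolding tors_def using pow_deg[OF r(1)] np by blast
  qed
  thus False using nz M.localization_zero_iff[OF p] by blast
 qed
next
 interpret M: noetherian_graded_mod R M by (rule noetherian_graded_modI[OF M])
 assume sup: "\<forall>p\<in>Spec R. \<not> localization_zero R p M --> (\<forall>d>0. deg R d <= p)"
 have gen: "EX B. \<forall>n\<ge>B. \<forall>r\<in>deg R n. act M n e r m = \<zero>[M,n + e]" if m: "m \<in> elts M e" for e m
 proof -
  let ?A = "%n. {r \<in> deg R n. act M n e r m \<in> null_sub M (n + e)}"
  have A: "gideal R ?A" by (rule M.gideal_residual[OF M.sub_null m])
  have "(ALL n. ?A n <= J n) --> (EX B. \<forall>n\<ge>B. deg R n <= J n)" if "gideal R J" for J using that
  proof (induction rule: gideal_induct)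
   case whole show ?case by blast
  next
   case (prime q)
   show ?case
   proof
    assume Aq: "ALL n. ?A n <= q \<inter> deg R n"
    have "\<not> tors R M q (null_sub M) e m" using Aq unfolding tors_def by blast
    hence "\<not> localization_zero R q M" using M.localization_zero_iff[OF prime(1)] m by blast
    hence "\<forall>d>0. deg R d <= q" using sup prime(1) by blast
    thus "EX B. \<forall>n\<ge>B. deg R n <= q \<inter> deg R n" by (intro exI[of _ 1]) auto
   qed
  next
   case (split J a d)
   show ?case
   proof
    assume AJ: "ALL n. ?A n <= J n"
    have "ALL n. ?A n <= gadd R J d a n" using AJ gadd_incl(1)[OF split(1,2)] by blast
    then obtain B1 where B1: "!!n. n \<ge> B1 ==> deg R n <= gadd R J d a n" using split(3) by blast
    have "ALL n. ?A n <= gcol R J d a n" using AJ gcol_incl[OF split(1,2)] by blast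
    then obtain B2 where B2: "!!n. n \<ge> B2 ==> deg R n <= gcol R J d a n" using split(4) by blast
    show "EX B. \<forall>n\<ge>B. deg R n <= J n"
    \<comment> \<open>The coefficient s has degree n - d, so the bound for (J : a) has to be raised
      by d.\<close>
    proof (intro exI[of _ "max B1 (B2 + d)"] allI impI subsetI)
     fix n r assume n: "max B1 (B2 + d) \<le> n" and r: "r \<in> deg R n"
     then obtain j s where js: "r = j \<oplus> s \<otimes> a" "j \<in> J n" "s \<in> deg R (n - d)"
      using B1[of n] unfolding gadd_def by auto
     have "s \<in> gcol R J d a (n - d)" using B2[of "n - d"] n js(3) by auto
     thus "r \<in> J n" using js gideal_add_closed[OF split(1)] by (auto simp: gcol_def)
    qed
   qed
  qed
  from this[OF A] show ?thesis by (auto simp: null_sub_def)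
 qed
 obtain S where S: "finite S" "\<forall>(d, m)\<in>S. m \<in> elts M d"
  "!!N. gsub R N M ==> ALL n. null_sub M n <= N n ==> \<forall>(d, m)\<in>S. m \<in> N d ==> ALL n. elts M n <= N n"
  by (rule fg_overE[OF fg[unfolded M.fg_iff]], rule that; assumption)
 have "EX N B. gsub R N M \<and> (\<forall>(d, m)\<in>S. m \<in> N d) \<and> (\<forall>n\<ge>B. N n <= {\<zero>[M,n]})"
  using S(1,2)
 proof (induction S)
  case empty
  have "gsub R (null_sub M) M" by (rule M.sub_null)
  moreover have "null_sub M n <= {\<zero>[M,n]}" for n by (simp add: null_sub_def)
  ultimately show ?case by blast
 next
  case (insert g S)
  obtain e m where g: "g = (e, m)" by (cases g)
  have m: "m \<in> elts M e" using insert.prems g by auto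
  obtain N B where N: "gsub R N M" "\<forall>(d, m)\<in>S. m \<in> N d" "!!n. n \<ge> B ==> N n <= {\<zero>[M,n]}"
   using insert by auto
  obtain B' where B': "!!n r. n \<ge> B' ==> r \<in> deg R n ==> act M n e r m = \<zero>[M,n + e]" using gen[OF m] by blast
  show ?case
  proof (intro exI[of _ "add_cyclic R M N e m"] exI[of _ "max B (B' + e)"] conjI allI impI subsetI)
   show "gsub R (add_cyclic R M N e m) M" by (rule M.sub_add_cyclic[OF N(1) m])
   show "\<forall>(d, m')\<in>insert g S. m' \<in> add_cyclic R M N e m d" using M.add_cyclic_incl[OF N(1) m] N(2) g by blast
   fix n x assume n: "max B (B' + e) \<le> n" and x: "x \<in> add_cyclic R M N e m n"
   then obtain y r where yr: "x = y \<oplus>[M,n] act M (n - e) e r m" "y \<in> N n" "r \<in> deg R (n - e)"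
    unfolding add_cyclic_def by blast
   have "y = \<zero>[M,n]" using N(3)[of n] n yr(2) by auto
   moreover have "act M (n - e) e r m = \<zero>[M,n]" using B'[of "n - e" r] n yr(3) by simp
   ultimately show "x \<in> {\<zero>[M,n]}" using yr(1) by simp
  qed
 qed
 then obtain N B where N: "gsub R N M" "\<forall>(d, m)\<in>S. m \<in> N d" "!!n. n \<ge> B ==> N n <= {\<zero>[M,n]}" by blast
 have "ALL n. null_sub M n <= N n" using M.sub_zero[OF N(1)] by (simp add: null_sub_def)
 hence "ALL n. elts M n <= N n" using S(3)[OF N(1)] N(2) by blast
 hence "\<forall>n\<ge>B. elts M n = {\<zero>[M,n]}" using N(3) M.G.zero_closed by blast
 thus "EX N. \<forall>n\<ge>N. elts M n = {\<zero>[M,n]}" by blast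
qed

end

section \<open>Triangulated categories\<close>

text \<open>Integer powers of a bijection of A; suspension on objects and on morphisms are both
  instances.\<close>

definition zpow :: "'a set => ('a => 'a) => int => 'a => 'a" where
 "zpow A s n x = (if 0 \<le> n then (s ^^ nat n) x else (inv_into A s ^^ nat (- n)) x)"

lemma zpow_succ:
 assumes s: "bij_betw s A A" and x: "x \<in> A"
 shows "zpow A s n x \<in> A" "zpow A s (n + 1) x = s (zpow A s n x)"
proof -
 have sA: "s y \<in> A" "inv_into A s y \<in> A" "s (inv_into A s y) = y" if "y \<in> A" for y
  using s that by (auto simp: bij_betw_def intro: inv_into_into f_inv_into_f)
 have 1: "(s ^^ k) x \<in> A" "(inv_into A s ^^ k) x \<in> A" for k by (induction k) (use x sA in auto)
 show "zpow A s n x \<in> A" using 1 by (simp add: zpow_def)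
 show "zpow A s (n + 1) x = s (zpow A s n x)"
 proof (cases "0 \<le> n")
  case True
  hence "nat (n + 1) = Suc (nat n)" by simp
  thus ?thesis using True by (simp add: zpow_def)
 next
  case False
  hence k: "nat (- n) = Suc (nat (- (n + 1)))" by simp
  have "zpow A s n x = inv_into A s ((inv_into A s ^^ nat (- (n + 1))) x)" using False by (simp only: zpow_def k) simp
  moreover have "zpow A s (n + 1) x = (inv_into A s ^^ nat (- (n + 1))) x" using False by (cases "n = - 1") (auto simp: zpow_def)
  ultimately show ?thesis using sA(3)[OF 1(2)] by simp
 qed
qed

lemma zpow_add:
 assumes s: "bij_betw s A A" and x: "x \<in> A"
 shows "zpow A s (m + n) x = zpow A s m (zpow A s n x)"
proof (induction m rule: int_induct[of _ 0])
 case base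
 show ?case by (simp add: zpow_def)
next
 case (step1 m)
 have "zpow A s (m + n + 1) x = s (zpow A s m (zpow A s n x))" using zpow_succ(2)[OF s x, of "m + n"] step1 by simp
 thus ?case using zpow_succ(2)[OF s zpow_succ(1)[OF s x], of m n] by (simp add: algebra_simps)
next
 case (step2 m)
 have y: "zpow A s n x \<in> A" by (rule zpow_succ(1)[OF s x])
 have "s (zpow A s (m - 1 + n) x) = zpow A s (m + n) x" using zpow_succ(2)[OF s x, of "m - 1 + n"] by (simp add: algebra_simps)
 also have "... = s (zpow A s (m - 1) (zpow A s n x))" using zpow_succ(2)[OF s y, of "m - 1"] step2 by simp
 finally show ?case using s zpow_succ(1)[OF s x] zpow_succ(1)[OF s y] by (auto simp: bij_betw_def dest: inj_onD)
qed

lemma susp_obj_zpow: "susp_obj T n = zpow (Obj T) (sus_obj T) n"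
 by (rule ext) (simp add: susp_obj_def zpow_def)

lemma susp_mor_zpow: "susp_mor T n = zpow (arrows T) (sus_mor T) n"
 by (rule ext) (simp add: susp_mor_def zpow_def)

lemma susp_0 [simp]: "susp_obj T 0 X = X" "susp_mor T 0 f = f"
 by (simp_all add: susp_obj_def susp_mor_def)

context additive_category
begin

abbreviation "ob X \<equiv> X \<in> Obj T"
abbreviation "arr f \<equiv> f \<in> arrows T"
abbreviation "zr X Y \<equiv> zero_mor T X Y"
abbreviation "idt X \<equiv> ident T X"
abbreviation plus_abbrev (infixl "+." 65) where "f +. g \<equiv> plus_mor T f g"

text \<open>Disjointness of the sets of morphisms makes source and target functions of the morphism.
  Together with \<open>mor_iff\<close> they let the simplifier check composability, and
  \<open>nul\<close> expresses vanishing without naming the objects.\<close>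

definition dm :: "'b => 'a" where "dm f = (SOME X. EX Y. ob X \<and> ob Y \<and> f \<in> Hom T X Y)"
definition cd :: "'b => 'a" where "cd f = (SOME Y. EX X. ob X \<and> ob Y \<and> f \<in> Hom T X Y)"
definition mor :: "'b => 'a => 'a => bool" where "mor f X Y \<longleftrightarrow> ob X \<and> ob Y \<and> f \<in> Hom T X Y"
definition ng :: "'b => 'b" where "ng f = neg_mor T (dm f) (cd f) f"
definition nul :: "'b => bool" where "nul f \<longleftrightarrow> f = zr (dm f) (cd f)"

lemma mor_dm_cd: "mor f X Y ==> dm f = X \<and> cd f = Y"
using someI_ex Hom_disjoint by (auto simp: dm_def mor_def cd_def)

lemma arr_mor: assumes "arr f" shows "mor f (dm f) (cd f)"
using assms conjunct1 mor_dm_cd conjunct2 by (auto simp: arrows_def mor_def)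

lemma arr_ob [simp]: "arr f ==> ob (dm f)" "arr f ==> ob (cd f)" and arrE: "arr f ==> f \<in> Hom T (dm f) (cd f)"
 using arr_mor unfolding mor_def by auto

lemma mor_iff [simp]: "mor f X Y \<longleftrightarrow> arr f \<and> dm f = X \<and> cd f = Y \<and> ob X \<and> ob Y"
using mor_dm_cd arr_mor by (auto simp: mor_def arrows_def)

lemma Hom_mor: "ob X ==> ob Y ==> f \<in> Hom T X Y \<longleftrightarrow> mor f X Y"
 by (simp only: mor_def simp_thms)

lemma cmp_arr [simp]:
 assumes "arr f" "arr g" "cd f = dm g"
 shows "arr (g \<cdot> f)" "dm (g \<cdot> f) = dm f" "cd (g \<cdot> f) = cd g"
 using cmp_Hom[of "dm f" "dm g" "cd g" f g] assms arrE[of f] arrE[of g] by (simp_all add: Hom_mor)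

lemma cmp_assoc' [simp]:
 assumes "arr f" "arr g" "arr h" "cd f = dm g" "cd g = dm h"
 shows "(h \<cdot> g) \<cdot> f = h \<cdot> (g \<cdot> f)"
 using cmp_assoc[of "dm f" "dm g" "dm h" "cd h" f g h] assms arrE[of f] arrE[of g] arrE[of h] by simp

lemma ident_arr [simp]:
 assumes "ob X" shows "arr (idt X)" "dm (idt X) = X" "cd (idt X) = X"
 using ident_Hom[OF assms] assms by (simp_all add: Hom_mor)

lemma cmp_idt [simp]: "arr f ==> cd f = X ==> idt X \<cdot> f = f" "arr f ==> dm f = X ==> f \<cdot> idt X = f"
 using ident_cmp[of "dm f" "cd f" f] cmp_ident[of "dm f" "cd f" f] arrE[of f] by auto

lemma zr_arr [simp]:
 assumes "ob X" "ob Y" shows "arr (zr X Y)" "dm (zr X Y) = X" "cd (zr X Y) = Y"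
 using abelian_monoid.zero_closed[OF abelian_group.axioms(1)[OF hom_abelian[OF assms]]] assms by (simp_all add: hom_group_def Hom_mor)

lemma plus_arr [simp]:
 assumes "arr f" "arr g" "dm f = dm g" "cd f = cd g"
 shows "arr (f +. g)" "dm (f +. g) = dm g" "cd (f +. g) = cd g"
 using abelian_monoid.a_closed[OF abelian_group.axioms(1)[OF hom_abelian[of "dm f" "cd f"]], of f g] assms arrE[of f] arrE[of g]
 by (simp_all add: hom_group_def Hom_mor)

lemma ng_arr [simp]: assumes "arr f" shows "arr (ng f)" "dm (ng f) = dm f" "cd (ng f) = cd f"
 using abelian_group.a_inv_closed[OF hom_abelian[of "dm f" "cd f"], of f] assms arrE[of f]
 by (simp_all add: hom_group_def Hom_mor ng_def neg_mor_def)

lemma plus_zr [simp]: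
 assumes "arr f" "dm f = X" "cd f = Y" shows "f +. zr X Y = f" "zr X Y +. f = f"
 using abelian_monoid.r_zero[OF abelian_group.axioms(1)[OF hom_abelian[of "dm f" "cd f"]], of f]
  abelian_monoid.l_zero[OF abelian_group.axioms(1)[OF hom_abelian[of "dm f" "cd f"]], of f] assms arrE[of f] by (auto simp: hom_group_def)

lemma plus_ng: assumes "arr f" shows "f +. ng f = zr (dm f) (cd f)" "ng f +. f = zr (dm f) (cd f)"
 using abelian_group.r_neg[OF hom_abelian[of "dm f" "cd f"], of f] abelian_group.l_neg[OF hom_abelian[of "dm f" "cd f"], of f]
  assms arrE[of f] by (auto simp: hom_group_def neg_mor_def ng_def)

lemma plus_assoc:
 assumes "arr f" "arr g" "arr h" "dm f = dm g" "cd f = cd g" "dm h = dm g" "cd h = cd g"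
 shows "(f +. g) +. h = f +. (g +. h)" using abelian_monoid.a_assoc[OF abelian_group.axioms(1)[OF hom_abelian[of "dm f" "cd f"]], of f g h]
  assms arrE[of f] arrE[of g] arrE[of h] by (auto simp: hom_group_def)

lemma plus_dist:
 assumes "arr f" "arr g" "arr h" "dm f = dm g" "cd f = cd g"
 shows "dm h = cd g ==> h \<cdot> (f +. g) = (h \<cdot> f) +. (h \<cdot> g)" "cd h = dm g ==> (f +. g) \<cdot> h = (f \<cdot> h) +. (g \<cdot> h)"
 using plus_cmp[of "dm f" "cd f" "cd h" f g h] cmp_plus[of "dm h" "cd h" "cd f" h f g]
  assms arrE[of f] arrE[of g] arrE[of h] by auto

lemma diff_zr:
 assumes "arr f" "arr g" "dm f = dm g" "cd f = cd g" "nul (f +. ng g)" shows "f = g"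
proof -
 have "(f +. ng g) +. g = g" using assms by (simp add: nul_def)
 thus ?thesis using assms by (simp add: plus_assoc plus_ng)
qed

lemma plus_eq_zr: assumes "arr f" "arr g" "dm f = dm g" "cd f = cd g" "f +. g = zr (dm g) (cd g)" shows "f = ng g"
proof -
 have "f = (f +. g) +. ng g" by (subst plus_assoc) (use assms in \<open>simp_all add: plus_ng\<close>)
 thus ?thesis using assms by simp
qed

lemma ng_ng [simp]: "arr f ==> ng (ng f) = f"
 using plus_eq_zr[of f "ng f"] plus_ng[of f] by simp

lemma nul_self: assumes "arr f" "f +. f = f" shows "nul f"
proof -
 have "f = (f +. f) +. ng f" by (subst plus_assoc) (use assms(1) in \<open>simp_all add: plus_ng\<close>)
 thus ?thesis using assms plus_ng(1)[of f] by (simp add: nul_def)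
qed

lemma nul_double: "arr f ==> nul f ==> f +. f = f"
 unfolding nul_def by (metis plus_zr(1))

lemma nul_cmp: assumes "arr f" "arr g" "cd f = dm g" "nul f \<or> nul g" shows "nul (g \<cdot> f)"
proof (rule nul_self)
 show "(g \<cdot> f) +. (g \<cdot> f) = g \<cdot> f" using assms(4)
 by (metis nul_double assms(1) plus_dist(1) assms(1-3) assms(2) plus_dist(2))
qed (use assms in simp)

lemma nul_zr [simp]: "ob X ==> ob Y ==> nul (zr X Y)"
 by (simp add: nul_def)

lemma nul_eq: "nul f ==> nul g ==> dm f = dm g ==> cd f = cd g ==> f = g"
 unfolding nul_def by metis

lemma nul_iff: "mor f X Y ==> nul f \<longleftrightarrow> f = zr X Y"
 by (auto simp: nul_def)

lemma ng_zr [simp]: "ob X ==> ob Y ==> ng (zr X Y) = zr X Y"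
 using plus_eq_zr[of "zr X Y" "zr X Y"] by simp

lemma nul_ng [simp]: "arr f ==> nul (ng f) \<longleftrightarrow> nul f"
 using ng_ng[of f] ng_zr[of "dm f" "cd f"] by (metis arr_ob ng_arr(2,3) nul_def)

lemma nul_plus: "arr f ==> arr g ==> dm f = dm g ==> cd f = cd g ==> nul f ==> nul g ==> nul (f +. g)"
 using nul_double nul_eq by metis

lemma cmp_ng [simp]:
 assumes "arr f" "arr g" "cd f = dm g" shows "g \<cdot> ng f = ng (g \<cdot> f)" "ng g \<cdot> f = ng (g \<cdot> f)"
proof -
 have "nul (g \<cdot> (ng f +. f))" "nul ((ng g +. g) \<cdot> f)"
  using nul_cmp[of "ng f +. f" g] nul_cmp[of f "ng g +. g"] assms by (simp_all add: plus_ng)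
 thus "g \<cdot> ng f = ng (g \<cdot> f)" "ng g \<cdot> f = ng (g \<cdot> f)"
  using assms plus_eq_zr[of "g \<cdot> ng f" "g \<cdot> f"] plus_eq_zr[of "ng g \<cdot> f" "g \<cdot> f"] by (simp_all add: plus_dist nul_def)
qed

lemma zero_obj_nul:
 assumes "zero_obj T Z" "arr f" "dm f = Z \<or> cd f = Z" shows "nul f"
proof -
 have "nul (idt Z)" "ob Z" using assms(1) by (auto simp: zero_obj_def nul_def)
 thus ?thesis using nul_cmp[of f "idt Z"] nul_cmp[of "idt Z" f] assms(2,3) by auto
qed

lemma zero_obj_iff: "ob Z ==> zero_obj T Z \<longleftrightarrow> nul (idt Z)"
 by (auto simp: zero_obj_def nul_def)

text \<open>The two morphisms of an exact pair are a weak kernel and a weak cokernel of each other.\<close>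

definition expair :: "'b => 'b => bool" where
 "expair f g \<longleftrightarrow> arr f \<and> arr g \<and> cd f = dm g \<and> nul (g \<cdot> f) \<and>
   (ALL u. arr u --> cd u = dm g --> nul (g \<cdot> u) --> (EX v. mor v (dm u) (dm f) \<and> f \<cdot> v = u)) \<and>
   (ALL u. arr u --> dm u = dm g --> nul (u \<cdot> f) --> (EX v. mor v (cd g) (cd u) \<and> v \<cdot> g = u))"

lemma expairD:
 assumes "expair f g"
 shows "arr f" "arr g" "cd f = dm g" "nul (g \<cdot> f)"
  "arr u ==> cd u = dm g ==> nul (g \<cdot> u) ==> EX v. mor v (dm u) (dm f) \<and> f \<cdot> v = u"
  "arr u ==> dm u = dm g ==> nul (u \<cdot> f) ==> EX v. mor v (cd g) (cd u) \<and> v \<cdot> g = u"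
 using assms unfolding expair_def by auto

text \<open>Rotating a triangle introduces a sign; exactness of a pair ignores it.\<close>

lemma expair_ng: assumes "arr f" "arr g" shows "expair (ng f) g \<longleftrightarrow> expair f g" "expair f (ng g) \<longleftrightarrow> expair f g"
proof -
 have 1: "expair (ng f) g" if e: "expair f g" for f g
 proof -
  note E = expairD[OF e]
  have "EX v. mor v (dm u) (dm (ng f)) \<and> ng f \<cdot> v = u" if u: "arr u" "cd u = dm g" "nul (g \<cdot> u)" for u
  proof -
   obtain v where "mor v (dm u) (dm f)" "f \<cdot> v = u" using E(5)[OF u] by blast
   thus ?thesis using E(1) u(1) by (intro exI[of _ "ng v"]) simp
  qed
  moreover have "EX v. mor v (cd g) (cd u) \<and> v \<cdot> g = u" if "arr u" "dm u = dm g" "nul (u \<cdot> ng f)" for u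
   using E(6)[of u] that E(1,3) by simp
  ultimately show ?thesis using E(1-4) by (simp add: expair_def)
 qed
 have 2: "expair f (ng g)" if e: "expair f g" for f g
 proof -
  note E = expairD[OF e]
  have "EX v. mor v (cd (ng g)) (cd u) \<and> v \<cdot> ng g = u" if u: "arr u" "dm u = dm (ng g)" "nul (u \<cdot> f)" for u
  proof -
   obtain v where "mor v (cd g) (cd u)" "v \<cdot> g = u" using E(6)[of u] u E(2) by auto
   thus ?thesis using E(2) u(1) by (intro exI[of _ "ng v"]) simp
  qed
  moreover have "EX v. mor v (dm u) (dm f) \<and> f \<cdot> v = u" if "arr u" "cd u = dm (ng g)" "nul (ng g \<cdot> u)" for u
   using E(5)[of u] that E(2) by simp
  ultimately show ?thesis using E(1-4) by (simp add: expair_def)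
 qed
 show "expair (ng f) g \<longleftrightarrow> expair f g" "expair f (ng g) \<longleftrightarrow> expair f g"
  using 1[of f g] 1[of "ng f" g] 2[of f g] 2[of f "ng g"] unfolding ng_ng[OF assms(1)] ng_ng[OF assms(2)] by blast+
qed

lemma expair_iso:
 assumes "expair e f" "nul e" "expair f g" "nul g"
 shows "iso_mor T (dm f) (cd f) f"
proof -
 note E = expairD[OF assms(1)] and F = expairD[OF assms(3)]
 obtain k where k: "mor k (cd f) (dm f)" "k \<cdot> f = idt (dm f)" using E(6)[of "idt (dm f)"] assms(2) E(1-3) by auto
 obtain l where l: "mor l (cd f) (dm f)" "f \<cdot> l = idt (cd f)" using F(5)[of "idt (cd f)"] assms(4) F(1-3) by auto
 have "k = k \<cdot> (f \<cdot> l)" using k l F(1) by simp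
 also have "... = (k \<cdot> f) \<cdot> l" using k(1) l(1) F(1) by simp
 finally have "k = l" using k(2) l(1) by simp
 thus ?thesis using k l F(1) unfolding iso_mor_def by (metis Hom_mor arr_ob mor_iff)
qed

lemma iso_morE:
 assumes "iso_mor T X Y f" "ob X" "ob Y"
 obtains g where "mor f X Y" "mor g Y X" "g \<cdot> f = idt X" "f \<cdot> g = idt Y" using assms unfolding iso_mor_def by (metis Hom_mor)

lemma iso_morI:
 assumes "mor f X Y" "mor g Y X" "g \<cdot> f = idt X" "f \<cdot> g = idt Y"
 shows "iso_obj T X Y" using assms Hom_mor unfolding iso_mor_def iso_obj_def by (metis mor_iff)

end

section \<open>Suspension and exact triangles\<close>

context triangulated_category
begin

abbreviation "so n X \<equiv> susp_obj T n X"
abbreviation "sm n f \<equiv> susp_mor T n f"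

lemma sus_arr:
 assumes "arr f" shows "arr (\<Sigma>\<^sub>m f)" "dm (\<Sigma>\<^sub>m f) = \<Sigma>\<^sub>o (dm f)" "cd (\<Sigma>\<^sub>m f) = \<Sigma>\<^sub>o (cd f)"
proof -
 have "\<Sigma>\<^sub>m f \<in> Hom T (\<Sigma>\<^sub>o (dm f)) (\<Sigma>\<^sub>o (cd f))" "ob (\<Sigma>\<^sub>o (dm f))" "ob (\<Sigma>\<^sub>o (cd f))"
  using sus_mor_bij[of "dm f" "cd f"] sus_obj_bij arrE[OF assms] assms by (auto simp: bij_betw_def)
 thus "arr (\<Sigma>\<^sub>m f)" "dm (\<Sigma>\<^sub>m f) = \<Sigma>\<^sub>o (dm f)" "cd (\<Sigma>\<^sub>m f) = \<Sigma>\<^sub>o (cd f)" by (simp_all add: Hom_mor)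
qed

lemma sus_obj_eq: "ob X ==> ob Y ==> \<Sigma>\<^sub>o X = \<Sigma>\<^sub>o Y \<longleftrightarrow> X = Y"
 using sus_obj_bij by (auto simp: bij_betw_def dest: inj_onD)

lemma sus_mor_arrows: "bij_betw \<Sigma>\<^sub>m (arrows T) (arrows T)"
 unfolding bij_betw_def
proof
 show "inj_on \<Sigma>\<^sub>m (arrows T)"
 proof (rule inj_onI)
  fix f g assume *: "arr f" "arr g" and e: "\<Sigma>\<^sub>m f = \<Sigma>\<^sub>m g"
  hence "dm f = dm g" "cd f = cd g" using sus_arr[of f] sus_arr[of g] sus_obj_eq by auto
  thus "f = g" using * e sus_mor_bij[of "dm f" "cd f"] arrE[of f] arrE[of g] by (auto simp: bij_betw_def dest: inj_onD)
 qed
 show "\<Sigma>\<^sub>m ` arrows T = arrows T"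
 proof
  show "\<Sigma>\<^sub>m ` arrows T <= arrows T" using sus_arr by auto
  show "arrows T <= \<Sigma>\<^sub>m ` arrows T"
  proof
   fix h assume h: "arr h"
   have "dm h \<in> \<Sigma>\<^sub>o ` Obj T" "cd h \<in> \<Sigma>\<^sub>o ` Obj T" using h sus_obj_bij by (simp_all add: bij_betw_def)
   then obtain X Y where "ob X" "ob Y" "dm h = \<Sigma>\<^sub>o X" "cd h = \<Sigma>\<^sub>o Y" by blast
   hence "h \<in> \<Sigma>\<^sub>m ` Hom T X Y" "Hom T X Y <= arrows T"
    using sus_mor_bij[of X Y] arrE[OF h] by (auto simp: bij_betw_def arrows_def)
   thus "h \<in> \<Sigma>\<^sub>m ` arrows T" by blast
  qed
 qed
qed

lemma so_ob [simp]: "ob X ==> ob (so n X)"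
 using zpow_succ(1)[OF sus_obj_bij] by (simp add: susp_obj_zpow)

lemma so_succ: "ob X ==> so (n + 1) X = \<Sigma>\<^sub>o (so n X)"
 using zpow_succ(2)[OF sus_obj_bij] by (simp add: susp_obj_zpow)

lemma so_so [simp]: "ob X ==> so m (so n X) = so (m + n) X"
 using zpow_add[OF sus_obj_bij] by (simp add: susp_obj_zpow)

lemma sm_succ: "arr f ==> sm (n + 1) f = \<Sigma>\<^sub>m (sm n f)"
 using zpow_succ(2)[OF sus_mor_arrows] by (simp add: susp_mor_zpow)

lemma sm_sm [simp]: "arr f ==> sm m (sm n f) = sm (m + n) f"
 using zpow_add[OF sus_mor_arrows] by (simp add: susp_mor_zpow)

lemma arr_sm [simp]: "arr f ==> arr (sm n f)"
 using zpow_succ(1)[OF sus_mor_arrows] by (simp add: susp_mor_zpow)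

lemma sus_susp: "ob X ==> \<Sigma>\<^sub>o X = so 1 X" "arr f ==> \<Sigma>\<^sub>m f = sm 1 f"
 using so_succ[of X 0] sm_succ[of f 0] by simp_all

lemma sus_mor_eq: "arr f ==> arr g ==> \<Sigma>\<^sub>m f = \<Sigma>\<^sub>m g \<longleftrightarrow> f = g"
 using sus_mor_arrows by (auto simp: bij_betw_def dest: inj_onD)

lemma sm_eq: assumes "arr f" "arr g" shows "sm n f = sm n g \<longleftrightarrow> f = g"
proof
 assume "sm n f = sm n g"
 hence "sm (- n) (sm n f) = sm (- n) (sm n g)" by simp
 thus "f = g" using assms by simp
qed simp

lemma int_shift_induct:
 assumes "P 0" "!!n. P n \<longleftrightarrow> P (n + 1)" shows "P (n :: int)"
 by (induction n rule: int_induct[of _ 0]) (use assms(1) assms(2)[of "_ - 1"] assms(2) in auto)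

lemma sm_dm_cd [simp]:
 assumes "arr f" shows "dm (sm n f) = so n (dm f)" "cd (sm n f) = so n (cd f)"
proof -
 have "dm (sm n f) = so n (dm f) \<and> cd (sm n f) = so n (cd f)"
 proof (rule int_shift_induct[of _ n])
  fix k
  have "dm (sm (k + 1) f) = \<Sigma>\<^sub>o (dm (sm k f))" "cd (sm (k + 1) f) = \<Sigma>\<^sub>o (cd (sm k f))"
   using sus_arr[of "sm k f"] assms by (simp_all add: sm_succ)
  thus "(dm (sm k f) = so k (dm f) \<and> cd (sm k f) = so k (cd f)) \<longleftrightarrow>
    (dm (sm (k + 1) f) = so (k + 1) (dm f) \<and> cd (sm (k + 1) f) = so (k + 1) (cd f))"
   using assms by (simp add: so_succ sus_obj_eq)
 qed simp
 thus "dm (sm n f) = so n (dm f)" "cd (sm n f) = so n (cd f)" by auto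
qed

lemma sm_idt [simp]: assumes "ob X" shows "sm n (idt X) = idt (so n X)"
proof (rule int_shift_induct[of "%n. sm n (idt X) = idt (so n X)"])
 fix k show "sm k (idt X) = idt (so k X) \<longleftrightarrow> sm (k + 1) (idt X) = idt (so (k + 1) X)"
  using assms sus_ident[of "so k X"] sus_mor_eq[of "sm k (idt X)" "idt (so k X)"] by (simp add: sm_succ so_succ)
qed simp

lemma sm_cmp [simp]:
 assumes "arr f" "arr g" "cd f = dm g" shows "sm n (g \<cdot> f) = sm n g \<cdot> sm n f"
proof (rule int_shift_induct[of "%n. sm n (g \<cdot> f) = sm n g \<cdot> sm n f"])
 fix k
 have "\<Sigma>\<^sub>m (sm k g \<cdot> sm k f) = \<Sigma>\<^sub>m (sm k g) \<cdot> \<Sigma>\<^sub>m (sm k f)"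
  using assms sus_cmp[of "so k (dm f)" "so k (dm g)" "so k (cd g)" "sm k f" "sm k g"] by (simp add: Hom_mor)
 thus "sm k (g \<cdot> f) = sm k g \<cdot> sm k f \<longleftrightarrow> sm (k + 1) (g \<cdot> f) = sm (k + 1) g \<cdot> sm (k + 1) f"
  using assms sus_mor_eq[of "sm k (g \<cdot> f)" "sm k g \<cdot> sm k f"] by (simp add: sm_succ)
qed simp

lemma sm_plus [simp]:
 assumes "arr f" "arr g" "dm f = dm g" "cd f = cd g" shows "sm n (f +. g) = sm n f +. sm n g"
proof (rule int_shift_induct[of "%n. sm n (f +. g) = sm n f +. sm n g"])
 fix k
 have "\<Sigma>\<^sub>m (sm k f +. sm k g) = \<Sigma>\<^sub>m (sm k f) +. \<Sigma>\<^sub>m (sm k g)"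
  using assms sus_plus[of "so k (dm f)" "so k (cd f)" "sm k f" "sm k g"] by (simp add: Hom_mor)
 thus "sm k (f +. g) = sm k f +. sm k g \<longleftrightarrow> sm (k + 1) (f +. g) = sm (k + 1) f +. sm (k + 1) g"
  using assms sus_mor_eq[of "sm k (f +. g)" "sm k f +. sm k g"] by (simp add: sm_succ)
qed simp

lemma nul_sm [simp]: assumes "arr f" shows "nul (sm n f) \<longleftrightarrow> nul f"
proof -
 have *: "nul (sm n f)" if "arr f" "nul f" for n f by (rule nul_self) (use that sm_plus[of f f n] nul_double[of f] in simp_all)
 show ?thesis using *[of f n] *[of "sm n f" "- n"] assms by auto
qed

lemma sm_ng [simp]: assumes "arr f" shows "sm n (ng f) = ng (sm n f)"
proof (rule plus_eq_zr)
 have "nul (sm n (ng f +. f))" using assms by (simp add: plus_ng)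
 thus "sm n (ng f) +. sm n f = zr (dm (sm n f)) (cd (sm n f))" using assms by (simp add: nul_def)
qed (use assms in simp_all)

lemma expair_sm: assumes "expair f g" shows "expair (sm n f) (sm n g)"
proof -
 note E = expairD[OF assms]
 have "EX v. mor v (dm u) (so n (dm f)) \<and> sm n f \<cdot> v = u" if u: "arr u" "cd u = so n (dm g)" "nul (sm n g \<cdot> u)" for u
 proof -
  have "nul (sm (- n) (sm n g \<cdot> u))" by (subst nul_sm) (use u E in simp_all)
  hence "nul (g \<cdot> sm (- n) u)" using u E by simp
  then obtain v where v: "mor v (so (- n) (dm u)) (dm f)" "f \<cdot> v = sm (- n) u" using E(5)[of "sm (- n) u"] u E by auto
  have "sm n f \<cdot> sm n v = sm n (f \<cdot> v)" using v(1) E by simp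
  also have "... = u" unfolding v(2) using u by simp
  finally show ?thesis using v(1) u E by (auto intro!: exI[of _ "sm n v"])
 qed
 moreover have "EX v. mor v (so n (cd g)) (cd u) \<and> v \<cdot> sm n g = u" if u: "arr u" "dm u = so n (dm g)" "nul (u \<cdot> sm n f)" for u
 proof -
  have "nul (sm (- n) (u \<cdot> sm n f))" by (subst nul_sm) (use u E in simp_all)
  hence "nul (sm (- n) u \<cdot> f)" using u E by simp
  then obtain v where v: "mor v (cd g) (so (- n) (cd u))" "v \<cdot> g = sm (- n) u" using E(6)[of "sm (- n) u"] u E by auto
  have "sm n v \<cdot> sm n g = sm n (v \<cdot> g)" using v(1) E by simp
  also have "... = u" unfolding v(2) using u by simp
  finally show ?thesis using v(1) u E by (auto intro!: exI[of _ "sm n v"])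
 qed
 moreover have "nul (sm n g \<cdot> sm n f)" using E nul_sm[of "g \<cdot> f" n] by simp
 ultimately show ?thesis using E(1-3) by (simp add: expair_def)
qed

lemma triD:
 assumes "exact_tri T X Y Z f g h"
 shows "mor f X Y" "mor g Y Z" "mor h Z (so 1 X)"
 using assms sus_obj_bij by (auto simp only: exact_tri_def mor_def sus_susp bij_betw_def so_ob)

lemma tri_rotate:
 assumes "exact_tri T X Y Z f g h" shows "exact_tri T Y Z (so 1 X) g h (ng (sm 1 f))"
proof -
 note D = triD[OF assms]
 have "exact_tri T Y Z (\<Sigma>\<^sub>o X) g h (neg_mor T (\<Sigma>\<^sub>o X) (\<Sigma>\<^sub>o Y) (\<Sigma>\<^sub>m f))"
  using TR2[of X Y Z f g h] D assms by (simp add: Hom_mor sus_susp)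
 moreover have "neg_mor T (\<Sigma>\<^sub>o X) (\<Sigma>\<^sub>o Y) (\<Sigma>\<^sub>m f) = ng (sm 1 f)" using D by (auto simp: sus_susp ng_def)
 ultimately show ?thesis using D(1) by (simp add: sus_susp)
qed

lemma tri_unrotate:
 assumes "mor f X Y" "mor g Y Z" "mor h Z (so 1 X)" "exact_tri T Y Z (so 1 X) g h (ng (sm 1 f))"
 shows "exact_tri T X Y Z f g h" using assms sus_susp TR2 Hom_mor by (fastforce simp: ng_def)

lemma tri_TR3:
 assumes "exact_tri T X Y Z f g h" "exact_tri T X' Y' Z' f' g' h'" "mor a X X'" "mor b Y Y'" "b \<cdot> f = f' \<cdot> a"
 shows "EX c. mor c Z Z' \<and> c \<cdot> g = g' \<cdot> b \<and> h' \<cdot> c = sm 1 a \<cdot> h"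
proof -
 obtain c where "c \<in> Hom T Z Z'" "c \<cdot> g = g' \<cdot> b" "h' \<cdot> c = \<Sigma>\<^sub>m a \<cdot> h"
  using TR3[OF assms(1,2) _ _ assms(5)] assms(3,4) by (auto simp add: Hom_mor)
 thus ?thesis using triD[OF assms(1)] triD[OF assms(2)] assms(3) by (intro exI[of _ c]) (simp add: Hom_mor sus_susp)
qed

lemma tri_ident:
 assumes "ob X" "zero_obj T Z" shows "exact_tri T X X Z (idt X) (zr X Z) (zr Z (so 1 X))"
 using TR1_ident[OF assms] assms by (simp add: sus_susp)

text \<open>Every morphism is up to sign a suspension, so exactness at the first object suffices.\<close>

lemma tri_expair1: assumes t: "exact_tri T X Y Z f g h" shows "expair f g"
proof -
 note D = triD[OF t]
 obtain Z0 where Z0: "zero_obj T Z0" using zero_exists by blast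
 hence o: "ob Z0" by (simp add: zero_obj_def)
 have n0: "nul u" if "arr u" "dm u = so n Z0 \<or> cd u = so n Z0" for u n
  by (rule zero_obj_nul[of "so n Z0"]) (use that o Z0 nul_sm[of "idt Z0" n] in \<open>simp_all add: zero_obj_iff\<close>)
 \<comment> \<open>Comparison with the triangle X = X -> 0 factors g f through a zero
   object.\<close>
 obtain c where c: "mor c Z0 Z" "c \<cdot> zr X Z0 = g \<cdot> f" using tri_TR3[OF tri_ident[OF _ Z0, of X] t, of "idt X" f] D by auto
 have "nul (c \<cdot> zr X Z0)" using nul_cmp[of "zr X Z0" c] c D o by simp
 hence gf: "nul (g \<cdot> f)" using c by simp
 have lift: "EX v. mor v (dm u) X \<and> f \<cdot> v = u" if u: "arr u" "cd u = dm g" "nul (g \<cdot> u)" for u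
 proof -
  let ?A = "dm u"
  have comm: "zr Z0 Z \<cdot> zr ?A Z0 = g \<cdot> u" by (rule nul_eq) (use u D o nul_cmp[of "zr ?A Z0" "zr Z0 Z"] in simp_all)
  \<comment> \<open>The completion axiom supplies the third map, so both triangles are rotated once;
    the desuspension of the filler is the lift of u.\<close>
  obtain c where c: "mor c (so 1 ?A) (so 1 X)" "ng (sm 1 f) \<cdot> c = sm 1 u \<cdot> ng (sm 1 (idt ?A))"
   using tri_TR3[OF tri_rotate[OF tri_ident[OF _ Z0, of ?A]] tri_rotate[OF t], of u "zr Z0 Z"] u D o comm by auto
  have "ng (ng (sm 1 f \<cdot> c)) = ng (ng (sm 1 u))" using c D u by simp
  hence "sm (- 1) (sm 1 f \<cdot> c) = sm (- 1) (sm 1 u)" using c(1) D u by simp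
  thus ?thesis using c(1) D u by (intro exI[of _ "sm (- 1) c"]) simp
 qed
 have ext: "EX v. mor v Z (cd u) \<and> v \<cdot> g = u" if u: "arr u" "dm u = dm g" "nul (u \<cdot> f)" for u
 proof -
  let ?B = "cd u" and ?Z = "so (- 1) Z0"
  have z: "zero_obj T (so 1 ?Z)" using Z0 o by simp
  \<comment> \<open>In this triangle the first object is zero and the second map is an identity; the
    third map supplied by the completion axiom is then a factorization of u through g.\<close>
  have "exact_tri T ?Z ?B ?B (zr ?Z ?B) (idt ?B) (zr ?B (so 1 ?Z))"
  proof (rule tri_unrotate)
   have "ng (sm 1 (zr ?Z ?B)) = zr (so 1 ?Z) (so 1 ?B)" by (rule nul_eq) (use u o in simp_all)
   thus "exact_tri T ?B ?B (so 1 ?Z) (idt ?B) (zr ?B (so 1 ?Z)) (ng (sm 1 (zr ?Z ?B)))" using tri_ident[OF _ z, of ?B] u by simp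
  qed (use u o in simp_all)
  moreover have "u \<cdot> f = zr ?Z ?B \<cdot> zr X ?Z" by (rule nul_eq) (use u D o nul_cmp[of "zr X ?Z" "zr ?Z ?B"] in simp_all)
  ultimately obtain c where "mor c Z ?B" "c \<cdot> g = idt ?B \<cdot> u"
   using tri_TR3[OF t, of ?Z ?B ?B "zr ?Z ?B" "idt ?B" "zr ?B (so 1 ?Z)" "zr X ?Z" u] u D o by (auto simp del: so_so)
  thus ?thesis using u by auto
 qed
 show ?thesis using D gf lift ext by (simp add: expair_def)
qed

lemma tri_expair:
 assumes t: "exact_tri T X Y Z f g h" shows "expair f g" "expair g h" "expair h (sm 1 f)" "expair (sm (- 1) h) f"
proof -
 note D = triD[OF t]
 show "expair f g" "expair g h" using tri_expair1[OF t] tri_expair1[OF tri_rotate[OF t]] .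
 show 3: "expair h (sm 1 f)" using tri_expair1[OF tri_rotate[OF tri_rotate[OF t]]] D by (simp add: expair_ng)
 show "expair (sm (- 1) h) f" using expair_sm[OF 3, of "- 1"] D by simp
qed

lemma cone_exists: assumes "arr f" obtains Z g h where "exact_tri T (dm f) (cd f) Z f g h"
 using TR1_cone[of "dm f" "cd f" f] arrE[OF assms] assms by auto

lemma zero_obj_so: "ob X ==> zero_obj T (so n X) \<longleftrightarrow> zero_obj T X"
 using nul_sm[of "idt X" n] by (simp add: zero_obj_iff)

lemma triangulated_sub_two:
 assumes S: "triangulated_sub T S" and t: "exact_tri T X Y Z f g h"
 shows "X \<in> S ==> Y \<in> S ==> Z \<in> S" "X \<in> S ==> Z \<in> S ==> Y \<in> S" "Y \<in> S ==> Z \<in> S ==> X \<in> S"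
proof -
 have c: "!!X Y Z f g h. exact_tri T X Y Z f g h ==> X \<in> S ==> Y \<in> S ==> Z \<in> S"
  and s: "!!X n. X \<in> S ==> so n X \<in> S" using S unfolding triangulated_sub_def by blast+
 note D = triD[OF t]
 have unsus: "W \<in> S" if "so 1 W \<in> S" "ob W" for W using s[OF that(1), of "- 1"] that(2) by simp
 show "X \<in> S ==> Y \<in> S ==> Z \<in> S" by (rule c[OF t])
 show "Y \<in> S ==> Z \<in> S ==> X \<in> S" using c[OF tri_rotate[OF t]] unsus[of X] D(1) by simp
 show "X \<in> S ==> Z \<in> S ==> Y \<in> S" using c[OF tri_rotate[OF tri_rotate[OF t]]] s[of X 1] unsus[of Y] D(1) by simp
qed

end

section \<open>Coproducts and compact objects\<close>

lemma coproduct_reindex: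
 assumes j: "bij_betw j A B" and c: "coproduct T B F Y io"
 shows "coproduct T A (F \<circ> j) Y (io \<circ> j)"
proof -
 let ?k = "inv_into A j"
 have k: "?k b \<in> A" "j (?k b) = b" if "b \<in> B" for b using that j by (auto simp: bij_betw_def inv_into_into f_inv_into_f)
 have jA: "j a \<in> B" "?k (j a) = a" if "a \<in> A" for a using that j by (auto simp: bij_betw_def)
 have "\<exists>!h. h \<in> Hom T Y Z \<and> (\<forall>a\<in>A. h \<cdot>\<^bsub>T\<^esub> io (j a) = f a)"
  if Z: "Z \<in> Obj T" and f: "\<forall>a\<in>A. f a \<in> Hom T (F (j a)) Z" for Z f
 proof -
  have "\<forall>b\<in>B. f (?k b) \<in> Hom T (F b) Z" using f k by metis
  hence "\<exists>!h. h \<in> Hom T Y Z \<and> (\<forall>b\<in>B. h \<cdot>\<^bsub>T\<^esub> io b = f (?k b))"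
   using c Z by (simp add: coproduct_def)
  moreover have "(\<forall>a\<in>A. h \<cdot>\<^bsub>T\<^esub> io (j a) = f a) \<longleftrightarrow> (\<forall>b\<in>B. h \<cdot>\<^bsub>T\<^esub> io b = f (?k b))" for h
   using jA k by metis
  ultimately show ?thesis by simp
 qed
 moreover have "\<forall>a\<in>A. io (j a) \<in> Hom T (F (j a)) Y" "Y \<in> Obj T" using c jA by (auto simp: coproduct_def)
 ultimately show ?thesis unfolding coproduct_def o_def by blast
qed

context additive_category
begin

definition cop :: "'i set => ('i => 'a) => 'a => ('i => 'b) => bool" where
 "cop J F Y io \<longleftrightarrow> F \<in> J \<rightarrow> Obj T \<and> coproduct T J F Y io"

text \<open>The endomorphism of a coproduct that projects to the summands indexed by
  \<open>K\<close>. Factoring through a finite part, as in \<open>fin_factor\<close>, becomes an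
  equation e f = f and needs no choice of a finite coproduct.\<close>

definition trunc :: "'i set => ('i => 'b) => 'a => 'i set => 'b => bool" where
 "trunc J io Y K e \<longleftrightarrow> mor e Y Y \<and> (\<forall>i\<in>K. e \<cdot> io i = io i) \<and> (\<forall>i\<in>J - K. nul (e \<cdot> io i))"

lemma copD:
 assumes "cop J F Y io" shows "i \<in> J ==> mor (io i) (F i) Y" "ob Y"
proof -
 show Y: "ob Y" using assms by (auto simp: cop_def coproduct_def)
 show "i \<in> J ==> mor (io i) (F i) Y" using assms Y Hom_mor by (auto simp: cop_def coproduct_def Pi_iff)
qed

lemma cop_univ:
 assumes "cop J F Y io" "ob Z" "!!i. i \<in> J ==> mor (f i) (F i) Z"
 shows "\<exists>!h. mor h Y Z \<and> (\<forall>i\<in>J. h \<cdot> io i = f i)"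
using assms(2,3) Hom_mor assms(1,2) copD(2) assms(1) assms(2) by (simp add: cop_def coproduct_def)

lemma cop_ex:
 assumes "cop J F Y io" "ob Z" "!!i. i \<in> J ==> mor (f i) (F i) Z"
 shows "EX h. mor h Y Z \<and> (\<forall>i\<in>J. h \<cdot> io i = f i)" using ex1_implies_ex[OF cop_univ[OF assms]] .

lemma cop_eq:
 assumes c: "cop J F Y io" and "arr h" "arr h'" "dm h = Y" "dm h' = Y" "cd h = cd h'" "!!i. i \<in> J ==> h \<cdot> io i = h' \<cdot> io i"
 shows "h = h'"
proof -
 have "mor (h \<cdot> io i) (F i) (cd h)" if "i \<in> J" for i using copD[OF c] that assms(2,4) by simp
 from cop_univ[OF c _ this] have u: "\<exists>!h1. mor h1 Y (cd h) \<and> (\<forall>i\<in>J. h1 \<cdot> io i = h \<cdot> io i)" using assms(2) by simp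
 then obtain h0 where "!!y. mor y Y (cd h) ==> \<forall>i\<in>J. y \<cdot> io i = h \<cdot> io i ==> y = h0" by blast
 from this[of h] this[of h'] show ?thesis using assms copD(2)[OF c] by simp
qed

lemma cop_nul:
 assumes c: "cop J F Y io" and "arr h" "dm h = Y" "!!i. i \<in> J ==> nul (h \<cdot> io i)"
 shows "nul h"
proof -
 have "h = zr Y (cd h)"
 proof (rule cop_eq[OF c])
  fix i assume i: "i \<in> J"
  show "h \<cdot> io i = zr Y (cd h) \<cdot> io i"
   by (rule nul_eq) (use assms i copD[OF c] nul_cmp[of "io i" "zr Y (cd h)"] in auto)
 qed (use assms copD[OF c] in auto)
 thus ?thesis using assms(2,3) by (simp add: nul_def)
qed

lemma cop_pr:
 assumes c: "cop J F Y io"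
 obtains pr where "!!i. i \<in> J ==> mor (pr i) Y (F i)" "!!i. i \<in> J ==> pr i \<cdot> io i = idt (F i)"
  "!!i j. i \<in> J ==> j \<in> J ==> j ~= i ==> nul (pr i \<cdot> io j)"
proof -
 have "\<forall>i\<in>J. EX p. mor p Y (F i) \<and> (\<forall>j\<in>J. p \<cdot> io j = (if j = i then idt (F i) else zr (F j) (F i)))"
 proof
  fix i assume "i \<in> J"
  thus "EX p. mor p Y (F i) \<and> (\<forall>j\<in>J. p \<cdot> io j = (if j = i then idt (F i) else zr (F j) (F i)))"
   by (intro cop_ex[OF c]) (use copD(1)[OF c] in auto)
 qed
 then obtain pr where pr: "\<forall>i\<in>J. mor (pr i) Y (F i) \<and> (\<forall>j\<in>J. pr i \<cdot> io j = (if j = i then idt (F i) else zr (F j) (F i)))"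
  unfolding bchoice_iff by blast
 show ?thesis
 proof (rule that)
  fix i j assume "i \<in> J" "j \<in> J" "j ~= i"
  thus "nul (pr i \<cdot> io j)" using pr copD(1)[OF c] by auto
 qed (use pr in auto)
qed

lemma trunc_exists:
 assumes c: "cop J F Y io" "K <= J" obtains e where "trunc J io Y K e"
proof -
 have "EX e. mor e Y Y \<and> (\<forall>i\<in>J. e \<cdot> io i = (if i \<in> K then io i else zr (F i) Y))"
  by (rule cop_ex[OF c(1)]) (use copD[OF c(1)] in auto)
 then obtain e where e: "mor e Y Y" "\<forall>i\<in>J. e \<cdot> io i = (if i \<in> K then io i else zr (F i) Y)" by blast
 have "nul (e \<cdot> io i)" if "i \<in> J - K" for i using e(2) that copD(1)[OF c(1), of i] copD(2)[OF c(1)] by auto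
 moreover have "e \<cdot> io i = io i" if "i \<in> K" for i using e(2) that c(2) by auto
 ultimately show ?thesis using that e(1) unfolding trunc_def by blast
qed

abbreviation "fsum X Y h K \<equiv> finsum (hom_group T X Y) h K"

lemma fsum_empty: "ob X ==> ob Y ==> fsum X Y h {} = zr X Y"
 using abelian_monoid.finsum_empty[OF abelian_group.axioms(1)[OF hom_abelian[of X Y]]] by (simp add: hom_group_def)

lemma fsum_insert:
 assumes "finite K" "a \<notin> K" "!!i. i \<in> insert a K ==> mor (h i) X Y" "ob X" "ob Y"
 shows "fsum X Y h (insert a K) = h a +. fsum X Y h K"
 using abelian_monoid.finsum_insert[OF abelian_group.axioms(1)[OF hom_abelian[of X Y]], of K a h] assms
 by (simp add: hom_group_def Pi_iff Hom_mor)

lemma fsum_mor: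
 assumes "finite K" "!!i. i \<in> K ==> mor (h i) X Y" "ob X" "ob Y" shows "mor (fsum X Y h K) X Y"
 using assms(1,2)
proof (induction K)
 case (insert a K)
 have "fsum X Y h (insert a K) = h a +. fsum X Y h K" by (rule fsum_insert) (use insert assms in auto)
 thus ?case using insert assms by simp
qed (use assms in \<open>simp add: fsum_empty\<close>)

lemma fsum_post:
 assumes "finite K" "!!i. i \<in> K ==> mor (h i) X Y" "mor p Y Z" "ob X"
 shows "p \<cdot> fsum X Y h K = fsum X Z (%i. p \<cdot> h i) K" using assms(1,2)
proof (induction K)
 case empty
 show ?case by (rule nul_eq) (use assms nul_cmp[of "zr X Y" p] in \<open>auto simp: fsum_empty\<close>)
next
 case (insert a K)
 have "mor (fsum X Y h K) X Y" by (rule fsum_mor) (use insert assms in auto)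
 moreover have "fsum X Y h (insert a K) = h a +. fsum X Y h K" by (rule fsum_insert) (use insert assms in auto)
 moreover have "fsum X Z (%i. p \<cdot> h i) (insert a K) = p \<cdot> h a +. fsum X Z (%i. p \<cdot> h i) K"
  by (rule fsum_insert) (use insert assms in auto)
 ultimately show ?case using insert assms plus_dist(1)[of "h a" "fsum X Y h K" p] by simp
qed

lemma fsum_pre:
 assumes "finite K" "!!i. i \<in> K ==> mor (h i) X Y" "mor p W X" "ob Y"
 shows "fsum X Y h K \<cdot> p = fsum W Y (%i. h i \<cdot> p) K" using assms(1,2)
proof (induction K)
 case empty
 show ?case by (rule nul_eq) (use assms nul_cmp[of p "zr X Y"] in \<open>auto simp: fsum_empty\<close>)
next
 case (insert a K)
 have "mor (fsum X Y h K) X Y" by (rule fsum_mor) (use insert assms in auto)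
 moreover have "fsum X Y h (insert a K) = h a +. fsum X Y h K" by (rule fsum_insert) (use insert assms in auto)
 moreover have "fsum W Y (%i. h i \<cdot> p) (insert a K) = h a \<cdot> p +. fsum W Y (%i. h i \<cdot> p) K"
  by (rule fsum_insert) (use insert assms in auto)
 ultimately show ?case using insert assms plus_dist(2)[of "h a" "fsum X Y h K" p] by simp
qed

lemma fsum_support:
 assumes "finite K" "!!i. i \<in> K ==> mor (h i) X Y" "ob X" "ob Y" "!!i. i \<in> K ==> \<not> Q i ==> nul (h i)"
 shows "fsum X Y h K = fsum X Y h {i \<in> K. Q i}" using assms(1,2,5)
proof (induction K)
 case empty thus ?case by simp
next
 case (insert a K)
 have m: "mor (fsum X Y h {i \<in> K. Q i}) X Y" by (rule fsum_mor) (use insert assms in auto)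
 have i: "fsum X Y h (insert a K) = h a +. fsum X Y h K" by (rule fsum_insert) (use insert assms in auto)
 show ?case
 proof (cases "Q a")
  case True
  have "fsum X Y h (insert a {i \<in> K. Q i}) = h a +. fsum X Y h {i \<in> K. Q i}" by (rule fsum_insert) (use insert assms in auto)
  moreover have "{i \<in> insert a K. Q i} = insert a {i \<in> K. Q i}" using True by auto
  ultimately show ?thesis using i insert.IH insert.prems assms(3,4) by simp
 next
  case False
  hence "{i \<in> insert a K. Q i} = {i \<in> K. Q i}" by auto
  moreover have "h a = zr X Y" using insert.prems False nul_iff[of "h a" X Y] assms(3,4) by simp
  ultimately show ?thesis using i insert m by simp
 qed
qed

lemma fsum_single:
 assumes "finite K" "!!i. i \<in> K ==> mor (h i) X Y" "ob X" "ob Y" "!!i. i \<in> K ==> i ~= j ==> nul (h i)"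
 shows "fsum X Y h K = (if j \<in> K then h j else zr X Y)"
proof (cases "j \<in> K")
 case True
 hence "{i \<in> K. i = j} = {j}" by auto
 thus ?thesis using fsum_support[of K h X Y "%i. i = j"] assms True fsum_insert[of "{}" j h X Y] by (simp add: fsum_empty)
next
 case False
 hence e: "{i \<in> K. i = j} = {}" by auto
 show ?thesis using fsum_support[of K h X Y "%i. i = j"] assms False unfolding e by (simp add: fsum_empty)
qed

lemma trunc_fsum:
 assumes c: "cop J F Y io" and t: "trunc J io Y K e" and K: "finite K" "K <= J"
  and pr: "!!i. i \<in> J ==> mor (pr i) Y (F i)" "!!i. i \<in> J ==> pr i \<cdot> io i = idt (F i)"
  "!!i j. i \<in> J ==> j \<in> J ==> j ~= i ==> nul (pr i \<cdot> io j)"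
 shows "e = fsum Y Y (%i. io i \<cdot> pr i) K"
proof (rule cop_eq[OF c])
 note C = copD[OF c]
 have m: "mor (io i \<cdot> pr i) Y Y" if "i \<in> K" for i using C pr(1) that K(2) by auto
 have fm: "mor (fsum Y Y (%i. io i \<cdot> pr i) K) Y Y" by (rule fsum_mor) (use K m C in auto)
 show "arr e" "dm e = Y" "cd e = cd (fsum Y Y (%i. io i \<cdot> pr i) K)" using t fm by (auto simp: trunc_def)
 show "arr (fsum Y Y (%i. io i \<cdot> pr i) K)" "dm (fsum Y Y (%i. io i \<cdot> pr i) K) = Y" using fm by auto
 fix j assume j: "j \<in> J"
 have "fsum Y Y (%i. io i \<cdot> pr i) K \<cdot> io j = fsum (F j) Y (%i. (io i \<cdot> pr i) \<cdot> io j) K"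
  by (rule fsum_pre) (use K m C j in auto)
 also have "... = (if j \<in> K then (io j \<cdot> pr j) \<cdot> io j else zr (F j) Y)"
 proof (rule fsum_single)
  fix i assume i: "i \<in> K"
  hence iJ: "i \<in> J" using K by auto
  show "mor ((io i \<cdot> pr i) \<cdot> io j) (F j) Y" using C(1)[of i] C(1)[of j] pr(1)[of i] iJ j by auto
  show "nul ((io i \<cdot> pr i) \<cdot> io j)" if "i ~= j"
   using nul_cmp[of "pr i \<cdot> io j" "io i"] C(1)[of i] C(1)[of j] pr(1)[of i] pr(3)[OF iJ j] that iJ j by auto
 qed (use K C j in auto)
 also have "... = e \<cdot> io j"
 proof (cases "j \<in> K")
  case True
  thus ?thesis using t C(1)[OF j] pr(1,2)[OF j] by (auto simp: trunc_def)
 next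
  case False
  hence "nul (e \<cdot> io j)" using t j by (auto simp: trunc_def)
  thus ?thesis using False t C(1)[OF j] nul_iff[of "e \<cdot> io j" "F j" Y] by (auto simp: trunc_def)
 qed
 finally show "e \<cdot> io j = fsum Y Y (%i. io i \<cdot> pr i) K \<cdot> io j" by simp
qed

definition fin_factor :: "'i set => ('i => 'b) => 'a => 'b => bool" where
 "fin_factor J io Y f \<longleftrightarrow> (EX K e. finite K \<and> K <= J \<and> trunc J io Y K e \<and> e \<cdot> f = f)"

text \<open>The projections of the coproduct recover the components of a finite sum, which gives
  injectivity of the canonical map. Surjectivity amounts to writing f as the finite sum of its
  components, which is the equation e f = f by \<open>trunc_fsum\<close>.\<close>

lemma compact_obj_iff:
 "compact_obj U T C \<longleftrightarrow> ob C \<and>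
  (ALL J F Y io f. J <= U --> small U J --> cop J F Y io --> mor f C Y --> fin_factor J io Y f)"
proof -
 have "bij_betw (%g. fsum C Y (%i. io i \<cdot> g i) {i \<in> J. g i ~= zr C (F i)})
   {g \<in> \<Pi>\<^sub>E i\<in>J. Hom T C (F i). finite {i \<in> J. g i ~= zr C (F i)}} (Hom T C Y)
  \<longleftrightarrow> (ALL f. mor f C Y --> fin_factor J io Y f)" (is "bij_betw ?s ?S _ \<longleftrightarrow> _")
  if c: "cop J F Y io" and C: "ob C" for J :: "'c set" and F Y io
 proof -
  note D = copD[OF c]
  have FJ: "ob (F i)" if "i \<in> J" for i using D(1)[OF that] by simp
  have gS: "mor (g i) C (F i)" if "g \<in> ?S" "i \<in> J" for g i
  proof -
   have "g i \<in> Hom T C (F i)" using that by (auto simp: PiE_iff)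
   thus ?thesis using Hom_mor[OF C FJ[OF that(2)]] by blast
  qed
  have sS: "mor (io i \<cdot> g i) C Y" if "g \<in> ?S" "i \<in> J" for g i using gS[OF that] D that by auto
  obtain pr where pr: "!!i. i \<in> J ==> mor (pr i) Y (F i)" "!!i. i \<in> J ==> pr i \<cdot> io i = idt (F i)"
   "!!i j. i \<in> J ==> j \<in> J ==> j ~= i ==> nul (pr i \<cdot> io j)" by (rule cop_pr[OF c], rule that; assumption)
  have prs: "pr j \<cdot> ?s g = g j" if g: "g \<in> ?S" and j: "j \<in> J" for g j
  proof -
   let ?K = "{i \<in> J. g i ~= zr C (F i)}"
   have K: "finite ?K" using g by auto
   have "pr j \<cdot> ?s g = fsum C (F j) (%i. pr j \<cdot> (io i \<cdot> g i)) ?K"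
    by (rule fsum_post) (use K sS[OF g] pr(1)[OF j] C in auto)
   also have "... = (if j \<in> ?K then pr j \<cdot> (io j \<cdot> g j) else zr C (F j))"
   proof (rule fsum_single)
    fix i assume i: "i \<in> ?K"
    hence iJ: "i \<in> J" by simp
    note M = D(1)[OF iJ] gS[OF g iJ] pr(1)[OF j]
    show "mor (pr j \<cdot> (io i \<cdot> g i)) C (F j)" using M by auto
    show "nul (pr j \<cdot> (io i \<cdot> g i))" if "i ~= j"
     using nul_cmp[of "g i" "pr j \<cdot> io i"] M pr(3)[OF j iJ that] by auto
   qed (use K C FJ[OF j] in auto)
   also have "... = g j"
   proof (cases "j \<in> ?K")
    case True
    have "pr j \<cdot> (io j \<cdot> g j) = (pr j \<cdot> io j) \<cdot> g j" using D(1)[OF j] gS[OF g j] pr(1)[OF j] by simp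
    thus ?thesis using pr(2)[OF j] gS[OF g j] True by simp
   qed (use j in auto)
   finally show ?thesis .
  qed
  have inj: "inj_on ?s ?S"
  proof (rule inj_onI)
   fix g g' assume *: "g \<in> ?S" "g' \<in> ?S" "?s g = ?s g'"
   have "g j = g' j" for j
   proof (cases "j \<in> J")
    case True thus ?thesis using prs[OF *(1) True] prs[OF *(2) True] *(3) by metis
   next
    case False thus ?thesis using *(1,2) PiE_arb[of g J _ j] PiE_arb[of g' J _ j] by auto
   qed
   thus "g = g'" by blast
  qed
  have sub: "?s g \<in> Hom T C Y" if "g \<in> ?S" for g
   unfolding Hom_mor[OF C D(2)] by (rule fsum_mor) (use that sS[OF that] C D(2) in auto)
  show ?thesis
  proof (intro iffI allI impI)
   fix f assume b: "bij_betw ?s ?S (Hom T C Y)" and f: "mor f C Y"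
   hence "f \<in> ?s ` ?S" using Hom_mor[OF C D(2)] unfolding bij_betw_def by blast
   then obtain g where g: "g \<in> ?S" "f = ?s g" by blast
   let ?K = "{i \<in> J. g i ~= zr C (F i)}"
   obtain e where e: "trunc J io Y ?K e" by (rule trunc_exists[OF c, of ?K]) auto
   have K: "finite ?K" using g by auto
   have "e \<cdot> f = fsum C Y (%i. e \<cdot> (io i \<cdot> g i)) ?K" unfolding g(2)
    by (rule fsum_post) (use K sS[OF g(1)] e C in \<open>auto simp: trunc_def\<close>)
   also have "... = f" unfolding g(2)
   proof (rule abelian_monoid.finsum_cong'[OF abelian_group.axioms(1)[OF hom_abelian[OF C D(2)]] refl])
    show "(%i. io i \<cdot> g i) \<in> ?K \<rightarrow> carrier (hom_group T C Y)"
     using sS[OF g(1)] by (auto simp: hom_group_def Hom_mor[OF C D(2)])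
    fix i assume i: "i \<in> ?K"
    have "e \<cdot> (io i \<cdot> g i) = (e \<cdot> io i) \<cdot> g i"
     by (rule cmp_assoc'[symmetric]) (use e D(1)[of i] gS[OF g(1), of i] i in \<open>auto simp: trunc_def\<close>)
    moreover have "e \<cdot> io i = io i" using e i unfolding trunc_def by blast
    ultimately show "e \<cdot> (io i \<cdot> g i) = io i \<cdot> g i" by metis
   qed
   finally show "fin_factor J io Y f" using e K unfolding fin_factor_def by blast
  next
   assume h: "ALL f. mor f C Y --> fin_factor J io Y f"
   have "f \<in> ?s ` ?S" if f0: "f \<in> Hom T C Y" for f
   proof -
    have f: "mor f C Y" using f0 Hom_mor[OF C D(2)] by blast
    then obtain K e where K: "finite K" "K <= J" and e: "trunc J io Y K e" "e \<cdot> f = f"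
     using h unfolding fin_factor_def by blast
    have em: "mor e Y Y" using e by (simp add: trunc_def)
    define g where "g = restrict (%i. pr i \<cdot> f) J"
    have gm: "mor (pr i \<cdot> f) C (F i)" if "i \<in> J" for i using pr(1)[OF that] f by auto
    have z: "nul (pr i \<cdot> f)" if i: "i \<in> J" "i \<notin> K" for i
    proof -
     have "nul (pr i \<cdot> e)"
     proof (rule cop_nul[OF c])
      fix j assume j: "j \<in> J"
      have "(pr i \<cdot> e) \<cdot> io j = pr i \<cdot> (e \<cdot> io j)" using pr(1)[OF i(1)] em D(1)[OF j] by simp
      moreover have "nul (pr i \<cdot> (e \<cdot> io j))"
      proof (cases "j \<in> K")
       case True thus ?thesis using e(1) pr(3)[OF i(1) j] i(2) by (auto simp: trunc_def)
      next
       case False thus ?thesis using e(1) j pr(1)[OF i(1)] em D(1)[OF j] nul_cmp[of "e \<cdot> io j" "pr i"] by (auto simp: trunc_def)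
      qed
      ultimately show "nul ((pr i \<cdot> e) \<cdot> io j)" by simp
     qed (use pr(1)[OF i(1)] em in auto)
     hence "nul ((pr i \<cdot> e) \<cdot> f)" using nul_cmp[of f "pr i \<cdot> e"] pr(1)[OF i(1)] em f by auto
     thus ?thesis using pr(1)[OF i(1)] em f e(2) by simp
    qed
    have gz: "g i ~= zr C (F i) \<longleftrightarrow> \<not> nul (pr i \<cdot> f)" if "i \<in> J" for i
     using that nul_iff[OF gm[OF that]] by (simp add: g_def)
    have Keq: "{i \<in> J. g i ~= zr C (F i)} = {i \<in> K. \<not> nul (pr i \<cdot> f)}" using gz z K(2) by blast
    have "f = fsum Y Y (%i. io i \<cdot> pr i) K \<cdot> f" using e(2) trunc_fsum[OF c e(1) K pr] by simp
    also have "... = fsum C Y (%i. (io i \<cdot> pr i) \<cdot> f) K" by (rule fsum_pre) (use K D pr(1) f in auto)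
    also have "... = fsum C Y (%i. (io i \<cdot> pr i) \<cdot> f) {i \<in> K. \<not> nul (pr i \<cdot> f)}"
    proof (rule fsum_support)
     fix i assume "i \<in> K"
     hence iJ: "i \<in> J" using K by auto
     note M = D(1)[OF iJ] pr(1)[OF iJ] f
     show "mor ((io i \<cdot> pr i) \<cdot> f) C Y" using M by auto
     show "nul ((io i \<cdot> pr i) \<cdot> f)" if "\<not> \<not> nul (pr i \<cdot> f)" using that nul_cmp[of "pr i \<cdot> f" "io i"] M by auto
    qed (use K C D in auto)
    also have "... = ?s g" unfolding Keq
    proof (rule abelian_monoid.finsum_cong'[OF abelian_group.axioms(1)[OF hom_abelian[OF C D(2)]] refl])
     have *: "mor (io i \<cdot> g i) C Y" "(io i \<cdot> pr i) \<cdot> f = io i \<cdot> g i" if "i \<in> J" for i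
      using D(1)[OF that] pr(1)[OF that] f that by (auto simp: g_def)
     thus "(%i. io i \<cdot> g i) \<in> {i \<in> K. \<not> nul (pr i \<cdot> f)} \<rightarrow> carrier (hom_group T C Y)"
      using K by (auto simp: hom_group_def Hom_mor[OF C D(2)] simp del: mor_iff)
     show "(io i \<cdot> pr i) \<cdot> f = io i \<cdot> g i" if "i \<in> {i \<in> K. \<not> nul (pr i \<cdot> f)}" for i using that * K by blast
    qed
    finally have "f = ?s g" .
    moreover have "g \<in> ?S"
    proof -
     have "g i \<in> Hom T C (F i)" if "i \<in> J" for i unfolding Hom_mor[OF C FJ[OF that]] using gm[OF that] that by (simp add: g_def)
     moreover have "finite {i \<in> J. g i ~= zr C (F i)}" unfolding Keq using K by simp
     ultimately show ?thesis by (simp add: g_def)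
    qed
    ultimately show ?thesis by blast
   qed
   thus "bij_betw ?s ?S (Hom T C Y)" unfolding bij_betw_def using inj sub by blast
  qed
 qed
 thus ?thesis unfolding compact_obj_def cop_def by (metis (no_types, lifting))
qed

end

lemma coproduct_cong: "(!!i. i \<in> A ==> F i = F' i) ==> coproduct T A F Y io ==> coproduct T A F' Y io"
 by (simp add: coproduct_def)

section \<open>Small coproducts, compact objects and homotopy colimits\<close>

locale big_category = triangulated_category T for T :: "('o, 'm) tcat" (structure) +
 fixes U :: "'u set"
 assumes univ: "universe U" and coproducts: "has_coproducts U T"
begin

abbreviation "cpt \<equiv> compact_obj U T"

lemma small_image: "small U A ==> small U (f ` A)"
 unfolding small_def using card_of_image ordLeq_ordLess_trans by blast

lemma small_subset: "small U A ==> B <= A ==> small U B"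
 unfolding small_def using card_of_mono1 ordLeq_ordLess_trans by blast

lemma small_nat: "small U (UNIV :: nat set)"
 using univ card_of_nat ordIso_ordLess_trans unfolding universe_def small_def by blast

lemma small_UN:
 assumes "small U I" "!!i. i \<in> I ==> small U (A i)" shows "small U (\<Union>i\<in>I. A i)"
proof -
 have "Card_order |U|" by (rule card_of_Card_order)
 moreover have "\<not> finite (Field |U| )"
  using univ infinite_iff_natLeq_ordLeq ordLess_imp_ordLeq unfolding universe_def by (metis Field_card_of)
 ultimately have "stable |U|" using univ regularCard_stable unfolding universe_def by blast
 thus ?thesis using stable_UNION assms unfolding small_def by blast
qed

text \<open>Coproducts and compactness are defined for index sets inside U; any small set is
  reindexed by such a set.\<close>

lemma small_index:
 assumes "small U A" obtains j where "bij_betw j A (j ` A)" "j ` A <= U" "small U (j ` A)"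
proof -
 have "|A| \<le>o |U|" using assms ordLess_imp_ordLeq by (auto simp: small_def)
 then obtain j where "inj_on j A" "j ` A <= U" using card_of_ordLeq[of A U] by blast
 thus ?thesis using that small_image[OF assms, of j] by (auto simp: bij_betw_def)
qed

lemma cop_exists:
 assumes "small U A" "!!i. i \<in> A ==> ob (F i)" obtains Y io where "cop A F Y io"
proof -
 obtain j where j: "bij_betw j A (j ` A)" "j ` A <= U" "small U (j ` A)" by (rule small_index[OF assms(1)])
 have i: "inv_into A j (j a) = a" if "a \<in> A" for a using j(1) that by (simp add: bij_betw_def)
 have "(%b. F (inv_into A j b)) \<in> j ` A \<rightarrow> Obj T" using i assms(2) by auto
 then obtain Y io where "coproduct T (j ` A) (%b. F (inv_into A j b)) Y io"
  using coproducts[unfolded has_coproducts_def, rule_format, of "j ` A" "%b. F (inv_into A j b)"] j(2,3) by auto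
 from coproduct_reindex[OF j(1) this] have "coproduct T A F Y (io \<circ> j)"
  by (rule coproduct_cong[where F = "(%b. F (inv_into A j b)) \<circ> j", rotated]) (simp only: o_def i)
 thus ?thesis using that assms(2) by (auto simp: cop_def)
qed

lemma localizing_cop:
 assumes "localizing_sub U T S" "small U A" "cop A F Y io" "!!i. i \<in> A ==> F i \<in> S" shows "Y \<in> S"
proof -
 obtain j where j: "bij_betw j A (j ` A)" "j ` A <= U" "small U (j ` A)" by (rule small_index[OF assms(2)])
 let ?k = "inv_into A j"
 have k: "bij_betw ?k (j ` A) A" by (rule bij_betw_inv_into[OF j(1)])
 have "coproduct T (j ` A) (F \<circ> ?k) Y (io \<circ> ?k)" by (rule coproduct_reindex[OF k]) (use assms(3) in \<open>simp add: cop_def\<close>)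
 moreover have "F \<circ> ?k \<in> j ` A \<rightarrow> S" unfolding Pi_iff o_def using bij_betwE[OF k] assms(4) by blast
 ultimately show ?thesis using assms(1) j(2,3) unfolding localizing_sub_def by blast
qed

lemma compact_ob: "cpt C ==> ob C"
 by (simp add: compact_obj_def)

lemma compact_factor:
 assumes "cpt C" "small U A" "cop A F Y io" "mor f C Y" shows "fin_factor A io Y f"
proof -
 obtain j where j: "bij_betw j A (j ` A)" "j ` A <= U" "small U (j ` A)" by (rule small_index[OF assms(2)])
 let ?k = "inv_into A j"
 have k: "bij_betw ?k (j ` A) A" by (rule bij_betw_inv_into[OF j(1)])
 have c: "coproduct T (j ` A) (F \<circ> ?k) Y (io \<circ> ?k)" by (rule coproduct_reindex[OF k]) (use assms(3) in \<open>simp add: cop_def\<close>)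
 have "F \<circ> ?k \<in> j ` A \<rightarrow> Obj T" unfolding Pi_iff o_def using bij_betwE[OF k] assms(3) by (auto simp: cop_def)
 hence "cop (j ` A) (F \<circ> ?k) Y (io \<circ> ?k)" using c by (simp add: cop_def)
 hence "fin_factor (j ` A) (io \<circ> ?k) Y f" using assms(1,4) j(2,3) unfolding compact_obj_iff by blast
 then obtain K e where K: "finite K" "K <= j ` A" "trunc (j ` A) (io \<circ> ?k) Y K e" "e \<cdot> f = f"
  unfolding fin_factor_def by blast
 have "nul (e \<cdot> io i)" if i: "i \<in> A" "i \<notin> ?k ` K" for i
 proof -
  have e: "?k (j i) = i" using j(1) i(1) by (simp add: bij_betw_def)
  hence "j i \<in> j ` A - K" using i by force
  hence "nul (e \<cdot> (io \<circ> ?k) (j i))" using K(3) unfolding trunc_def by blast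
  thus ?thesis using e by simp
 qed
 hence "trunc A io Y (?k ` K) e" using K(3) by (auto simp: trunc_def)
 moreover have "?k ` K <= A" using K(2) k by (auto simp: bij_betw_def)
 ultimately show ?thesis using K(1,4) unfolding fin_factor_def by blast
qed

lemma compactI:
 assumes "ob C" "!!(J :: 'u set) F Y io f. J <= U ==> small U J ==> cop J F Y io ==> mor f C Y ==> fin_factor J io Y f"
 shows "cpt C" unfolding compact_obj_iff using assms by blast

lemma copI:
 assumes "ob Y" "!!i. i \<in> J ==> mor (io i) (F i) Y"
  "!!Z f. ob Z ==> (!!i. i \<in> J ==> mor (f i) (F i) Z) ==> EX h. mor h Y Z \<and> (\<forall>i\<in>J. h \<cdot> io i = f i)"
  "!!h. arr h ==> dm h = Y ==> (!!i. i \<in> J ==> nul (h \<cdot> io i)) ==> nul h"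
 shows "cop J F Y io"
proof -
 have "\<exists>!h. h \<in> Hom T Y Z \<and> (\<forall>i\<in>J. h \<cdot> io i = f i)" if Z: "ob Z" and f: "\<forall>i\<in>J. f i \<in> Hom T (F i) Z" for Z f
 proof -
  have "mor (f i) (F i) Z" if "i \<in> J" for i using f that assms(2)[OF that] Z Hom_mor[of "F i" Z "f i"] by simp
  then obtain h where h: "mor h Y Z" "\<forall>i\<in>J. h \<cdot> io i = f i" using assms(3)[OF Z] by blast
  have "h' = h" if h': "mor h' Y Z" "\<forall>i\<in>J. h' \<cdot> io i = f i" for h'
  proof (rule diff_zr)
   show "nul (h' +. ng h)"
   proof (rule assms(4))
    fix i assume i: "i \<in> J"
    have "(h' +. ng h) \<cdot> io i = h' \<cdot> io i +. ng (h \<cdot> io i)" using h(1) h'(1) assms(2)[OF i] by (simp add: plus_dist)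
    also have "... = h \<cdot> io i +. ng (h \<cdot> io i)" using h(2) h'(2) i by simp
    finally show "nul ((h' +. ng h) \<cdot> io i)" using h(1) assms(2)[OF i] by (simp add: plus_ng)
   qed (use h h' in auto)
  qed (use h h' in auto)
  thus ?thesis using h unfolding Hom_mor[OF assms(1) Z] by blast
 qed
 moreover have "\<forall>i\<in>J. io i \<in> Hom T (F i) Y \<and> ob (F i)" using assms(2) Hom_mor assms(1) by (metis mor_iff)
 ultimately show ?thesis using assms(1) unfolding cop_def coproduct_def by blast
qed

lemma cop_shift:
 assumes c: "cop J F Y io" shows "cop J (%i. so n (F i)) (so n Y) (%i. sm n (io i))"
proof (rule copI)
 note D = copD[OF c]
 show "ob (so n Y)" "!!i. i \<in> J ==> mor (sm n (io i)) (so n (F i)) (so n Y)" using D by simp_all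
 fix Z f assume Z: "ob Z" and f: "!!i. i \<in> J ==> mor (f i) (so n (F i)) Z"
 have "EX h. mor h Y (so (- n) Z) \<and> (\<forall>i\<in>J. h \<cdot> io i = sm (- n) (f i))"
  by (rule cop_ex[OF c]) (use f Z D in simp_all)
 then obtain h where h: "mor h Y (so (- n) Z)" "!!i. i \<in> J ==> h \<cdot> io i = sm (- n) (f i)" by blast
 have "sm n h \<cdot> sm n (io i) = f i" if "i \<in> J" for i
 proof -
  have "sm n h \<cdot> sm n (io i) = sm n (h \<cdot> io i)" using h(1) D(1)[OF that] by simp
  thus ?thesis using h(2)[OF that] f[OF that] by simp
 qed
 thus "EX h. mor h (so n Y) Z \<and> (\<forall>i\<in>J. h \<cdot> sm n (io i) = f i)" using h(1) Z by (intro exI[of _ "sm n h"]) simp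
next
 note D = copD[OF c]
 fix h assume h: "arr h" "dm h = so n Y" "!!i. i \<in> J ==> nul (h \<cdot> sm n (io i))"
 have "nul (sm (- n) h)"
 proof (rule cop_nul[OF c])
  fix i assume i: "i \<in> J"
  have "sm (- n) h \<cdot> io i = sm (- n) (h \<cdot> sm n (io i))" using h(1,2) D(1)[OF i] by simp
  also have "nul ..." by (subst nul_sm) (use h D(1)[OF i] i in auto)
  finally show "nul (sm (- n) h \<cdot> io i)" .
 qed (use h D in simp_all)
 thus "nul h" using h(1) by simp
qed

lemma compact_so: assumes C: "cpt C" shows "cpt (so n C)"
proof (rule compactI)
 show o: "ob (so n C)" using compact_ob[OF C] by simp
 fix J :: "'u set" and F Y io f assume J: "J <= U" "small U J" and c: "cop J F Y io" and f: "mor f (so n C) Y"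
 note D = copD[OF c]
 have "fin_factor J (%i. sm (- n) (io i)) (so (- n) Y) (sm (- n) f)"
  by (rule compact_factor[OF C J(2) cop_shift[OF c]]) (use f compact_ob[OF C] in simp)
 then obtain K e where K: "finite K" "K <= J" "trunc J (%i. sm (- n) (io i)) (so (- n) Y) K e" "e \<cdot> sm (- n) f = sm (- n) f"
  unfolding fin_factor_def by blast
 have e: "mor e (so (- n) Y) (so (- n) Y)" using K by (simp add: trunc_def)
 have s: "sm n e \<cdot> g = sm n (e \<cdot> sm (- n) g)" if "arr g" "cd g = Y" for g using that e D by simp
 have "trunc J io Y K (sm n e)" unfolding trunc_def
 proof (intro conjI ballI)
  show "mor (sm n e) Y Y" using e D by simp
  show "sm n e \<cdot> io i = io i" if "i \<in> K" for i using s[of "io i"] K(2,3) that D(1)[of i] by (auto simp: trunc_def)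
  show "nul (sm n e \<cdot> io i)" if "i \<in> J - K" for i
  proof -
   have "nul (sm n (e \<cdot> sm (- n) (io i)))" by (subst nul_sm) (use K(3) that D(1)[of i] e in \<open>auto simp: trunc_def\<close>)
   thus ?thesis using s[of "io i"] D(1)[of i] that by simp
  qed
 qed
 moreover have "sm n e \<cdot> f = f" using s[of f] f K(4) by simp
 ultimately show "fin_factor J io Y f" using K(1,2) unfolding fin_factor_def by blast
qed

lemma trunc_absorb:
 assumes c: "cop J F Y io" and "trunc J io Y K e" "trunc J io Y K' e'" "K <= K'" "K' <= J"
 shows "e' \<cdot> e = e"
proof (rule cop_eq[OF c])
 have m: "mor e Y Y" "mor e' Y Y" using assms by (simp_all add: trunc_def)
 thus "arr (e' \<cdot> e)" "arr e" "dm (e' \<cdot> e) = Y" "dm e = Y" "cd (e' \<cdot> e) = cd e" by simp_all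
 fix i assume i: "i \<in> J"
 note D = copD(1)[OF c i]
 have a: "(e' \<cdot> e) \<cdot> io i = e' \<cdot> (e \<cdot> io i)" using m D by simp
 show "(e' \<cdot> e) \<cdot> io i = e \<cdot> io i"
 proof (cases "i \<in> K")
  case True
  hence "e \<cdot> io i = io i" "e' \<cdot> io i = io i" using assms unfolding trunc_def by blast+
  thus ?thesis using a by metis
 next
  case False
  hence "nul (e \<cdot> io i)" using assms i unfolding trunc_def by blast
  moreover from this have "nul (e' \<cdot> (e \<cdot> io i))" using nul_cmp[of "e \<cdot> io i" e'] m D by simp
  ultimately show ?thesis unfolding a by (intro nul_eq) (use m D in simp_all)
 qed
qed

text \<open>Let e truncate f v. Then f - e f vanishes on B and factors through w by a map x from the
  suspension of A, which has its own truncation. A truncation h to the union of both index sets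
  fixes f - e f and e f, hence f.\<close>

lemma compact_cone:
 assumes t: "exact_tri T A B W u v w" and A: "cpt A" and B: "cpt B"
 shows "cpt W"
proof (rule compactI)
 note E = triD[OF t]
 show "ob W" using E by simp
 fix J :: "'u set" and F Y io f assume J: "J <= U" "small U J" and c: "cop J F Y io" and f: "mor f W Y"
 have "fin_factor J io Y (f \<cdot> v)" by (rule compact_factor[OF B J(2) c]) (use f E in simp)
 then obtain K e where K: "finite K" "K <= J" "trunc J io Y K e" "e \<cdot> (f \<cdot> v) = f \<cdot> v" unfolding fin_factor_def by blast
 have e: "mor e Y Y" using K(3) by (simp add: trunc_def)
 let ?d = "f +. ng (e \<cdot> f)"
 have "?d \<cdot> v = (f \<cdot> v) +. ng (e \<cdot> (f \<cdot> v))" using f e E by (simp add: plus_dist)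
 hence "nul (?d \<cdot> v)" unfolding K(4) using f E by (simp add: plus_ng)
 then obtain x where x: "mor x (so 1 A) Y" "x \<cdot> w = ?d" using expairD(6)[OF tri_expair(2)[OF t], of ?d] f e E by auto
 have "fin_factor J io Y x" by (rule compact_factor[OF compact_so[OF A] J(2) c x(1)])
 then obtain K' e' where K': "finite K'" "K' <= J" "trunc J io Y K' e'" "e' \<cdot> x = x" unfolding fin_factor_def by blast
 have e': "mor e' Y Y" using K'(3) by (simp add: trunc_def)
 obtain h where h: "trunc J io Y (K \<union> K') h" by (rule trunc_exists[OF c, of "K \<union> K'"]) (use K K' in auto)
 have hm: "mor h Y Y" using h by (simp add: trunc_def)
 have ab: "h \<cdot> e = e" "h \<cdot> e' = e'" using trunc_absorb[OF c K(3) h] trunc_absorb[OF c K'(3) h] K K' by auto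
 have "h \<cdot> x = h \<cdot> (e' \<cdot> x)" using K'(4) by simp
 also have "... = (h \<cdot> e') \<cdot> x" by (rule cmp_assoc'[symmetric]) (use hm e' x in simp_all)
 finally have hx: "h \<cdot> x = x" using ab K'(4) by simp
 have "h \<cdot> ?d = (h \<cdot> x) \<cdot> w" unfolding x(2)[symmetric] by (rule cmp_assoc'[symmetric]) (use hm x E in simp_all)
 hence hd: "h \<cdot> ?d = ?d" using hx x by simp
 have he: "h \<cdot> (e \<cdot> f) = e \<cdot> f" using cmp_assoc'[of f e h] ab hm e f by simp
 have f2: "f = ?d +. e \<cdot> f" using f e by (simp add: plus_assoc plus_ng)
 have "h \<cdot> f = h \<cdot> (?d +. e \<cdot> f)" using f2 by simp
 also have "... = h \<cdot> ?d +. h \<cdot> (e \<cdot> f)" by (rule plus_dist(1)) (use hm e f in simp_all)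
 also have "... = f" unfolding hd he using f2 by simp
 finally have "h \<cdot> f = f" .
 thus "fin_factor J io Y f" using h K(1,2) K'(1,2) unfolding fin_factor_def by (intro exI[of _ "K \<union> K'"] exI[of _ h]) auto
qed

primrec trans_mor :: "(nat => 'm) => nat => nat => 'm => 'm" where
 "trans_mor u k 0 c = c"
| "trans_mor u k (Suc m) c = trans_mor u (Suc k) m (u k \<cdot> c)"

lemma trans_mor_arr:
 assumes "!!k. mor (u k) (X k) (X (Suc k))"
 shows "mor c C (X k) ==> mor (trans_mor u k m c) C (X (k + m))"
proof (induction m arbitrary: k c)
 case (Suc m)
 have "mor (u k \<cdot> c) C (X (Suc k))" using assms[of k] Suc.prems by simp
 from Suc.IH[OF this] show ?case by simp
qed simp

lemma trans_mor_cmp: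
 assumes "!!k. mor (u k) (X k) (X (Suc k))"
 shows "mor c C (X k) ==> mor d B C ==> trans_mor u k m (c \<cdot> d) = trans_mor u k m c \<cdot> d"
proof (induction m arbitrary: k c)
 case (Suc m)
 have "mor (u k \<cdot> c) C (X (Suc k))" "u k \<cdot> (c \<cdot> d) = (u k \<cdot> c) \<cdot> d" using assms[of k] Suc.prems by simp_all
 with Suc.IH[OF this(1) Suc.prems(2)] show ?case by simp
qed simp

lemma trans_mor_cocone:
 assumes "!!k. mor (u k) (X k) (X (Suc k))" "!!k. mor (w k) (X k) W" "!!k. w (Suc k) \<cdot> u k = w k"
 shows "mor c C (X k) ==> w (k + m) \<cdot> trans_mor u k m c = w k \<cdot> c"
proof (induction m arbitrary: k c)
 case (Suc m)
 have "mor (u k \<cdot> c) C (X (Suc k))" using assms(1)[of k] Suc.prems by simp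
 from Suc.IH[OF this] have "w (k + Suc m) \<cdot> trans_mor u k (Suc m) c = w (Suc k) \<cdot> (u k \<cdot> c)" by simp
 also have "... = (w (Suc k) \<cdot> u k) \<cdot> c" using assms(1)[of k] assms(2)[of "Suc k"] Suc.prems by simp
 finally show ?case unfolding assms(3) .
qed simp

text \<open>The properties of a mapping telescope that are used: a weakly universal cocone, and, in
  the last two clauses, that morphisms from a compact object into W are the colimit of those into
  the stages.\<close>

definition hocolim :: "(nat => 'o) => (nat => 'm) => 'o => (nat => 'm) => bool" where
 "hocolim X u W w \<longleftrightarrow> (ALL k. mor (w k) (X k) W) \<and> (ALL k. w (Suc k) \<cdot> u k = w k) \<and>
   (ALL B b. ob B --> (ALL k. mor (b k) (X k) B) --> (ALL k. b (Suc k) \<cdot> u k = b k) -->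
    (EX h. mor h W B \<and> (ALL k. h \<cdot> w k = b k))) \<and>
   (ALL C c. cpt C --> mor c C W --> (EX k c'. mor c' C (X k) \<and> w k \<cdot> c' = c)) \<and>
   (ALL C c k. cpt C --> mor c C (X k) --> nul (w k \<cdot> c) --> (EX m. nul (trans_mor u k m c)))"

text \<open>
 \<open>\<Phi> = 1 - shift\<close>; composing it with the maps \<open>\<psi> j\<close>, given by the transition morphisms into \<open>X j\<close>,
 yields the projections of the coproduct.  This makes \<open>\<Phi>\<close> injective on morphisms from compact objects.
\<close>

lemma hocolim_exists:
 assumes u: "!!k. mor (u k) (X k) (X (Suc k))"
 shows "EX W w. hocolim X u W w"
proof -
 have oX: "ob (X k)" for k using u[of k] by simp
 obtain P io where c: "cop UNIV X P io" by (rule cop_exists[OF small_nat oX])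
 have D: "mor (io k) (X k) P" for k using copD(1)[OF c UNIV_I] .
 have P: "ob P" by (rule copD(2)[OF c])
 obtain pr where pr: "!!i. mor (pr i) P (X i)" "!!i. pr i \<cdot> io i = idt (X i)" "!!i j. j ~= i ==> nul (pr i \<cdot> io j)"
  by (rule cop_pr[OF c]) (blast intro: UNIV_I)
 have "\<exists>\<Phi>. mor \<Phi> P P \<and> (\<forall>k\<in>UNIV. \<Phi> \<cdot> io k = io k +. ng (io (Suc k) \<cdot> u k))"
  by (rule cop_ex[OF c P]) (use D u P oX in auto)
 then obtain \<Phi> where \<Phi>: "mor \<Phi> P P" "!!k. \<Phi> \<cdot> io k = io k +. ng (io (Suc k) \<cdot> u k)" by blast
 obtain W g h where t: "exact_tri T P P W \<Phi> g h" using cone_exists[of \<Phi>] \<Phi>(1) by auto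
 note E = triD[OF t] and X1 = expairD[OF tri_expair(1)[OF t]] and X2 = expairD[OF tri_expair(2)[OF t]] and X3 = expairD[OF tri_expair(3)[OF t]]
 have "EX p. mor p P (X j) \<and> (\<forall>i\<in>UNIV. p \<cdot> io i = (if i \<le> j then trans_mor u i (j - i) (idt (X i)) else zr (X i) (X j)))" for j
 proof (rule cop_ex[OF c oX])
  show "mor (if i \<le> j then trans_mor u i (j - i) (idt (X i)) else zr (X i) (X j)) (X i) (X j)" for i
   using trans_mor_arr[of u X, OF u, of "idt (X i)" "X i" i "j - i"] oX[of i] oX[of j] by simp
 qed
 hence "ALL j. EX p. mor p P (X j) \<and> (ALL i. p \<cdot> io i = (if i \<le> j then trans_mor u i (j - i) (idt (X i)) else zr (X i) (X j)))"
  by blast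
 then obtain \<psi> where \<psi>: "!!j. mor (\<psi> j) P (X j)"
  "!!j i. \<psi> j \<cdot> io i = (if i \<le> j then trans_mor u i (j - i) (idt (X i)) else zr (X i) (X j))" by metis
 \<comment> \<open>On the summand X i with i < j the two terms of \<Phi> cancel, at i = j the
   identity remains, and for i > j both terms vanish.\<close>
 have \<psi>\<Phi>: "\<psi> j \<cdot> \<Phi> = pr j" for j
 proof (rule cop_eq[OF c])
  fix i
  note M = D[of i] D[of "Suc i"] u[of i] \<psi>(1)[of j] \<Phi>(1) oX[of i] oX[of j] oX[of "Suc i"]
  have "(\<psi> j \<cdot> \<Phi>) \<cdot> io i = \<psi> j \<cdot> (io i +. ng (io (Suc i) \<cdot> u i))" using M \<Phi>(2)[of i] by simp
  also have "... = \<psi> j \<cdot> io i +. ng (\<psi> j \<cdot> (io (Suc i) \<cdot> u i))" using M by (simp add: plus_dist)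
  also have "\<psi> j \<cdot> (io (Suc i) \<cdot> u i) = (\<psi> j \<cdot> io (Suc i)) \<cdot> u i" using M by simp
  finally have eq: "(\<psi> j \<cdot> \<Phi>) \<cdot> io i = \<psi> j \<cdot> io i +. ng ((\<psi> j \<cdot> io (Suc i)) \<cdot> u i)" .
  show "(\<psi> j \<cdot> \<Phi>) \<cdot> io i = pr j \<cdot> io i"
  proof (cases "i < j")
   case True
   hence e: "j - i = Suc (j - Suc i)" by simp
   have "trans_mor u i (j - i) (idt (X i)) = trans_mor u (Suc i) (j - Suc i) (idt (X (Suc i)) \<cdot> u i)"
    unfolding e trans_mor.simps using M by simp
   also have "... = trans_mor u (Suc i) (j - Suc i) (idt (X (Suc i))) \<cdot> u i" by (rule trans_mor_cmp[of u X, OF u]) (use M in simp_all)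
   finally have "\<psi> j \<cdot> io i = (\<psi> j \<cdot> io (Suc i)) \<cdot> u i" using True by (simp add: \<psi>(2))
   moreover have "arr (\<psi> j \<cdot> io i)" "ob (X j)" "dm (\<psi> j \<cdot> io i) = X i" "cd (\<psi> j \<cdot> io i) = X j" using M by simp_all
   ultimately have "nul ((\<psi> j \<cdot> \<Phi>) \<cdot> io i)" using eq M by (metis plus_ng(1) nul_zr)
   thus ?thesis by (rule nul_eq) (use pr(1)[of j] pr(3)[of i j] True M in simp_all)
  next
   case False
   have "(\<psi> j \<cdot> io (Suc i)) \<cdot> u i = zr (X i) (X j)"
    by (rule nul_eq) (use False M \<psi>(2)[of j "Suc i"] nul_cmp[of "u i" "zr (X (Suc i)) (X j)"] in simp_all)
   hence "(\<psi> j \<cdot> \<Phi>) \<cdot> io i = \<psi> j \<cdot> io i" using eq M by simp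
   also have "... = pr j \<cdot> io i"
   proof (cases "i = j")
    case True thus ?thesis using \<psi>(2)[of j j] pr(2) by simp
   next
    case F: False
    show ?thesis by (rule nul_eq) (use F False M \<psi>(2)[of j i] pr(3)[OF F] pr(1)[of j] in simp_all)
   qed
   finally show ?thesis .
  qed
 qed (use \<psi>(1)[of j] pr(1)[of j] \<Phi>(1) in simp_all)
 let ?w = "%k. g \<cdot> io k"
 have w: "mor (?w k) (X k) W" for k using D[of k] E by simp
 have wu: "?w (Suc k) \<cdot> u k = ?w k" for k
 proof (rule diff_zr[symmetric])
  note M = D[of k] D[of "Suc k"] u[of k] E
  have "nul ((g \<cdot> \<Phi>) \<cdot> io k)" using nul_cmp[of "io k" "g \<cdot> \<Phi>"] X1(4) M by simp
  moreover have "(g \<cdot> \<Phi>) \<cdot> io k = g \<cdot> (io k +. ng (io (Suc k) \<cdot> u k))" using \<Phi>(2)[of k] M by simp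
  moreover have "... = ?w k +. ng (?w (Suc k) \<cdot> u k)" using M by (simp add: plus_dist)
  ultimately show "nul (?w k +. ng (?w (Suc k) \<cdot> u k))" by simp
 qed (use D[of k] D[of "Suc k"] u[of k] E in simp_all)
 \<comment> \<open>A morphism from a compact object meets only finitely many summands; N bounds
   their indices.\<close>
 have fac: "EX N e. (\<forall>i\<ge>N. nul (pr i \<cdot> d)) \<and> (EX K. finite K \<and> K <= {..N} \<and> trunc UNIV io P K e \<and> e \<cdot> d = d)"
  if C: "cpt C" and d: "mor d C P" for C d
 proof -
  obtain K e where K: "finite K" "trunc UNIV io P K e" "e \<cdot> d = d"
   using compact_factor[OF C small_nat c d] unfolding fin_factor_def by blast
  obtain N where N: "!!i. i \<in> K ==> i < N" using finite_nat_bounded[OF K(1)] by blast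
  have em: "mor e P P" using K(2) by (simp add: trunc_def)
  have "nul (pr i \<cdot> d)" if i: "i \<ge> N" for i
  proof -
   have "nul (pr i \<cdot> e)"
   proof (rule cop_nul[OF c])
    fix j
    note M = pr(1)[of i] em D[of j]
    have "nul (pr i \<cdot> (e \<cdot> io j))"
    proof (cases "j \<in> K")
     case True
     hence "j ~= i" "e \<cdot> io j = io j" using N[of j] i K(2) by (auto simp: trunc_def)
     thus ?thesis using pr(3) by simp
    next
     case False
     thus ?thesis using K(2) nul_cmp[of "e \<cdot> io j" "pr i"] M by (simp add: trunc_def)
    qed
    thus "nul ((pr i \<cdot> e) \<cdot> io j)" using M by simp
   qed (use pr(1)[of i] em in simp_all)
   hence "nul ((pr i \<cdot> e) \<cdot> d)" using nul_cmp[of d "pr i \<cdot> e"] pr(1)[of i] em d by simp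
   thus ?thesis using pr(1)[of i] em d K(3) by simp
  qed
  moreover have "K <= {..N}" using N less_imp_le by auto
  ultimately show ?thesis using K by blast
 qed
 have inj: "nul d" if C: "cpt C" and d: "mor d C P" and z: "nul (\<Phi> \<cdot> d)" for C d
 proof -
  have prd: "nul (pr j \<cdot> d)" for j
  proof -
   have "pr j \<cdot> d = \<psi> j \<cdot> (\<Phi> \<cdot> d)" using \<psi>\<Phi>[of j, symmetric] \<psi>(1)[of j] \<Phi>(1) d by simp
   thus ?thesis using nul_cmp[of "\<Phi> \<cdot> d" "\<psi> j"] z \<psi>(1)[of j] \<Phi>(1) d by simp
  qed
  obtain N K e where K: "finite K" "trunc UNIV io P K e" "e \<cdot> d = d" using fac[OF C d] by blast
  have m: "mor (io i \<cdot> pr i) P P" for i using D[of i] pr(1)[of i] by simp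
  have "e = fsum P P (%i. io i \<cdot> pr i) K" by (rule trunc_fsum[OF c K(2,1)]) (use pr in auto)
  hence "d = fsum P P (%i. io i \<cdot> pr i) K \<cdot> d" using K(3) by simp
  also have "... = fsum C P (%i. (io i \<cdot> pr i) \<cdot> d) K" by (rule fsum_pre[OF K(1) m d P])
  also have "... = fsum C P (%i. (io i \<cdot> pr i) \<cdot> d) {i \<in> K. False}"
  proof (rule fsum_support[OF K(1)])
   fix i
   note M = D[of i] pr(1)[of i] d
   show "mor ((io i \<cdot> pr i) \<cdot> d) C P" using M by simp
   show "nul ((io i \<cdot> pr i) \<cdot> d)" using nul_cmp[of "pr i \<cdot> d" "io i"] prd[of i] M by simp
  qed (use d in simp_all)
  also have "... = zr C P" using fsum_empty[of C P] d by simp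
  finally show "nul d" using d by (metis mor_iff nul_zr)
 qed
 show ?thesis
 proof (rule exI[of _ W], rule exI[of _ ?w], unfold hocolim_def, intro conjI allI impI)
  show "mor (?w k) (X k) W" "?w (Suc k) \<cdot> u k = ?w k" for k by (rule w wu)+
  fix B b assume B: "ob B" and b0: "ALL k. mor (b k) (X k) B" "ALL k. b (Suc k) \<cdot> u k = b k"
  note b = b0[rule_format]
  obtain q where q: "mor q P B" "!!k. q \<cdot> io k = b k" using cop_ex[OF c B, of b] b(1) by blast
  have "nul (q \<cdot> \<Phi>)"
  proof (rule cop_nul[OF c])
   fix k
   note M = D[of k] D[of "Suc k"] u[of k] q(1) b(1)[of k] \<Phi>(1)
   have "(q \<cdot> \<Phi>) \<cdot> io k = q \<cdot> (io k +. ng (io (Suc k) \<cdot> u k))" using \<Phi>(2)[of k] M by simp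
   also have "... = q \<cdot> io k +. ng (q \<cdot> (io (Suc k) \<cdot> u k))" using M by (simp add: plus_dist)
   also have "q \<cdot> (io (Suc k) \<cdot> u k) = (q \<cdot> io (Suc k)) \<cdot> u k" using M by simp
   finally show "nul ((q \<cdot> \<Phi>) \<cdot> io k)" using q(2) b(2) M plus_ng(1)[of "b k"] by simp
  qed (use q(1) \<Phi>(1) in simp_all)
  then obtain v where v: "mor v W B" "v \<cdot> g = q" using X1(6)[of q] q(1) E by auto
  have "v \<cdot> ?w k = b k" for k
  proof -
   have "v \<cdot> ?w k = (v \<cdot> g) \<cdot> io k" using v(1) E D[of k] by simp
   thus ?thesis using v(2) q(2) by simp
  qed
  thus "EX h. mor h W B \<and> (ALL k. h \<cdot> ?w k = b k)" using v(1) by blast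
 next
  fix C y assume C: "cpt C" and y: "mor y C W"
  \<comment> \<open>The composite of y with the connecting map is, after desuspension, killed by
    \<Phi>, so it vanishes by injectivity; hence y lifts to the coproduct.\<close>
  have "nul (sm (- 1) (h \<cdot> y))"
  proof (rule inj[OF compact_so[OF C, of "- 1"]])
   have "\<Phi> \<cdot> sm (- 1) (h \<cdot> y) = sm (- 1) ((sm 1 \<Phi> \<cdot> h) \<cdot> y)" using E y by simp
   also have "nul ..." by (subst nul_sm) (use X3(4) nul_cmp[of y "sm 1 \<Phi> \<cdot> h"] E y in simp_all)
   finally show "nul (\<Phi> \<cdot> sm (- 1) (h \<cdot> y))" .
  qed (use E y in simp)
  hence "nul (h \<cdot> y)" by (subst (asm) nul_sm) (use E y in simp_all)
  then obtain d where d: "mor d C P" "g \<cdot> d = y" using X2(5)[of y] y E by auto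
  obtain N K e where K: "K <= {..N}" "trunc UNIV io P K e" "e \<cdot> d = d" using fac[OF C d(1)] by blast
  have em: "mor e P P" using K(2) by (simp add: trunc_def)
  \<comment> \<open>Summands with index up to N can be pushed forward into X N without changing
    their image in W.\<close>
  have eq: "?w N \<cdot> (\<psi> N \<cdot> e) = g \<cdot> e"
  proof (rule cop_eq[OF c])
   fix i
   note M = w[of N] \<psi>(1)[of N] em D[of i] E
   show "(?w N \<cdot> (\<psi> N \<cdot> e)) \<cdot> io i = (g \<cdot> e) \<cdot> io i"
   proof (cases "i \<in> K")
    case True
    hence iN: "i \<le> N" and ei: "e \<cdot> io i = io i" using K(1,2) by (auto simp: trunc_def)
    have "(?w N \<cdot> (\<psi> N \<cdot> e)) \<cdot> io i = ?w N \<cdot> (\<psi> N \<cdot> (e \<cdot> io i))" using M D[of N] by simp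
    also have "... = ?w (i + (N - i)) \<cdot> trans_mor u i (N - i) (idt (X i))" using ei \<psi>(2)[of N i] iN by simp
    also have "... = ?w i \<cdot> idt (X i)" by (rule trans_mor_cocone[of u X, OF u w wu, of "idt (X i)" "X i"]) (use oX in simp)
    also have "... = g \<cdot> (e \<cdot> io i)" using w[of i] ei by simp
    finally show ?thesis using M by simp
   next
    case False
    hence z: "nul (e \<cdot> io i)" using K(2) by (simp add: trunc_def)
    have "nul ((?w N \<cdot> \<psi> N) \<cdot> (e \<cdot> io i))" "nul (g \<cdot> (e \<cdot> io i))"
     using nul_cmp[of "e \<cdot> io i" "?w N \<cdot> \<psi> N"] nul_cmp[of "e \<cdot> io i" g] z M by simp_all
    thus ?thesis by (intro nul_eq) (use M D[of N] in simp_all)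
   qed
  qed (use w[of N] \<psi>(1)[of N] em E in simp_all)
  have "?w N \<cdot> (\<psi> N \<cdot> d) = (?w N \<cdot> (\<psi> N \<cdot> e)) \<cdot> d"
   using w[of N] \<psi>(1)[of N] em d(1) E K(3) D[of N] by simp
  also have "... = y" unfolding eq using em d E K(3) by simp
  finally show "EX k c'. mor c' C (X k) \<and> ?w k \<cdot> c' = y" using \<psi>(1)[of N] d(1) by (intro exI[of _ N] exI[of _ "\<psi> N \<cdot> d"]) simp
 next
  fix C y k assume C: "cpt C" and y: "mor y C (X k)" and z: "nul (?w k \<cdot> y)"
  obtain d where d: "mor d C P" "\<Phi> \<cdot> d = io k \<cdot> y" using X1(5)[of "io k \<cdot> y"] y D[of k] E z by auto
  obtain N where N: "!!i. i \<ge> N ==> nul (pr i \<cdot> d)" using fac[OF C d(1)] by blast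
  \<comment> \<open>At this index the projection of d vanishes; it equals the transition of y
    through N further stages.\<close>
  let ?j = "k + N"
  note M = \<psi>(1)[of ?j] \<Phi>(1) D[of k] d(1) y
  have "pr ?j \<cdot> d = \<psi> ?j \<cdot> (\<Phi> \<cdot> d)" using \<psi>\<Phi>[of ?j, symmetric] M by simp
  also have "... = (\<psi> ?j \<cdot> io k) \<cdot> y" unfolding d(2) using M by simp
  also have "... = trans_mor u k N (idt (X k)) \<cdot> y" unfolding \<psi>(2) by simp
  also have "... = trans_mor u k N (idt (X k) \<cdot> y)" by (rule trans_mor_cmp[of u X "idt (X k)" "X k" k y C, OF u, symmetric]) (use y in simp_all)
  also have "... = trans_mor u k N y" using y by simp
  finally show "EX m. nul (trans_mor u k m y)" using N[of ?j] by (intro exI[of _ N]) simp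
 qed
qed

end

section \<open>Torsion morphisms\<close>

locale linear_category = big_category T U + noetherian_graded_ring R
 for T :: "('o, 'm) tcat" (structure) and U :: "'u set" and R :: "('r, 'z) gring_scheme" +
 fixes \<phi> :: "int => 'r => 'o => 'm"
 assumes linear: "linear_action R T \<phi>"
begin

abbreviation "TS \<equiv> torsion_sub U R T \<phi>"
abbreviation "HS \<equiv> hom_star T \<phi>"
abbreviation "LT \<equiv> localization_triangle U R T \<phi>"
abbreviation "GV \<equiv> Gamma_V U R T \<phi>"
abbreviation "LV \<equiv> L_V U R T \<phi>"

lemma lin_mor [simp]:
 assumes "r \<in> deg R n" "ob X" shows "arr (\<phi> n r X)" "dm (\<phi> n r X) = X" "cd (\<phi> n r X) = so n X"
proof -
 have "\<phi> n r X \<in> Hom T X (so n X)" using linear assms unfolding linear_action_def graded_center_def by blast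
 thus "arr (\<phi> n r X)" "dm (\<phi> n r X) = X" "cd (\<phi> n r X) = so n X" using assms by (simp_all add: Hom_mor)
qed

lemma lin_natural:
 assumes "r \<in> deg R n" "arr f" shows "\<phi> n r (cd f) \<cdot> f = sm n f \<cdot> \<phi> n r (dm f)"
proof -
 have "\<phi> n r \<in> graded_center T n" using linear assms(1) unfolding linear_action_def by blast
 thus ?thesis using arrE[OF assms(2)] arr_ob[OF assms(2)] by (simp add: graded_center_def)
qed

lemma lin_sus:
 assumes "r \<in> deg R n" "ob X"
 shows "\<phi> n r (so 1 X) = (if even n then sm 1 (\<phi> n r X) else ng (sm 1 (\<phi> n r X)))"
proof -
 have "\<phi> n r \<in> graded_center T n" using linear assms(1) unfolding linear_action_def by blast
 hence "\<phi> n r (\<Sigma>\<^sub>o X) = (if even n then \<Sigma>\<^sub>m (\<phi> n r X)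
   else neg_mor T (\<Sigma>\<^sub>o X) (so (n + 1) X) (\<Sigma>\<^sub>m (\<phi> n r X)))"
  using assms(2) unfolding graded_center_def by blast
 thus ?thesis using assms by (simp add: sus_susp ng_def add.commute)
qed

lemma lin_add: "r \<in> deg R n ==> s \<in> deg R n ==> ob X ==> \<phi> n (r \<oplus>\<^bsub>R\<^esub> s) X = \<phi> n r X +. \<phi> n s X"
 using linear unfolding linear_action_def by blast

lemma lin_mult: "r \<in> deg R m ==> s \<in> deg R n ==> ob X ==> \<phi> (m + n) (r \<otimes>\<^bsub>R\<^esub> s) X = sm n (\<phi> m r X) \<cdot> \<phi> n s X"
 using linear unfolding linear_action_def by blast

lemma lin_one: "ob X ==> \<phi> 0 \<one>\<^bsub>R\<^esub> X = idt X"
 using linear unfolding linear_action_def by blast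

lemma lin_mult2:
 assumes "r \<in> deg R m" "s \<in> deg R n" "ob X"
 shows "\<phi> (n + m) (s \<otimes>\<^bsub>R\<^esub> r) X = \<phi> m r (so n X) \<cdot> \<phi> n s X"
 using lin_mult[OF assms(2,1,3)] lin_natural[OF assms(1), of "\<phi> n s X"] assms by simp

text \<open>The sign is left undetermined: it affects neither the vanishing of a composite nor
  torsion.\<close>

lemma lin_so:
 assumes "r \<in> deg R n" "ob X" shows "\<phi> n r (so k X) = sm k (\<phi> n r X) \<or> \<phi> n r (so k X) = ng (sm k (\<phi> n r X))"
proof (rule int_shift_induct[of _ k])
 fix k
 have s: "\<phi> n r (so (k + 1) X) = sm 1 (\<phi> n r (so k X)) \<or> \<phi> n r (so (k + 1) X) = ng (sm 1 (\<phi> n r (so k X)))"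
  using lin_sus[OF assms(1), of "so k X"] assms(2) by (simp add: add.commute)
 let ?a = "\<phi> n r (so k X)" and ?b = "sm k (\<phi> n r X)"
 have m: "arr ?a" "arr ?b" "dm ?a = dm ?b" "cd ?a = cd ?b" using assms by (simp_all add: add.commute)
 have 1: "sm 1 ?b = sm (k + 1) (\<phi> n r X)" using assms by (simp add: add.commute)
 have 2: "ng (sm 1 ?a) = sm (k + 1) (\<phi> n r X) \<longleftrightarrow> ?a = ng ?b" "ng (sm 1 ?a) = ng (sm (k + 1) (\<phi> n r X)) \<longleftrightarrow> ?a = ?b"
  "sm 1 ?a = sm (k + 1) (\<phi> n r X) \<longleftrightarrow> ?a = ?b" "sm 1 ?a = ng (sm (k + 1) (\<phi> n r X)) \<longleftrightarrow> ?a = ng ?b"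
  unfolding 1[symmetric] using m by (metis sm_eq sm_ng ng_ng ng_arr(1))+
 show "(\<phi> n r (so k X) = sm k (\<phi> n r X) \<or> \<phi> n r (so k X) = ng (sm k (\<phi> n r X))) \<longleftrightarrow>
   (\<phi> n r (so (k + 1) X) = sm (k + 1) (\<phi> n r X) \<or> \<phi> n r (so (k + 1) X) = ng (sm (k + 1) (\<phi> n r X)))"
  using s 2 by metis
qed simp

lemma lin_so_nul:
 assumes "r \<in> deg R n" "arr f" "cd f = so k X" "ob X"
 shows "nul (\<phi> n r (so k X) \<cdot> f) \<longleftrightarrow> nul (sm k (\<phi> n r X) \<cdot> f)"
 using lin_so[OF assms(1,4), of k] assms by (auto simp: add.commute)

text \<open>
 Torsion is taken with respect to a multiplicative family \<open>S\<close> of homogeneous elements: the complement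
 of a prime, the powers of an element, or \<open>{1}\<close>, in which case torsion means vanishing.
\<close>

definition mfam :: "(int => 'r set) => bool" where
 "mfam S \<longleftrightarrow> (ALL i. S i <= deg R i) \<and> \<one>\<^bsub>R\<^esub> \<in> S 0 \<and> (ALL i j. \<forall>s\<in>S i. \<forall>t\<in>S j. s \<otimes>\<^bsub>R\<^esub> t \<in> S (i + j))"

definition tor :: "(int => 'r set) => 'm => bool" where
 "tor S f \<longleftrightarrow> (EX i. \<exists>s\<in>S i. nul (\<phi> i s (cd f) \<cdot> f))"

text \<open>With \<open>avoid p\<close> this says that Hom*(A, B) vanishes at p, with
  \<open>ones\<close> that Hom*(A, B) is zero. Suspensions are put on the source;
  \<open>TP_iff\<close> moves them to the target.\<close>

definition TP :: "(int => 'r set) => 'o => 'o => bool" where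
 "TP S A B \<longleftrightarrow> (ALL n f. mor f (so n A) B --> tor S f)"

definition ones :: "int => 'r set" where "ones i = (if i = 0 then {\<one>\<^bsub>R\<^esub>} else {})"
definition avoid :: "'r set => int => 'r set" where "avoid q i = deg R i - q"
definition powers :: "int => 'r => int => 'r set" where "powers d x i = {x [^]\<^bsub>R\<^esub> k | k :: nat. i = int k * d}"

lemma mfam_ones: "mfam ones"
 using one_deg by (auto simp: mfam_def ones_def)

lemma mfam_avoid: "q \<in> Spec R ==> mfam (avoid q)"
 using Spec_one one_deg mult_deg Spec_prime dcar unfolding mfam_def avoid_def by blast

lemma tor_ones: "arr f ==> tor ones f \<longleftrightarrow> nul f"
 by (auto simp: tor_def ones_def lin_one)

lemma TP_ones: "TP ones A B \<longleftrightarrow> (ALL n f. mor f (so n A) B --> nul f)"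
 by (auto simp: TP_def tor_ones)

context
 fixes S assumes S: "mfam S"
begin

lemma mfam_deg: "s \<in> S i ==> s \<in> deg R i"
 using S by (auto simp: mfam_def)

lemma tor_nul: assumes "arr f" "nul f" shows "tor S f"
 unfolding tor_def using S assms by (intro exI[of _ 0] bexI[of _ "\<one>\<^bsub>R\<^esub>"]) (auto simp: lin_one mfam_def)

lemma tor_pre: assumes "tor S f" "arr f" "arr g" "cd g = dm f" shows "tor S (f \<cdot> g)"
proof -
 obtain i s where s: "s \<in> S i" "nul (\<phi> i s (cd f) \<cdot> f)" using assms(1) by (auto simp: tor_def)
 hence "nul ((\<phi> i s (cd f) \<cdot> f) \<cdot> g)" using nul_cmp[of g "\<phi> i s (cd f) \<cdot> f"] mfam_deg[OF s(1)] assms by simp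
 thus ?thesis unfolding tor_def using s(1) mfam_deg[OF s(1)] assms by (intro exI[of _ i] bexI[of _ s]) simp_all
qed

lemma tor_post: assumes "tor S f" "arr f" "arr g" "dm g = cd f" shows "tor S (g \<cdot> f)"
proof -
 obtain i s where s: "s \<in> S i" "nul (\<phi> i s (cd f) \<cdot> f)" using assms(1) by (auto simp: tor_def)
 note d = mfam_deg[OF s(1)]
 have "\<phi> i s (cd g) \<cdot> (g \<cdot> f) = (\<phi> i s (cd g) \<cdot> g) \<cdot> f" using d assms by simp
 also have "... = sm i g \<cdot> (\<phi> i s (cd f) \<cdot> f)" unfolding lin_natural[OF d assms(3)] using d assms by simp
 finally have "nul (\<phi> i s (cd g) \<cdot> (g \<cdot> f))" using nul_cmp[of "\<phi> i s (cd f) \<cdot> f" "sm i g"] s d assms by simp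
 thus ?thesis unfolding tor_def using s(1) assms by (intro exI[of _ i] bexI[of _ s]) simp_all
qed

lemma tor_sm: assumes "arr f" shows "tor S (sm n f) \<longleftrightarrow> tor S f"
proof -
 have *: "nul (\<phi> i s (so n (cd f)) \<cdot> sm n f) \<longleftrightarrow> nul (\<phi> i s (cd f) \<cdot> f)" if "s \<in> S i" for i s
 proof -
  note d = mfam_deg[OF that]
  have "nul (\<phi> i s (so n (cd f)) \<cdot> sm n f) \<longleftrightarrow> nul (sm n (\<phi> i s (cd f)) \<cdot> sm n f)"
   by (rule lin_so_nul[OF d]) (use assms in simp_all)
  also have "... \<longleftrightarrow> nul (sm n (\<phi> i s (cd f) \<cdot> f))" using d assms by simp
  also have "... \<longleftrightarrow> nul (\<phi> i s (cd f) \<cdot> f)" by (rule nul_sm) (use d assms in simp)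
  finally show ?thesis .
 qed
 thus ?thesis unfolding tor_def using assms by simp
qed

lemma tor_mult: assumes "s \<in> S i" "arr f" "tor S (\<phi> i s (cd f) \<cdot> f)" shows "tor S f"
proof -
 note d = mfam_deg[OF assms(1)]
 obtain j t where t: "t \<in> S j" "nul (\<phi> j t (so i (cd f)) \<cdot> (\<phi> i s (cd f) \<cdot> f))"
  using assms d by (auto simp: tor_def)
 have "\<phi> j t (so i (cd f)) \<cdot> (\<phi> i s (cd f) \<cdot> f) = \<phi> (i + j) (s \<otimes>\<^bsub>R\<^esub> t) (cd f) \<cdot> f"
  unfolding lin_mult2[OF mfam_deg[OF t(1)] d arr_ob(2)[OF assms(2)]] using d mfam_deg[OF t(1)] assms(2) by simp
 moreover have "s \<otimes>\<^bsub>R\<^esub> t \<in> S (i + j)" using S assms(1) t(1) by (auto simp: mfam_def)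
 ultimately show ?thesis unfolding tor_def using t(2) by auto
qed

lemma tor_add: assumes "arr f" "arr g" "dm f = dm g" "cd f = cd g" "tor S f" "tor S g" shows "tor S (f +. g)"
proof -
 obtain i s where s: "s \<in> S i" "nul (\<phi> i s (cd g) \<cdot> f)" using assms(4,5) by (auto simp: tor_def)
 obtain j t where t: "t \<in> S j" "nul (\<phi> j t (cd g) \<cdot> g)" using assms(6) by (auto simp: tor_def)
 note d = mfam_deg[OF s(1)] mfam_deg[OF t(1)]
 let ?a = "\<phi> (i + j) (s \<otimes>\<^bsub>R\<^esub> t) (cd g)"
 have a: "?a = \<phi> j t (so i (cd g)) \<cdot> \<phi> i s (cd g)" "?a = sm j (\<phi> i s (cd g)) \<cdot> \<phi> j t (cd g)"
  using lin_mult2[OF d(2,1)] lin_mult[OF d] assms(2) by simp_all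
 have st: "s \<otimes>\<^bsub>R\<^esub> t \<in> S (i + j)" using S s(1) t(1) by (auto simp: mfam_def)
 have "?a \<cdot> f = \<phi> j t (so i (cd g)) \<cdot> (\<phi> i s (cd g) \<cdot> f)" unfolding a(1) using d assms by simp
 hence 1: "nul (?a \<cdot> f)" using nul_cmp[of "\<phi> i s (cd g) \<cdot> f" "\<phi> j t (so i (cd g))"] s d assms by simp
 have "?a \<cdot> g = sm j (\<phi> i s (cd g)) \<cdot> (\<phi> j t (cd g) \<cdot> g)" unfolding a(2) using d assms by simp
 hence 2: "nul (?a \<cdot> g)" using nul_cmp[of "\<phi> j t (cd g) \<cdot> g" "sm j (\<phi> i s (cd g))"] t d assms by (simp add: add.commute)
 have "?a \<cdot> (f +. g) = ?a \<cdot> f +. ?a \<cdot> g" using mfam_deg[OF st] assms by (simp add: plus_dist)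
 hence "nul (?a \<cdot> (f +. g))" using nul_plus[OF _ _ _ _ 1 2] mfam_deg[OF st] assms by simp
 thus ?thesis unfolding tor_def using st assms by (intro exI[of _ "i + j"] bexI[of _ "s \<otimes>\<^bsub>R\<^esub> t"]) simp_all
qed

lemma tor_fsum:
 assumes "finite K" "!!i. i \<in> K ==> mor (h i) X Y \<and> tor S (h i)" "ob X" "ob Y" shows "tor S (fsum X Y h K)"
 using assms(1,2)
proof (induction K)
 case empty
 show ?case by (rule tor_nul) (use assms in \<open>simp_all add: fsum_empty\<close>)
next
 case (insert a K)
 have i: "fsum X Y h (insert a K) = h a +. fsum X Y h K" by (rule fsum_insert) (use insert assms in auto)
 have "mor (fsum X Y h K) X Y" by (rule fsum_mor) (use insert assms in auto)
 thus ?case unfolding i by (intro tor_add) (use insert in auto)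
qed

text \<open>Exactness of localization: if s kills v f, then s f lifts along a suspension of u, and
  the lift is torsion by assumption. \<open>tor_extend\<close> is the dual for factorizations
  through v.\<close>

lemma tor_lift:
 assumes "expair u v" "arr f" "cd f = dm v" "tor S (v \<cdot> f)" "!!i w. mor w (dm f) (so i (dm u)) ==> tor S w"
 shows "tor S f"
proof -
 note E = expairD[OF assms(1)]
 obtain i s where s: "s \<in> S i" "nul (\<phi> i s (cd v) \<cdot> (v \<cdot> f))" using assms(2,3,4) E by (auto simp: tor_def)
 note d = mfam_deg[OF s(1)]
 have "\<phi> i s (cd v) \<cdot> (v \<cdot> f) = (\<phi> i s (cd v) \<cdot> v) \<cdot> f" using d assms(2,3) E by simp
 also have "... = sm i v \<cdot> (\<phi> i s (cd f) \<cdot> f)" unfolding lin_natural[OF d E(2)] using d assms(2,3) E by simp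
 finally have "nul (sm i v \<cdot> (\<phi> i s (cd f) \<cdot> f))" using s(2) by simp
 then obtain w where w: "mor w (dm f) (so i (dm u))" "sm i u \<cdot> w = \<phi> i s (cd f) \<cdot> f"
  using expairD(5)[OF expair_sm[OF assms(1), of i], of "\<phi> i s (cd f) \<cdot> f"] d E assms(2,3) by auto
 have "tor S (sm i u \<cdot> w)" by (rule tor_post) (use assms(5)[OF w(1)] w(1) E in simp_all)
 thus ?thesis using tor_mult[OF s(1) assms(2)] w(2) by simp
qed

lemma tor_extend:
 assumes "expair u v" "arr f" "dm f = dm v" "tor S (f \<cdot> u)" "!!i w. mor w (cd v) (so i (cd f)) ==> tor S w"
 shows "tor S f"
proof -
 note E = expairD[OF assms(1)]
 obtain i s where s: "s \<in> S i" "nul (\<phi> i s (cd f) \<cdot> (f \<cdot> u))" using assms(2,3,4) E by (auto simp: tor_def)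
 note d = mfam_deg[OF s(1)]
 have "nul ((\<phi> i s (cd f) \<cdot> f) \<cdot> u)" using s(2) d assms(2,3) E by simp
 then obtain w where w: "mor w (cd v) (so i (cd f))" "w \<cdot> v = \<phi> i s (cd f) \<cdot> f"
  using E(6)[of "\<phi> i s (cd f) \<cdot> f"] d E assms(2,3) by auto
 have "tor S (w \<cdot> v)" by (rule tor_pre) (use assms(5)[OF w(1)] w(1) E in simp_all)
 thus ?thesis using tor_mult[OF s(1) assms(2)] w(2) by simp
qed

lemma TP_tor: assumes "TP S A B" "mor f (so m A) (so n B)" "ob A" "ob B" shows "tor S f"
proof -
 have "tor S (sm (- n) f)" using assms unfolding TP_def by (auto intro!: spec[of _ "m - n"])
 thus ?thesis using tor_sm[of f "- n"] assms(2) by simp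
qed

lemma TP_tor': "TP S A B ==> ob A ==> ob B ==> mor f A (so n B) ==> tor S f"
 using TP_tor[of A B f 0 n] by simp

lemma TP_tor'': "TP S A B ==> ob A ==> ob B ==> mor f A B ==> tor S f"
 using TP_tor[of A B f 0 0] by simp

lemma TP_iff: assumes "ob A" "ob B" shows "TP S A B \<longleftrightarrow> (ALL n f. mor f A (so n B) --> tor S f)"
proof
 assume h: "ALL n f. mor f A (so n B) --> tor S f"
 show "TP S A B" unfolding TP_def
 proof (intro allI impI)
  fix n f assume f: "mor f (so n A) B"
  have "tor S (sm (- n) f)" using h[rule_format, of "sm (- n) f" "- n"] f assms by simp
  thus "tor S f" using tor_sm[of f "- n"] f by simp
 qed
qed (use TP_tor' assms in blast)

lemma TP_right: assumes A: "ob A" shows "triangulated_sub T {B \<in> Obj T. TP S A B}"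
 unfolding triangulated_sub_def
proof (intro conjI allI impI ballI)
 obtain Z where Z: "zero_obj T Z" using zero_exists by blast
 hence "ob Z" by (simp add: zero_obj_def)
 moreover have "TP S A Z" unfolding TP_def using zero_obj_nul[OF Z] tor_nul by simp
 ultimately show "{B \<in> Obj T. TP S A B} ~= {}" by blast
next
 fix B n assume B: "B \<in> {B \<in> Obj T. TP S A B}"
 have "TP S A (so n B)" unfolding TP_def using TP_tor[of A B _ _ n] B A by blast
 thus "so n B \<in> {B \<in> Obj T. TP S A B}" using B by simp
next
 fix X Y Z f g h assume h: "exact_tri T X Y Z f g h \<and> X \<in> {B \<in> Obj T. TP S A B} \<and> Y \<in> {B \<in> Obj T. TP S A B}"
 note E = triD[OF conjunct1[OF h]]
 have "TP S A Z" unfolding TP_def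
 proof (intro allI impI)
  fix n k assume k: "mor k (so n A) Z"
  show "tor S k"
  proof (rule tor_lift[OF tri_expair(2)[OF conjunct1[OF h]]])
   show "tor S (h \<cdot> k)" by (rule TP_tor[of A X _ n 1]) (use h E k A in simp_all)
   show "tor S w" if "mor w (dm k) (so i (dm g))" for i w by (rule TP_tor[of A Y w n i]) (use h E k A that in simp_all)
  qed (use k E in simp_all)
 qed
 thus "Z \<in> {B \<in> Obj T. TP S A B}" using E by simp
qed auto

lemma TP_left: assumes B: "ob B" shows "triangulated_sub T {A \<in> Obj T. TP S A B}"
 unfolding triangulated_sub_def
proof (intro conjI allI impI ballI)
 obtain Z where Z: "zero_obj T Z" using zero_exists by blast
 hence o: "ob Z" by (simp add: zero_obj_def)
 moreover have "TP S Z B" unfolding TP_iff[OF o B] using zero_obj_nul[OF Z] tor_nul by simp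
 ultimately show "{A \<in> Obj T. TP S A B} ~= {}" by blast
next
 fix A n assume A: "A \<in> {A \<in> Obj T. TP S A B}"
 have "TP S (so n A) B" unfolding TP_def
 proof (intro allI impI)
  fix k f assume "mor f (so k (so n A)) B"
  thus "tor S f" by (intro TP_tor[of A B f "k + n" 0]) (use A B in simp_all)
 qed
 thus "so n A \<in> {A \<in> Obj T. TP S A B}" using A by simp
next
 fix X Y Z f g h assume h: "exact_tri T X Y Z f g h \<and> X \<in> {A \<in> Obj T. TP S A B} \<and> Y \<in> {A \<in> Obj T. TP S A B}"
 note E = triD[OF conjunct1[OF h]]
 have oZ: "ob Z" using E by simp
 have "TP S Z B" unfolding TP_iff[OF oZ B]
 proof (intro allI impI)
  fix n k assume k: "mor k Z (so n B)"
  show "tor S k"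
  proof (rule tor_extend[OF tri_expair(2)[OF conjunct1[OF h]]])
   show "tor S (k \<cdot> g)" by (rule TP_tor'[of Y B _ n]) (use h E k B in simp_all)
   show "tor S w" if "mor w (cd h) (so i (cd k))" for i w by (rule TP_tor[of X B w 1 "i + n"]) (use h E k B that in simp_all)
  qed (use k E in simp_all)
 qed
 thus "Z \<in> {A \<in> Obj T. TP S A B}" using E by simp
qed auto

text \<open>A map from a compact object into a coproduct is a finite sum of maps through the
  summands, and finitely many denominators have a common multiple.\<close>

lemma TP_localizing: assumes A: "cpt A" shows "localizing_sub U T {B \<in> Obj T. TP S A B}"
 unfolding localizing_sub_def
proof (intro conjI allI impI TP_right)
 show oA: "ob A" by (rule compact_ob[OF A])
 fix J :: "'u set" and F Y io
 assume h: "J <= U \<and> small U J \<and> F \<in> J \<rightarrow> {B \<in> Obj T. TP S A B} \<and> coproduct T J F Y io"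
 hence c: "cop J F Y io" by (auto simp: cop_def)
 note D = copD[OF c]
 obtain pr where pr: "!!i. i \<in> J ==> mor (pr i) Y (F i)" "!!i. i \<in> J ==> pr i \<cdot> io i = idt (F i)"
  "!!i j. i \<in> J ==> j \<in> J ==> j ~= i ==> nul (pr i \<cdot> io j)" by (rule cop_pr[OF c], rule that; assumption)
 have "TP S A Y" unfolding TP_def
 proof (intro allI impI)
  fix n f assume f: "mor f (so n A) Y"
  obtain K e where K: "finite K" "K <= J" "trunc J io Y K e" "e \<cdot> f = f"
   using compact_factor[OF compact_so[OF A] conjunct1[OF conjunct2[OF h]] c f] unfolding fin_factor_def by blast
  have m: "mor (io i) (F i) Y" "mor (pr i) Y (F i)" if "i \<in> K" for i using D(1) pr(1) that K(2) by blast+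
  have "f = fsum Y Y (%i. io i \<cdot> pr i) K \<cdot> f" using K(4) trunc_fsum[OF c K(3,1,2) pr] by simp
  also have "... = fsum (so n A) Y (%i. (io i \<cdot> pr i) \<cdot> f) K" by (rule fsum_pre[OF K(1)]) (use m f in auto)
  also have "tor S ..."
  proof (rule tor_fsum[OF K(1)])
   fix i assume i: "i \<in> K"
   note M = m[OF i] f
   have "TP S A (F i)" using h i K(2) by auto
   moreover have "mor (pr i \<cdot> f) (so n A) (F i)" using M by simp
   ultimately have "tor S (pr i \<cdot> f)" unfolding TP_def by blast
   hence "tor S (io i \<cdot> (pr i \<cdot> f))" by (rule tor_post) (use M in simp_all)
   thus "mor ((io i \<cdot> pr i) \<cdot> f) (so n A) Y \<and> tor S ((io i \<cdot> pr i) \<cdot> f)" using M by simp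
  qed (use f in simp_all)
  finally show "tor S f" .
 qed
 thus "Y \<in> {B \<in> Obj T. TP S A B}" using D(2) by simp
qed

lemma tor_idt: assumes "ob B" "tor S (idt B)" shows "ob A ==> TP S A B" "ob C ==> TP S B C"
proof -
 show "TP S A B" if "ob A" unfolding TP_def
 proof (intro allI impI)
  fix n f assume f: "mor f (so n A) B"
  have "tor S (idt B \<cdot> f)" by (rule tor_pre) (use assms f in simp_all)
  thus "tor S f" using f by simp
 qed
 show "TP S B C" if C: "ob C" unfolding TP_iff[OF assms(1) C]
 proof (intro allI impI)
  fix n f assume f: "mor f B (so n C)"
  have "tor S (f \<cdot> idt B)" by (rule tor_post) (use assms f in simp_all)
  thus "tor S f" using f by simp
 qed
qed

lemma TP_self: assumes "ob B" "TP S B B" shows "tor S (idt B)"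
 by (rule TP_tor''[OF assms(2)]) (use assms in simp_all)

end

text \<open>In the first variable coproducts are treated only for \<open>ones\<close>: a map out of
  an infinite coproduct may have torsion components without a common denominator, but it vanishes
  once all components do.\<close>

lemma TP_ones_localizing_left: assumes B: "ob B" shows "localizing_sub U T {A \<in> Obj T. TP ones A B}"
 unfolding localizing_sub_def
proof (intro conjI allI impI TP_left[OF mfam_ones B])
 fix J :: "'u set" and F Y io
 assume h: "J <= U \<and> small U J \<and> F \<in> J \<rightarrow> {A \<in> Obj T. TP ones A B} \<and> coproduct T J F Y io"
 hence c: "cop J F Y io" by (auto simp: cop_def)
 have "TP ones Y B" unfolding TP_ones
 proof (intro allI impI)
  fix n f assume f: "mor f (so n Y) B"
  show "nul f"
  proof (rule cop_nul[OF cop_shift[OF c, of n]])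
   fix i assume i: "i \<in> J"
   hence "TP ones (F i) B" using h by auto
   thus "nul (f \<cdot> sm n (io i))" using f copD(1)[OF c i] unfolding TP_ones by simp
  qed (use f in simp_all)
 qed
 thus "Y \<in> {A \<in> Obj T. TP ones A B}" using copD(2)[OF c] by simp
qed

end

section \<open>Local cohomology triangles\<close>

context linear_category
begin

lemma hom_star_module:
 assumes o: "ob A" "ob B" shows "gmodule R (HS A B)"
proof -
 have e: "elts (HS A B) n = {f. mor f A (so n B)}" for n
  using o by (auto simp: hom_star_def hom_group_def Hom_mor simp del: mor_iff)
 have s: "\<zero>[HS A B,n] = zr A (so n B)" "f \<oplus>[HS A B,n] g = f +. g"
  "act (HS A B) i j r f = sm j (\<phi> i r B) \<cdot> f" for n i j r f g by (simp_all add: hom_star_def hom_group_def)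
 have m: "arr (sm j (\<phi> i r B))" "dm (sm j (\<phi> i r B)) = so j B" "cd (sm j (\<phi> i r B)) = so (i + j) B" if "r \<in> deg R i" for i j r
  using that o by (simp_all add: add.commute)
 have mult: "sm k (\<phi> (i + j) (r \<otimes>\<^bsub>R\<^esub> t) B) = sm (j + k) (\<phi> i r B) \<cdot> sm k (\<phi> j t B)" if "r \<in> deg R i" "t \<in> deg R j" for i j k r t
  using lin_mult[OF that o(2)] that o by (simp add: add.commute)
 have plus: "sm k (\<phi> i (r \<oplus>\<^bsub>R\<^esub> t) B) = sm k (\<phi> i r B) +. sm k (\<phi> i t B)" if "r \<in> deg R i" "t \<in> deg R i" for i k r t
  using lin_add[OF that o(2)] that o by simp
 show ?thesis unfolding graded_module_def s e
 proof (intro conjI allI ballI; (unfold mem_Collect_eq)?)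
  show "abelian_group (cmpt (HS A B) n)" for n using hom_abelian o by (simp add: hom_star_def)
  fix i j r assume r: "r \<in> deg R i"
  fix x assume x: "mor x A (so j B)"
  show "mor (sm j (\<phi> i r B) \<cdot> x) A (so (i + j) B)" using m[OF r] x o by simp
  show "sm j (\<phi> i r B) \<cdot> (x +. y) = sm j (\<phi> i r B) \<cdot> x +. sm j (\<phi> i r B) \<cdot> y" if "mor y A (so j B)" for y
   by (rule plus_dist(1)) (use m[OF r] x that in simp_all)
  show "sm j (\<phi> i (r \<oplus>\<^bsub>R\<^esub> t) B) \<cdot> x = sm j (\<phi> i r B) \<cdot> x +. sm j (\<phi> i t B) \<cdot> x" if "t \<in> deg R i" for t
   unfolding plus[OF r that] by (rule plus_dist(2)) (use m[OF r] m[OF that] x in simp_all)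
 next
  fix i j k r t x assume h: "r \<in> deg R i" "t \<in> deg R j" "mor x A (so k B)"
  show "sm k (\<phi> (i + j) (r \<otimes>\<^bsub>R\<^esub> t) B) \<cdot> x = sm (j + k) (\<phi> i r B) \<cdot> (sm k (\<phi> j t B) \<cdot> x)"
   unfolding mult[OF h(1,2)] by (rule cmp_assoc') (use m[OF h(1)] m[OF h(2)] h(3) in simp_all)
 next
  fix j x assume "mor x A (so j B)"
  thus "sm j (\<phi> 0 \<one>\<^bsub>R\<^esub> B) \<cdot> x = x" using lin_one[OF o(2)] o by simp
 qed
qed

lemma elts_hom_star: "ob A ==> ob B ==> f \<in> elts (HS A B) n \<longleftrightarrow> mor f A (so n B)"
 by (simp only: hom_star_def hom_group_def Hom_mor so_ob gmod.simps partial_object.simps)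

lemma tors_hom_star:
 assumes o: "ob A" "ob B" and f: "mor f A (so n B)"
 shows "tors R (HS A B) p (null_sub (HS A B)) n f \<longleftrightarrow> tor (avoid p) f"
proof -
 have "act (HS A B) i n s f \<in> null_sub (HS A B) (i + n) \<longleftrightarrow> nul (\<phi> i s (cd f) \<cdot> f)"
  if s: "s \<in> deg R i" for i s
 proof -
  have "mor (sm n (\<phi> i s B) \<cdot> f) A (so (i + n) B)" using f s o by (simp add: add.commute)
  from nul_iff[OF this] show ?thesis using lin_so_nul[OF s, of f n B] f o by (simp add: null_sub_def hom_star_def hom_group_def)
 qed
 thus ?thesis by (auto simp: tors_def tor_def avoid_def)
qed

lemma localization_zero_TP:
 assumes o: "ob A" "ob B" and p: "p \<in> Spec R"
 shows "localization_zero R p (HS A B) \<longleftrightarrow> TP (avoid p) A B"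
 unfolding graded_mod.localization_zero_iff[OF gmodI[OF hom_star_module[OF o]] p] TP_iff[OF mfam_avoid[OF p] o]
 using tors_hom_star[OF o] elts_hom_star[OF o] by blast

lemma torsion_sub_iff:
 "X \<in> TS V \<longleftrightarrow> ob X \<and> (ALL C. cpt C --> (\<forall>q\<in>Spec R. q \<notin> V --> TP (avoid q) C X))"
 using localization_zero_TP compact_ob unfolding torsion_sub_def by blast

lemma torsion_sub_triangulated: "triangulated_sub T (TS V)"
proof -
 have C: "triangulated_sub T {B \<in> Obj T. TP (avoid q) C B}" if "cpt C" "q \<in> Spec R" for C q
  by (rule TP_right[OF mfam_avoid[OF that(2)] compact_ob[OF that(1)]])
 show ?thesis unfolding triangulated_sub_def
 proof (intro conjI allI impI ballI)
  obtain Z where Z: "zero_obj T Z" using zero_exists by blast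
  have "TP (avoid q) C Z" if "q \<in> Spec R" for q C unfolding TP_def using zero_obj_nul[OF Z] tor_nul[OF mfam_avoid[OF that]] by simp
  hence "Z \<in> TS V" using Z by (auto simp: torsion_sub_iff zero_obj_def)
  thus "TS V ~= {}" by blast
  show "TS V <= Obj T" by (auto simp: torsion_sub_iff)
  show "so n X \<in> TS V" if X: "X \<in> TS V" for X n
  proof -
   have "TP (avoid q) C (so n X)" if "cpt C" "q \<in> Spec R" "q \<notin> V" for C q
   proof -
    have "X \<in> {B \<in> Obj T. TP (avoid q) C B}" using X that by (auto simp: torsion_sub_iff)
    hence "so n X \<in> {B \<in> Obj T. TP (avoid q) C B}" using C[OF that(1,2)] unfolding triangulated_sub_def by blast
    thus ?thesis by simp
   qed
   thus ?thesis using X by (auto simp: torsion_sub_iff)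
  qed
  fix X Y Z f g h assume h: "exact_tri T X Y Z f g h \<and> X \<in> TS V \<and> Y \<in> TS V"
  have "TP (avoid q) C Z" if "cpt C" "q \<in> Spec R" "q \<notin> V" for C q
   using triangulated_sub_two(1)[OF C[OF that(1,2)] conjunct1[OF h]] h that by (auto simp: torsion_sub_iff)
  thus "Z \<in> TS V" using triD(2)[OF conjunct1[OF h]] by (auto simp: torsion_sub_iff)
 qed
qed

lemma tor_lift_ex:
 assumes S: "mfam S" and e: "expair u v" and f: "arr f" "cd f = dm v" "tor S (v \<cdot> f)"
 obtains i s w where "s \<in> S i" "mor w (dm f) (so i (dm u))" "sm i u \<cdot> w = \<phi> i s (cd f) \<cdot> f"
proof -
 note E = expairD[OF e]
 obtain i s where s: "s \<in> S i" "nul (\<phi> i s (cd v) \<cdot> (v \<cdot> f))" using f E by (auto simp: tor_def)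
 note d = mfam_deg[OF S s(1)]
 have "\<phi> i s (cd v) \<cdot> (v \<cdot> f) = (\<phi> i s (cd v) \<cdot> v) \<cdot> f" using d f E by simp
 also have "... = sm i v \<cdot> (\<phi> i s (cd f) \<cdot> f)" unfolding lin_natural[OF d E(2)] using d f E by simp
 finally have "nul (sm i v \<cdot> (\<phi> i s (cd f) \<cdot> f))" using s(2) by simp
 then obtain w where "mor w (dm f) (so i (dm u))" "sm i u \<cdot> w = \<phi> i s (cd f) \<cdot> f"
  using expairD(5)[OF expair_sm[OF e, of i], of "\<phi> i s (cd f) \<cdot> f"] d E f by auto
 thus ?thesis using that s(1) by blast
qed

section \<open>Construction of localization triangles\<close>

lemma tri_fiber: assumes "arr g" obtains G f h where "exact_tri T G (dm g) (cd g) f g h"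
proof -
 obtain Z h z where t: "exact_tri T (dm g) (cd g) Z g h z" by (rule cone_exists[OF assms])
 note E = triD[OF t]
 have "exact_tri T (so (- 1) Z) (dm g) (cd g) (ng (sm (- 1) z)) g h" by (rule tri_unrotate) (use E t in simp_all)
 thus ?thesis by (rule that)
qed

text \<open>\<open>X'\<close> is the cone of a map \<open>p\<close> to \<open>X\<close> from a coproduct of members of \<open>\<K>\<close>.\<close>

definition tower_step :: "'o set => 'o => 'o => 'm => 'm => 'm => bool" where
 "tower_step \<K> X X' p u v \<longleftrightarrow> expair p u \<and> expair u v \<and> mor u X X' \<and> cd v = so 1 (dm p) \<and>
   (\<forall>K\<in>\<K>. ALL c. mor c K X --> nul (u \<cdot> c)) \<and>
   (ALL b. arr b --> dm b = X --> (\<forall>K\<in>\<K>. ALL c. mor c K (cd b) --> nul c) --> nul (b \<cdot> p)) \<and>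
   (ALL S C. mfam S --> cpt C --> (\<forall>K\<in>\<K>. TP S C K) --> TP S C (dm p))"

text \<open>The coproduct has one copy of the source for every morphism from a member of \<K> to X,
  and \<open>p\<close> evaluates it. The index set is small because the members of \<K> are compact,
  where local smallness is available.\<close>

lemma tower_step_exists:
 assumes small: "small U \<K>" and ls: "locally_small U T" and K: "!!K. K \<in> \<K> ==> cpt K" and X: "ob X"
 shows "EX X' p u v. tower_step \<K> X X' p u v"
proof -
 let ?A = "\<Union>K\<in>\<K>. Hom T K X"
 have sA: "small U ?A" by (rule small_UN[OF small]) (use ls K X in \<open>auto simp: locally_small_def\<close>)
 have Ad: "arr a" "dm a \<in> \<K>" "cd a = X" if a: "a \<in> ?A" for a
 proof -
  obtain K' where K': "K' \<in> \<K>" "a \<in> Hom T K' X" using a by blast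
  hence "mor a K' X" using Hom_mor[OF compact_ob[OF K[OF K'(1)]] X] by blast
  thus "arr a" "dm a \<in> \<K>" "cd a = X" using K'(1) by auto
 qed
 obtain P io where c: "cop ?A dm P io" by (rule cop_exists[OF sA, of dm], rule arr_ob(1)[OF Ad(1)])
 note D = copD[OF c]
 obtain p where p: "mor p P X" "!!a. a \<in> ?A ==> p \<cdot> io a = a"
 proof -
  have "mor a (dm a) X" if "a \<in> ?A" for a using Ad[OF that] X by simp
  from cop_ex[OF c X this] show ?thesis using that by blast
 qed
 obtain X' u v where t: "exact_tri T P X X' p u v" using cone_exists[of p] p(1) by auto
 note E = triD[OF t] and ex = tri_expair[OF t]
 show ?thesis
 proof (intro exI, unfold tower_step_def, intro conjI ballI allI impI)
  show "expair p u" "expair u v" "mor u X X'" "cd v = so 1 (dm p)" using ex E by auto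
  fix K f assume KK: "K \<in> \<K>" and f: "mor f K X"
  hence fA: "f \<in> ?A" using Hom_mor[OF compact_ob[OF K[OF KK]] X] by blast
  have "nul ((u \<cdot> p) \<cdot> io f)" using nul_cmp[of "io f" "u \<cdot> p"] expairD(4)[OF ex(1)] D(1)[OF fA] E by simp
  thus "nul (u \<cdot> f)" using p(2)[OF fA] D(1)[OF fA] E by simp
 next
  fix b assume b: "arr b" "dm b = X" "\<forall>K\<in>\<K>. ALL c. mor c K (cd b) --> nul c"
  show "nul (b \<cdot> p)"
  proof (rule cop_nul[OF c])
   fix a assume a: "a \<in> ?A"
   have "nul (b \<cdot> a)" using b(3)[rule_format, of "dm a" "b \<cdot> a"] Ad[OF a] b(1,2) by simp
   thus "nul ((b \<cdot> p) \<cdot> io a)" using p(2)[OF a] p(1) b(1,2) D(1)[OF a] by simp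
  qed (use b p in simp_all)
 next
  fix S C assume h: "mfam S" "cpt C" "\<forall>K\<in>\<K>. TP S C K"
  have "P \<in> {B \<in> Obj T. TP S C B}" by (rule localizing_cop[OF TP_localizing[OF h(1,2)] sA c]) (use h(3) Ad in auto)
  thus "TP S C (dm p)" using p(1) by simp
 qed
qed

text \<open>W receives only zero maps from \<K>, and g is weakly universal among maps from X to such
  objects. The last clause, that G inherits from \<K> every torsion property tested by compact
  objects, does the work of membership of G in Loc(\<K>).\<close>

definition tower_tri :: "'o set => 'o => 'o => 'o => 'm => 'm => 'm => bool" where
 "tower_tri \<K> X G W f g h \<longleftrightarrow> exact_tri T G X W f g h \<and> (\<forall>K\<in>\<K>. ALL c. mor c K W --> nul c) \<and>
   (ALL b. arr b --> dm b = X --> (\<forall>K\<in>\<K>. ALL c. mor c K (cd b) --> nul c) --> (EX v. mor v W (cd b) \<and> v \<cdot> g = b)) \<and>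
   (ALL S C. mfam S --> cpt C --> (\<forall>K\<in>\<K>. TP S C K) --> TP S C G)"

text \<open>A map from a member of \<K> to the homotopy colimit W comes from a stage, by
  compactness, and dies at the next one. Each transition map has cone and fiber built from
  coproducts of \<K>, so torsion passes through finitely many stages; compactness reduces every map
  to that case.\<close>

lemma tower:
 assumes small: "small U \<K>" and ls: "locally_small U T" and K: "!!K. K \<in> \<K> ==> cpt K" and X: "ob X"
 shows "EX G W f g h. tower_tri \<K> X G W f g h"
proof -
 have "EX Q. ALL Y. ob Y --> (case Q Y of (X', p, u, v) => tower_step \<K> Y X' p u v)"
  by (rule choice) (use tower_step_exists[OF small ls K] in \<open>auto simp: split_paired_Ex\<close>)
 then obtain Q where Q: "!!Y. ob Y ==> (case Q Y of (X', p, u, v) => tower_step \<K> Y X' p u v)" by blast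
 define Xs where "Xs = rec_nat X (%_ Y. fst (Q Y))"
 define ps where "ps k = fst (snd (Q (Xs k)))" for k
 define us where "us k = fst (snd (snd (Q (Xs k))))" for k
 define vs where "vs k = snd (snd (snd (Q (Xs k))))" for k
 have X0: "Xs 0 = X" and XS: "!!k. Xs (Suc k) = fst (Q (Xs k))" by (simp_all add: Xs_def)
 have st0: "tower_step \<K> (Xs k) (Xs (Suc k)) (ps k) (us k) (vs k)" if "ob (Xs k)" for k
  using Q[OF that] unfolding ps_def us_def vs_def XS by (simp add: case_prod_beta)
 have oX: "ob (Xs k)" for k
 proof (induction k)
  case (Suc k) thus ?case using st0[OF Suc] by (simp add: tower_step_def)
 qed (simp add: X0 X)
 note st = st0[OF oX, unfolded tower_step_def]
 have ex: "expair (ps k) (us k)" "expair (us k) (vs k)" and u: "mor (us k) (Xs k) (Xs (Suc k))" and vs: "cd (vs k) = so 1 (dm (ps k))" for k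
  using st[of k] by blast+
 have TPp: "TP S C (dm (ps k))" if "mfam S" "cpt C" "\<forall>K\<in>\<K>. TP S C K" for S C k using st[of k] that by blast
 obtain W w where hc: "hocolim Xs us W w" using hocolim_exists[of us Xs, OF u] by blast
 note hD = hc[unfolded hocolim_def]
 have w: "mor (w k) (Xs k) W" "w (Suc k) \<cdot> us k = w k" for k using hD by blast+
 have w3: "EX h. mor h W B \<and> (ALL k. h \<cdot> w k = b k)"
  if "ob B" "!!k. mor (b k) (Xs k) B" "!!k. b (Suc k) \<cdot> us k = b k" for B b using hD that by blast
 have w4: "EX k c'. mor c' C (Xs k) \<and> w k \<cdot> c' = c" if "cpt C" "mor c C W" for C c using hD that by blast
 have w5: "EX m. nul (trans_mor us k m c)" if "cpt C" "mor c C (Xs k)" "nul (w k \<cdot> c)" for C c k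
  using hD that by blast
 obtain G f h where t: "exact_tri T G X W f (w 0) h" using tri_fiber[of "w 0"] w(1)[of 0] X0 by auto
 note E = triD[OF t] and tx = tri_expair[OF t]
 have "tower_tri \<K> X G W f (w 0) h" unfolding tower_tri_def
 proof (intro conjI ballI allI impI t)
  fix K c assume KK: "K \<in> \<K>" and c: "mor c K W"
  obtain k c' where c': "mor c' K (Xs k)" "w k \<cdot> c' = c" using w4[OF K[OF KK] c] by blast
  have n: "nul (us k \<cdot> c')" using st[of k] KK c'(1) by blast
  have "c = (w (Suc k) \<cdot> us k) \<cdot> c'" unfolding w(2) c'(2) ..
  also have "... = w (Suc k) \<cdot> (us k \<cdot> c')" using w(1)[of "Suc k"] u[of k] c'(1) by simp
  finally show "nul c" using nul_cmp[of "us k \<cdot> c'" "w (Suc k)"] n w(1)[of "Suc k"] u[of k] c'(1) by simp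
 next
  fix b assume b: "arr b" "dm b = X" "\<forall>K\<in>\<K>. ALL c. mor c K (cd b) --> nul c"
  have "EX bs. ALL k. (mor (bs k) (Xs k) (cd b) \<and> (k = 0 --> bs k = b)) \<and> bs (Suc k) \<cdot> us k = bs k"
  proof (rule dependent_nat_choice)
   show "EX x. mor x (Xs 0) (cd b) \<and> ((0::nat) = 0 --> x = b)" using b X0 by auto
   fix x and k :: nat assume x: "mor x (Xs k) (cd b) \<and> (k = 0 --> x = b)"
   have "nul (x \<cdot> ps k)" using st[of k] x b(3) by auto
   thus "EX y. (mor y (Xs (Suc k)) (cd b) \<and> (Suc k = 0 --> y = b)) \<and> y \<cdot> us k = x"
    using expairD(6)[OF ex(1)[of k], of x] x u[of k] by auto
  qed
  then obtain bs where bs: "!!k. mor (bs k) (Xs k) (cd b)" "bs 0 = b" "!!k. bs (Suc k) \<cdot> us k = bs k" by blast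
  show "EX v. mor v W (cd b) \<and> v \<cdot> w 0 = b" using w3[OF arr_ob(2)[OF b(1)] bs(1,3)] bs(2) by auto
 next
  fix S C assume S: "mfam S" and C: "cpt C" and KC: "\<forall>K\<in>\<K>. TP S C K"
  note oC = compact_ob[OF C] and P = TPp[OF S C]
  \<comment> \<open>A map that dies after finitely many stages is torsion: at each stage a multiple
    lifts to the coproduct that was coned off.\<close>
  have ker: "tor S d" if "mor d (so n C) (Xs k)" "nul (trans_mor us k m d)" for n k m d using that
  proof (induction m arbitrary: k d)
   case 0 thus ?case using tor_nul[OF S, of d] by simp
  next
   case (Suc m)
   have td: "tor S (us k \<cdot> d)" by (rule Suc.IH[of _ "Suc k"]) (use Suc.prems u[of k] in simp_all)
   show ?case
   proof (rule tor_lift[OF S ex(1)[of k] _ _ td])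
    show "arr d" "cd d = dm (us k)" using Suc.prems u[of k] by simp_all
    show "tor S w" if "mor w (dm d) (so i (dm (ps k)))" for i w
     by (rule TP_tor[OF S P[of k], of w n i]) (use KC that Suc.prems oC expairD(1)[OF ex(1)[of k]] in auto)
   qed
  qed
  \<comment> \<open>A multiple of a map to stage k + 1 comes from stage k, since its image in the
    suspended coproduct is torsion; at stage 0 the composite h w vanishes.\<close>
  have coker: "tor S ((h \<cdot> w k) \<cdot> d)" if "mor d (so n C) (Xs k)" for n k d using that
  proof (induction k arbitrary: n d)
   case 0
   have "nul (h \<cdot> w 0)" using expairD(4)[OF tx(2)] .
   thus ?case using nul_cmp[of d "h \<cdot> w 0"] 0 E X0 by (intro tor_nul[OF S]) simp_all
  next
   case (Suc k)
   have M: "arr (us k)" "dm (us k) = Xs k" "cd (us k) = Xs (Suc k)" "arr (w (Suc k))" "dm (w (Suc k)) = Xs (Suc k)" "cd (w (Suc k)) = W"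
    "arr (vs k)" "dm (vs k) = Xs (Suc k)" "arr d" "dm d = so n C" "cd d = Xs (Suc k)"
    using u[of k] w(1)[of "Suc k"] Suc.prems expairD(2,3)[OF ex(2)[of k]] by simp_all
   have "tor S (vs k \<cdot> d)"
    by (rule TP_tor[OF S P[of k], of "vs k \<cdot> d" n 1]) (use KC M oC vs[of k] expairD(1)[OF ex(1)[of k]] in auto)
   then obtain i s c where s: "s \<in> S i" "mor c (so n C) (so i (Xs k))" "sm i (us k) \<cdot> c = \<phi> i s (cd d) \<cdot> d"
    using tor_lift_ex[OF S ex(2)[of k], of d] M by (metis arr_ob(1,2) so_ob)
   let ?hw = "h \<cdot> w (Suc k)"
   have hw: "arr ?hw" "dm ?hw = Xs (Suc k)" using E M by simp_all
   note ds = mfam_deg[OF S s(1)]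
   have "\<phi> i s (cd (?hw \<cdot> d)) \<cdot> (?hw \<cdot> d) = (\<phi> i s (cd ?hw) \<cdot> ?hw) \<cdot> d" using hw M ds oX[of "Suc k"] by simp
   also have "... = sm i ?hw \<cdot> (\<phi> i s (cd d) \<cdot> d)" unfolding lin_natural[OF ds hw(1)] using hw M ds oX[of "Suc k"] by simp
   also have "... = sm i (?hw \<cdot> us k) \<cdot> c" unfolding s(3)[symmetric] using hw M s(2) by simp
   also have "?hw \<cdot> us k = h \<cdot> w k" using E M w(2)[of k] by simp
   also have "sm i (h \<cdot> w k) \<cdot> c = sm i ((h \<cdot> w k) \<cdot> sm (- i) c)" using E w(1)[of k] s(2) by simp
   also have "tor S ..."
   proof (subst tor_sm[OF S])
    have m: "mor (sm (- i) c) (so (n - i) C) (Xs k)" using s(2) oX oC by simp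
    show "tor S ((h \<cdot> w k) \<cdot> sm (- i) c)" by (rule Suc.IH[OF m])
    show "arr ((h \<cdot> w k) \<cdot> sm (- i) c)" using m E w(1)[of k] by simp
   qed
   finally show ?case by (rule tor_mult[OF S s(1), rotated]) (use hw M in simp)
  qed
  show "TP S C G" unfolding TP_def
  proof (intro allI impI)
   fix n d assume d: "mor d (so n C) G"
   \<comment> \<open>Since f d dies in W, it dies at a finite stage and is torsion; then a multiple
     of d comes from the desuspension of W along h, and such maps are torsion by
     \<open>coker\<close>.\<close>
   have "nul ((w 0 \<cdot> f) \<cdot> d)" using nul_cmp[of d "w 0 \<cdot> f"] expairD(4)[OF tx(1)] d E by simp
   then obtain m where "nul (trans_mor us 0 m (f \<cdot> d))" using w5[OF compact_so[OF C, of n], of "f \<cdot> d" 0] d E X0 by auto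
   hence "tor S (f \<cdot> d)" by (rule ker[rotated]) (use d E X0 in auto)
   then obtain i s c where s: "s \<in> S i" "mor c (so n C) (so i (so (- 1) W))" "sm i (sm (- 1) h) \<cdot> c = \<phi> i s (cd d) \<cdot> d"
    using tor_lift_ex[OF S tx(4), of d] d E by (metis mor_iff sm_dm_cd(1))
   have oW: "ob W" using E by simp
   have mm: "mor (sm (1 - i) c) (so (n + 1 - i) C) W" using s(2) oC oW by (simp add: algebra_simps)
   obtain k c' where c': "mor c' (so (n + 1 - i) C) (Xs k)" "w k \<cdot> c' = sm (1 - i) c" using w4[OF compact_so[OF C] mm] by blast
   have "sm i (sm (- 1) h) \<cdot> c = sm (i - 1) (h \<cdot> sm (1 - i) c)" using s(2) E oW by simp
   also have "h \<cdot> sm (1 - i) c = (h \<cdot> w k) \<cdot> c'" unfolding c'(2)[symmetric] using w(1)[of k] c'(1) E by simp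
   also have "tor S (sm (i - 1) ((h \<cdot> w k) \<cdot> c'))"
   proof (subst tor_sm[OF S])
    show "tor S ((h \<cdot> w k) \<cdot> c')" by (rule coker[OF c'(1)])
    show "arr ((h \<cdot> w k) \<cdot> c')" using c'(1) w(1)[of k] E by simp
   qed
   finally show "tor S d" unfolding s(3) by (rule tor_mult[OF S s(1), rotated]) (use d in simp)
  qed
 qed
 thus ?thesis by blast
qed

text \<open>\<K> is to detect zero objects of T_V. For Y in T_V the tower over Y ends in an object
  W' of T_V without maps from \<K>, so W' = 0. Every map from Y to the end W of the tower over X
  factors through W', hence vanishes.\<close>

lemma localization_triangle_exists:
 assumes small: "small U \<K>" and ls: "locally_small U T" and K: "!!K. K \<in> \<K> ==> cpt K \<and> K \<in> TS V"
  and det: "!!Y. Y \<in> TS V ==> (!!K c. K \<in> \<K> ==> mor c K Y ==> nul c) ==> zero_obj T Y"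
  and X: "ob X"
 shows "EX G L. LT V X G L"
proof -
 let ?T = "TS V"
 have Kc: "!!K. K \<in> \<K> ==> cpt K" using K by blast
 have GT: "G \<in> ?T \<and> exact_tri T G Y W f g h" if "tower_tri \<K> Y G W f g h" for Y G W f g h
 proof -
  have t: "exact_tri T G Y W f g h" and C: "!!S C. mfam S ==> cpt C ==> \<forall>K\<in>\<K>. TP S C K ==> TP S C G"
   using that unfolding tower_tri_def by blast+
  have "TP (avoid q) C G" if "cpt C" "q \<in> Spec R" "q \<notin> V" for C q
   by (rule C[OF mfam_avoid[OF that(2)] that(1)]) (use K that in \<open>auto simp: torsion_sub_iff\<close>)
  thus ?thesis using t triD(1)[OF t] by (auto simp: torsion_sub_iff)
 qed
 obtain G W f g h where tw: "tower_tri \<K> X G W f g h" using tower[OF small ls Kc X] by blast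
 have t: "exact_tri T G X W f g h" and loc: "!!K c. K \<in> \<K> ==> mor c K W ==> nul c" using tw unfolding tower_tri_def by blast+
 have W: "ob W" using triD[OF t] by simp
 have "Hom T Y W = {zr Y W}" if Y: "Y \<in> ?T" for Y
 proof -
  have oY: "ob Y" using Y by (simp add: torsion_sub_iff)
  obtain G' W' f' g' h' where tw': "tower_tri \<K> Y G' W' f' g' h'" using tower[OF small ls Kc oY] by blast
  have t': "exact_tri T G' Y W' f' g' h'" and loc': "!!K c. K \<in> \<K> ==> mor c K W' ==> nul c"
   and ext': "!!b. arr b ==> dm b = Y ==> (\<forall>K\<in>\<K>. ALL c. mor c K (cd b) --> nul c) ==> EX v. mor v W' (cd b) \<and> v \<cdot> g' = b"
   using tw' unfolding tower_tri_def by blast+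
  have "G' \<in> ?T" using GT[OF tw'] by blast
  hence "W' \<in> ?T" using triangulated_sub_two(1)[OF torsion_sub_triangulated t'] Y by blast
  hence z: "zero_obj T W'" using det loc' by blast
  have "nul b" if b: "mor b Y W" for b
  proof -
   have "\<forall>K\<in>\<K>. ALL c. mor c K (cd b) --> nul c" using loc b by auto
   then obtain v where v: "mor v W' (cd b)" "v \<cdot> g' = b" using ext'[of b] b by auto
   thus ?thesis using nul_cmp[of g' v] zero_obj_nul[OF z, of v] triD[OF t'] by auto
  qed
  hence "Hom T Y W <= {zr Y W}" using Hom_mor[OF oY W] nul_iff by blast
  moreover have "zr Y W \<in> Hom T Y W" unfolding Hom_mor[OF oY W] using oY W by simp
  ultimately show ?thesis by blast
 qed
 thus ?thesis unfolding localization_triangle_def using t GT[OF tw] by blast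
qed

end

section \<open>Koszul objects\<close>

context linear_category
begin

definition cone :: "'m => 'o" where
 "cone f = (SOME Z. EX g h. exact_tri T (dm f) (cd f) Z f g h)"

lemma cone_tri: assumes "arr f" obtains g h where "exact_tri T (dm f) (cd f) (cone f) f g h"
proof -
 have "EX Z g h. exact_tri T (dm f) (cd f) Z f g h" using cone_exists[OF assms] by metis
 hence "EX g h. exact_tri T (dm f) (cd f) (cone f) f g h" unfolding cone_def by (rule someI_ex)
 thus ?thesis using that by blast
qed

lemma koszul_tri:
 assumes "x \<in> deg R d" "ob D" obtains g h where "exact_tri T D (so d D) (cone (\<phi> d x D)) (\<phi> d x D) g h"
 using cone_tri[of "\<phi> d x D"] assms by auto

lemma koszul_ob [simp]: "x \<in> deg R d ==> ob D ==> ob (cone (\<phi> d x D))"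
 by (rule koszul_tri[of x d D]) (auto dest!: triD(2))

lemma koszul_compact: "x \<in> deg R d ==> cpt D ==> cpt (cone (\<phi> d x D))"
 by (rule koszul_tri[of x d D]) (auto intro: compact_cone compact_so dest: compact_ob)

lemma tor_idt_cone:
 assumes S: "mfam S" and t: "exact_tri T A B Z f g h" and "tor S (idt A)" "tor S (idt B)" shows "tor S (idt Z)"
proof -
 note E = triD[OF t]
 have o: "ob A" "ob B" "ob Z" using E by simp_all
 have "TP S A Z" "TP S B Z" using tor_idt(2)[OF S] assms(3,4) o by blast+
 hence "TP S Z Z" using triangulated_sub_two(1)[OF TP_left[OF S o(3)] t] o by simp
 thus ?thesis by (rule TP_self[OF S o(3)])
qed

text \<open>The square of \<open>x\<close> annihilates the cone of \<open>x\<close>.\<close>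

lemma koszul_idt:
 assumes S: "mfam S" and x: "x \<in> S d" and D: "ob D" shows "tor S (idt (cone (\<phi> d x D)))"
proof -
 note xd = mfam_deg[OF S x]
 obtain g h where t: "exact_tri T D (so d D) (cone (\<phi> d x D)) (\<phi> d x D) g h" by (rule koszul_tri[OF xd D])
 let ?Z = "cone (\<phi> d x D)"
 note E = triD[OF t] and ex = tri_expair[OF t]
 \<comment> \<open>Up to sign h x = x h = 0, so the action of x on the cone factors through g; and x
   g = g x = 0, again up to sign. Hence x acts with square zero.\<close>
 have "nul (sm 1 (\<phi> d x D) \<cdot> h)" using expairD(4)[OF ex(3)] .
 hence "nul (\<phi> d x (so 1 D) \<cdot> h)" using lin_so_nul[OF xd, of h 1 D] E D by simp
 hence n: "nul (sm d h \<cdot> \<phi> d x ?Z)" using lin_natural[OF xd, of h] E by simp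
 obtain w where w: "mor w ?Z (so d (so d D))" "sm d g \<cdot> w = \<phi> d x ?Z"
  using expairD(5)[OF expair_sm[OF ex(2), of d], of "\<phi> d x ?Z"] n E xd D by auto
 have "nul (sm d (g \<cdot> \<phi> d x D))" by (subst nul_sm) (use expairD(4)[OF ex(1)] E xd D in simp_all)
 hence "nul (sm d g \<cdot> sm d (\<phi> d x D))" using E xd D by (subst (asm) sm_cmp) simp_all
 hence "nul (sm d g \<cdot> \<phi> d x (so d D))" using lin_so[OF xd D, of d] E xd D by auto
 hence "nul (\<phi> d x ?Z \<cdot> g)" using lin_natural[OF xd, of g] E by simp
 hence "tor S g" unfolding tor_def using x E by auto
 hence "tor S (sm d g)" using tor_sm[OF S] E by simp
 hence "tor S (sm d g \<cdot> w)" by (rule tor_pre[OF S]) (use w E in simp_all)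
 hence "tor S (\<phi> d x (cd (idt ?Z)) \<cdot> idt ?Z)" unfolding w(2) using xd E by simp
 thus ?thesis by (rule tor_mult[OF S x, rotated]) (use E in simp)
qed

text \<open>By naturality x f = 0 means that a suspension of f vanishes after composition with x on
  B, so it extends over the cone of x on B; there are no nonzero maps from the cone to Y.\<close>

lemma koszul_detect:
 assumes x: "x \<in> deg R d" and o: "ob B" "ob Y" and Z: "TP ones (cone (\<phi> d x B)) Y"
  and f: "mor f (so n B) (so m Y)" and n: "nul (\<phi> d x (so m Y) \<cdot> f)"
 shows "nul f"
proof -
 obtain g h where t: "exact_tri T B (so d B) (cone (\<phi> d x B)) (\<phi> d x B) g h" by (rule koszul_tri[OF x o(1)])
 note E = triD[OF t]
 have oZ: "ob (cone (\<phi> d x B))" using x o by simp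
 have "nul (sm d f \<cdot> \<phi> d x (so n B))" using lin_natural[OF x, of f] n f by simp
 hence "nul (sm d f \<cdot> sm n (\<phi> d x B))" using lin_so[OF x o(1), of n] f x o by (auto simp: add.commute)
 then obtain v where v: "mor v (so n (cone (\<phi> d x B))) (so d (so m Y))" "v \<cdot> sm n g = sm d f"
  using expairD(6)[OF expair_sm[OF tri_expair(1)[OF t], of n], of "sm d f"] f E o by (auto simp: add.commute)
 have "mor v (so n (cone (\<phi> d x B))) (so (d + m) Y)" using v(1) o by simp
 hence "tor ones v" using TP_tor[OF mfam_ones Z _ oZ o(2)] by blast
 hence "nul v" using v(1) tor_ones by simp
 hence "nul (sm d f)" using nul_cmp[of "sm n g" v] v E by simp
 thus "nul f" using f by simp
qed

lemma koszul_detect_powers: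
 assumes x: "x \<in> deg R d" and o: "ob B" "ob Y" and Z: "TP ones (cone (\<phi> d x B)) Y" and P: "TP (powers d x) B Y"
 shows "TP ones B Y"
proof -
 have k: "nul f" if "nul (\<phi> (int k * d) (x [^]\<^bsub>R\<^esub> k) Y \<cdot> f)" "mor f (so n B) Y" for k n f using that(1)
 proof (induction k)
  case 0
  thus ?case using that(2) lin_one o by simp
 next
  case (Suc k)
  note p = pow_deg[OF x, of k]
  have e: "int (Suc k) * d = int k * d + d" by (simp add: algebra_simps)
  have "\<phi> (int (Suc k) * d) (x [^]\<^bsub>R\<^esub> Suc k) Y = \<phi> d x (so (int k * d) Y) \<cdot> \<phi> (int k * d) (x [^]\<^bsub>R\<^esub> k) Y"
   unfolding e using lin_mult2[OF x p o(2)] by simp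
  hence "nul (\<phi> d x (so (int k * d) Y) \<cdot> (\<phi> (int k * d) (x [^]\<^bsub>R\<^esub> k) Y \<cdot> f))"
   using Suc.prems that(2) x p o by simp
  hence "nul (\<phi> (int k * d) (x [^]\<^bsub>R\<^esub> k) Y \<cdot> f)"
   by (rule koszul_detect[OF x o Z, rotated]) (use that(2) p o in simp)
  thus ?case by (rule Suc.IH)
 qed
 show ?thesis unfolding TP_ones
 proof (intro allI impI)
  fix n f assume f: "mor f (so n B) Y"
  hence "tor (powers d x) f" using P unfolding TP_def by blast
  then obtain j :: nat where "nul (\<phi> (int j * d) (x [^]\<^bsub>R\<^esub> j) Y \<cdot> f)" using f by (auto simp: tor_def powers_def)
  thus "nul f" using k f by blast
 qed
qed

fun koszul :: "(int \<times> 'r) list => 'o => 'o" where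
 "koszul [] D = D"
| "koszul ((d, x) # xs) D = koszul xs (cone (\<phi> d x D))"

definition hom_list :: "(int \<times> 'r) list => bool" where
 "hom_list xs \<longleftrightarrow> (\<forall>(d, x)\<in>set xs. x \<in> deg R d)"

lemma hom_list_simps [simp]: "hom_list []" "hom_list ((d, x) # xs) \<longleftrightarrow> x \<in> deg R d \<and> hom_list xs"
 by (auto simp: hom_list_def)

lemma koszul_list_compact: "hom_list xs ==> cpt D ==> cpt (koszul xs D)"
 by (induction xs D rule: koszul.induct) (auto intro: koszul_compact)

lemma koszul_list_idt:
 assumes S: "mfam S" shows "hom_list xs ==> ob D ==> tor S (idt D) \<or> (\<exists>(d, x)\<in>set xs. x \<in> S d) ==> tor S (idt (koszul xs D))"
proof (induction xs D rule: koszul.induct)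
 case (2 d x xs D)
 have x: "x \<in> deg R d" using 2 by simp
 have "tor S (idt (cone (\<phi> d x D)))" if "tor S (idt D)"
 proof -
  obtain g h where t: "exact_tri T D (so d D) (cone (\<phi> d x D)) (\<phi> d x D) g h" by (rule koszul_tri[OF x 2(3)])
  have "tor S (idt (so d D))" using tor_sm[OF S, of "idt D" d] that 2(3) by simp
  thus ?thesis using tor_idt_cone[OF S t that] by blast
 qed
 moreover have "tor S (idt (cone (\<phi> d x D)))" if "x \<in> S d" by (rule koszul_idt[OF S that 2(3)])
 ultimately have "tor S (idt (cone (\<phi> d x D))) \<or> (\<exists>(d, x)\<in>set xs. x \<in> S d)" using 2(4) by auto
 thus ?case using 2(1) 2(2) 2(3) x by simp
qed auto

lemma koszul_list_detect:
 assumes Y: "ob Y"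
 shows "hom_list xs ==> cpt B ==>
  (!!d x B. (d, x) \<in> set xs ==> cpt B ==> TP (powers d x) B Y) ==>
  TP ones (koszul xs B) Y ==> TP ones B Y"
proof (induction xs B rule: koszul.induct)
 case (2 d x xs B)
 have x: "x \<in> deg R d" "hom_list xs" using 2(2) by simp_all
 have "TP ones (cone (\<phi> d x B)) Y"
 proof (rule 2(1)[OF x(2) koszul_compact[OF x(1) 2(3)]])
  show "TP (powers d' x') B' Y" if "(d', x') \<in> set xs" "cpt B'" for d' x' B' by (rule 2(4)) (use that in simp_all)
  show "TP ones (koszul xs (cone (\<phi> d x B))) Y" using 2(5) by simp
 qed
 thus ?case by (rule koszul_detect_powers[OF x(1) compact_ob[OF 2(3)] Y]) (rule 2(4); simp add: 2(3))
qed simp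

text \<open>If no power of x kills f, a prime q containing the annihilator of f avoids x. Then q
  does not contain p, so f is torsion at q, contrary to the choice of q.\<close>

lemma torsion_V_powers:
 assumes p: "p \<in> Spec R" and Y: "Y \<in> TS (V_of R p)" and x: "x \<in> deg R d" "x \<in> p"
  and B: "cpt B"
 shows "TP (powers d x) B Y" unfolding TP_def
proof (intro allI impI)
 fix n f assume f: "mor f (so n B) Y"
 have oY: "ob Y" using f by simp
 let ?J = "%m. {r \<in> deg R m. nul (\<phi> m r Y \<cdot> f)}"
 have J: "gideal R ?J"
 proof (rule gidealI)
  fix m show "\<zero>\<^bsub>R\<^esub> \<in> ?J m"
  proof -
   have "\<zero>\<^bsub>R\<^esub> \<oplus>\<^bsub>R\<^esub> \<zero>\<^bsub>R\<^esub> = \<zero>\<^bsub>R\<^esub>" using r_zero[OF zero_closed] .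
   hence "\<phi> m \<zero>\<^bsub>R\<^esub> Y +. \<phi> m \<zero>\<^bsub>R\<^esub> Y = \<phi> m \<zero>\<^bsub>R\<^esub> Y" using lin_add[of "\<zero>\<^bsub>R\<^esub>" m "\<zero>\<^bsub>R\<^esub>" Y] oY by simp
   hence "nul (\<phi> m \<zero>\<^bsub>R\<^esub> Y)" by (rule nul_self[rotated]) (use oY in simp)
   thus ?thesis using nul_cmp[of f "\<phi> m \<zero>\<^bsub>R\<^esub> Y"] f by simp
  qed
  fix r s assume rs: "r \<in> ?J m" "s \<in> ?J m"
  have "\<phi> m (r \<oplus>\<^bsub>R\<^esub> s) Y \<cdot> f = \<phi> m r Y \<cdot> f +. \<phi> m s Y \<cdot> f"
   using lin_add[of r m s Y] rs f by (simp add: plus_dist)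
  thus "r \<oplus>\<^bsub>R\<^esub> s \<in> ?J m" using nul_plus[of "\<phi> m r Y \<cdot> f" "\<phi> m s Y \<cdot> f"] rs f deg_add by simp
 next
  fix i j r s assume rs: "r \<in> deg R i" "s \<in> ?J j"
  hence s: "s \<in> deg R j" "nul (\<phi> j s Y \<cdot> f)" by auto
  have "\<phi> (i + j) (r \<otimes>\<^bsub>R\<^esub> s) Y \<cdot> f = sm j (\<phi> i r Y) \<cdot> (\<phi> j s Y \<cdot> f)"
   using lin_mult[OF rs(1) s(1) oY] rs(1) s f by simp
  thus "r \<otimes>\<^bsub>R\<^esub> s \<in> ?J (i + j)"
   using nul_cmp[of "\<phi> j s Y \<cdot> f" "sm j (\<phi> i r Y)"] rs(1) s f mult_deg[OF rs(1) s(1)] by simp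
 qed auto
 show "tor (powers d x) f"
 proof (rule ccontr)
  assume nt: "\<not> tor (powers d x) f"
  have nJ: "x [^]\<^bsub>R\<^esub> k \<notin> ?J (int k * d)" for k :: nat using nt f by (auto simp: tor_def powers_def)
  obtain q where q: "q \<in> Spec R" "ALL n. ?J n <= q" "x \<notin> q" by (rule prime_avoiding_powers[OF J x(1) nJ]) blast
  have "q \<notin> V_of R p" using q(3) x(2) by (auto simp: V_of_def)
  hence "TP (avoid q) B Y" using Y B q(1) by (auto simp: torsion_sub_iff)
  hence "tor (avoid q) f" using f unfolding TP_def by blast
  thus False using q(2) f by (auto simp: tor_def avoid_def)
 qed
qed

lemma Spec_generators:
 assumes p: "p \<in> Spec R"
 obtains xs where "hom_list xs" "!!d x. (d, x) \<in> set xs ==> x \<in> p"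
  "!!q. q \<in> Spec R ==> (\<forall>(d, x)\<in>set xs. x \<in> q) ==> p <= q"
proof -
 obtain S where S: "finite S" "!!d a. (d, a) \<in> S ==> a \<in> p \<inter> deg R d"
  "!!K n. gideal R K ==> (!!d a. (d, a) \<in> S ==> a \<in> K d) ==> p \<inter> deg R n <= K n"
  using gideal_fg[OF Spec_gideal[OF p]] by metis
 obtain xs where xs: "set xs = S" using finite_list[OF S(1)] by blast
 show ?thesis
 proof (rule that[of xs])
  show "hom_list xs" "!!d x. (d, x) \<in> set xs ==> x \<in> p" using S(2) xs by (auto simp: hom_list_def)
  fix q assume q: "q \<in> Spec R" "\<forall>(d, x)\<in>set xs. x \<in> q"
  have "p \<inter> deg R n <= q \<inter> deg R n" for n by (rule S(3)[OF Spec_gideal[OF q(1)]]) (use q(2) xs S(2) in auto)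
  thus "p <= q" by (intro Spec_subset_homogeneous[OF p Spec_ideal[OF q(1)]]) blast
 qed
qed

text \<open>For a prime q outside V some member of the list lies outside q, while its square kills
  the corresponding cone; so the identity of the Koszul object is torsion at q.\<close>

lemma koszul_torsion_V:
 assumes q: "!!q. q \<in> Spec R ==> (\<forall>(d, x)\<in>set xs. x \<in> q) ==> q \<in> V" and xs: "hom_list xs" and D: "cpt D"
 shows "koszul xs D \<in> TS V"
proof -
 note o = compact_ob[OF D] compact_ob[OF koszul_list_compact[OF xs D]]
 have "TP (avoid q) C (koszul xs D)" if "cpt C" "q \<in> Spec R" "q \<notin> V" for C q
 proof -
  have "\<not> (\<forall>(d, x)\<in>set xs. x \<in> q)" using assms(1)[OF that(2)] that(3) by blast
  hence "\<exists>(d, x)\<in>set xs. x \<in> avoid q d" using xs unfolding avoid_def hom_list_def by fast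
  hence "tor (avoid q) (idt (koszul xs D))" by (intro koszul_list_idt[OF mfam_avoid[OF that(2)] xs o(1)]) simp
  thus ?thesis using tor_idt(1)[OF mfam_avoid[OF that(2)] o(2)] compact_ob[OF that(1)] by blast
 qed
 thus ?thesis using o(2) by (auto simp: torsion_sub_iff)
qed

end

section \<open>Localization triangles for V(p) and Z(p)\<close>

locale generated_category = linear_category T U R \<phi>
 for T :: "('o, 'm) tcat" (structure) and U :: "'u set" and R :: "('r, 'z) gring_scheme" and \<phi> +
 assumes ls: "locally_small U T" and cg: "compactly_generated U T"
begin

text \<open>Nothing bounds the number of scalars in R by U. The generators are therefore closed
  under cones of all morphisms from C to a suspension of C: these form a small set, and the action
  of every scalar is among them.\<close>

lemma small_koszul_closed:
 obtains \<C> \<K> where "!!Y. ob Y ==> (!!C. C \<in> \<C> ==> TP ones C Y) ==> zero_obj T Y" "small U \<K>"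
  "!!C. C \<in> \<C> ==> cpt C" "!!K. K \<in> \<K> ==> cpt K"
  "!!C xs n. C \<in> \<C> ==> hom_list xs ==> so n (koszul xs C) \<in> \<K>"
proof -
 obtain \<C> where C: "small U \<C>" "!!C. C \<in> \<C> ==> cpt C" "Loc U T \<C> = Obj T"
  using cg unfolding compactly_generated_def by blast
 define \<G> where "\<G> = rec_nat \<C> (%_ A. \<Union>C\<in>A. \<Union>d\<in>(UNIV :: int set). cone ` Hom T C (so d C))"
 have G0: "\<G> 0 = \<C>" and GS: "\<G> (Suc k) = (\<Union>C\<in>\<G> k. \<Union>d\<in>(UNIV :: int set). cone ` Hom T C (so d C))" for k
  by (simp_all add: \<G>_def)
 have int: "small U (UNIV :: int set)"
 proof -
  have "range (%k. if even k then int (k div 2) else - int (k div 2)) = UNIV" (is "range ?f = _")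
  proof (intro equalityI subsetI)
   fix z :: int
   have "z = ?f (if z \<ge> 0 then 2 * nat z else 2 * nat (- z) + 1)" by simp
   thus "z \<in> range ?f" by (rule range_eqI)
  qed simp
  thus ?thesis using small_image[OF small_nat] by metis
 qed
 have Gc: "cpt A" if "A \<in> \<G> k" for A k using that
 proof (induction k arbitrary: A)
  case 0 thus ?case using C(2) G0 by simp
 next
  case (Suc k)
  then obtain B d f where B: "B \<in> \<G> k" "f \<in> Hom T B (so d B)" "A = cone f" unfolding GS by blast
  have Bc: "cpt B" by (rule Suc.IH[OF B(1)])
  have "mor f B (so d B)" using B(2) compact_ob[OF Bc] Hom_mor by simp
  then obtain g h where "exact_tri T B (so d B) A f g h" using cone_tri[of f] B(3) by auto
  thus ?case using compact_cone Bc compact_so by blast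
 qed
 have Gs: "small U (\<G> k)" for k
 proof (induction k)
  case (Suc k)
  show ?case unfolding GS
  proof (intro small_UN[OF Suc] small_UN[OF int] small_image)
   fix B d assume "B \<in> \<G> k"
   thus "small U (Hom T B (so d B))" using ls Gc compact_ob unfolding locally_small_def by (meson so_ob)
  qed
 qed (simp add: G0 C(1))
 have kz: "koszul xs A \<in> \<G> (k + length xs)" if "A \<in> \<G> k" "hom_list xs" for A k xs using that
 proof (induction xs A arbitrary: k rule: koszul.induct)
  case (2 d x xs A)
  have o: "ob A" using Gc[OF 2(2)] compact_ob by blast
  have "\<phi> d x A \<in> Hom T A (so d A)" using 2(3) o Hom_mor[of A "so d A"] by simp
  hence "cone (\<phi> d x A) \<in> \<G> (Suc k)" unfolding GS using 2(2) by blast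
  from 2(1)[OF this] show ?case using 2(3) by simp
 qed simp
 show ?thesis
 proof (rule that[of \<C> "\<Union>k\<in>(UNIV :: nat set). \<Union>n\<in>(UNIV :: int set). so n ` \<G> k"])
  fix Y assume Y: "ob Y" and z: "!!C. C \<in> \<C> ==> TP ones C Y"
  have "\<C> <= {A \<in> Obj T. TP ones A Y}" using z C(2) compact_ob by blast
  hence "Loc U T \<C> <= {A \<in> Obj T. TP ones A Y}" unfolding Loc_def using TP_ones_localizing_left[OF Y] by blast
  hence "TP ones Y Y" using Y C(3) by blast
  thus "zero_obj T Y" using TP_self[OF mfam_ones Y] tor_ones[of "idt Y"] Y zero_obj_iff by simp
 next
  show "small U (\<Union>k\<in>(UNIV :: nat set). \<Union>n\<in>(UNIV :: int set). so n ` \<G> k)"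
   by (intro small_UN small_nat int small_image Gs)
  show "cpt K" if "K \<in> (\<Union>k\<in>(UNIV :: nat set). \<Union>n\<in>(UNIV :: int set). so n ` \<G> k)" for K
   using that Gc compact_so by blast
  fix A xs n assume A: "A \<in> \<C>" "hom_list xs"
  hence "koszul xs A \<in> \<G> (0 + length xs)" by (intro kz) (simp_all add: G0)
  thus "so n (koszul xs A) \<in> (\<Union>k\<in>(UNIV :: nat set). \<Union>n\<in>(UNIV :: int set). so n ` \<G> k)" by blast
 qed (rule C(2))
qed

text \<open>The detecting set consists of the members of \<K> in T_V. For V(p) it contains the
  Koszul objects on generators of p, which detect because powers of these generators kill maps from
  compact objects into Y. For Z(p) each map from a generator into Y is killed by some x outside p,
  and the cone of that x lies in T_V.\<close>

lemma local_triangle: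
 assumes p: "p \<in> Spec R" and V: "V = V_of R p \<or> V = Z_of R p" and X: "ob X"
 shows "LT V X (GV V X) (LV V X)"
proof -
 let ?T = "TS V"
 obtain \<C> \<K> where gen: "!!Y. ob Y ==> (!!C. C \<in> \<C> ==> TP ones C Y) ==> zero_obj T Y" and "small U \<K>"
  and Cc: "!!C. C \<in> \<C> ==> cpt C" and Kc: "!!K. K \<in> \<K> ==> cpt K"
  and kz: "!!C xs n. C \<in> \<C> ==> hom_list xs ==> so n (koszul xs C) \<in> \<K>" using small_koszul_closed by metis
 have "EX G L. LT V X G L"
 proof (rule localization_triangle_exists[OF small_subset[OF \<open>small U \<K>\<close>, of "\<K> \<inter> ?T"] ls _ _ X])
  fix Y assume Y: "Y \<in> ?T" and loc: "!!K c. K \<in> \<K> \<inter> ?T ==> mor c K Y ==> nul c"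
  have oY: "ob Y" using Y by (simp add: torsion_sub_iff)
  have kzY: "TP ones (koszul xs C) Y" if C: "C \<in> \<C>" and xs: "hom_list xs"
   "!!q. q \<in> Spec R ==> (\<forall>(d, x)\<in>set xs. x \<in> q) ==> q \<in> V" for C xs unfolding TP_ones
  proof (intro allI impI)
   fix n f assume f: "mor f (so n (koszul xs C)) Y"
   have "koszul xs C \<in> ?T" by (rule koszul_torsion_V[OF xs(2,1) Cc[OF C]])
   hence "so n (koszul xs C) \<in> \<K> \<inter> ?T" using torsion_sub_triangulated kz[OF C xs(1)] unfolding triangulated_sub_def by blast
   thus "nul f" using loc f by blast
  qed
  show "zero_obj T Y"
  proof (rule gen[OF oY])
   fix C assume C: "C \<in> \<C>"
   note cC = Cc[OF C]
   note oC = compact_ob[OF cC]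
   show "TP ones C Y"
   proof (cases "V = V_of R p")
    case True
    obtain xs where xs: "hom_list xs" "!!d x. (d, x) \<in> set xs ==> x \<in> p"
     "!!q. q \<in> Spec R ==> (\<forall>(d, x)\<in>set xs. x \<in> q) ==> p <= q" using Spec_generators[OF p] by metis
    show ?thesis
    proof (rule koszul_list_detect[OF oY xs(1) cC])
     show "TP (powers d x) B Y" if "(d, x) \<in> set xs" "cpt B" for d x B
      by (rule torsion_V_powers[OF p _ _ xs(2)[OF that(1)] that(2)]) (use Y True xs(1) that(1) in \<open>auto simp: hom_list_def\<close>)
     show "TP ones (koszul xs C) Y" by (rule kzY[OF C xs(1)]) (use xs(3) True in \<open>auto simp: V_of_def\<close>)
    qed
   next
    case False
    hence VZ: "V = Z_of R p" using V by blast
    show ?thesis unfolding TP_ones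
    proof (intro allI impI)
     fix n f assume f: "mor f (so n C) Y"
     have "p \<notin> V" using VZ by (simp add: Z_of_def)
     hence "TP (avoid p) C Y" using Y cC p by (auto simp: torsion_sub_iff)
     hence "tor (avoid p) f" using f unfolding TP_def by blast
     then obtain d x where x: "x \<in> deg R d" "x \<notin> p" "nul (\<phi> d x Y \<cdot> f)" using f by (auto simp: tor_def avoid_def)
     have "TP ones (koszul [(d, x)] C) Y" by (rule kzY[OF C]) (use x VZ in \<open>auto simp: Z_of_def\<close>)
     thus "nul f" using koszul_detect[OF x(1) oC oY, of f n 0] f x(3) by simp
    qed
   qed
  qed
 qed (use Kc in auto)
 then obtain G L where "case (G, L) of (G, L) => LT V X G L" by auto
 hence "case local_pair U R T \<phi> V X of (G, L) => LT V X G L" unfolding local_pair_def by (rule someI)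
 thus ?thesis by (simp add: Gamma_V_def L_V_def case_prod_beta)
qed

end

section \<open>Support of compact objects\<close>

context big_category
begin

lemma triangulated_sub_zero: "triangulated_sub T S ==> zero_obj T Z ==> Z \<in> S"
 using tri_ident unfolding triangulated_sub_def by blast

lemma localizing_Int:
 assumes "localizing_sub U T A" "localizing_sub U T B" shows "localizing_sub U T (A \<inter> B)"
proof -
 have t: "triangulated_sub T A" "triangulated_sub T B" using assms by (simp_all add: localizing_sub_def)
 obtain Z where Z: "zero_obj T Z" using zero_exists by blast
 have "triangulated_sub T (A \<inter> B)" unfolding triangulated_sub_def
 proof (intro conjI allI impI ballI)
  show "A \<inter> B ~= {}" using triangulated_sub_zero[OF _ Z] t by blast
  show "A \<inter> B <= Obj T" using t unfolding triangulated_sub_def by blast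
  show "so n X \<in> A \<inter> B" if "X \<in> A \<inter> B" for X n using t that unfolding triangulated_sub_def by blast
  show "Z' \<in> A \<inter> B" if h: "exact_tri T X Y Z' f g h \<and> X \<in> A \<inter> B \<and> Y \<in> A \<inter> B" for X Y Z' f g h
   using triangulated_sub_two(1)[OF t(1) conjunct1[OF h]] triangulated_sub_two(1)[OF t(2) conjunct1[OF h]] h by blast
 qed
 moreover have "Y \<in> A \<inter> B" if h: "J <= U \<and> small U J \<and> F \<in> J \<rightarrow> A \<inter> B \<and> coproduct T J F Y io" for J :: "'u set" and F Y io
 proof -
  have c: "cop J F Y io" using h t unfolding cop_def triangulated_sub_def by blast
  show ?thesis using localizing_cop[OF assms(1) _ c] localizing_cop[OF assms(2) _ c] h by blast
 qed
 ultimately show ?thesis unfolding localizing_sub_def by blast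
qed

end

locale noetherian_generated_category = generated_category T U R \<phi>
 for T :: "('o, 'm) tcat" (structure) and U :: "'u set" and R :: "('r, 'z) gring_scheme" and \<phi> +
 assumes nc: "noetherian_category U R T \<phi>"
begin

text \<open>\<open>Hom*(C, D)\<close> is a quotient of \<open>End*(C \<oplus> D)\<close>.\<close>

lemma hom_star_fg:
 assumes C: "cpt C" and D: "cpt D"
 shows "finitely_generated R (HS C D)"
proof -
 note o = compact_ob[OF C] compact_ob[OF D]
 \<comment> \<open>The cone of a zero map is the direct sum of D and C; in this form its compactness
   follows from \<open>compact_cone\<close>. The maps r and s split i and q.\<close>
 let ?u = "zr (so (- 1) C) D"
 obtain E i q where t: "exact_tri T (so (- 1) C) D E ?u i q" using cone_exists[of ?u] o by auto
 note M = triD[OF t] and ex = tri_expair[OF t]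
 have Ec: "cpt E" by (rule compact_cone[OF t compact_so[OF C] D])
 note oE = compact_ob[OF Ec]
 have m: "mor i D E" "mor q E C" using M o by simp_all
 obtain r where r: "mor r E D" "r \<cdot> i = idt D" using expairD(6)[OF ex(1), of "idt D"] M o by auto
 obtain s where s: "mor s C E" "q \<cdot> s = idt C" using expairD(5)[OF ex(3), of "idt C"] M o by auto
 let ?M = "HS E E" and ?N = "HS C D" and ?F = "%n f. sm n r \<cdot> (f \<cdot> s)"
 note e = elts_hom_star[OF oE oE] elts_hom_star[OF o]
 have st: "f \<oplus>[HS A B,n] g = f +. g" "act (HS A B) i j r f = sm j (\<phi> i r B) \<cdot> f" for A B n i j r f g
  by (simp_all add: hom_star_def hom_group_def)
 have F: "gmod_hom R ?M ?N ?F" unfolding gmod_hom_def st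
 proof (intro conjI allI ballI Pi_I)
  show "?F n f \<in> elts ?N n" if "f \<in> elts ?M n" for n f using that r s unfolding e by simp
  show "?F n (f +. g) = ?F n f +. ?F n g" if "f \<in> elts ?M n" "g \<in> elts ?M n" for n f g
   using that r s unfolding e by (simp add: plus_dist)
  fix k j a f assume a: "a \<in> deg R k" and f: "f \<in> elts ?M j"
  have "sm j (\<phi> k a D) \<cdot> sm j r = sm j (\<phi> k a (cd r) \<cdot> r)" using a r by simp
  also have "... = sm (j + k) r \<cdot> sm j (\<phi> k a E)" unfolding lin_natural[OF a conjunct1[OF r(1)[unfolded mor_iff]]] using a r by simp
  finally have "sm (k + j) r \<cdot> sm j (\<phi> k a E) = sm j (\<phi> k a D) \<cdot> sm j r" by (simp add: add.commute)
  moreover have "?F (k + j) (sm j (\<phi> k a E) \<cdot> f) = (sm (k + j) r \<cdot> sm j (\<phi> k a E)) \<cdot> (f \<cdot> s)"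
   using a f r s unfolding e by (simp add: add.commute)
  moreover have "sm j (\<phi> k a D) \<cdot> ?F j f = (sm j (\<phi> k a D) \<cdot> sm j r) \<cdot> (f \<cdot> s)" using a f r s unfolding e by simp
  ultimately show "?F (k + j) (sm j (\<phi> k a E) \<cdot> f) = sm j (\<phi> k a D) \<cdot> ?F j f" by simp
 qed
 have im: "?F n ` elts ?M n = elts ?N n" for n
 proof (intro equalityI subsetI)
  show "x \<in> elts ?N n" if "x \<in> ?F n ` elts ?M n" for x using that F unfolding gmod_hom_def by blast
  fix g assume g: "g \<in> elts ?N n"
  have gm: "mor g C (so n D)" using g unfolding e .
  have "?F n (sm n i \<cdot> (g \<cdot> q)) = sm n (r \<cdot> i) \<cdot> (g \<cdot> (q \<cdot> s))" using gm m r(1) s(1) by simp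
  hence "g = ?F n (sm n i \<cdot> (g \<cdot> q))" unfolding r(2) s(2) using gm o by simp
  moreover have "sm n i \<cdot> (g \<cdot> q) \<in> elts ?M n" unfolding e using gm m by simp
  ultimately show "g \<in> ?F n ` elts ?M n" by blast
 qed
 note mM = hom_star_module[OF oE oE] and mN = hom_star_module[OF o]
 have "finitely_generated R ?M" using nc Ec unfolding noetherian_category_def by blast
 hence "fg_over R ?M (elts ?M) (null_sub ?M)" using graded_mod.fg_iff[OF gmodI[OF mM]] by simp
 hence "fg_over R ?N (%n. ?F n ` elts ?M n) (null_sub ?N)"
 proof (rule fg_over_image[OF graded_commutative_ring_axioms mM mN F])
  show "gsub R (elts ?M) ?M" by (rule graded_mod.sub_whole[OF gmodI[OF mM]])
  show "gsub R (null_sub ?N) ?N" by (rule graded_mod.sub_null[OF gmodI[OF mN]])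
  show "null_sub ?M n <= elts ?M n" for n unfolding null_sub_def using oE by (auto simp: hom_star_def hom_group_def Hom_mor)
  show "?F n ` null_sub ?M n <= null_sub ?N n" for n
  proof -
   have "nul (sm n r \<cdot> (zr E (so n E) \<cdot> s))" using nul_cmp[of "zr E (so n E) \<cdot> s" "sm n r"] nul_cmp[of s "zr E (so n E)"] r s by simp
   hence "sm n r \<cdot> (zr E (so n E) \<cdot> s) = zr C (so n D)" by (rule nul_eq) (use r s in simp_all)
   thus ?thesis by (simp add: null_sub_def hom_star_def hom_group_def)
  qed
 qed
 hence "fg_over R ?N (elts ?N) (null_sub ?N)" unfolding im .
 thus ?thesis using graded_mod.fg_iff[OF gmodI[OF mN]] by simp
qed

section \<open>Support of compact objects at a fixed prime\<close>

context
 fixes p assumes p: "p \<in> Spec R"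
begin

text \<open>If Hom*(C, D//x) vanishes at p, multiplication by x is surjective on Hom*(C, D) at p: a
  multiple s f dies in the cone and hence is x y. As x lies in p, Nakayama's lemma applies.\<close>

lemma nakayama_koszul:
 assumes C: "cpt C" and D: "cpt D" and x: "x \<in> deg R d" "x \<in> p"
  and Z: "TP (avoid p) C (cone (\<phi> d x D))"
 shows "TP (avoid p) C D"
proof -
 note o = compact_ob[OF C] compact_ob[OF D] and S = mfam_avoid[OF p]
 let ?Z = "cone (\<phi> d x D)" and ?M = "HS C D"
 obtain g h where t: "exact_tri T D (so d D) ?Z (\<phi> d x D) g h" by (rule koszul_tri[OF x(1) o(2)])
 note E = triD[OF t]
 interpret M: graded_mod R ?M by (rule gmodI[OF hom_star_module[OF o]])
 have oZ: "ob ?Z" using x o by simp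
 show ?thesis unfolding TP_iff[OF S o]
 proof (intro allI impI)
  fix n f assume f: "mor f C (so n D)"
  have "tors R ?M p (null_sub ?M) n f"
  proof (rule M.nakayama[OF p M.sub_whole M.sub_null _ x])
   show "fg_over R ?M (elts ?M) (null_sub ?M)" using hom_star_fg[OF C D] M.fg_iff by simp
   show "f \<in> elts ?M n" unfolding elts_hom_star[OF o] by (rule f)
   fix n f assume "f \<in> elts ?M n"
   hence f: "mor f C (so n D)" unfolding elts_hom_star[OF o] .
   let ?F = "sm (n - d) g \<cdot> f"
   have F: "mor ?F C (so (n - d) ?Z)" using f E o by simp
   hence "tor (avoid p) ?F" by (rule TP_tor'[OF S Z o(1) oZ])
   then obtain i s where s: "s \<in> deg R i" "s \<notin> p" "nul (\<phi> i s (cd ?F) \<cdot> ?F)" by (auto simp: tor_def avoid_def)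
   have "\<phi> i s (cd ?F) \<cdot> ?F = (\<phi> i s (cd (sm (n - d) g)) \<cdot> sm (n - d) g) \<cdot> f" using s(1) f E o by simp
   also have "... = sm (i + n - d) g \<cdot> (\<phi> i s (so n D) \<cdot> f)"
    unfolding lin_natural[OF s(1) arr_sm[OF conjunct1[OF E(2)[unfolded mor_iff]]]] using s(1) f E o by (simp add: algebra_simps)
   finally have "nul (sm (i + n - d) g \<cdot> (\<phi> i s (so n D) \<cdot> f))" using s(3) by simp
   hence "nul (sm (i + n - d) g \<cdot> (sm n (\<phi> i s D) \<cdot> f))"
    using lin_so[OF s(1) o(2), of n] s(1) f E o by (auto simp: algebra_simps)
   then obtain y where y: "mor y C (so (i + n - d) D)" "sm (i + n - d) (\<phi> d x D) \<cdot> y = sm n (\<phi> i s D) \<cdot> f"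
    using expairD(5)[OF expair_sm[OF tri_expair(1)[OF t], of "i + n - d"], of "sm n (\<phi> i s D) \<cdot> f"] s(1) f E o x
    by (auto simp: algebra_simps)
   have ye: "y \<in> elts ?M (i + n - d)" unfolding elts_hom_star[OF o] by (rule y(1))
   have fe: "f \<in> elts ?M n" unfolding elts_hom_star[OF o] by (rule f)
   have "act ?M i n s f = act ?M d (i + n - d) x y" using y(2) by (simp add: hom_star_def)
   moreover have "act ?M i n s f \<in> elts ?M (i + n)" by (rule M.act_closed[OF s(1) fe refl])
   ultimately have "act ?M i n s f \<ominus>[?M,i + n] act ?M d (i + n - d) x y \<in> null_sub ?M (i + n)"
    using M.G.r_neg[of "act ?M i n s f" "i + n"] by (simp add: a_minus_def null_sub_def)
   thus "EX i s y. s \<in> deg R i \<and> s \<notin> p \<and> y \<in> elts ?M (i + n - d) \<and>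
     act ?M i n s f \<ominus>[?M,i + n] act ?M d (i + n - d) x y \<in> null_sub ?M (i + n)"
    using s(1,2) ye by blast
  qed
  thus "tor (avoid p) f" using tors_hom_star[OF o f] by blast
 qed
qed

lemma nakayama_koszul_list:
 assumes C: "cpt C"
 shows "hom_list xs ==> cpt D ==> \<forall>(d, x)\<in>set xs. x \<in> p ==> TP (avoid p) C (koszul xs D) ==> TP (avoid p) C D"
proof (induction xs D rule: koszul.induct)
 case (2 d x xs D)
 have x: "x \<in> deg R d" "x \<in> p" "hom_list xs" using 2(2,4) by simp_all
 have "TP (avoid p) C (cone (\<phi> d x D))" by (rule 2(1)[OF x(3) koszul_compact[OF x(1) 2(3)]]) (use 2(4,5) in auto)
 thus ?case by (rule nakayama_koszul[OF C 2(3) x(1,2)])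
qed simp

lemma koszul_triangulated:
 assumes S: "triangulated_sub T S" shows "hom_list xs ==> D \<in> S ==> koszul xs D \<in> S"
proof (induction xs D rule: koszul.induct)
 case (2 d x xs D)
 have D: "ob D" "so d D \<in> S" using S 2(3) unfolding triangulated_sub_def by blast+
 have x: "x \<in> deg R d" using 2(2) by simp
 obtain g h where t: "exact_tri T D (so d D) (cone (\<phi> d x D)) (\<phi> d x D) g h" by (rule koszul_tri[OF x D(1)])
 show ?case using 2(1)[OF _ triangulated_sub_two(1)[OF S t 2(3) D(2)]] 2(2) by simp
qed simp

abbreviation "TZ \<equiv> TS (Z_of R p)"
abbreviation "TV \<equiv> TS (V_of R p)"

definition orth :: "'o set => 'o => bool" where
 "orth S L \<longleftrightarrow> ob L \<and> (\<forall>Y\<in>S. ALL f. mor f Y L --> nul f)"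

lemma localization_triangleE:
 assumes "LT V X G L"
 obtains f g h where "exact_tri T G X L f g h" "G \<in> TS V" "orth (TS V) L"
proof -
 obtain f g h where t: "exact_tri T G X L f g h" using assms unfolding localization_triangle_def by blast
 have L: "ob L" using triD[OF t] by simp
 have "nul f" if "Y \<in> TS V" "mor f Y L" for Y f
 proof -
  have oY: "ob Y" using that(1) by (simp add: torsion_sub_iff)
  have "f \<in> Hom T Y L" using that(2) Hom_mor[OF oY L] by blast
  thus ?thesis using assms that(1) oY L unfolding localization_triangle_def by auto
 qed
 thus ?thesis using that[OF t] assms L unfolding localization_triangle_def orth_def by blast
qed

lemma torsion_so: "X \<in> TS V ==> so n X \<in> TS V"
 using torsion_sub_triangulated unfolding triangulated_sub_def by blast

lemma TZ_TP: "X \<in> TZ ==> cpt C ==> TP (avoid p) C X"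
 using p by (auto simp: torsion_sub_iff Z_of_def)

text \<open>For x outside p the cone of x on C lies in T_Z(p), so it has no nonzero maps to L; thus
  x acts injectively on Hom*(C, L).\<close>

lemma torsion_free:
 assumes L: "orth TZ L" and C: "cpt C" and x: "x \<in> deg R d" "x \<notin> p"
  and f: "mor f (so n C) (so m L)" "nul (\<phi> d x (so m L) \<cdot> f)"
 shows "nul f"
proof (rule koszul_detect[OF x(1) compact_ob[OF C] _ _ f])
 show oL: "ob L" using L by (simp add: orth_def)
 have "koszul [(d, x)] C \<in> TZ" by (rule koszul_torsion_V[OF _ _ C]) (use x in \<open>auto simp: Z_of_def\<close>)
 hence "cone (\<phi> d x C) \<in> TZ" by simp
 thus "TP ones (cone (\<phi> d x C)) L" using L torsion_so unfolding TP_ones orth_def by blast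
qed

text \<open>At p nothing is contributed by G, so Hom*(C, X) and Hom*(C, L) agree there; and elements
  outside p act injectively on Hom*(C, L), so its vanishing at p is vanishing.\<close>

lemma local_zero_iff:
 assumes lt: "LT (Z_of R p) X G L" and C: "cpt C"
 shows "TP ones C L \<longleftrightarrow> TP (avoid p) C X"
proof -
 note S = mfam_avoid[OF p] and oC = compact_ob[OF C]
 obtain f g h where t: "exact_tri T G X L f g h" and G: "G \<in> TZ" and L: "orth TZ L" by (rule localization_triangleE[OF lt])
 note E = triD[OF t] and ex = tri_expair[OF t]
 have GT: "TP (avoid p) C G" by (rule TZ_TP[OF G C])
 have o: "ob G" "ob X" "ob L" using E by simp_all
 show ?thesis
 proof
  assume z: "TP ones C L"
  show "TP (avoid p) C X" unfolding TP_def
  proof (intro allI impI)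
   fix n a assume a: "mor a (so n C) X"
   have "mor (g \<cdot> a) (so n C) L" using a E by simp
   hence "nul (g \<cdot> a)" using z unfolding TP_ones by blast
   then obtain w where w: "mor w (so n C) G" "f \<cdot> w = a" using expairD(5)[OF ex(1), of a] a E by auto
   have "tor (avoid p) w" using GT w(1) unfolding TP_def by blast
   hence "tor (avoid p) (f \<cdot> w)" by (rule tor_post[OF S]) (use w(1) E in simp_all)
   thus "tor (avoid p) a" using w(2) by simp
  qed
 next
  assume z: "TP (avoid p) C X"
  show "TP ones C L" unfolding TP_ones
  proof (intro allI impI)
   fix n a assume a: "mor a (so n C) L"
   have "tor (avoid p) a"
   proof (rule tor_lift[OF S ex(2)])
    show "tor (avoid p) (h \<cdot> a)" by (rule TP_tor[OF S GT, of _ n 1]) (use a E oC in simp_all)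
    show "tor (avoid p) w" if "mor w (dm a) (so i (dm g))" for i w by (rule TP_tor[OF S z, of w n i]) (use that a E oC in simp_all)
   qed (use a E in simp_all)
   then obtain d x where x: "x \<in> deg R d" "x \<notin> p" "nul (\<phi> d x L \<cdot> a)" using a by (auto simp: tor_def avoid_def)
   thus "nul a" using torsion_free[OF L C x(1,2), of a n 0] a by simp
  qed
 qed
qed

text \<open>For a map a from C to L some multiple s a with s outside p comes from X and is killed by
  some t outside q. Exchanging s and t up to sign gives s t a = 0, and s acts injectively; so t a =
  0.\<close>

lemma local_TV:
 assumes lt: "LT (Z_of R p) X G L" and X: "X \<in> TV"
 shows "L \<in> TV"
proof -
 note S = mfam_avoid[OF p]
 obtain f g h where t: "exact_tri T G X L f g h" and G: "G \<in> TZ" and L: "orth TZ L" by (rule localization_triangleE[OF lt])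
 note E = triD[OF t] and ex = tri_expair[OF t]
 have o: "ob G" "ob X" "ob L" using E by simp_all
 have "TP (avoid q) C L" if C: "cpt C" and q: "q \<in> Spec R" "q \<notin> V_of R p" for C q unfolding TP_def
 proof (intro allI impI)
  fix n a assume a: "mor a (so n C) L"
  note oC = compact_ob[OF C] and Sq = mfam_avoid[OF q(1)]
  have "tor (avoid p) (h \<cdot> a)" by (rule TP_tor[OF S TZ_TP[OF G C], of _ n 1]) (use a E oC in simp_all)
  then obtain i s w where s: "s \<in> avoid p i" "mor w (dm a) (so i (dm g))" "sm i g \<cdot> w = \<phi> i s (cd a) \<cdot> a"
   using tor_lift_ex[OF S ex(2), of a] a E by (metis mor_iff)
  have si: "s \<in> deg R i" "s \<notin> p" using s(1) by (auto simp: avoid_def)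
  have XT: "TP (avoid q) C X" using X C q by (auto simp: torsion_sub_iff)
  have "tor (avoid q) w" by (rule TP_tor[OF Sq XT, of w n i]) (use s(2) a E oC in simp_all)
  hence "tor (avoid q) (sm i g \<cdot> w)" by (rule tor_post[OF Sq]) (use s(2) E in simp_all)
  then obtain j t where t: "t \<in> avoid q j" "nul (\<phi> j t (so i L) \<cdot> (\<phi> i s L \<cdot> a))"
   unfolding s(3) using a si by (auto simp: tor_def)
  have tj: "t \<in> deg R j" using t(1) by (simp add: avoid_def)
  have "\<phi> j t (so i L) \<cdot> (\<phi> i s L \<cdot> a) = (\<phi> j t (so i L) \<cdot> \<phi> i s L) \<cdot> a" using a si tj by simp
  also have "... = (sm j (\<phi> i s L) \<cdot> \<phi> j t L) \<cdot> a"
   using lin_mult2[OF tj si(1) o(3)] lin_mult[OF si(1) tj o(3)] by simp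
  also have "... = sm j (\<phi> i s L) \<cdot> (\<phi> j t L \<cdot> a)" using a si tj by simp
  finally have "nul (\<phi> i s (so j L) \<cdot> (\<phi> j t L \<cdot> a))"
   using t(2) lin_so_nul[OF si(1), of "\<phi> j t L \<cdot> a" j L] a tj o by simp
  hence "nul (\<phi> j t L \<cdot> a)" by (rule torsion_free[OF L C si, of _ n j, rotated]) (use a tj in simp)
  thus "tor (avoid q) a" using t(1) a by (auto simp: tor_def)
 qed
 thus ?thesis using o by (auto simp: torsion_sub_iff)
qed

lemma zero_of_orth: assumes "L \<in> TS V" "orth (TS V) L" shows "zero_obj T L"
proof -
 have "ob L" using assms(2) by (simp add: orth_def)
 thus ?thesis using assms zero_obj_iff[of L] unfolding orth_def by simp
qed

text \<open>If the map from G to X is zero, the identity of the suspension of G factors through L,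
  which receives only zero maps from T_V.\<close>

lemma zero_fiber:
 assumes lt: "LT V X G L" and "!!f. mor f G X ==> nul f" shows "zero_obj T G"
proof -
 obtain f g h where t: "exact_tri T G X L f g h" and G: "G \<in> TS V" and L: "orth (TS V) L"
  by (rule localization_triangleE[OF lt])
 note E = triD[OF t] and ex = tri_expair[OF t]
 have "nul f" using assms(2) E by blast
 then obtain v where v: "mor v (so 1 G) L" "h \<cdot> v = idt (so 1 G)" using expairD(5)[OF ex(3), of "idt (so 1 G)"] E by auto
 have "nul v" using L torsion_so[OF G, of 1] v(1) unfolding orth_def by blast
 hence "nul (idt (so 1 G))" using nul_cmp[of v h] v E by simp
 thus ?thesis using zero_obj_so[of G 1] zero_obj_iff[of "so 1 G"] E by simp
qed

abbreviation "LZ \<equiv> LV (Z_of R p)"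

lemmas lt_Z = local_triangle[OF p disjI2[OF refl]]
lemmas lt_V = local_triangle[OF p disjI1[OF refl]]

text \<open>Such a Y is unchanged, up to isomorphism, by localization away from Z(p), its G being
  zero; and the result is unchanged by \<Gamma>_V(p), the remaining localization being zero. Hence Y
  is isomorphic to its own \<Gamma>_p.\<close>

lemma Gamma_p_imageI:
 assumes Y: "Y \<in> TV" "orth TZ Y" shows "Y \<in> Gamma_p_image U R T \<phi> p"
proof -
 have oY: "ob Y" using Y by (simp add: orth_def)
 let ?G = "GV (Z_of R p) Y" and ?L = "LZ Y"
 obtain f g h where t: "exact_tri T ?G Y ?L f g h" and G: "?G \<in> TZ" and L: "orth TZ ?L" by (rule localization_triangleE[OF lt_Z[OF oY]])
 note E = triD[OF t] and ex = tri_expair[OF t]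
 have zG: "zero_obj T ?G" by (rule zero_fiber[OF lt_Z[OF oY]]) (use Y(2) G in \<open>auto simp: orth_def\<close>)
 have "zero_obj T (so 1 ?G)" using zG E zero_obj_so[of ?G 1] by simp
 hence "iso_mor T Y ?L g" using expair_iso[OF ex(1) zero_obj_nul[OF zG] ex(2) zero_obj_nul] E by auto
 then obtain k where k: "mor g Y ?L" "mor k ?L Y" "k \<cdot> g = idt Y" "g \<cdot> k = idt ?L" by (rule iso_morE) (use E in simp_all)
 have LV: "?L \<in> TV" by (rule local_TV[OF lt_Z[OF oY] Y(1)])
 have oL: "ob ?L" using E by simp
 let ?G' = "GV (V_of R p) ?L" and ?L' = "LV (V_of R p) ?L"
 obtain f' g' h' where t': "exact_tri T ?G' ?L ?L' f' g' h'" and G': "?G' \<in> TV" and L': "orth TV ?L'"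
  by (rule localization_triangleE[OF lt_V[OF oL]])
 note E' = triD[OF t'] and ex' = tri_expair[OF t']
 have "?L' \<in> TV" by (rule triangulated_sub_two(1)[OF torsion_sub_triangulated t' G' LV])
 hence zL: "zero_obj T ?L'" by (rule zero_of_orth[OF _ L'])
 have "nul h'" "nul g'" using zero_obj_nul[OF zL] E' by simp_all
 hence "iso_mor T ?G' ?L f'" using expair_iso[OF ex'(4) _ ex'(1)] E' by auto
 then obtain k' where k': "mor f' ?G' ?L" "mor k' ?L ?G'" "k' \<cdot> f' = idt ?G'" "f' \<cdot> k' = idt ?L" by (rule iso_morE) (use E' in simp_all)
 have "iso_obj T ?G' Y"
 proof (rule iso_morI)
  show "mor (k \<cdot> f') ?G' Y" "mor (k' \<cdot> g) Y ?G'" using k(1,2) k'(1,2) by simp_all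
  have "(k' \<cdot> g) \<cdot> (k \<cdot> f') = k' \<cdot> ((g \<cdot> k) \<cdot> f')" using k(1,2) k'(1,2) by simp
  thus "(k' \<cdot> g) \<cdot> (k \<cdot> f') = idt ?G'" unfolding k(4) using k'(1,3) by simp
  have "(k \<cdot> f') \<cdot> (k' \<cdot> g) = k \<cdot> ((f' \<cdot> k') \<cdot> g)" using k(1,2) k'(1,2) by simp
  thus "(k \<cdot> f') \<cdot> (k' \<cdot> g) = idt Y" unfolding k'(4) using k(1,3) by simp
 qed
 thus ?thesis unfolding Gamma_p_image_def Gamma_p_def using oY by blast
qed

text \<open>If \<Gamma>_p D = 0, the Koszul object on D has no maps to the localization of D, and
  Nakayama's lemma carries this back to End*(D). If the identity of D is torsion at p, then D lies
  in T_Z(p) and its localization is zero.\<close>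

lemma supp_obj_iff:
 assumes D: "cpt D" shows "p \<in> supp_obj U R T \<phi> D \<longleftrightarrow> \<not> TP (avoid p) D D"
proof -
 note o = compact_ob[OF D] and S = mfam_avoid[OF p]
 let ?L = "LZ D"
 obtain f g h where t: "exact_tri T (GV (Z_of R p) D) D ?L f g h" and G: "GV (Z_of R p) D \<in> TZ"
  and L: "orth TZ ?L" by (rule localization_triangleE[OF lt_Z[OF o]])
 have oL: "ob ?L" using triD[OF t] by simp
 let ?G = "GV (V_of R p) ?L"
 obtain f' g' h' where t': "exact_tri T ?G ?L (LV (V_of R p) ?L) f' g' h'" and L': "orth TV (LV (V_of R p) ?L)"
  by (rule localization_triangleE[OF lt_V[OF oL]])
 note E = triD[OF t] and E' = triD[OF t']
 have "zero_obj T ?G \<longleftrightarrow> TP (avoid p) D D"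
 proof
  assume z: "zero_obj T ?G"
  obtain xs where xs: "hom_list xs" "!!d x. (d, x) \<in> set xs ==> x \<in> p"
   "!!q. q \<in> Spec R ==> (\<forall>(d, x)\<in>set xs. x \<in> q) ==> p <= q" using Spec_generators[OF p] by metis
  let ?W = "koszul xs D"
  have W: "cpt ?W" by (rule koszul_list_compact[OF xs(1) D])
  note oW = compact_ob[OF W]
  have WV: "?W \<in> TV" by (rule koszul_torsion_V[OF _ xs(1) D]) (use xs(3) in \<open>auto simp: V_of_def\<close>)
  \<comment> \<open>\<open>?W\<close> lies in T_V(p), so its maps to \<open>?L\<close> factor
    through \<Gamma>_p D, which is zero.\<close>
  have "TP ones ?W ?L" unfolding TP_ones
  proof (intro allI impI)
   fix n a assume a: "mor a (so n ?W) ?L"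
   have "nul (g' \<cdot> a)" using L' torsion_so[OF WV, of n] a E' unfolding orth_def by simp
   then obtain w where w: "mor w (so n ?W) ?G" "f' \<cdot> w = a" using expairD(5)[OF tri_expair(1)[OF t'], of a] a E' by auto
   thus "nul a" using nul_cmp[of w f'] zero_obj_nul[OF z, of w] E' by auto
  qed
  \<comment> \<open>As \<open>?W\<close> is built from D by cones, End*(\<open>?W\<close>) vanishes
    at p as well. So the identity of \<open>?W\<close> is torsion, which makes Hom*(D,
    \<open>?W\<close>) vanish at p.\<close>
  hence WD: "TP (avoid p) ?W D" using local_zero_iff[OF lt_Z[OF o] W] by blast
  hence "?W \<in> {B \<in> Obj T. TP (avoid p) ?W B}" using o by (intro koszul_triangulated[OF TP_right[OF S oW] xs(1)]) simp
  hence "tor (avoid p) (idt ?W)" using TP_self[OF S oW] by blast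
  hence "TP (avoid p) D ?W" by (rule tor_idt(1)[OF S oW _ o])
  thus "TP (avoid p) D D" by (rule nakayama_koszul_list[OF D xs(1) D, rotated]) (use xs(2) in auto)
 next
  assume "TP (avoid p) D D"
  hence td: "tor (avoid p) (idt D)" by (rule TP_self[OF S o])
  have DZ: "D \<in> TZ"
  proof -
   have "TP (avoid q) C D" if "cpt C" "q \<in> Spec R" "q \<notin> Z_of R p" for C q
   proof -
    have "q <= p" using that by (auto simp: Z_of_def)
    hence "tor (avoid q) (idt D)" using td by (auto simp: tor_def avoid_def)
    thus ?thesis by (rule tor_idt(1)[OF mfam_avoid[OF that(2)] o _ compact_ob[OF that(1)]])
   qed
   thus ?thesis using o by (auto simp: torsion_sub_iff)
  qed
  hence "nul g" using L E unfolding orth_def by blast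
  then obtain v where v: "mor v (so 1 (GV (Z_of R p) D)) ?L" "v \<cdot> h = idt ?L"
   using expairD(6)[OF tri_expair(2)[OF t], of "idt ?L"] E by auto
  have "nul v" using L torsion_so[OF G, of 1] v(1) unfolding orth_def by blast
  hence "nul (idt ?L)" using nul_cmp[of h v] v E by simp
  hence "zero_obj T ?L" using zero_obj_iff oL by blast
  thus "zero_obj T ?G" by (intro zero_fiber[OF lt_V[OF oL]]) (auto intro: zero_obj_nul)
 qed
 thus ?thesis using p by (simp add: supp_obj_def Gamma_p_def)
qed

lemma local_zero_iff_supports:
 assumes st: "stratified U R T \<phi>" and C: "cpt C" and D: "cpt D"
 shows "TP (avoid p) C D \<longleftrightarrow> TP (avoid p) C C \<or> TP (avoid p) D D"
proof
 note o = compact_ob[OF C] compact_ob[OF D] and S = mfam_avoid[OF p]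
 show "TP (avoid p) C D" if "TP (avoid p) C C \<or> TP (avoid p) D D"
  using that tor_idt(2)[OF S o(1) _ o(2)] tor_idt(1)[OF S o(2) _ o(1)] TP_self[OF S] o by blast
 assume CD: "TP (avoid p) C D"
 show "TP (avoid p) C C \<or> TP (avoid p) D D"
 proof (rule ccontr)
  assume n: "\<not> (TP (avoid p) C C \<or> TP (avoid p) D D)"
  obtain xs where xs: "hom_list xs" "!!d x. (d, x) \<in> set xs ==> x \<in> p"
   "!!q. q \<in> Spec R ==> (\<forall>(d, x)\<in>set xs. x \<in> q) ==> p <= q" using Spec_generators[OF p] by metis
  let ?I = "Gamma_p_image U R T \<phi> p"
  have K: "cpt (koszul xs A)" "LZ (koszul xs A) \<in> ?I" if A: "cpt A" for A
  proof -
   show k: "cpt (koszul xs A)" by (rule koszul_list_compact[OF xs(1) A])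
   note lt = lt_Z[OF compact_ob[OF k]]
   have "koszul xs A \<in> TV" by (rule koszul_torsion_V[OF _ xs(1) A]) (use xs(3) in \<open>auto simp: V_of_def\<close>)
   hence "LZ (koszul xs A) \<in> TV" by (rule local_TV[OF lt])
   moreover have "orth TZ (LZ (koszul xs A))" by (rule localization_triangleE[OF lt])
   ultimately show "LZ (koszul xs A) \<in> ?I" by (rule Gamma_p_imageI)
  qed
  \<comment> \<open>Vanishing of maps into the localized Koszul object is carried back to vanishing
    of Hom*(A, B) at p.\<close>
  have nak: "TP (avoid p) A B" if A: "cpt A" and B: "cpt B" and "TP ones A (LZ (koszul xs B))" for A B
  proof -
   have "TP (avoid p) A (koszul xs B)" using local_zero_iff[OF lt_Z[OF compact_ob[OF K(1)[OF B]]] A] that(3) by blast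
   thus ?thesis by (rule nakayama_koszul_list[OF A xs(1) B, rotated]) (use xs(2) in auto)
  qed
  have nz: "\<not> zero_obj T (LZ (koszul xs D))"
  proof
   assume "zero_obj T (LZ (koszul xs D))"
   hence "TP ones D (LZ (koszul xs D))" unfolding TP_ones using zero_obj_nul by auto
   thus False using nak[OF D D] n by blast
  qed
  hence min: "minimal_sub U T ?I" using st p K(2)[OF D] unfolding stratified_def zero_sub_def by blast
  let ?S = "?I \<inter> {B \<in> Obj T. TP ones C B}"
  have "localizing_sub U T ?S" using localizing_Int[OF _ TP_localizing[OF mfam_ones C]] min unfolding minimal_sub_def by blast
  moreover have "LZ (koszul xs D) \<in> ?S"
  proof -
   have "koszul xs D \<in> {B \<in> Obj T. TP (avoid p) C B}" using CD o by (intro koszul_triangulated[OF TP_right[OF S o(1)] xs(1)]) simp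
   hence "TP ones C (LZ (koszul xs D))" using local_zero_iff[OF lt_Z[OF compact_ob[OF K(1)[OF D]]] C] by blast
   moreover have "ob (LZ (koszul xs D))" using K(2)[OF D] by (simp add: Gamma_p_image_def)
   ultimately show ?thesis using K(2)[OF D] by blast
  qed
  ultimately have "?S = ?I" using min nz unfolding minimal_sub_def zero_sub_def by blast
  hence "TP ones C (LZ (koszul xs C))" using K(2)[OF C] by blast
  thus False using nak[OF C C] n by blast
 qed
qed

end

section \<open>Support and boundedness of Hom*(C, D)\<close>

lemma supp_hom_star:
 assumes st: "stratified U R T \<phi>" and C: "cpt C" and D: "cpt D"
 shows "{p \<in> Spec R. \<not> localization_zero R p (HS C D)} = supp_obj U R T \<phi> C \<inter> supp_obj U R T \<phi> D"
proof -
 have "p \<in> supp_obj U R T \<phi> C \<inter> supp_obj U R T \<phi> D \<longleftrightarrow> \<not> localization_zero R p (HS C D)" if "p \<in> Spec R" for p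
  using supp_obj_iff[OF that C] supp_obj_iff[OF that D] local_zero_iff_supports[OF that st C D]
   localization_zero_TP[OF compact_ob[OF C] compact_ob[OF D] that] by blast
 thus ?thesis by (auto simp: supp_obj_def)
qed

lemma hom_bounded_iff:
 assumes C: "cpt C" and D: "cpt D"
 shows "(EX N. \<forall>n\<ge>N. Hom T C (so n D) = {zr C (so n D)}) \<longleftrightarrow>
  (\<forall>p\<in>{p \<in> Spec R. \<not> localization_zero R p (HS C D)}. \<forall>d>0. deg R d <= p)"
proof -
 have "elts (HS C D) n = Hom T C (so n D)" "\<zero>[HS C D,n] = zr C (so n D)" for n
  by (simp_all add: hom_star_def hom_group_def)
 hence "(EX N. \<forall>n\<ge>N. Hom T C (so n D) = {zr C (so n D)}) \<longleftrightarrow>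
   (\<forall>p\<in>Spec R. \<not> localization_zero R p (HS C D) --> (\<forall>d>0. deg R d <= p))"
  using bounded_iff_support[OF hom_star_module[OF compact_ob[OF C] compact_ob[OF D]] hom_star_fg[OF C D]] by simp
 thus ?thesis by (simp only: mem_Collect_eq Ball_def imp_conjL)
qed

end

theorem theorem1p3:
 fixes U :: "'u set" and R :: "'r gring" and T :: "('o, 'm) tcat"
  and \<phi> :: "int => 'r => 'o => 'm" and C D :: 'o
 assumes "graded_commutative_ring R" and "noetherian_ring R"
  and "universe U" and "triangulated_category T" and "locally_small U T"
  and "has_coproducts U T" and "compactly_generated U T" and "linear_action R T \<phi>"
  and "noetherian_category U R T \<phi>" and "stratified U R T \<phi>"
  and "compact_obj U T C" and "compact_obj U T D"
 shows "supp_gmod R (hom_star T \<phi> C D) = supp_obj U R T \<phi> C \<inter> supp_obj U R T \<phi> D \<and>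
     ((\<forall>i<0. deg R i = {\<zero>\<^bsub>R\<^esub>}) -->
      ((\<exists>N. \<forall>n\<ge>N. Hom T C (susp_obj T n D) = {zero_mor T C (susp_obj T n D)}) \<longleftrightarrow>
      (\<exists>N. \<forall>n\<ge>N. Hom T D (susp_obj T n C) = {zero_mor T D (susp_obj T n C)})))"
proof -
 interpret triangulated_category T by fact
 interpret R: noetherian_graded_ring R using assms(1,2) by (simp add: noetherian_graded_ring_def)
 interpret noetherian_generated_category T U R \<phi> by unfold_locales fact+
 note CD = supp_hom_star[OF assms(10-12)] and DC = supp_hom_star[OF assms(10,12,11)]
 have "supp_gmod R (hom_star T \<phi> C D) = {p \<in> Spec R. \<not> localization_zero R p (hom_star T \<phi> C D)}"
  using R.supp_gmod_eq[OF hom_star_module hom_star_fg] assms(11,12) compact_ob by blast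
 thus ?thesis unfolding CD hom_bounded_iff[OF assms(11,12)] hom_bounded_iff[OF assms(12,11)] DC by blast
qed

end
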